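(* Let $s\in(0,1)$, $\alpha\in(s,1)$, $n\ge 2$, and let $E\subset\mathbb R^n$ satisfy assumption (h1) below. Suppose there is $\sigma\in(-1,1)$ such that $$\nu_E(q)\cdot\nu_H(q)=\sigma\qquad\text{for all } q\in M\cap\partial H.$$ Then for every unit vector $e\in S^{n-1}\cap\partial H$ there is a hyperplane $\pi_e$ orthogonal to $e$ such that, denoting by $\rho$ the reflection across $\pi_e$, $$|E\,\Delta\,\rho(E)|\le C\,\mathrm{diam}(E)^{n}\sqrt{\delta_s(E)},$$ where $C=C(n,s)$ depends only on $n$ and $s$ (one may take $C=3\sqrt{5/(2(n+s))}$). Here $|\cdot|$ is Lebesgue measure and $\Delta$ is symmetric difference.
   Context: $H=\{x\in\mathbb R^n:x_n>0\}$, with outer unit normal $\nu_H=-e_n$ on $\partial H$. Assumption (h1): $s\in(0,1)$, $\alpha\in(s,1)$, $n\ge 2$, and $E\subset\mathbb R^n$ is a bounded open connected subset of $H$ such that $M:=\overline{\partial E\cap H}$ is a $C^{2,\alpha}$-hypersurface with boundary, whose manifold boundary is ${\rm bd}(M)=M\cap\partial H$. $\nu_E$ denotes the outer unit normal to $E$ along $M$ (it extends continuously to $M\cap\partial H$). For $q\in M\cap H$ the fractional mean curvature is $$\mathbf H^s_E(q)=\mathrm{p.v.}\int_{\mathbb R^n}\frac{\chi_{E^c}(x)-\chi_E(x)}{|x-q|^{n+s}}\,dx=\lim_{\varepsilon\to0^+}\int_{\mathbb R^n\setminus B_\varepsilon(q)}\frac{\chi_{E^c}(x)-\chi_E(x)}{|x-q|^{n+s}}\,dx,$$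 which is finite and $C^1$ on $M\cap H$. The $s$-deficit of $E$ is $$\delta_s(E)=\mathrm{diam}(E)^{s+1}\sup\Big\{\frac{|\mathbf H^s_E(p)-\mathbf H^s_E(q)|}{|p-q|}:\ p,q\in M\cap H,\ p\neq q,\ p_n=q_n\Big\}.$$ *)

theory Defs
  imports "HOL-Analysis.Analysis"
begin

text \<open>Ambient space R^n is modelled as real^'n, with n = CARD('n).
  The distinguished coordinate x_n is the component at an index k :: 'n.\<close>

definition halfspace :: "'n::finite \<Rightarrow> (real^'n) set" where
  "halfspace k = {x. x $ k > 0}"

definition C2alpha :: "real \<Rightarrow> (real^'n::finite \<Rightarrow> real^'m::finite) \<Rightarrow> (real^'n) set \<Rightarrow> bool" where
  "C2alpha \<alpha> f U \<longleftrightarrow> open U \<and>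
     (\<exists>f' f'' L.
        (\<forall>x\<in>U. (f has_derivative blinfun_apply (f' x)) (at x)
              \<and> (f' has_derivative blinfun_apply (f'' x)) (at x)) \<and>
        (\<forall>x\<in>U. \<forall>y\<in>U. norm (f'' x - f'' y) \<le> L * dist x y powr \<alpha>))"

definition C2alpha_diffeo :: "real \<Rightarrow> (real^'n::finite \<Rightarrow> real^'n) \<Rightarrow> (real^'n) set \<Rightarrow> (real^'n) set \<Rightarrow> bool" where
  "C2alpha_diffeo \<alpha> \<phi> U V \<longleftrightarrow> open U \<and> open V \<and> \<phi> ` U = V \<and> inj_on \<phi> U \<and>
     C2alpha \<alpha> \<phi> U \<and> C2alpha \<alpha> (inv_into U \<phi>) V"

definition C2alpha_hypersurface_with_boundary ::
  "real \<Rightarrow> (real^'n::finite) set \<Rightarrow> (real^'n) set \<Rightarrow> bool" where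
  "C2alpha_hypersurface_with_boundary \<alpha> M B \<longleftrightarrow> B \<subseteq> M \<and>
     (\<forall>p\<in>M. \<exists>U V \<phi> i j. p \<in> U \<and> i \<noteq> j \<and> C2alpha_diffeo \<alpha> \<phi> U V \<and>
        \<phi> ` (M \<inter> U) = V \<inter> {y. y $ i = 0 \<and> y $ j \<ge> 0} \<and>
        \<phi> ` (B \<inter> U) = V \<inter> {y. y $ i = 0 \<and> y $ j = 0})"

definition outer_unit_normal ::
  "'n::finite \<Rightarrow> (real^'n) set \<Rightarrow> (real^'n) set \<Rightarrow> (real^'n \<Rightarrow> real^'n) \<Rightarrow> bool" where
  "outer_unit_normal k E M nu \<longleftrightarrow>
     (\<forall>q\<in>M. norm (nu q) = 1) \<and> continuous_on M nu \<and>
     (\<forall>q\<in>M. ((\<lambda>x. (nu q \<bullet> (x - q)) / norm (x - q)) \<longlongrightarrow> 0) (at q within M)) \<and>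
     (\<forall>q\<in>M \<inter> halfspace k. \<exists>r>0. \<forall>t. 0 < t \<and> t < r \<longrightarrow>
         q + t *\<^sub>R nu q \<notin> E \<and> q - t *\<^sub>R nu q \<in> E)"

definition frac_mean_curv :: "real \<Rightarrow> (real^'n::finite) set \<Rightarrow> real^'n \<Rightarrow> real" where
  "frac_mean_curv s E q =
     Lim (at_right 0)
       (\<lambda>\<epsilon>. LINT x : - ball q \<epsilon> | lborel.
              (indicator (- E) x - indicator E x) / norm (x - q) powr (real CARD('n) + s))"

text \<open>The s-deficit, with values in the extended reals (it may be +infinity).
  The supremum is taken over a set of nonnegative quotients (with 0 added, so that
  the sup of an empty family is 0).\<close>
definition s_deficit :: "real \<Rightarrow> 'n::finite \<Rightarrow> (real^'n) set \<Rightarrow> (real^'n) set \<Rightarrow> ereal" where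
  "s_deficit s k E M =
     ereal (diameter E powr (s + 1)) *
     Sup (insert 0 {ereal (\<bar>frac_mean_curv s E p - frac_mean_curv s E q\<bar> / norm (p - q)) | p q.
            p \<in> M \<inter> halfspace k \<and> q \<in> M \<inter> halfspace k \<and> p \<noteq> q \<and> p $ k = q $ k})"

text \<open>Reflection across the hyperplane {x. x \<bullet> e = c} (e a unit vector).\<close>
definition reflection :: "real^'n::finite \<Rightarrow> real \<Rightarrow> real^'n \<Rightarrow> real^'n" where
  "reflection e c x = x - (2 * (x \<bullet> e - c)) *\<^sub>R e"

definition symdiff :: "'a set \<Rightarrow> 'a set \<Rightarrow> 'a set" where
  "symdiff A B = (A - B) \<union> (B - A)"

end

theory Submission
  imports Defs
begin

text \<open>
  Move a hyperplane orthogonal to \<open>e\<close> to the supremum \<open>lam\<close> of the midpoints of the chords of \<open>E\<close> in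
  direction \<open>e\<close>. Then \<open>E\<close> beyond the plane reflects into \<open>E\<close>, and a sequence of chords with midpoints
  tending to the plane has limit endpoints \<open>q\<close> and \<open>p\<close> that are mirror images of each other. For the
  kernel \<open>|z|\<^sup>-\<^sup>(\<^sup>n\<^sup>+\<^sup>s\<^sup>)\<close>, the difference of the potentials of \<open>E\<close> at \<open>q\<close> and \<open>p\<close> only sees the part \<open>A\<close> of
  \<open>E\<close> whose mirror image leaves \<open>E\<close>, and is at least \<open>|p - q|\<close> times a multiple of the first moment of
  \<open>A\<close> about the plane. It equals half the difference of the fractional mean curvatures, so that the
  deficit controls this moment, and the moment controls \<open>|A|\<^sup>2\<close>.

  If \<open>p = q\<close>, or if \<open>p\<close> and \<open>q\<close> lie on \<open>\<partial>H\<close>, the argument is applied to nearby pairs of points of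
  \<open>M \<inter> H\<close> at equal height. The potentials are then split at a scale \<open>\<rho>\<close>; the outer part passes to the
  limit, and the inner part is \<open>O(\<rho> powr (\<alpha> - s))\<close> relative to the distance of the pair, because
  \<open>E\<close> is a \<open>C\<^sup>2\<^sup>,\<^sup>\<alpha>\<close> subgraph there. On \<open>\<partial>H\<close> the constant contact angle makes the two graphs touch
  to first order (\<open>p \<noteq> q\<close>) or makes the mixed second derivative vanish (\<open>p = q\<close>).
\<close>

section \<open>A convex truncation of the kernel\<close>

text \<open>The function \<open>t powr (-b)\<close>, continued below \<open>a\<close> by its tangent at \<open>a\<close>, so that it stays convex and \<open>C\<^sup>1\<close>;
  it is applied to \<open>t = |z|\<^sup>2\<close>.\<close>
definition trunc_powr :: "real \<Rightarrow> real \<Rightarrow> real \<Rightarrow> real" where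
  "trunc_powr b a t = (if a \<le> t then t powr (-b) else a powr (-b) - b * a powr (-b-1) * (t - a))"

definition trunc_powr_slope :: "real \<Rightarrow> real \<Rightarrow> real \<Rightarrow> real" where
  "trunc_powr_slope b a t = b * max a t powr (-b-1)"

lemma has_real_derivative_trunc_powr:
  assumes "0 < a"
  shows "(trunc_powr b a has_real_derivative - trunc_powr_slope b a t) (at t)"
proof -
  have powr: "((\<lambda>t. t powr (-b)) has_vector_derivative - (b * t powr (-b-1))) (at t within S)"
    if "0 < t" for t S
    unfolding has_real_derivative_iff_has_vector_derivative[symmetric] using that
    by (auto intro!: derivative_eq_intros)
  have tangent: "((\<lambda>t. a powr (-b) - b * a powr (-b-1) * (t - a)) has_vector_derivative - (b * a powr (-b-1)))
      (at t within S)" for t S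
    unfolding has_real_derivative_iff_has_vector_derivative[symmetric]
    by (auto intro!: derivative_eq_intros)
  have "((\<lambda>t. if t \<in> {a..} then t powr (-b) else a powr (-b) - b * a powr (-b-1) * (t - a)) has_vector_derivative
      (if t \<in> {a..} then - (b * t powr (-b-1)) else - (b * a powr (-b-1)))) (at t within UNIV)"
    by (rule has_vector_derivative_If_within_closures[where T="{..<a}"])
      (use assms in \<open>auto intro!: powr tangent\<close>)
  then have "(trunc_powr b a has_vector_derivative - trunc_powr_slope b a t) (at t)"
    by (cases "a \<le> t") (simp_all add: trunc_powr_def[abs_def] trunc_powr_slope_def max_def split del: if_split)
  then show ?thesis by (simp add: has_real_derivative_iff_has_vector_derivative)
qed

lemma continuous_on_trunc_powr [continuous_intros]:
  assumes "0 < a" "continuous_on S f"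
  shows "continuous_on S (\<lambda>x. trunc_powr b a (f x))"
proof -
  have "continuous_on UNIV (trunc_powr b a)"
    using has_real_derivative_trunc_powr[OF assms(1)] by (intro DERIV_continuous_on) auto
  then show ?thesis by (rule continuous_on_compose2[OF _ assms(2)]) auto
qed

lemma continuous_on_trunc_powr_slope [continuous_intros]:
  assumes "0 < a" "continuous_on S f"
  shows "continuous_on S (\<lambda>x. trunc_powr_slope b a (f x))"
  unfolding trunc_powr_slope_def using assms by (intro continuous_intros) auto

lemma trunc_powr_slope_antimono:
  "0 < b \<Longrightarrow> 0 < a \<Longrightarrow> a \<le> a' \<Longrightarrow> t \<le> t' \<Longrightarrow> trunc_powr_slope b a' t' \<le> trunc_powr_slope b a t"
  unfolding trunc_powr_slope_def by (intro mult_left_mono powr_mono2') auto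

lemma trunc_powr_slope_nonneg: "0 < b \<Longrightarrow> 0 \<le> trunc_powr_slope b a t"
  by (simp add: trunc_powr_slope_def)

lemma trunc_powr_ge_tangent:
  assumes "0 < a" "0 < b"
  shows "trunc_powr b a x \<ge> trunc_powr b a y + trunc_powr_slope b a y * (y - x)"
proof (cases x y rule: linorder_cases)
  case less
  obtain z where z: "x < z" "z < y" "trunc_powr b a y - trunc_powr b a x = (y - x) * - trunc_powr_slope b a z"
    using MVT2[OF less, of "trunc_powr b a" "\<lambda>t. - trunc_powr_slope b a t"]
      has_real_derivative_trunc_powr[OF assms(1)] by auto
  have "(y - x) * trunc_powr_slope b a y \<le> (y - x) * trunc_powr_slope b a z"
    using assms z less by (intro mult_left_mono trunc_powr_slope_antimono) auto
  then show ?thesis using z by (simp add: algebra_simps)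
next
  case greater
  obtain z where z: "y < z" "z < x" "trunc_powr b a x - trunc_powr b a y = (x - y) * - trunc_powr_slope b a z"
    using MVT2[OF greater, of "trunc_powr b a" "\<lambda>t. - trunc_powr_slope b a t"]
      has_real_derivative_trunc_powr[OF assms(1)] by auto
  have "(x - y) * trunc_powr_slope b a z \<le> (x - y) * trunc_powr_slope b a y"
    using assms z greater by (intro mult_left_mono trunc_powr_slope_antimono) auto
  then show ?thesis using z by (simp add: algebra_simps)
qed simp

lemma trunc_powr_antimono:
  assumes "0 < a" "0 < b" "x \<le> y"
  shows "trunc_powr b a y \<le> trunc_powr b a x"
  using trunc_powr_ge_tangent[OF assms(1,2), of y x] assms
    mult_nonneg_nonneg[OF trunc_powr_slope_nonneg[OF assms(2), of a y], of "y - x"]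
  by linarith

lemma trunc_powr_nonneg:
  assumes "0 < a" "0 < b"
  shows "0 \<le> trunc_powr b a t"
proof (cases "a \<le> t")
  case False
  then have "trunc_powr b a a \<le> trunc_powr b a t" using assms by (intro trunc_powr_antimono) auto
  then show ?thesis by (simp add: trunc_powr_def) (smt (verit) powr_ge_zero)
qed (simp add: trunc_powr_def)

lemma trunc_powr_antimono_cutoff:
  assumes "0 < a" "0 < b" "a \<le> a'"
  shows "trunc_powr b a' t \<le> trunc_powr b a t"
proof (cases "a' \<le> t")
  case False
  let ?g = "\<lambda>t. trunc_powr b a' t - trunc_powr b a t"
  have "?g t \<le> ?g a'"
  proof (rule DERIV_nonneg_imp_nondecreasing[of t a'])
    fix x assume "t \<le> x" "x \<le> a'"
    have "(?g has_real_derivative - trunc_powr_slope b a' x - - trunc_powr_slope b a x) (at x)"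
      using assms by (intro DERIV_diff has_real_derivative_trunc_powr) auto
    moreover have "0 \<le> - trunc_powr_slope b a' x - - trunc_powr_slope b a x"
      using trunc_powr_slope_antimono[of b a a' x x] assms by auto
    ultimately show "\<exists>y. (?g has_real_derivative y) (at x) \<and> 0 \<le> y" by blast
  qed (use False in simp)
  also have "\<dots> = 0" using assms by (simp add: trunc_powr_def)
  finally show ?thesis by simp
qed (use assms in \<open>simp add: trunc_powr_def\<close>)

lemma trunc_powr_le_powr:
  assumes "0 < a" "0 < b" "0 < t"
  shows "trunc_powr b a t \<le> t powr (-b)"
proof (cases "a \<le> t")
  case False
  have "trunc_powr b a t \<le> trunc_powr b t t" using False assms by (intro trunc_powr_antimono_cutoff) auto
  then show ?thesis by (simp add: trunc_powr_def)
qed (simp add: trunc_powr_def)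

lemma trunc_powr_le_max:
  assumes "0 < a" "0 < b" "0 \<le> t"
  shows "trunc_powr b a t \<le> (1 + b) * (max a t) powr (-b)"
proof (cases "a \<le> t")
  case True
  then have "trunc_powr b a t \<le> 1 * t powr (-b)" by (simp add: trunc_powr_def)
  also have "\<dots> \<le> (1 + b) * t powr (-b)" using assms by (intro mult_right_mono) auto
  finally show ?thesis using True by (simp add: max_def)
next
  case False
  have "trunc_powr b a t \<le> trunc_powr b a 0" using assms by (intro trunc_powr_antimono) auto
  also have "\<dots> = a powr (-b) + b * (a powr (-b-1) * a)" using assms by (simp add: trunc_powr_def)
  also have "a powr (-b-1) * a = a powr (-b)" using assms powr_add[of a "-b-1" 1] by simp
  finally show ?thesis using False by (simp add: max_def algebra_simps)
qed

lemma abs_mult_trunc_powr_slope_le: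
  assumes "0 < a" "0 < b" "0 \<le> \<zeta>"
  shows "\<bar>v\<bar> * trunc_powr_slope b a (\<zeta> + v\<^sup>2) \<le> b * max a \<zeta> powr (- b - 1/2)"
proof -
  define M where "M = max a (\<zeta> + v\<^sup>2)"
  have "0 < M" using assms by (simp add: M_def)
  have "\<bar>v\<bar> = sqrt (v\<^sup>2)" by simp
  also have "\<dots> \<le> sqrt M" using assms by (intro real_sqrt_le_mono) (auto simp: M_def)
  also have "\<dots> = M powr (1/2)" using \<open>0 < M\<close> by (simp add: powr_half_sqrt)
  finally have "\<bar>v\<bar> * trunc_powr_slope b a (\<zeta> + v\<^sup>2) \<le> M powr (1/2) * trunc_powr_slope b a (\<zeta> + v\<^sup>2)"
    using assms by (intro mult_right_mono trunc_powr_slope_nonneg)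
  also have "\<dots> = b * (M powr (1/2) * M powr (-b-1))" by (simp add: trunc_powr_slope_def M_def)
  also have "M powr (1/2) * M powr (-b-1) = M powr (-b-1/2)"
    unfolding powr_add[symmetric] by (rule arg_cong[where f="\<lambda>x. M powr x"]) simp
  also have "b * M powr (-b-1/2) \<le> b * max a \<zeta> powr (- b - 1/2)"
    using assms unfolding M_def by (intro mult_left_mono powr_mono2' max.mono) (auto simp: less_max_iff_disj)
  finally show ?thesis .
qed

text \<open>Here \<open>\<zeta>\<close> plays the role of the squared distance of a line to the origin and \<open>v\<close>
  is the coordinate along that line.\<close>
lemma trunc_powr_diff_lipschitz_along_line:
  assumes "0 < a" "a \<le> a'" "0 < b" "0 \<le> \<zeta>"
  shows "\<bar>(trunc_powr b a (\<zeta> + u\<^sup>2) - trunc_powr b a' (\<zeta> + u\<^sup>2))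
      - (trunc_powr b a (\<zeta> + v\<^sup>2) - trunc_powr b a' (\<zeta> + v\<^sup>2))\<bar>
    \<le> 2 * b * max a \<zeta> powr (- b - 1/2) * \<bar>u - v\<bar>"
proof -
  let ?k = "\<lambda>v. trunc_powr b a (\<zeta> + v\<^sup>2) - trunc_powr b a' (\<zeta> + v\<^sup>2)"
  let ?k' = "\<lambda>v. 2 * v * (trunc_powr_slope b a' (\<zeta> + v\<^sup>2) - trunc_powr_slope b a (\<zeta> + v\<^sup>2))"
  have deriv: "(?k has_real_derivative ?k' v) (at v)" for v
  proof -
    have "((\<lambda>v. \<zeta> + v\<^sup>2) has_real_derivative 2 * v) (at v)" by (auto intro!: derivative_eq_intros)
    then have "(?k has_real_derivative (- trunc_powr_slope b a (\<zeta> + v\<^sup>2) * (2 * v))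
        - (- trunc_powr_slope b a' (\<zeta> + v\<^sup>2) * (2 * v))) (at v)"
      using assms by (intro DERIV_diff DERIV_chain2[OF has_real_derivative_trunc_powr]) auto
    then show ?thesis by (rule DERIV_cong) (simp add: algebra_simps)
  qed
  have bound: "\<bar>?k' v\<bar> \<le> 2 * b * max a \<zeta> powr (- b - 1/2)" for v
  proof -
    have "\<bar>trunc_powr_slope b a' (\<zeta> + v\<^sup>2) - trunc_powr_slope b a (\<zeta> + v\<^sup>2)\<bar> \<le> trunc_powr_slope b a (\<zeta> + v\<^sup>2)"
      using trunc_powr_slope_antimono[of b a a' "\<zeta> + v\<^sup>2" "\<zeta> + v\<^sup>2"] trunc_powr_slope_nonneg[of b a' "\<zeta> + v\<^sup>2"] assms
      by simp
    then have "\<bar>?k' v\<bar> \<le> 2 * \<bar>v\<bar> * trunc_powr_slope b a (\<zeta> + v\<^sup>2)"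
      unfolding abs_mult by (intro mult_mono) auto
    then show ?thesis using abs_mult_trunc_powr_slope_le[of a b \<zeta> v] assms by simp
  qed
  have "norm (?k u - ?k v) \<le> (2 * b * max a \<zeta> powr (- b - 1/2)) * norm (u - v)"
    by (rule field_differentiable_bound[of UNIV ?k ?k']) (use deriv bound in auto)
  then show ?thesis by simp
qed

text \<open>Matching the intermediate points of the two increments is what keeps the error
  quadratic in the small quantities.\<close>
lemma paired_increment_bound:
  fixes T t :: "real \<Rightarrow> real"
  assumes T: "\<And>v. (T has_real_derivative t v) (at v)" and even: "\<And>v. t (-v) = t v"
    and bound: "\<And>v. \<bar>t v\<bar> \<le> K" and lipschitz: "\<And>u v. \<bar>t u - t v\<bar> \<le> L * \<bar>u - v\<bar>" "0 \<le> L"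
    and close: "(\<bar>x1 - y1\<bar> \<le> \<delta> \<and> \<bar>x2 - y2\<bar> \<le> \<delta>) \<or> (\<bar>x1 + y1\<bar> \<le> \<delta> \<and> \<bar>x2 + y2\<bar> \<le> \<delta>)"
  shows "\<bar>T x1 - T x2 + (T y1 - T y2)\<bar> \<le> K * \<bar>x1 - x2 + (y1 - y2)\<bar> + L * \<delta> * \<bar>y1 - y2\<bar>"
proof -
  define f where "f = (\<lambda>\<theta>. T (x2 + \<theta> * (x1 - x2)) + T (y2 + \<theta> * (y1 - y2)))"
  define f' where "f' = (\<lambda>\<theta>. t (x2 + \<theta> * (x1 - x2)) * (x1 - x2) + t (y2 + \<theta> * (y1 - y2)) * (y1 - y2))"
  have "(f has_real_derivative f' \<theta>) (at \<theta>)" for \<theta>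
    unfolding f_def f'_def
    by (intro DERIV_add DERIV_chain2[OF T]) (auto intro!: derivative_eq_intros)
  then obtain \<theta> where \<theta>: "0 < \<theta>" "\<theta> < 1" "f 1 - f 0 = f' \<theta>"
    using MVT2[of 0 1 f f'] by auto
  define x where "x = x2 + \<theta> * (x1 - x2)"
  define y where "y = y2 + \<theta> * (y1 - y2)"
  have convex: "\<bar>(1 - \<theta>) * c + \<theta> * d\<bar> \<le> \<delta>" if "\<bar>c\<bar> \<le> \<delta>" "\<bar>d\<bar> \<le> \<delta>" for c d
    using convex_bound_le[of c \<delta> d "1 - \<theta>" \<theta>] convex_bound_le[of "-c" \<delta> "-d" "1 - \<theta>" \<theta>] \<theta> that
    by (simp add: abs_le_iff)
  have "\<bar>t x - t y\<bar> \<le> L * \<delta>"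
    using close
  proof
    assume "\<bar>x1 - y1\<bar> \<le> \<delta> \<and> \<bar>x2 - y2\<bar> \<le> \<delta>"
    then have "\<bar>x - y\<bar> \<le> \<delta>" using convex[of "x2 - y2" "x1 - y1"] by (simp add: x_def y_def algebra_simps)
    then show ?thesis using lipschitz by (meson mult_left_mono order_trans)
  next
    assume "\<bar>x1 + y1\<bar> \<le> \<delta> \<and> \<bar>x2 + y2\<bar> \<le> \<delta>"
    then have "\<bar>x - (-y)\<bar> \<le> \<delta>" using convex[of "x2 + y2" "x1 + y1"] by (simp add: x_def y_def algebra_simps)
    then show ?thesis using lipschitz even by (metis mult_left_mono order_trans)
  qed
  then have mismatch: "\<bar>(t y - t x) * (y1 - y2)\<bar> \<le> L * \<delta> * \<bar>y1 - y2\<bar>"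
    by (simp add: abs_mult mult_right_mono abs_minus_commute)
  have matched: "\<bar>t x * (x1 - x2 + (y1 - y2))\<bar> \<le> K * \<bar>x1 - x2 + (y1 - y2)\<bar>"
    using bound by (simp add: abs_mult mult_right_mono)
  have "T x1 - T x2 + (T y1 - T y2) = f 1 - f 0" by (simp add: f_def)
  also have "\<dots> = t x * (x1 - x2 + (y1 - y2)) + (t y - t x) * (y1 - y2)"
    unfolding \<theta>(3) f'_def x_def[symmetric] y_def[symmetric] by (simp add: algebra_simps)
  finally show ?thesis using matched mismatch by linarith
qed

section \<open>Integrals of powers of the norm\<close>

lemma nn_integral_powr_from_0:
  fixes r p c :: real
  assumes "-1 < p" "0 \<le> r" "0 \<le> c"
  shows "(\<integral>\<^sup>+\<rho>. ennreal (c * \<rho> powr p) * indicator {0..r} \<rho> \<partial>lborel) = ennreal (c * (r powr (p + 1) / (p + 1)))"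
proof -
  have "((\<lambda>\<rho>. c * \<rho> powr p) has_integral c * (r powr (p + 1) / (p + 1))) {0..r}"
    using assms by (intro has_integral_mult_right has_integral_powr_from_0) auto
  then have "((\<lambda>\<rho>. if \<rho> \<in> {0..r} then c * \<rho> powr p else 0) has_integral c * (r powr (p + 1) / (p + 1))) UNIV"
    by (simp only: has_integral_restrict_UNIV)
  from nn_integral_has_integral_lborel[OF _ _ this]
  have "(\<integral>\<^sup>+\<rho>. ennreal (if \<rho> \<in> {0..r} then c * \<rho> powr p else 0) \<partial>lborel) = ennreal (c * (r powr (p + 1) / (p + 1)))"
    using assms by simp
  also have "(\<lambda>\<rho>. ennreal (if \<rho> \<in> {0..r} then c * \<rho> powr p else 0)) = (\<lambda>\<rho>. ennreal (c * \<rho> powr p) * indicator {0..r} \<rho>)"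
    by (auto simp: indicator_def fun_eq_iff)
  finally show ?thesis .
qed

lemma nn_integral_powr_tail:
  fixes r p c :: real
  assumes "0 < p" "0 < r" "0 \<le> c"
  shows "(\<integral>\<^sup>+\<rho>. ennreal (c * \<rho> powr (-p-1)) * indicator {r..} \<rho> \<partial>lborel) = ennreal (c / p * r powr (-p))"
proof -
  have "(\<integral>\<^sup>+\<rho>. ennreal (c * \<rho> powr (-p-1)) * indicator {r..} \<rho> \<partial>lborel) = ennreal (0 - (- (c / p) * r powr (-p)))"
  proof (rule nn_integral_FTC_atLeast)
    fix \<rho> assume "r \<le> \<rho>"
    then show "((\<lambda>\<rho>. - (c / p) * \<rho> powr (-p)) has_real_derivative c * \<rho> powr (-p-1)) (at \<rho>)"
      using assms by (auto intro!: derivative_eq_intros)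
  next
    have "((\<lambda>\<rho>. \<rho> powr (-p)) \<longlongrightarrow> 0) at_top"
      using assms by (intro tendsto_neg_powr filterlim_ident) auto
    then show "((\<lambda>\<rho>. - (c / p) * \<rho> powr (-p)) \<longlongrightarrow> 0) at_top" by (rule tendsto_mult_right_zero)
  qed (use assms in auto)
  then show ?thesis by simp
qed

lemma nn_integral_powr_between:
  fixes \<gamma> t r :: real
  assumes "0 < t" "t \<le> r" "0 \<le> \<gamma>"
  shows "(\<integral>\<^sup>+\<rho>. ennreal (\<gamma> * \<rho> powr (-\<gamma>-1)) * indicator {t..r} \<rho> \<partial>lborel) = ennreal (t powr (-\<gamma>) - r powr (-\<gamma>))"
proof -
  have "(\<integral>\<^sup>+\<rho>. ennreal (\<gamma> * \<rho> powr (-\<gamma>-1)) * indicator {t..r} \<rho> \<partial>lborel) = ennreal (- (r powr (-\<gamma>)) - - (t powr (-\<gamma>)))"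
  proof (rule nn_integral_FTC_Icc)
    fix \<rho> assume "\<rho> \<in> {t..r}"
    then show "((\<lambda>\<rho>. - (\<rho> powr (-\<gamma>))) has_real_derivative \<gamma> * \<rho> powr (-\<gamma>-1)) (at \<rho>)"
      using assms by (auto intro!: derivative_eq_intros)
  qed (use assms in auto)
  then show ?thesis by simp
qed

lemma borel_measurable_norm_layers [measurable]:
  fixes g :: "real \<Rightarrow> ennreal"
  assumes [measurable]: "g \<in> borel_measurable borel"
  shows "(\<lambda>(z, \<rho>). g \<rho> * indicator {norm (z::'a::euclidean_space)..} \<rho>) \<in> borel_measurable (lborel \<Otimes>\<^sub>M lborel)"
proof -
  have "(\<lambda>(z::'a, \<rho>). g \<rho> * indicator {norm z..} \<rho>) = (\<lambda>x. g (snd x) * indicator {x. norm (fst x) \<le> snd x} x)"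
    by (auto simp: indicator_def fun_eq_iff)
  also have "\<dots> \<in> borel_measurable (lborel \<Otimes>\<^sub>M lborel)" by measurable
  finally show ?thesis .
qed

lemma nn_integral_norm_layer_cake:
  fixes g :: "real \<Rightarrow> ennreal"
  assumes g: "g \<in> borel_measurable borel" and g0: "\<And>\<rho>. \<rho> \<le> 0 \<Longrightarrow> g \<rho> = 0"
  shows "(\<integral>\<^sup>+z. \<integral>\<^sup>+\<rho>. g \<rho> * indicator {norm (z::'a::euclidean_space)..} \<rho> \<partial>lborel \<partial>lborel)
    = (\<integral>\<^sup>+\<rho>. g \<rho> * ennreal (unit_ball_vol DIM('a) * \<rho> powr DIM('a)) \<partial>lborel)"
proof -
  have "(\<integral>\<^sup>+z. \<integral>\<^sup>+\<rho>. g \<rho> * indicator {norm (z::'a)..} \<rho> \<partial>lborel \<partial>lborel)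
      = (\<integral>\<^sup>+\<rho>. \<integral>\<^sup>+z. g \<rho> * indicator {norm (z::'a)..} \<rho> \<partial>lborel \<partial>lborel)"
    by (rule lborel_pair.Fubini'[symmetric, OF borel_measurable_norm_layers[OF g]])
  also have "\<dots> = (\<integral>\<^sup>+\<rho>. g \<rho> * ennreal (unit_ball_vol DIM('a) * \<rho> powr DIM('a)) \<partial>lborel)"
  proof (rule nn_integral_cong)
    fix \<rho> :: real
    show "(\<integral>\<^sup>+z. g \<rho> * indicator {norm (z::'a)..} \<rho> \<partial>lborel) = g \<rho> * ennreal (unit_ball_vol DIM('a) * \<rho> powr DIM('a))"
    proof (cases "0 < \<rho>")
      case True
      have "(\<integral>\<^sup>+z. g \<rho> * indicator {norm (z::'a)..} \<rho> \<partial>lborel) = (\<integral>\<^sup>+z. g \<rho> * indicator (cball (0::'a) \<rho>) z \<partial>lborel)"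
        by (intro nn_integral_cong) (auto simp: indicator_def)
      also have "\<dots> = g \<rho> * emeasure lborel (cball (0::'a) \<rho>)" by (simp add: nn_integral_cmult_indicator)
      also have "emeasure lborel (cball (0::'a) \<rho>) = ennreal (unit_ball_vol DIM('a) * \<rho> powr DIM('a))"
        using True by (subst emeasure_cball) (auto simp: powr_realpow)
      finally show ?thesis .
    qed (simp add: g0)
  qed
  finally show ?thesis .
qed

definition ball_powr_const :: "'a::euclidean_space itself \<Rightarrow> real \<Rightarrow> real" where
  "ball_powr_const _ \<gamma> = unit_ball_vol (real DIM('a)) * real DIM('a) / (real DIM('a) - \<gamma>)"

lemma nn_integral_layers_powr_le:
  fixes \<gamma> r :: real
  assumes \<gamma>: "0 \<le> \<gamma>" "\<gamma> < DIM('a::euclidean_space)" and r: "0 < r"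
  defines "g \<equiv> \<lambda>\<rho>. ennreal (\<gamma> * \<rho> powr (-\<gamma>-1)) * indicator {0<..r} \<rho>"
  shows "(\<integral>\<^sup>+z. \<integral>\<^sup>+\<rho>. g \<rho> * indicator {norm (z::'a)..} \<rho> \<partial>lborel \<partial>lborel)
    \<le> ennreal (\<gamma> * unit_ball_vol DIM('a) * (r powr (DIM('a) - \<gamma>) / (DIM('a) - \<gamma>)))"
proof -
  define n where "n = real DIM('a)"
  define \<omega> where "\<omega> = unit_ball_vol n"
  have \<omega>: "0 \<le> \<omega>" by (simp add: \<omega>_def n_def)
  have "(\<integral>\<^sup>+z. \<integral>\<^sup>+\<rho>. g \<rho> * indicator {norm (z::'a)..} \<rho> \<partial>lborel \<partial>lborel) = (\<integral>\<^sup>+\<rho>. g \<rho> * ennreal (\<omega> * \<rho> powr n) \<partial>lborel)"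
    unfolding \<omega>_def n_def by (rule nn_integral_norm_layer_cake) (auto simp: g_def)
  also have "\<dots> \<le> (\<integral>\<^sup>+\<rho>. ennreal (\<gamma> * \<omega> * \<rho> powr (n-\<gamma>-1)) * indicator {0..r} \<rho> \<partial>lborel)"
  proof (intro nn_integral_mono)
    fix \<rho> :: real
    have "\<rho> powr (-\<gamma>-1) * \<rho> powr n = \<rho> powr (n-\<gamma>-1)" by (simp add: powr_add[symmetric] algebra_simps)
    then have "ennreal (\<gamma> * \<rho> powr (-\<gamma>-1)) * ennreal (\<omega> * \<rho> powr n) = ennreal (\<gamma> * \<omega> * \<rho> powr (n-\<gamma>-1))"
      using \<omega> \<gamma> by (simp add: ennreal_mult[symmetric] mult.assoc mult.left_commute[of _ \<omega>])
    then show "g \<rho> * ennreal (\<omega> * \<rho> powr n) \<le> ennreal (\<gamma> * \<omega> * \<rho> powr (n-\<gamma>-1)) * indicator {0..r} \<rho>"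
      by (auto simp: g_def indicator_def)
  qed
  also have "\<dots> = ennreal (\<gamma> * \<omega> * (r powr (n - \<gamma>) / (n - \<gamma>)))"
    using nn_integral_powr_from_0[of "n - \<gamma> - 1" r "\<gamma> * \<omega>"] \<gamma> r \<omega> by (simp add: n_def)
  finally show ?thesis by (simp add: \<omega>_def n_def)
qed

lemma powr_indicator_ball_le_layers:
  fixes \<gamma> r :: real and z :: "'a::real_normed_vector"
  assumes \<gamma>: "0 \<le> \<gamma>" and z: "z \<noteq> 0"
  defines "g \<equiv> \<lambda>\<rho>. ennreal (\<gamma> * \<rho> powr (-\<gamma>-1)) * indicator {0<..r} \<rho>"
  shows "ennreal (norm z powr (-\<gamma>)) * indicator (ball 0 r) z
    \<le> ennreal (r powr (-\<gamma>)) * indicator (ball 0 r) z + (\<integral>\<^sup>+\<rho>. g \<rho> * indicator {norm z..} \<rho> \<partial>lborel)"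
proof (cases "z \<in> ball 0 r")
  case True
  have pos: "0 < norm z" using z by simp
  have "(\<integral>\<^sup>+\<rho>. g \<rho> * indicator {norm z..} \<rho> \<partial>lborel)
      = (\<integral>\<^sup>+\<rho>. ennreal (\<gamma> * \<rho> powr (-\<gamma>-1)) * indicator {norm z..r} \<rho> \<partial>lborel)"
    using less_le_trans[OF pos] by (intro nn_integral_cong) (auto simp: g_def indicator_def)
  also have "\<dots> = ennreal (norm z powr (-\<gamma>) - r powr (-\<gamma>))"
    using True pos \<gamma> by (intro nn_integral_powr_between) auto
  finally show ?thesis using True pos \<gamma>
    by (simp add: ennreal_plus[symmetric] powr_mono2' del: ennreal_plus)
qed auto

lemma nn_integral_ball_powr:
  fixes \<gamma> r :: real
  assumes \<gamma>: "0 \<le> \<gamma>" "\<gamma> < DIM('a::euclidean_space)" and r: "0 < r"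
  shows "(\<integral>\<^sup>+z. ennreal (norm z powr (-\<gamma>)) * indicator (ball (0::'a) r) z \<partial>lborel)
    \<le> ennreal (ball_powr_const TYPE('a) \<gamma> * r powr (DIM('a) - \<gamma>))"
proof -
  define n where "n = real DIM('a)"
  define \<omega> where "\<omega> = unit_ball_vol n"
  define g where "g = (\<lambda>\<rho>. ennreal (\<gamma> * \<rho> powr (-\<gamma>-1)) * indicator {0<..r} \<rho>)"
  have \<omega>: "0 \<le> \<omega>" by (simp add: \<omega>_def n_def)
  have layers: "(\<integral>\<^sup>+z. \<integral>\<^sup>+\<rho>. g \<rho> * indicator {norm (z::'a)..} \<rho> \<partial>lborel \<partial>lborel)
      \<le> ennreal (\<gamma> * \<omega> * (r powr (n - \<gamma>) / (n - \<gamma>)))"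
    unfolding g_def \<omega>_def n_def by (rule nn_integral_layers_powr_le[OF \<gamma> r])
  have meas: "(\<lambda>z. \<integral>\<^sup>+\<rho>. g \<rho> * indicator {norm (z::'a)..} \<rho> \<partial>lborel) \<in> borel_measurable lborel"
    using lborel.borel_measurable_nn_integral[OF borel_measurable_norm_layers[of g]] by (simp add: g_def)
  have "(\<integral>\<^sup>+z. ennreal (norm z powr (-\<gamma>)) * indicator (ball (0::'a) r) z \<partial>lborel)
      \<le> (\<integral>\<^sup>+z. ennreal (r powr (-\<gamma>)) * indicator (ball (0::'a) r) z + (\<integral>\<^sup>+\<rho>. g \<rho> * indicator {norm z..} \<rho> \<partial>lborel) \<partial>lborel)"
    by (rule nn_integral_mono_AE) (use AE_lborel_singleton[of "0::'a"] powr_indicator_ball_le_layers[OF \<gamma>(1), of _ r]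
        in \<open>auto simp: g_def elim!: eventually_mono\<close>)
  also have "\<dots> = ennreal (r powr (-\<gamma>)) * emeasure lborel (ball (0::'a) r)
      + (\<integral>\<^sup>+z. \<integral>\<^sup>+\<rho>. g \<rho> * indicator {norm (z::'a)..} \<rho> \<partial>lborel \<partial>lborel)"
  proof (subst nn_integral_add[OF _ meas])
    show "(\<lambda>z. ennreal (r powr (-\<gamma>)) * indicator (ball (0::'a) r) z) \<in> borel_measurable lborel"
      by (intro borel_measurable_times_ennreal borel_measurable_const borel_measurable_indicator) simp
  qed (simp add: nn_integral_cmult_indicator)
  also have "emeasure lborel (ball (0::'a) r) = ennreal (\<omega> * r powr n)"
    using r by (subst emeasure_ball) (auto simp: \<omega>_def n_def powr_realpow)
  also have "ennreal (r powr (-\<gamma>)) * ennreal (\<omega> * r powr n) = ennreal (\<omega> * (r powr (-\<gamma>) * r powr n))"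
    using \<omega> by (simp add: ennreal_mult[symmetric] mult_ac)
  also have "r powr (-\<gamma>) * r powr n = r powr (n - \<gamma>)" by (simp add: powr_add[symmetric])
  finally have "(\<integral>\<^sup>+z. ennreal (norm z powr (-\<gamma>)) * indicator (ball (0::'a) r) z \<partial>lborel)
      \<le> ennreal (\<omega> * r powr (n - \<gamma>)) + ennreal (\<gamma> * \<omega> * (r powr (n - \<gamma>) / (n - \<gamma>)))"
    using layers by (meson add_left_mono order_trans)
  also have "\<dots> = ennreal (\<omega> * r powr (n - \<gamma>) + \<gamma> * \<omega> * (r powr (n - \<gamma>) / (n - \<gamma>)))"
    using \<omega> \<gamma> by (intro ennreal_plus[symmetric]) (auto simp: n_def)
  also have "\<omega> * r powr (n - \<gamma>) + \<gamma> * \<omega> * (r powr (n - \<gamma>) / (n - \<gamma>)) = \<omega> * n / (n - \<gamma>) * r powr (n - \<gamma>)"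
    using \<gamma> by (simp add: n_def field_simps)
  finally show ?thesis by (simp add: ball_powr_const_def \<omega>_def n_def)
qed

lemma integrable_powr_outside_ball:
  fixes m r :: real
  assumes m: "DIM('a::euclidean_space) < m" and r: "0 < r"
  shows "integrable lborel (\<lambda>z::'a. norm z powr (-m) * indicator (- ball 0 r) z)"
proof (rule integrableI_bounded)
  define n where "n = real DIM('a)"
  define \<omega> where "\<omega> = unit_ball_vol n"
  define g where "g = (\<lambda>\<rho>. ennreal (m * \<rho> powr (-m-1)) * indicator {r..} \<rho>)"
  have \<omega>: "0 \<le> \<omega>" by (simp add: \<omega>_def n_def)
  have pos: "0 < m" "0 < m - n" using m by (simp_all add: n_def)
  have pointwise: "ennreal (norm (norm z powr (-m) * indicator (- ball 0 r) z)) \<le> (\<integral>\<^sup>+\<rho>. g \<rho> * indicator {norm z..} \<rho> \<partial>lborel)"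
    for z :: 'a
  proof (cases "z \<in> ball 0 r")
    case False
    have "(\<integral>\<^sup>+\<rho>. g \<rho> * indicator {norm z..} \<rho> \<partial>lborel) = (\<integral>\<^sup>+\<rho>. ennreal (m * \<rho> powr (-m-1)) * indicator {norm z..} \<rho> \<partial>lborel)"
      using False by (intro nn_integral_cong) (auto simp: g_def indicator_def)
    also have "\<dots> = ennreal (norm z powr (-m))"
      using nn_integral_powr_tail[of m "norm z" m] pos(1) False r by (cases "z = 0") auto
    finally show ?thesis using False by simp
  qed auto
  have "(\<integral>\<^sup>+z. ennreal (norm (norm z powr (-m) * indicator (- ball (0::'a) r) z)) \<partial>lborel)
      \<le> (\<integral>\<^sup>+z. \<integral>\<^sup>+\<rho>. g \<rho> * indicator {norm (z::'a)..} \<rho> \<partial>lborel \<partial>lborel)"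
    by (rule nn_integral_mono) (rule pointwise)
  also have "\<dots> = (\<integral>\<^sup>+\<rho>. g \<rho> * ennreal (\<omega> * \<rho> powr n) \<partial>lborel)"
    unfolding \<omega>_def n_def by (rule nn_integral_norm_layer_cake) (use r in \<open>auto simp: g_def\<close>)
  also have "\<dots> = (\<integral>\<^sup>+\<rho>. ennreal (m * \<omega> * \<rho> powr (-(m-n)-1)) * indicator {r..} \<rho> \<partial>lborel)"
  proof (intro nn_integral_cong)
    fix \<rho> :: real
    have "\<rho> powr (-m-1) * \<rho> powr n = \<rho> powr (-(m-n)-1)" by (simp add: powr_add[symmetric] algebra_simps)
    then have "ennreal (m * \<rho> powr (-m-1)) * ennreal (\<omega> * \<rho> powr n) = ennreal (m * \<omega> * \<rho> powr (-(m-n)-1))"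
      using \<omega> pos by (simp add: ennreal_mult[symmetric] mult.assoc mult.left_commute[of _ \<omega>])
    then show "g \<rho> * ennreal (\<omega> * \<rho> powr n) = ennreal (m * \<omega> * \<rho> powr (-(m-n)-1)) * indicator {r..} \<rho>"
      by (simp add: g_def indicator_def)
  qed
  also have "\<dots> < \<infinity>" using nn_integral_powr_tail[OF pos(2) r, of "m * \<omega>"] pos \<omega> by simp
  finally show "(\<integral>\<^sup>+z. ennreal (norm (norm z powr (-m) * indicator (- ball (0::'a) r) z)) \<partial>lborel) < \<infinity>" .
qed simp

section \<open>Integration along parallel lines\<close>

definition perp :: "'a::real_inner \<Rightarrow> 'a \<Rightarrow> 'a" where
  "perp \<eta> z = z - (z \<bullet> \<eta>) *\<^sub>R \<eta>"

lemma perp_add: "perp \<eta> (y + z) = perp \<eta> y + perp \<eta> z"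
  by (simp add: perp_def inner_add_left algebra_simps)

lemma perp_scaleR: "perp \<eta> (c *\<^sub>R z) = c *\<^sub>R perp \<eta> z"
  by (simp add: perp_def algebra_simps)

lemma perp_minus: "perp \<eta> (- z) = - perp \<eta> z"
  by (simp add: perp_def)

lemma perp_diff: "perp \<eta> (y - z) = perp \<eta> y - perp \<eta> z"
  by (simp add: perp_def inner_diff_left algebra_simps)

lemma inner_perp: "norm \<eta> = 1 \<Longrightarrow> perp \<eta> z \<bullet> \<eta> = 0"
  by (simp add: perp_def inner_diff_left norm_eq_1)

lemma perp_self: "norm \<eta> = 1 \<Longrightarrow> perp \<eta> \<eta> = 0"
  by (simp add: perp_def norm_eq_1)

lemma perp_perp: "norm \<eta> = 1 \<Longrightarrow> perp \<eta> (perp \<eta> z) = perp \<eta> z"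
  using inner_perp[of \<eta> z] by (simp add: perp_def)

lemma perp_orthogonal: "z \<bullet> \<eta> = 0 \<Longrightarrow> perp \<eta> z = z"
  by (simp add: perp_def)

lemma norm_perp_le: "norm \<eta> = 1 \<Longrightarrow> norm (perp \<eta> z) \<le> norm z"
proof -
  assume \<eta>: "norm \<eta> = 1"
  have "(norm (perp \<eta> z))\<^sup>2 = (norm z)\<^sup>2 - (z \<bullet> \<eta>)\<^sup>2"
    unfolding power2_norm_eq_inner perp_def using \<eta>
    by (simp add: inner_diff_left inner_diff_right norm_eq_1 inner_commute power2_eq_square)
  then have "(norm (perp \<eta> z))\<^sup>2 \<le> (norm z)\<^sup>2" by simp
  then show ?thesis by (simp add: power2_le_iff_abs_le)
qed

lemma norm_add_orthogonal_sq:
  "norm \<eta> = 1 \<Longrightarrow> z \<bullet> \<eta> = 0 \<Longrightarrow> (norm (z + u *\<^sub>R \<eta>))\<^sup>2 = (norm z)\<^sup>2 + u\<^sup>2"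
  unfolding power2_norm_eq_inner
  by (simp add: inner_add_left inner_add_right norm_eq_1 inner_commute power2_eq_square)

lemma continuous_on_perp [continuous_intros]:
  "continuous_on S f \<Longrightarrow> continuous_on S (\<lambda>x. perp \<eta> (f x))"
  unfolding perp_def by (intro continuous_intros)

lemma borel_measurable_perp [measurable]: "perp (\<eta>::'a::euclidean_space) \<in> borel \<rightarrow>\<^sub>M borel"
  by (intro borel_measurable_continuous_onI continuous_intros)

lemma AE_perp_nonzero:
  fixes \<eta> :: "'a::euclidean_space"
  assumes "2 \<le> DIM('a)"
  shows "AE z in lborel. perp \<eta> z \<noteq> 0"
proof -
  have "{z. perp \<eta> z = 0} \<subseteq> span {\<eta>}"
  proof
    fix z assume "z \<in> {z. perp \<eta> z = 0}"
    then have "z = (z \<bullet> \<eta>) *\<^sub>R \<eta>" by (simp add: perp_def)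
    then show "z \<in> span {\<eta>}" by (metis span_base span_scale singletonI)
  qed
  moreover have "negligible (span {\<eta>})"
  proof (rule negligible_lowdim)
    have "dim (span {\<eta>}) \<le> card {\<eta>}" by (metis dim_span dim_le_card' finite.emptyI finite_insert)
    then show "dim (span {\<eta>}) < DIM('a)" using assms by simp
  qed
  ultimately have "negligible {z. perp \<eta> z = 0}" by (rule negligible_subset[rotated])
  moreover have "closed {z. perp \<eta> z = 0}"
    by (intro closed_Collect_eq continuous_intros)
  ultimately have "{z. perp \<eta> z = 0} \<in> null_sets lborel"
    by (simp add: negligible_iff_null_sets null_sets_completion_iff)
  then show ?thesis by (auto intro!: AE_I'[of "{z. perp \<eta> z = 0}"])
qed

text \<open>A weight whose integral along every line parallel to \<open>\<eta>\<close> (except \<open>\<real>\<eta>\<close> itself) is 1, and on whose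
  support \<open>norm z\<close> and \<open>norm (perp \<eta> z)\<close> are comparable. It turns integrals over the
  hyperplane orthogonal to \<open>\<eta>\<close> into integrals over the whole space.\<close>
definition line_weight :: "'a::euclidean_space \<Rightarrow> 'a \<Rightarrow> real" where
  "line_weight \<eta> z = (if \<bar>z \<bullet> \<eta>\<bar> < norm (perp \<eta> z) then 1 / (2 * norm (perp \<eta> z)) else 0)"

lemma borel_measurable_line_weight [measurable]: "line_weight \<eta> \<in> borel_measurable borel"
  unfolding line_weight_def by measurable

lemma line_weight_nonneg: "0 \<le> line_weight \<eta> z"
  by (simp add: line_weight_def)

lemma nn_integral_line_weight_line:
  fixes \<eta> y :: "'a::euclidean_space"
  assumes "norm \<eta> = 1" "perp \<eta> y \<noteq> 0"
  shows "(\<integral>\<^sup>+u. ennreal (line_weight \<eta> (y - u *\<^sub>R \<eta>)) \<partial>lborel) = 1"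
proof -
  define t where "t = norm (perp \<eta> y)"
  have t: "0 < t" using assms by (simp add: t_def)
  have "ennreal (line_weight \<eta> (y - u *\<^sub>R \<eta>)) = ennreal (1 / (2 * t)) * indicator {y \<bullet> \<eta> - t <..< y \<bullet> \<eta> + t} u" for u
    using assms
    by (auto simp: line_weight_def perp_diff perp_scaleR perp_self inner_diff_left norm_eq_1 t_def indicator_def)
  then have "(\<integral>\<^sup>+u. ennreal (line_weight \<eta> (y - u *\<^sub>R \<eta>)) \<partial>lborel) = ennreal (1 / (2 * t)) * ennreal (2 * t)"
    using t by (simp add: nn_integral_cmult_indicator)
  then show ?thesis using t by (simp flip: ennreal_mult)
qed

lemma nn_integral_lborel_translate:
  fixes f :: "'a::euclidean_space \<Rightarrow> ennreal"
  assumes "f \<in> borel_measurable borel"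
  shows "(\<integral>\<^sup>+z. f (z + c) \<partial>lborel) = (\<integral>\<^sup>+z. f z \<partial>lborel)"
proof -
  have "(\<integral>\<^sup>+z. f z \<partial>distr lborel borel ((+) c)) = (\<integral>\<^sup>+z. f (c + z) \<partial>lborel)"
    using assms by (intro nn_integral_distr) auto
  then show ?thesis by (simp add: lborel_distr_plus add.commute)
qed

lemma nn_integral_lines:
  fixes \<eta> :: "'a::euclidean_space" and h :: "'a \<Rightarrow> ennreal"
  assumes \<eta>: "norm \<eta> = 1" and dim: "2 \<le> DIM('a)" and [measurable]: "h \<in> borel_measurable borel"
  shows "(\<integral>\<^sup>+z. h z \<partial>lborel) = (\<integral>\<^sup>+z. ennreal (line_weight \<eta> z) * (\<integral>\<^sup>+u. h (perp \<eta> z + u *\<^sub>R \<eta>) \<partial>lborel) \<partial>lborel)"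
proof -
  have line: "(\<integral>\<^sup>+u. h (perp \<eta> z + u *\<^sub>R \<eta>) \<partial>lborel) = (\<integral>\<^sup>+u. h (z + u *\<^sub>R \<eta>) \<partial>lborel)" for z
    using nn_integral_real_affine[of "\<lambda>u. h (perp \<eta> z + u *\<^sub>R \<eta>)" 1 "z \<bullet> \<eta>"]
    by (simp add: perp_def algebra_simps)
  have "(\<integral>\<^sup>+z. ennreal (line_weight \<eta> z) * (\<integral>\<^sup>+u. h (perp \<eta> z + u *\<^sub>R \<eta>) \<partial>lborel) \<partial>lborel)
      = (\<integral>\<^sup>+z. \<integral>\<^sup>+u. ennreal (line_weight \<eta> z) * h (z + u *\<^sub>R \<eta>) \<partial>lborel \<partial>lborel)"
    unfolding line by (subst nn_integral_cmult[symmetric]) auto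
  also have "\<dots> = (\<integral>\<^sup>+u. \<integral>\<^sup>+z. ennreal (line_weight \<eta> z) * h (z + u *\<^sub>R \<eta>) \<partial>lborel \<partial>lborel)"
    by (rule lborel_pair.Fubini') measurable
  also have "\<dots> = (\<integral>\<^sup>+u. \<integral>\<^sup>+y. ennreal (line_weight \<eta> (y - u *\<^sub>R \<eta>)) * h y \<partial>lborel \<partial>lborel)"
  proof (rule nn_integral_cong)
    fix u :: real
    show "(\<integral>\<^sup>+z. ennreal (line_weight \<eta> z) * h (z + u *\<^sub>R \<eta>) \<partial>lborel)
        = (\<integral>\<^sup>+y. ennreal (line_weight \<eta> (y - u *\<^sub>R \<eta>)) * h y \<partial>lborel)"
      using nn_integral_lborel_translate[of "\<lambda>y. ennreal (line_weight \<eta> (y - u *\<^sub>R \<eta>)) * h y" "u *\<^sub>R \<eta>"]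
      by simp
  qed
  also have "\<dots> = (\<integral>\<^sup>+y. \<integral>\<^sup>+u. ennreal (line_weight \<eta> (y - u *\<^sub>R \<eta>)) * h y \<partial>lborel \<partial>lborel)"
    by (rule lborel_pair.Fubini'[symmetric]) measurable
  also have "\<dots> = (\<integral>\<^sup>+y. h y \<partial>lborel)"
  proof (rule nn_integral_cong_AE)
    show "AE y in lborel. (\<integral>\<^sup>+u. ennreal (line_weight \<eta> (y - u *\<^sub>R \<eta>)) * h y \<partial>lborel) = h y"
      using AE_perp_nonzero[OF dim, of \<eta>]
      by (rule eventually_mono) (simp add: nn_integral_multc nn_integral_line_weight_line[OF \<eta>])
  qed
  finally show ?thesis ..
qed

lemma distr_lines:
  fixes \<eta> :: "'a::euclidean_space"
  assumes \<eta>: "norm \<eta> = 1" and dim: "2 \<le> DIM('a)"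
  shows "distr (density (lborel \<Otimes>\<^sub>M lborel) (\<lambda>x. ennreal (line_weight \<eta> (fst x)))) borel (\<lambda>x. perp \<eta> (fst x) + snd x *\<^sub>R \<eta>)
    = lborel"
proof (rule measure_eqI)
  fix A assume "A \<in> sets (distr (density (lborel \<Otimes>\<^sub>M lborel) (\<lambda>x. ennreal (line_weight \<eta> (fst x))))
      borel (\<lambda>x. perp \<eta> (fst x) + snd x *\<^sub>R \<eta>))"
  then have [measurable]: "A \<in> sets borel" by simp
  have "emeasure (distr (density (lborel \<Otimes>\<^sub>M lborel) (\<lambda>x. ennreal (line_weight \<eta> (fst x)))) borel
      (\<lambda>x. perp \<eta> (fst x) + snd x *\<^sub>R \<eta>)) A
    = (\<integral>\<^sup>+x. ennreal (line_weight \<eta> (fst x)) * indicator A (perp \<eta> (fst x) + snd x *\<^sub>R \<eta>) \<partial>(lborel \<Otimes>\<^sub>M lborel))"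
    by (simp add: nn_integral_indicator[symmetric] nn_integral_distr nn_integral_density del: nn_integral_indicator)
  also have "\<dots> = (\<integral>\<^sup>+z. \<integral>\<^sup>+u. ennreal (line_weight \<eta> z) * indicator A (perp \<eta> z + u *\<^sub>R \<eta>) \<partial>lborel \<partial>lborel)"
    by (subst lborel.nn_integral_fst[symmetric]) auto
  also have "\<dots> = (\<integral>\<^sup>+z. indicator A z \<partial>lborel)"
    by (subst nn_integral_lines[OF \<eta> dim]) (auto intro!: nn_integral_cong nn_integral_cmult)
  finally show "emeasure (distr (density (lborel \<Otimes>\<^sub>M lborel) (\<lambda>x. ennreal (line_weight \<eta> (fst x)))) borel
      (\<lambda>x. perp \<eta> (fst x) + snd x *\<^sub>R \<eta>)) A = emeasure lborel A" by simp
qed simp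

lemma fubini_lines:
  fixes \<eta> :: "'a::euclidean_space" and h :: "'a \<Rightarrow> real"
  assumes \<eta>: "norm \<eta> = 1" and dim: "2 \<le> DIM('a)" and h: "integrable lborel h"
  shows "integrable lborel (\<lambda>z. line_weight \<eta> z * (LINT u|lborel. h (perp \<eta> z + u *\<^sub>R \<eta>)))"
    and "(LINT z|lborel. h z) = (LINT z|lborel. line_weight \<eta> z * (LINT u|lborel. h (perp \<eta> z + u *\<^sub>R \<eta>)))"
proof -
  have [measurable]: "h \<in> borel_measurable borel" using h by simp
  define f where "f = (\<lambda>z u. line_weight \<eta> z * h (perp \<eta> z + u *\<^sub>R \<eta>))"
  note lines = distr_lines[OF \<eta> dim, symmetric]
  have integrable_f: "integrable (lborel \<Otimes>\<^sub>M lborel) (\<lambda>(z, u). f z u)"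
    using h by (subst (asm) lines)
      (simp add: integrable_distr_eq integrable_real_density case_prod_beta' f_def line_weight_nonneg)
  show "integrable lborel (\<lambda>z. line_weight \<eta> z * (LINT u|lborel. h (perp \<eta> z + u *\<^sub>R \<eta>)))"
    using lborel_pair.integrable_fst'[OF integrable_f] by (simp add: f_def)
  have "(LINT z|lborel. h z) = (LINT (z, u)|(lborel \<Otimes>\<^sub>M lborel). f z u)"
    by (subst lines) (simp add: integral_distr integral_real_density case_prod_beta' f_def line_weight_nonneg)
  also have "\<dots> = (LINT z|lborel. LINT u|lborel. f z u)"
    using lborel_pair.integral_fst'[OF integrable_f] by simp
  finally show "(LINT z|lborel. h z) = (LINT z|lborel. line_weight \<eta> z * (LINT u|lborel. h (perp \<eta> z + u *\<^sub>R \<eta>)))"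
    by (simp add: f_def)
qed

definition lines_const :: "'a::euclidean_space itself \<Rightarrow> real \<Rightarrow> real" where
  "lines_const _ \<gamma> = 2 powr (\<gamma>+1) * ball_powr_const TYPE('a) (\<gamma>+1) * 2 powr (real DIM('a) - (\<gamma>+1))"

lemma lines_const_nonneg: "\<gamma> + 1 < real DIM('a) \<Longrightarrow> 0 \<le> lines_const TYPE('a::euclidean_space) \<gamma>"
  by (simp add: lines_const_def ball_powr_const_def)

lemma line_weight_powr_le:
  fixes \<gamma> r :: real and \<eta> z :: "'a::euclidean_space"
  assumes \<gamma>: "-1 \<le> \<gamma>" and \<eta>: "norm \<eta> = 1"
  shows "line_weight \<eta> z * (norm (perp \<eta> z) powr (-\<gamma>) * indicator {..<r} (norm (perp \<eta> z)))
    \<le> 2 powr (\<gamma>+1) * (norm z powr (-(\<gamma>+1)) * indicator (ball 0 (2*r)) z)"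
proof (cases "\<bar>z \<bullet> \<eta>\<bar> < norm (perp \<eta> z) \<and> norm (perp \<eta> z) < r")
  case True
  define t where "t = norm (perp \<eta> z)"
  have "z = perp \<eta> z + (z \<bullet> \<eta>) *\<^sub>R \<eta>" by (simp add: perp_def)
  then have "norm z \<le> norm (perp \<eta> z) + norm ((z \<bullet> \<eta>) *\<^sub>R \<eta>)" by (metis norm_triangle_ineq)
  then have t: "0 < t" "norm z \<le> 2 * t" "t \<le> norm z"
    using True \<eta> norm_perp_le[OF \<eta>, of z] by (auto simp: t_def)
  have "1 / (2*t) * t powr (-\<gamma>) \<le> t powr (-1) * t powr (-\<gamma>)"
    using t by (intro mult_right_mono) (auto simp: powr_minus_divide divide_simps)
  also have "\<dots> = t powr (-(\<gamma>+1))"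
    unfolding powr_add[symmetric] by (rule arg_cong[where f="\<lambda>x. t powr x"]) simp
  also have "\<dots> \<le> (norm z / 2) powr (-(\<gamma>+1))"
    using t \<gamma> by (intro powr_mono2') auto
  also have "\<dots> = 2 powr (\<gamma>+1) * norm z powr (-(\<gamma>+1))"
    using t unfolding powr_divide powr_minus by (simp add: divide_simps)
  finally show ?thesis using True t by (simp add: line_weight_def t_def indicator_def)
qed (auto simp: line_weight_def)

lemma nn_integral_line_weight_powr:
  fixes \<gamma> r :: real and \<eta> :: "'a::euclidean_space"
  assumes \<gamma>: "-1 \<le> \<gamma>" "\<gamma> + 1 < DIM('a)" and r: "0 < r" and \<eta>: "norm \<eta> = 1"
  shows "(\<integral>\<^sup>+z. ennreal (line_weight \<eta> z * (norm (perp \<eta> z) powr (-\<gamma>) * indicator {..<r} (norm (perp \<eta> z)))) \<partial>lborel)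
    \<le> ennreal (lines_const TYPE('a) \<gamma> * r powr (real DIM('a) - 1 - \<gamma>))"
proof -
  let ?C = "ball_powr_const TYPE('a) (\<gamma>+1)"
  have "(\<integral>\<^sup>+z. ennreal (line_weight \<eta> z * (norm (perp \<eta> z) powr (-\<gamma>) * indicator {..<r} (norm (perp \<eta> z)))) \<partial>lborel)
      \<le> (\<integral>\<^sup>+z. ennreal (2 powr (\<gamma>+1)) * (ennreal (norm z powr (-(\<gamma>+1))) * indicator (ball (0::'a) (2*r)) z) \<partial>lborel)"
    using line_weight_powr_le[OF \<gamma>(1) \<eta>]
    by (intro nn_integral_mono)
       (auto simp: ennreal_mult[symmetric] ennreal_indicator[symmetric] simp del: ennreal_indicator intro!: ennreal_leI)
  also have "\<dots> = ennreal (2 powr (\<gamma>+1)) * (\<integral>\<^sup>+z. ennreal (norm z powr (-(\<gamma>+1))) * indicator (ball (0::'a) (2*r)) z \<partial>lborel)"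
    by (intro nn_integral_cmult borel_measurable_times_ennreal borel_measurable_indicator) auto
  also have "\<dots> \<le> ennreal (2 powr (\<gamma>+1)) * ennreal (?C * (2*r) powr (DIM('a) - (\<gamma>+1)))"
    using r \<gamma> by (intro mult_left_mono nn_integral_ball_powr) auto
  also have "\<dots> = ennreal (lines_const TYPE('a) \<gamma> * r powr (real DIM('a) - 1 - \<gamma>))"
    using r \<gamma>
    by (simp add: ennreal_mult[symmetric] powr_mult lines_const_def ball_powr_const_def algebra_simps)
  finally show ?thesis .
qed

lemma nn_integral_line_weight_le:
  fixes F :: "'a::euclidean_space \<Rightarrow> ennreal" and \<gamma> r K :: real
  assumes \<gamma>: "-1 \<le> \<gamma>" "\<gamma> + 1 < DIM('a)" and r: "0 < r" and \<eta>: "norm \<eta> = 1" and K: "0 \<le> K"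
    and F: "\<And>z. z \<bullet> \<eta> = 0 \<Longrightarrow> z \<noteq> 0 \<Longrightarrow> F z \<le> ennreal (K * (norm z powr (-\<gamma>) * indicator {..<r} (norm z)))"
  shows "(\<integral>\<^sup>+z. ennreal (line_weight \<eta> z) * F (perp \<eta> z) \<partial>lborel)
    \<le> ennreal (K * lines_const TYPE('a) \<gamma> * r powr (real DIM('a) - 1 - \<gamma>))"
proof -
  let ?b = "\<lambda>z. line_weight \<eta> z * (norm (perp \<eta> z) powr (-\<gamma>) * indicator {..<r} (norm (perp \<eta> z)))"
  have "ennreal (line_weight \<eta> z) * F (perp \<eta> z) \<le> ennreal K * ennreal (?b z)" for z
  proof (cases "perp \<eta> z = 0")
    case False
    then have "ennreal (line_weight \<eta> z) * F (perp \<eta> z)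
        \<le> ennreal (line_weight \<eta> z) * ennreal (K * (norm (perp \<eta> z) powr (-\<gamma>) * indicator {..<r} (norm (perp \<eta> z))))"
      by (intro mult_left_mono F inner_perp \<eta>) auto
    then show ?thesis using K by (simp add: ennreal_mult[symmetric] line_weight_nonneg mult_ac)
  qed (simp add: line_weight_def)
  then have "(\<integral>\<^sup>+z. ennreal (line_weight \<eta> z) * F (perp \<eta> z) \<partial>lborel) \<le> ennreal K * (\<integral>\<^sup>+z. ennreal (?b z) \<partial>lborel)"
    by (subst nn_integral_cmult[symmetric]) (auto intro!: nn_integral_mono)
  also have "\<dots> \<le> ennreal K * ennreal (lines_const TYPE('a) \<gamma> * r powr (real DIM('a) - 1 - \<gamma>))"
    by (intro mult_left_mono nn_integral_line_weight_powr \<gamma> r \<eta>) auto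
  also have "\<dots> = ennreal (K * lines_const TYPE('a) \<gamma> * r powr (real DIM('a) - 1 - \<gamma>))"
    using K lines_const_nonneg[OF \<gamma>(2)] by (simp add: ennreal_mult[symmetric] mult.assoc)
  finally show ?thesis .
qed

lemma integral_bound_by_lines:
  fixes \<eta> :: "'a::euclidean_space" and h :: "'a \<Rightarrow> real" and \<gamma> r K :: real
  assumes dim: "2 \<le> DIM('a)" and \<gamma>: "-1 \<le> \<gamma>" "\<gamma> + 1 < DIM('a)" and r: "0 < r" and \<eta>: "norm \<eta> = 1"
    and h: "integrable lborel h" and K: "0 \<le> K"
    and line: "\<And>z. z \<bullet> \<eta> = 0 \<Longrightarrow> z \<noteq> 0 \<Longrightarrow>
      \<bar>LINT u|lborel. h (z + u *\<^sub>R \<eta>)\<bar> \<le> K * (norm z powr (-\<gamma>) * indicator {..<r} (norm z))"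
  shows "\<bar>LINT z|lborel. h z\<bar> \<le> K * lines_const TYPE('a) \<gamma> * r powr (real DIM('a) - 1 - \<gamma>)"
proof -
  let ?I = "\<lambda>z. LINT u|lborel. h (z + u *\<^sub>R \<eta>)"
  have "ennreal \<bar>LINT z|lborel. h z\<bar> = ennreal \<bar>LINT z|lborel. line_weight \<eta> z * ?I (perp \<eta> z)\<bar>"
    using fubini_lines(2)[OF \<eta> dim h] by simp
  also have "\<dots> \<le> (\<integral>\<^sup>+z. ennreal \<bar>line_weight \<eta> z * ?I (perp \<eta> z)\<bar> \<partial>lborel)"
    using integral_norm_bound_ennreal[OF fubini_lines(1)[OF \<eta> dim h]] by simp
  also have "\<dots> = (\<integral>\<^sup>+z. ennreal (line_weight \<eta> z) * ennreal \<bar>?I (perp \<eta> z)\<bar> \<partial>lborel)"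
    by (simp add: abs_mult line_weight_nonneg ennreal_mult)
  also have "\<dots> \<le> ennreal (K * lines_const TYPE('a) \<gamma> * r powr (real DIM('a) - 1 - \<gamma>))"
    by (rule nn_integral_line_weight_le[OF \<gamma> r \<eta> K]) (intro ennreal_leI line)
  finally show ?thesis
    using K lines_const_nonneg[OF \<gamma>(2)] by (subst (asm) ennreal_le_iff) auto
qed

lemma nn_integral_bound_by_lines:
  fixes \<eta> :: "'a::euclidean_space" and h :: "'a \<Rightarrow> ennreal" and \<gamma> r K :: real
  assumes dim: "2 \<le> DIM('a)" and \<gamma>: "-1 \<le> \<gamma>" "\<gamma> + 1 < DIM('a)" and r: "0 < r" and \<eta>: "norm \<eta> = 1"
    and h: "h \<in> borel_measurable borel" and K: "0 \<le> K"
    and line: "\<And>z. z \<bullet> \<eta> = 0 \<Longrightarrow> z \<noteq> 0 \<Longrightarrow>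
      (\<integral>\<^sup>+u. h (z + u *\<^sub>R \<eta>) \<partial>lborel) \<le> ennreal (K * (norm z powr (-\<gamma>) * indicator {..<r} (norm z)))"
  shows "(\<integral>\<^sup>+z. h z \<partial>lborel) \<le> ennreal (K * lines_const TYPE('a) \<gamma> * r powr (real DIM('a) - 1 - \<gamma>))"
  using nn_integral_line_weight_le[OF \<gamma> r \<eta> K line] by (simp add: nn_integral_lines[OF \<eta> dim h])

section \<open>Truncated kernels and potentials\<close>

lemma power2_powr_half:
  fixes t x :: real
  assumes "0 \<le> t"
  shows "(t\<^sup>2) powr (-(x/2)) = t powr (-x)"
proof (cases "t = 0")
  case False
  then have "t\<^sup>2 = t powr 2" using assms by (simp add: powr_numeral)
  then have "(t\<^sup>2) powr (-(x/2)) = t powr (2 * -(x/2))" by (simp only: powr_powr)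
  then show ?thesis by simp
qed simp

lemma max_power2: "0 \<le> x \<Longrightarrow> 0 \<le> y \<Longrightarrow> max (x\<^sup>2) (y\<^sup>2) = (max x y)\<^sup>2" for x y :: real
  by (cases "x \<le> y") (auto simp: max_def power_mono power2_le_iff_abs_le)

lemma integrable_indicator_times_bounded:
  fixes f :: "'a::euclidean_space \<Rightarrow> real"
  assumes E: "E \<in> sets borel" "bounded E" and f: "f \<in> borel_measurable borel"
    and bound: "\<And>x. x \<in> E \<Longrightarrow> \<bar>f x\<bar> \<le> K"
  shows "integrable lborel (\<lambda>x. indicator E x * f x)"
proof (rule Bochner_Integration.integrable_bound)
  show "integrable lborel (\<lambda>x. K * indicator E x)"
    using E emeasure_bounded_finite[OF E(2)] by (intro integrable_mult_right integrable_real_indicator) auto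
  show "AE x in lborel. norm (indicator E x * f x) \<le> norm (K * indicator E x)"
    using order_trans[OF bound abs_ge_self] by (intro AE_I2) (auto simp: indicator_def)
qed (use E f in simp)

lemma integrable_bounded_support:
  fixes f :: "'a::euclidean_space \<Rightarrow> real"
  assumes "f \<in> borel_measurable borel" "\<And>z. \<bar>f z\<bar> \<le> K" and "\<And>z. r \<le> norm z \<Longrightarrow> f z = 0"
  shows "integrable lborel f"
proof -
  have "integrable lborel (\<lambda>z. indicator (ball 0 r) z * f z)"
    by (rule integrable_indicator_times_bounded[where K=K]) (use assms in auto)
  moreover have "indicator (ball 0 r) z * f z = f z" for z using assms(3)[of z] by (auto simp: indicator_def)
  ultimately show ?thesis by simp
qed

definition trunc_kernel :: "real \<Rightarrow> real \<Rightarrow> 'a::real_normed_vector \<Rightarrow> real" where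
  "trunc_kernel m \<rho> z = trunc_powr (m/2) (\<rho>\<^sup>2) ((norm z)\<^sup>2)"

definition near_kernel :: "real \<Rightarrow> real \<Rightarrow> real \<Rightarrow> 'a::real_normed_vector \<Rightarrow> real" where
  "near_kernel m \<epsilon> \<rho> z = trunc_kernel m \<epsilon> z - trunc_kernel m \<rho> z"

lemma trunc_kernel_cong: "norm y = norm z \<Longrightarrow> trunc_kernel m \<rho> y = trunc_kernel m \<rho> z"
  by (simp add: trunc_kernel_def)

lemma near_kernel_cong: "norm y = norm z \<Longrightarrow> near_kernel m \<epsilon> \<rho> y = near_kernel m \<epsilon> \<rho> z"
  by (simp add: near_kernel_def cong: trunc_kernel_cong)

lemma continuous_on_trunc_kernel [continuous_intros]:
  assumes "0 < \<rho>" "continuous_on S f"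
  shows "continuous_on S (\<lambda>x. trunc_kernel m \<rho> (f x))"
  unfolding trunc_kernel_def using assms by (intro continuous_intros) auto

lemma borel_measurable_trunc_kernel:
  fixes f :: "'b \<Rightarrow> 'a::euclidean_space"
  assumes "0 < \<rho>" "f \<in> borel_measurable M"
  shows "(\<lambda>x. trunc_kernel m \<rho> (f x)) \<in> borel_measurable M"
  using assms by (intro measurable_compose[OF assms(2)] borel_measurable_continuous_onI continuous_intros)

lemma borel_measurable_near_kernel:
  "0 < \<epsilon> \<Longrightarrow> \<epsilon> \<le> \<rho> \<Longrightarrow> (near_kernel m \<epsilon> \<rho> :: 'a::euclidean_space \<Rightarrow> real) \<in> borel_measurable borel"
  unfolding near_kernel_def[abs_def] by (intro borel_measurable_diff borel_measurable_trunc_kernel) auto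

lemma trunc_kernel_nonneg: "0 < \<rho> \<Longrightarrow> 0 < m \<Longrightarrow> 0 \<le> trunc_kernel m \<rho> z"
  by (simp add: trunc_kernel_def trunc_powr_nonneg)

lemma trunc_kernel_outside: "0 \<le> \<rho> \<Longrightarrow> \<rho> \<le> norm z \<Longrightarrow> trunc_kernel m \<rho> z = norm z powr (-m)"
  by (simp add: trunc_kernel_def trunc_powr_def power_mono power2_powr_half)

lemma trunc_kernel_le_powr:
  assumes "0 < \<rho>" "0 < m" "z \<noteq> 0"
  shows "trunc_kernel m \<rho> z \<le> norm z powr (-m)"
  using trunc_powr_le_powr[of "\<rho>\<^sup>2" "m/2" "(norm z)\<^sup>2"] assms by (simp add: trunc_kernel_def power2_powr_half)

lemma trunc_kernel_le:
  assumes "0 < \<rho>" "0 < m"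
  shows "trunc_kernel m \<rho> z \<le> (1 + m/2) * \<rho> powr (-m)"
proof -
  have "trunc_kernel m \<rho> z \<le> (1 + m/2) * max (\<rho>\<^sup>2) ((norm z)\<^sup>2) powr (-(m/2))"
    unfolding trunc_kernel_def using assms by (intro trunc_powr_le_max) auto
  also have "\<dots> \<le> (1 + m/2) * (\<rho>\<^sup>2) powr (-(m/2))" using assms by (intro mult_left_mono powr_mono2') auto
  finally show ?thesis using assms by (simp add: power2_powr_half)
qed

lemma near_kernel_nonneg: "0 < \<epsilon> \<Longrightarrow> \<epsilon> \<le> \<rho> \<Longrightarrow> 0 < m \<Longrightarrow> 0 \<le> near_kernel m \<epsilon> \<rho> z"
  by (simp add: near_kernel_def trunc_kernel_def trunc_powr_antimono_cutoff power_mono)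

lemma near_kernel_le: "0 < \<epsilon> \<Longrightarrow> \<epsilon> \<le> \<rho> \<Longrightarrow> 0 < m \<Longrightarrow> near_kernel m \<epsilon> \<rho> z \<le> (1 + m/2) * \<epsilon> powr (-m)"
  using trunc_kernel_le[of \<epsilon> m z] trunc_kernel_nonneg[of \<rho> m z] by (simp add: near_kernel_def)

lemma near_kernel_outside: "0 < \<epsilon> \<Longrightarrow> \<epsilon> \<le> \<rho> \<Longrightarrow> \<rho> \<le> norm z \<Longrightarrow> near_kernel m \<epsilon> \<rho> z = 0"
  by (simp add: near_kernel_def trunc_kernel_outside)

lemma near_kernel_add: "near_kernel m \<epsilon> \<rho> z + near_kernel m \<rho> r z = near_kernel m \<epsilon> r z"
  by (simp add: near_kernel_def)

lemma near_kernel_along_line_le: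
  assumes \<eta>: "norm \<eta> = 1" "z \<bullet> \<eta> = 0" and \<epsilon>: "0 < \<epsilon>" "\<epsilon> \<le> \<rho>" and m: "0 < m"
  shows "near_kernel m \<epsilon> \<rho> (z + v *\<^sub>R \<eta>) \<le> (1 + m/2) * max \<epsilon> (norm z) powr (-m)"
proof -
  have "near_kernel m \<epsilon> \<rho> (z + v *\<^sub>R \<eta>) \<le> trunc_kernel m \<epsilon> (z + v *\<^sub>R \<eta>)"
    using trunc_kernel_nonneg[of \<rho> m "z + v *\<^sub>R \<eta>"] \<epsilon> m by (simp add: near_kernel_def)
  also have "\<dots> \<le> (1 + m/2) * max (\<epsilon>\<^sup>2) ((norm z)\<^sup>2 + v\<^sup>2) powr (-(m/2))"
    unfolding trunc_kernel_def norm_add_orthogonal_sq[OF \<eta>] using \<epsilon> m by (intro trunc_powr_le_max) auto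
  also have "\<dots> \<le> (1 + m/2) * max (\<epsilon>\<^sup>2) ((norm z)\<^sup>2) powr (-(m/2))"
    using \<epsilon> m by (intro mult_left_mono powr_mono2' max.mono) (auto simp: less_max_iff_disj)
  finally show ?thesis using \<epsilon> by (simp add: max_power2 power2_powr_half)
qed

lemma near_kernel_along_line_lipschitz:
  assumes \<eta>: "norm \<eta> = 1" "z \<bullet> \<eta> = 0" and \<epsilon>: "0 < \<epsilon>" "\<epsilon> \<le> \<rho>" and m: "0 < m"
  shows "\<bar>near_kernel m \<epsilon> \<rho> (z + u *\<^sub>R \<eta>) - near_kernel m \<epsilon> \<rho> (z + v *\<^sub>R \<eta>)\<bar>
    \<le> m * max \<epsilon> (norm z) powr (-(m+1)) * \<bar>u - v\<bar>"
proof -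
  have "\<bar>near_kernel m \<epsilon> \<rho> (z + u *\<^sub>R \<eta>) - near_kernel m \<epsilon> \<rho> (z + v *\<^sub>R \<eta>)\<bar>
      \<le> 2 * (m/2) * max (\<epsilon>\<^sup>2) ((norm z)\<^sup>2) powr (- (m/2) - 1/2) * \<bar>u - v\<bar>"
    unfolding near_kernel_def trunc_kernel_def norm_add_orthogonal_sq[OF \<eta>]
    using \<epsilon> m by (intro trunc_powr_diff_lipschitz_along_line) (auto intro: power_mono)
  also have "- (m/2) - 1/2 = - ((m+1)/2)" by (simp add: field_simps)
  finally show ?thesis
    using \<epsilon> by (simp only: max_power2 power2_powr_half less_imp_le norm_ge_zero max.coboundedI1)
qed

definition trunc_potential :: "real \<Rightarrow> real \<Rightarrow> 'a::euclidean_space set \<Rightarrow> 'a \<Rightarrow> real" where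
  "trunc_potential m \<rho> E q = (LINT z|lborel. indicator E (q + z) * trunc_kernel m \<rho> z)"

definition near_potential :: "real \<Rightarrow> real \<Rightarrow> real \<Rightarrow> 'a::euclidean_space set \<Rightarrow> 'a \<Rightarrow> real" where
  "near_potential m \<epsilon> \<rho> E q = (LINT z|lborel. indicator E (q + z) * near_kernel m \<epsilon> \<rho> z)"

lemma integrable_trunc_kernel:
  assumes m: "real DIM('a::euclidean_space) < m" and \<rho>: "0 < \<rho>"
  shows "integrable lborel (trunc_kernel m \<rho> :: 'a \<Rightarrow> real)"
proof (rule Bochner_Integration.integrable_bound)
  let ?bound = "\<lambda>z::'a. (1 + m/2) * \<rho> powr (-m) * indicator (ball 0 \<rho>) z + norm z powr (-m) * indicator (- ball 0 \<rho>) z"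
  have pos: "0 < m" using m by simp
  show "integrable lborel ?bound"
    using emeasure_bounded_finite[OF bounded_ball, of "0::'a" \<rho>] m \<rho>
    by (intro Bochner_Integration.integrable_add integrable_mult_right integrable_real_indicator integrable_powr_outside_ball)
       (auto simp: infinity_ennreal_def)
  show "AE z in lborel. norm (trunc_kernel m \<rho> z) \<le> norm (?bound z)"
  proof (rule AE_I2)
    fix z :: 'a
    show "norm (trunc_kernel m \<rho> z) \<le> norm (?bound z)"
      using trunc_kernel_nonneg[OF \<rho> pos, of z] trunc_kernel_le[OF \<rho> pos, of z] trunc_kernel_outside[of \<rho> z m] \<rho> pos
      by (cases "norm z < \<rho>") auto
  qed
  show "trunc_kernel m \<rho> \<in> borel_measurable lborel" by (rule borel_measurable_trunc_kernel[OF \<rho>]) simp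
qed

lemma integrable_indicator_translate_times:
  fixes f :: "'a::euclidean_space \<Rightarrow> real"
  assumes f: "integrable lborel f" and [measurable]: "E \<in> sets borel"
  shows "integrable lborel (\<lambda>z. indicator E (q + z) * f z)" "integrable lborel (\<lambda>z. indicator E (q - z) * f z)"
proof -
  have [measurable]: "f \<in> borel_measurable borel" using f by simp
  show "integrable lborel (\<lambda>z. indicator E (q + z) * f z)" "integrable lborel (\<lambda>z. indicator E (q - z) * f z)"
    by (rule Bochner_Integration.integrable_bound[OF f]; auto simp: indicator_def)+
qed

lemma integrable_near_kernel:
  assumes "0 < \<epsilon>" "\<epsilon> \<le> \<rho>" "0 < m"
  shows "integrable lborel (near_kernel m \<epsilon> \<rho> :: 'a::euclidean_space \<Rightarrow> real)"
  by (rule integrable_bounded_support[where r=\<rho> and K="(1 + m/2) * \<epsilon> powr (-m)"])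
    (use assms in \<open>simp_all add: borel_measurable_near_kernel near_kernel_nonneg near_kernel_le near_kernel_outside\<close>)

lemma near_potential_eq:
  fixes E :: "'a::euclidean_space set"
  assumes "real DIM('a) < m" "0 < \<epsilon>" "0 < \<rho>" "E \<in> sets borel"
  shows "near_potential m \<epsilon> \<rho> E q = trunc_potential m \<epsilon> E q - trunc_potential m \<rho> E q"
  using integrable_indicator_translate_times(1)[OF integrable_trunc_kernel assms(4)] assms
  by (simp add: near_potential_def trunc_potential_def near_kernel_def right_diff_distrib)

lemma near_potential_add:
  assumes "0 < \<epsilon>" "\<epsilon> \<le> \<rho>" "\<rho> \<le> r" "0 < m" "E \<in> sets borel"
  shows "near_potential m \<epsilon> \<rho> E q + near_potential m \<rho> r E q = near_potential m \<epsilon> r E q"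
proof -
  have "near_potential m \<epsilon> \<rho> E q + near_potential m \<rho> r E q
      = (LINT z|lborel. indicator E (q + z) * near_kernel m \<epsilon> \<rho> z + indicator E (q + z) * near_kernel m \<rho> r z)"
    unfolding near_potential_def using assms
    by (intro Bochner_Integration.integral_add[symmetric] integrable_indicator_translate_times integrable_near_kernel) auto
  then show ?thesis by (simp add: near_potential_def near_kernel_add flip: distrib_left)
qed

lemma trunc_potential_alt:
  fixes q :: "'a::euclidean_space"
  assumes [measurable]: "E \<in> sets borel" and \<rho>: "0 < \<rho>"
  shows "trunc_potential m \<rho> E q = (LINT x|lborel. indicator E x * trunc_kernel m \<rho> (x - q))"
proof -
  have [measurable]: "(\<lambda>x. trunc_kernel m \<rho> (x - q)) \<in> borel_measurable borel"
    using \<rho> by (intro borel_measurable_trunc_kernel) auto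
  have "(LINT x|lborel. indicator E x * trunc_kernel m \<rho> (x - q))
      = (LINT x|distr lborel borel ((+) q). indicator E x * trunc_kernel m \<rho> (x - q))"
    by (simp only: lborel_distr_plus)
  also have "\<dots> = (LINT z|lborel. indicator E (q + z) * trunc_kernel m \<rho> (q + z - q))"
    by (rule integral_distr) measurable
  finally show ?thesis by (simp add: trunc_potential_def)
qed

lemma integrable_indicator_trunc_kernel_diff:
  fixes E :: "'a::euclidean_space set"
  assumes "E \<in> sets borel" "bounded E" and \<rho>: "0 < \<rho>" "0 < m"
  shows "integrable lborel (\<lambda>x. indicator E x * trunc_kernel m \<rho> (x - q))"
  by (intro integrable_indicator_times_bounded[where K="(1 + m/2) * \<rho> powr (-m)"] borel_measurable_trunc_kernel)
    (use assms in \<open>simp_all add: trunc_kernel_nonneg trunc_kernel_le\<close>)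

lemma trunc_potential_tendsto:
  fixes q :: "'a::euclidean_space"
  assumes E: "E \<in> sets borel" "bounded E" and \<rho>: "0 < \<rho>" "0 < m" and x: "x \<longlonglongrightarrow> q"
  shows "(\<lambda>j. trunc_potential m \<rho> E (x j)) \<longlonglongrightarrow> trunc_potential m \<rho> E q"
  unfolding trunc_potential_alt[OF E(1) \<rho>(1)]
proof (rule integral_dominated_convergence[where w="\<lambda>x. indicator E x * ((1 + m/2) * \<rho> powr (-m))"])
  show "integrable lborel (\<lambda>x. indicator E x * ((1 + m/2) * \<rho> powr (-m)))"
    by (rule integrable_indicator_times_bounded[OF E, where K="\<bar>(1 + m/2) * \<rho> powr (-m)\<bar>"]) auto
  have "continuous_on UNIV (trunc_kernel m \<rho> :: 'a \<Rightarrow> real)"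
    by (rule continuous_on_trunc_kernel[OF \<rho>(1) continuous_on_id])
  then have cont: "isCont (trunc_kernel m \<rho>) z" for z :: 'a by (simp add: continuous_on_eq_continuous_at)
  show "AE z in lborel. (\<lambda>j. indicator E z * trunc_kernel m \<rho> (z - x j)) \<longlonglongrightarrow> indicator E z * trunc_kernel m \<rho> (z - q)"
    by (intro AE_I2 tendsto_mult tendsto_const isCont_tendsto_compose[OF cont] tendsto_diff x)
  show "AE z in lborel. norm (indicator E z * trunc_kernel m \<rho> (z - x j)) \<le> indicator E z * ((1 + m/2) * \<rho> powr (-m))" for j
    by (intro AE_I2) (simp add: indicator_def trunc_kernel_nonneg[OF \<rho>] trunc_kernel_le[OF \<rho>])
qed (intro borel_measurable_integrable[OF integrable_indicator_trunc_kernel_diff[OF E \<rho>]])+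

section \<open>Hyperplane reflections\<close>

definition mirror :: "'a::real_inner \<Rightarrow> 'a \<Rightarrow> 'a" where
  "mirror v z = z - (2 * (z \<bullet> v)) *\<^sub>R v"

lemma mirror_add: "mirror v (y + z) = mirror v y + mirror v z"
  by (simp add: mirror_def inner_add_left algebra_simps)

lemma mirror_scaleR: "mirror v (c *\<^sub>R z) = c *\<^sub>R mirror v z"
  by (simp add: mirror_def algebra_simps)

lemma mirror_diff: "mirror v (y - z) = mirror v y - mirror v z"
  by (simp add: mirror_def inner_diff_left algebra_simps)

lemma mirror_self: "norm v = 1 \<Longrightarrow> mirror v v = - v"
  by (simp add: mirror_def norm_eq_1 scaleR_2)

lemma mirror_orthogonal: "z \<bullet> v = 0 \<Longrightarrow> mirror v z = z"
  by (simp add: mirror_def)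

lemma mirror_inner: "norm v = 1 \<Longrightarrow> mirror v y \<bullet> mirror v z = y \<bullet> z"
  by (simp add: mirror_def inner_diff_left inner_diff_right norm_eq_1 inner_commute algebra_simps)

lemma norm_mirror: "norm v = 1 \<Longrightarrow> norm (mirror v z) = norm z"
  by (simp add: norm_eq_sqrt_inner mirror_inner)

lemma mirror_mirror: "norm v = 1 \<Longrightarrow> mirror v (mirror v z) = z"
  by (simp add: mirror_def inner_diff_left norm_eq_1 algebra_simps)

lemma continuous_on_mirror [continuous_intros]:
  "continuous_on S f \<Longrightarrow> continuous_on S (\<lambda>x. mirror v (f x))"
  unfolding mirror_def by (intro continuous_intros)

lemma borel_measurable_mirror [measurable]: "mirror (v::'a::euclidean_space) \<in> borel \<rightarrow>\<^sub>M borel"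
  by (intro borel_measurable_continuous_onI continuous_intros)

lemma distr_lborel_mirror:
  fixes v :: "'a::euclidean_space"
  assumes v: "norm v = 1" and dim: "2 \<le> DIM('a)"
  shows "distr lborel borel (mirror v) = lborel"
proof (rule measure_eqI)
  fix A assume "A \<in> sets (distr lborel borel (mirror v))"
  then have [measurable]: "A \<in> sets borel" by simp
  have mirror_line: "mirror v (perp v z + u *\<^sub>R v) = perp v z + (0 + (-1) * u) *\<^sub>R v" for z u
    using v inner_perp[OF v, of z] by (simp add: mirror_add mirror_scaleR mirror_self mirror_orthogonal)
  have "emeasure (distr lborel borel (mirror v)) A = (\<integral>\<^sup>+z. indicator A (mirror v z) \<partial>lborel)"
    by (simp add: nn_integral_indicator[symmetric] nn_integral_distr del: nn_integral_indicator)
  also have "\<dots> = (\<integral>\<^sup>+z. ennreal (line_weight v z) * (\<integral>\<^sup>+u. indicator A (mirror v (perp v z + u *\<^sub>R v)) \<partial>lborel) \<partial>lborel)"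
    by (rule nn_integral_lines[OF v dim]) measurable
  also have "\<dots> = (\<integral>\<^sup>+z. ennreal (line_weight v z) * (\<integral>\<^sup>+u. indicator A (perp v z + u *\<^sub>R v) \<partial>lborel) \<partial>lborel)"
  proof (rule nn_integral_cong)
    fix z :: 'a
    have "(\<integral>\<^sup>+u. indicator A (mirror v (perp v z + u *\<^sub>R v)) \<partial>lborel) = (\<integral>\<^sup>+u. indicator A (perp v z + u *\<^sub>R v) \<partial>lborel :: ennreal)"
      using nn_integral_real_affine[of "\<lambda>u. indicator A (perp v z + u *\<^sub>R v)" "-1" 0]
      by (simp add: mirror_line)
    then show "ennreal (line_weight v z) * (\<integral>\<^sup>+u. indicator A (mirror v (perp v z + u *\<^sub>R v)) \<partial>lborel)
      = ennreal (line_weight v z) * (\<integral>\<^sup>+u. indicator A (perp v z + u *\<^sub>R v) \<partial>lborel)" by simp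
  qed
  also have "\<dots> = (\<integral>\<^sup>+z. indicator A z \<partial>lborel)"
    by (rule nn_integral_lines[OF v dim, symmetric]) measurable
  finally show "emeasure (distr lborel borel (mirror v)) A = emeasure lborel A" by simp
qed simp

lemma distr_lborel_uminus: "distr lborel borel uminus = (lborel :: 'a::euclidean_space measure)"
  using lborel_affine[of "-1" "0::'a"] by (simp add: density_1)

lemma distr_lborel_compose:
  assumes "distr lborel borel f = (lborel :: 'a::euclidean_space measure)" "distr lborel borel g = lborel"
    and [measurable]: "f \<in> borel \<rightarrow>\<^sub>M borel" "g \<in> borel \<rightarrow>\<^sub>M borel"
  shows "distr lborel borel (\<lambda>x. g (f x)) = lborel"
proof -
  have "distr lborel borel (g \<circ> f) = distr (distr lborel borel f) borel g"
    by (rule distr_distr[symmetric]) auto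
  then show ?thesis by (simp add: assms o_def)
qed

section \<open>Paired subgraphs\<close>

lemma has_bochner_integral_between:
  fixes T t :: "real \<Rightarrow> real"
  assumes T: "\<And>v. (T has_real_derivative t v) (at v)" and t: "continuous_on UNIV t"
  shows "has_bochner_integral lborel (\<lambda>u. (indicator {..<x1} u - indicator {..<x2} u) * t u) (T x1 - T x2)"
proof -
  have [measurable]: "t \<in> borel_measurable borel" using t by (rule borel_measurable_continuous_onI)
  have ordered: "has_bochner_integral lborel (\<lambda>u. (indicator {..<y} u - indicator {..<x} u) * t u) (T y - T x)"
    if "x \<le> y" for x y
  proof -
    have "has_bochner_integral lborel (\<lambda>u. t u * indicator {x..y} u) (T y - T x)"
      using that T t by (intro has_bochner_integral_FTC_Icc_real) (auto simp: continuous_on_eq_continuous_at)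
    moreover have "AE u in lborel. t u * indicator {x..y} u = (indicator {..<y} u - indicator {..<x} u) * t u"
      using AE_lborel_singleton[of y] by (rule eventually_mono) (use that in \<open>auto simp: indicator_def\<close>)
    ultimately show ?thesis by (subst (asm) has_bochner_integral_cong_AE) auto
  qed
  show ?thesis
  proof (cases "x2 \<le> x1")
    case False
    then have "has_bochner_integral lborel (\<lambda>u. - ((indicator {..<x2} u - indicator {..<x1} u) * t u)) (- (T x2 - T x1))"
      by (intro has_bochner_integral_minus ordered) auto
    then show ?thesis by (simp add: algebra_simps)
  qed (rule ordered)
qed

definition paired_const :: "real \<Rightarrow> real \<Rightarrow> real" where
  "paired_const m L = (1 + m/2) * L + m * L\<^sup>2"

text \<open>Near \<open>p\<close> and \<open>q\<close>, the sets \<open>E1\<close> and \<open>E2\<close> are subgraphs over the hyperplane orthogonal to \<open>\<eta>\<close>, possibly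
  cut by a half-space. Averaging over the involution \<open>R\<close> before integrating along the lines parallel to
  \<open>\<eta>\<close> cancels the first-order part of \<open>g1 - g2\<close>.\<close>
locale paired_subgraphs =
  fixes m \<gamma> \<epsilon> r L \<omega> :: real and \<eta> :: "'a::euclidean_space" and R :: "'a \<Rightarrow> 'a" and uncut :: "'a \<Rightarrow> bool"
    and E1 E2 :: "'a set" and p q :: 'a and g1 g2 w :: "'a \<Rightarrow> real"
  assumes dim: "2 \<le> DIM('a)" and m: "0 < m" and \<gamma>: "-1 \<le> \<gamma>" "\<gamma> + 1 < DIM('a)"
    and \<eta>: "norm \<eta> = 1" and \<epsilon>: "0 < \<epsilon>" "\<epsilon> \<le> r" and L: "0 \<le> L" and \<omega>: "0 \<le> \<omega>"
    and R_distr: "distr lborel borel R = lborel" and R_measurable [measurable]: "R \<in> borel \<rightarrow>\<^sub>M borel"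
    and R_shift: "\<And>z u. R (z + u *\<^sub>R \<eta>) = R z + u *\<^sub>R \<eta>" and R_orthogonal: "\<And>z. z \<bullet> \<eta> = 0 \<Longrightarrow> R z \<bullet> \<eta> = 0"
    and norm_R: "\<And>z. norm (R z) = norm z"
    and uncut_R: "\<And>z. uncut (R z) = uncut z" and uncut_shift: "\<And>z u. uncut (z + u *\<^sub>R \<eta>) = uncut z"
    and E_measurable [measurable]: "E1 \<in> sets borel" "E2 \<in> sets borel"
    and E1: "\<And>z. norm z < r \<Longrightarrow> p + z \<in> E1 \<longleftrightarrow> uncut z \<and> z \<bullet> \<eta> < g1 (perp \<eta> z)"
    and E2: "\<And>z. norm z < r \<Longrightarrow> q + z \<in> E2 \<longleftrightarrow> uncut z \<and> z \<bullet> \<eta> < g2 (perp \<eta> z)"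
    and R_symmetry: "\<And>z. z \<bullet> \<eta> = 0 \<Longrightarrow> z \<noteq> 0 \<Longrightarrow> norm z < r \<Longrightarrow>
      \<bar>g1 z - g1 (R z)\<bar> \<le> L * w z \<and> \<bar>g2 z - g2 (R z)\<bar> \<le> L * w z \<or>
      \<bar>g1 z + g1 (R z)\<bar> \<le> L * w z \<and> \<bar>g2 z + g2 (R z)\<bar> \<le> L * w z"
    and difference: "\<And>z. z \<bullet> \<eta> = 0 \<Longrightarrow> z \<noteq> 0 \<Longrightarrow> norm z < r \<Longrightarrow> \<bar>g1 z - g2 z\<bar> \<le> L * \<omega> * norm z"
    and paired_difference: "\<And>z. z \<bullet> \<eta> = 0 \<Longrightarrow> z \<noteq> 0 \<Longrightarrow> norm z < r \<Longrightarrow>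
      \<bar>(g1 z - g2 z) + (g1 (R z) - g2 (R z))\<bar> \<le> L * \<omega> * w z"
    and weight: "\<And>z. z \<bullet> \<eta> = 0 \<Longrightarrow> z \<noteq> 0 \<Longrightarrow> norm z < r \<Longrightarrow>
      0 \<le> w z \<and> w z * max \<epsilon> (norm z) powr (-m) \<le> 2 * norm z powr (-\<gamma>)"
begin

definition integrand :: "'a \<Rightarrow> real" where
  "integrand z = (indicator E1 (p + z) - indicator E2 (q + z)) * near_kernel m \<epsilon> r z"

lemma integrand_outside: "r \<le> norm z \<Longrightarrow> integrand z = 0"
  by (simp add: integrand_def near_kernel_outside[OF \<epsilon>])

lemma integrable_integrand: "integrable lborel integrand" "integrable lborel (\<lambda>z. integrand (R z))"
  and integral_integrand_R: "(LINT z|lborel. integrand (R z)) = (LINT z|lborel. integrand z)"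
proof -
  have [measurable]: "near_kernel m \<epsilon> r \<in> borel_measurable (borel :: 'a measure)"
    by (rule borel_measurable_near_kernel[OF \<epsilon>])
  have [measurable]: "integrand \<in> borel_measurable borel" unfolding integrand_def[abs_def] by measurable
  have bound: "\<bar>integrand z\<bar> \<le> (1 + m/2) * \<epsilon> powr (-m)" for z
    using near_kernel_nonneg[OF \<epsilon> m, of z] near_kernel_le[OF \<epsilon> m, of z]
    by (auto simp: integrand_def indicator_def)
  show "integrable lborel integrand" "integrable lborel (\<lambda>z. integrand (R z))"
    by (rule integrable_bounded_support[OF _ bound, of _ r]; simp add: integrand_outside norm_R)+
  have "(LINT z|distr lborel borel R. integrand z) = (LINT z|lborel. integrand (R z))"
    by (rule integral_distr) auto
  then show "(LINT z|lborel. integrand (R z)) = (LINT z|lborel. integrand z)" by (simp add: R_distr)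
qed

lemma integrand_line:
  assumes z: "z \<bullet> \<eta> = 0" and T: "\<And>v. (T has_real_derivative near_kernel m \<epsilon> r (z + v *\<^sub>R \<eta>)) (at v)"
  shows "has_bochner_integral lborel (\<lambda>u. integrand (z + u *\<^sub>R \<eta>)) (if uncut z then T (g1 z) - T (g2 z) else 0)"
proof -
  have perp_line: "perp \<eta> (z + u *\<^sub>R \<eta>) = z" "(z + u *\<^sub>R \<eta>) \<bullet> \<eta> = u" for u
    using z \<eta> by (simp_all add: perp_add perp_scaleR perp_self perp_orthogonal inner_add_left norm_eq_1)
  have on_line: "integrand (z + u *\<^sub>R \<eta>) =
      (if uncut z then (indicator {..<g1 z} u - indicator {..<g2 z} u) * near_kernel m \<epsilon> r (z + u *\<^sub>R \<eta>) else 0)" for u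
  proof (cases "norm (z + u *\<^sub>R \<eta>) < r")
    case True
    then show ?thesis using E1[OF True] E2[OF True]
      by (auto simp: integrand_def perp_line uncut_shift indicator_def)
  qed (simp add: integrand_def near_kernel_outside[OF \<epsilon>])
  have "continuous_on UNIV (\<lambda>v. near_kernel m \<epsilon> r (z + v *\<^sub>R \<eta>))"
    unfolding near_kernel_def using \<epsilon> by (intro continuous_intros) auto
  then show ?thesis
    unfolding on_line using has_bochner_integral_between[OF T, of "g1 z" "g2 z"]
    by (auto simp: has_bochner_integral_zero)
qed

lemma paired_line_increment:
  assumes z: "z \<bullet> \<eta> = 0" "z \<noteq> 0" "norm z < r"
    and T: "\<And>v. (T has_real_derivative near_kernel m \<epsilon> r (z + v *\<^sub>R \<eta>)) (at v)"
  shows "\<bar>T (g1 z) - T (g2 z) + (T (g1 (R z)) - T (g2 (R z)))\<bar> \<le> 2 * \<omega> * paired_const m L * norm z powr (-\<gamma>)"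
proof -
  define M where "M = max \<epsilon> (norm z)"
  have M: "0 < M" "norm z \<le> M" using \<epsilon> by (auto simp: M_def)
  have wz: "0 \<le> w z" "w z * M powr (-m) \<le> 2 * norm z powr (-\<gamma>)" using weight[OF z] by (auto simp: M_def)
  have Rz: "R z \<bullet> \<eta> = 0" "R z \<noteq> 0" "norm (R z) < r"
    using R_orthogonal[OF z(1)] norm_R[of z] z by auto
  have "\<bar>T (g1 z) - T (g2 z) + (T (g1 (R z)) - T (g2 (R z)))\<bar>
      \<le> (1 + m/2) * M powr (-m) * \<bar>g1 z - g2 z + (g1 (R z) - g2 (R z))\<bar>
        + m * M powr (-(m+1)) * (L * w z) * \<bar>g1 (R z) - g2 (R z)\<bar>"
    unfolding M_def
  proof (rule paired_increment_bound[OF T])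
    show "near_kernel m \<epsilon> r (z + (- v) *\<^sub>R \<eta>) = near_kernel m \<epsilon> r (z + v *\<^sub>R \<eta>)" for v
    proof (rule near_kernel_cong)
      have "(norm (z + (- v) *\<^sub>R \<eta>))\<^sup>2 = (norm (z + v *\<^sub>R \<eta>))\<^sup>2"
        by (simp only: norm_add_orthogonal_sq[OF \<eta> z(1)] power2_minus)
      then show "norm (z + (- v) *\<^sub>R \<eta>) = norm (z + v *\<^sub>R \<eta>)" by (simp add: power2_eq_iff_nonneg)
    qed
    show "\<bar>near_kernel m \<epsilon> r (z + v *\<^sub>R \<eta>)\<bar> \<le> (1 + m/2) * max \<epsilon> (norm z) powr (-m)" for v
      using near_kernel_along_line_le[OF \<eta> z(1) \<epsilon> m, of v] near_kernel_nonneg[OF \<epsilon> m, of "z + v *\<^sub>R \<eta>"]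
      by simp
  qed (use near_kernel_along_line_lipschitz[OF \<eta> z(1) \<epsilon> m] R_symmetry[OF z] m in auto)
  also have "\<dots> \<le> (1 + m/2) * M powr (-m) * (L * \<omega> * w z) + m * M powr (-(m+1)) * (L * w z) * (L * \<omega> * M)"
  proof (intro add_mono mult_left_mono)
    show "\<bar>g1 z - g2 z + (g1 (R z) - g2 (R z))\<bar> \<le> L * \<omega> * w z" by (rule paired_difference[OF z])
    have "\<bar>g1 (R z) - g2 (R z)\<bar> \<le> L * \<omega> * norm z" using difference[OF Rz] by (simp add: norm_R)
    also have "\<dots> \<le> L * \<omega> * M" using M L \<omega> by (intro mult_left_mono) auto
    finally show "\<bar>g1 (R z) - g2 (R z)\<bar> \<le> L * \<omega> * M" .
  qed (use m L wz in auto)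
  also have "\<dots> = (1 + m/2) * L * \<omega> * (w z * M powr (-m)) + m * L\<^sup>2 * \<omega> * (w z * (M powr (-(m+1)) * M))"
    by (simp add: power2_eq_square mult_ac)
  also have "M powr (-(m+1)) * M = M powr (-m)" using powr_add[of M "-(m+1)" 1] M by simp
  also have "(1 + m/2) * L * \<omega> * (w z * M powr (-m)) + m * L\<^sup>2 * \<omega> * (w z * M powr (-m))
      = \<omega> * paired_const m L * (w z * M powr (-m))"
    by (simp add: paired_const_def algebra_simps)
  also have "\<dots> \<le> \<omega> * paired_const m L * (2 * norm z powr (-\<gamma>))"
    using wz(2) m L \<omega> by (intro mult_left_mono) (auto simp: paired_const_def)
  finally show ?thesis by (simp add: mult_ac)
qed

lemma paired_line_bound:
  assumes z: "z \<bullet> \<eta> = 0" "z \<noteq> 0"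
  shows "\<bar>LINT u|lborel. integrand (z + u *\<^sub>R \<eta>) + integrand (R (z + u *\<^sub>R \<eta>))\<bar>
    \<le> (2 * \<omega> * paired_const m L) * (norm z powr (-\<gamma>) * indicator {..<r} (norm z))"
proof (cases "norm z < r")
  case False
  have "norm z \<le> norm (z + u *\<^sub>R \<eta>)" for u
    by (rule power2_le_imp_le) (simp_all add: norm_add_orthogonal_sq[OF \<eta> z(1)])
  then have "r \<le> norm (z + u *\<^sub>R \<eta>)" for u using False by (meson linorder_not_less order_trans)
  then show ?thesis using False by (simp add: integrand_outside norm_R)
next
  case True
  have norm_line: "norm (R z + v *\<^sub>R \<eta>) = norm (z + v *\<^sub>R \<eta>)" for v by (simp add: norm_R flip: R_shift)
  have "continuous_on UNIV (\<lambda>v. near_kernel m \<epsilon> r (z + v *\<^sub>R \<eta>))"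
    unfolding near_kernel_def using \<epsilon> by (intro continuous_intros) auto
  then obtain T where T: "\<And>v. (T has_real_derivative near_kernel m \<epsilon> r (z + v *\<^sub>R \<eta>)) (at v)"
    using einterval_antiderivative[of "-\<infinity>" "\<infinity>" "\<lambda>v. near_kernel m \<epsilon> r (z + v *\<^sub>R \<eta>)"]
    by (auto simp: continuous_on_eq_continuous_at has_real_derivative_iff_has_vector_derivative)
  have "has_bochner_integral lborel (\<lambda>u. integrand (R (z + u *\<^sub>R \<eta>))) (if uncut z then T (g1 (R z)) - T (g2 (R z)) else 0)"
    using integrand_line[OF R_orthogonal[OF z(1)], of T] T near_kernel_cong[OF norm_line]
    by (simp add: R_shift uncut_R)
  from has_bochner_integral_integral_eq[OF has_bochner_integral_add[OF integrand_line[OF z(1) T] this]]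
  have "(LINT u|lborel. integrand (z + u *\<^sub>R \<eta>) + integrand (R (z + u *\<^sub>R \<eta>))) =
      (if uncut z then T (g1 z) - T (g2 z) + (T (g1 (R z)) - T (g2 (R z))) else 0)" by auto
  moreover have "0 \<le> 2 * \<omega> * paired_const m L * norm z powr (-\<gamma>)" using m L \<omega> by (simp add: paired_const_def)
  ultimately show ?thesis using paired_line_increment[OF z True T] True by simp
qed

lemma near_potential_difference_le:
  "\<bar>near_potential m \<epsilon> r E1 p - near_potential m \<epsilon> r E2 q\<bar>
    \<le> \<omega> * paired_const m L * lines_const TYPE('a) \<gamma> * r powr (real DIM('a) - 1 - \<gamma>)"
proof -
  have "\<bar>LINT z|lborel. integrand z + integrand (R z)\<bar>
      \<le> (2 * \<omega> * paired_const m L) * lines_const TYPE('a) \<gamma> * r powr (real DIM('a) - 1 - \<gamma>)"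
    using \<epsilon> m L \<omega> integrable_integrand
    by (intro integral_bound_by_lines[OF dim \<gamma> _ \<eta>] paired_line_bound) (auto simp: paired_const_def)
  also have "(LINT z|lborel. integrand z + integrand (R z)) = 2 * (LINT z|lborel. integrand z)"
    using integrable_integrand integral_integrand_R by simp
  also have "(LINT z|lborel. integrand z) = near_potential m \<epsilon> r E1 p - near_potential m \<epsilon> r E2 q"
    using integrable_indicator_translate_times(1)[OF integrable_near_kernel[where 'a='a, OF \<epsilon> m]]
    by (simp add: integrand_def near_potential_def left_diff_distrib)
  finally show ?thesis by (simp add: abs_mult)
qed

end

lemma paired_weight_bound:
  fixes t \<epsilon> m \<alpha> h :: real
  assumes t: "0 < t" and h: "0 \<le> h" "h \<le> \<epsilon>" and \<alpha>: "0 < \<alpha>" "\<alpha> < m"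
  shows "(t powr (1+\<alpha>) + h powr \<alpha> * t) * max \<epsilon> t powr (-m) \<le> 2 * t powr (1+\<alpha>-m)"
proof -
  define M where "M = max \<epsilon> t"
  have M: "0 < M" "t \<le> M" "h \<le> M" using t h by (auto simp: M_def)
  have "t powr (1+\<alpha>) * M powr (-m) \<le> t powr (1+\<alpha>) * t powr (-m)"
    using M t \<alpha> by (intro mult_left_mono powr_mono2') auto
  also have "\<dots> = t powr (1+\<alpha>-m)" by (simp add: powr_add[symmetric])
  finally have first_term: "t powr (1+\<alpha>) * M powr (-m) \<le> t powr (1+\<alpha>-m)" .
  have "h powr \<alpha> * t * M powr (-m) \<le> M powr \<alpha> * t * M powr (-m)"
    using M t h \<alpha> by (intro mult_right_mono powr_mono2) auto
  also have "\<dots> = t * M powr (\<alpha>-m)" by (simp add: powr_add[symmetric] mult_ac)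
  also have "\<dots> \<le> t * t powr (\<alpha>-m)" using M t \<alpha> by (intro mult_left_mono powr_mono2') auto
  also have "\<dots> = t powr (1+\<alpha>-m)" using t powr_add[of t 1 "\<alpha>-m"] by (simp add: add_diff_eq)
  finally show ?thesis using first_term by (simp add: M_def distrib_right)
qed

definition graph_const :: "'a::euclidean_space itself \<Rightarrow> real \<Rightarrow> real \<Rightarrow> real \<Rightarrow> real" where
  "graph_const _ s \<alpha> L = paired_const (real DIM('a) + s) L * lines_const TYPE('a) (real DIM('a) + s - 1 - \<alpha>)"

lemma graph_const_nonneg:
  assumes "0 < s" "s < \<alpha>" "0 \<le> L"
  shows "0 \<le> graph_const TYPE('a::euclidean_space) s \<alpha> L"
  unfolding graph_const_def paired_const_def using assms by (intro mult_nonneg_nonneg lines_const_nonneg) auto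

locale subgraph_pair =
  fixes m s \<alpha> r L \<omega> :: real and \<eta> :: "'a::euclidean_space"
    and E1 E2 :: "'a set" and g1 g2 :: "'a \<Rightarrow> real"
  assumes dim: "2 \<le> DIM('a)" and m_eq: "m = real DIM('a) + s" and exponents: "0 < s" "s < \<alpha>" "\<alpha> < 1"
    and \<eta>: "norm \<eta> = 1" and L: "0 \<le> L" and \<omega>: "0 \<le> \<omega>"
    and E_measurable [measurable]: "E1 \<in> sets borel" "E2 \<in> sets borel"
    and g1_odd: "\<And>z. z \<bullet> \<eta> = 0 \<Longrightarrow> norm z < r \<Longrightarrow> \<bar>g1 z + g1 (-z)\<bar> \<le> L * norm z powr (1+\<alpha>)"
    and g2_odd: "\<And>z. z \<bullet> \<eta> = 0 \<Longrightarrow> norm z < r \<Longrightarrow> \<bar>g2 z + g2 (-z)\<bar> \<le> L * norm z powr (1+\<alpha>)"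
    and difference: "\<And>z. z \<bullet> \<eta> = 0 \<Longrightarrow> norm z < r \<Longrightarrow> \<bar>g1 z - g2 z\<bar> \<le> L * \<omega> * norm z"
    and difference_odd: "\<And>z. z \<bullet> \<eta> = 0 \<Longrightarrow> norm z < r \<Longrightarrow>
      \<bar>(g1 z - g2 z) + (g1 (-z) - g2 (-z))\<bar> \<le> L * \<omega> * norm z powr (1+\<alpha>)"
begin

lemma near_potential_difference_le_uncut:
  assumes \<epsilon>: "0 < \<epsilon>" "\<epsilon> \<le> \<rho>" "\<rho> \<le> r"
    and E1: "\<And>z. norm z < \<rho> \<Longrightarrow> p + z \<in> E1 \<longleftrightarrow> z \<bullet> \<eta> < g1 (perp \<eta> z)"
    and E2: "\<And>z. norm z < \<rho> \<Longrightarrow> q + z \<in> E2 \<longleftrightarrow> z \<bullet> \<eta> < g2 (perp \<eta> z)"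
  shows "\<bar>near_potential m \<epsilon> \<rho> E1 p - near_potential m \<epsilon> \<rho> E2 q\<bar> \<le> \<omega> * graph_const TYPE('a) s \<alpha> L * \<rho> powr (\<alpha> - s)"
proof -
  let ?R = "\<lambda>z. - mirror \<eta> z"
  have R_eq: "?R z = -z" if "z \<bullet> \<eta> = 0" for z using that by (simp add: mirror_orthogonal)
  interpret paired_subgraphs m "m - 1 - \<alpha>" \<epsilon> \<rho> L \<omega> \<eta> ?R "\<lambda>_. True" E1 E2 p q g1 g2 "\<lambda>z. norm z powr (1+\<alpha>)"
  proof
    show "distr lborel borel ?R = lborel"
      by (rule distr_lborel_compose[OF distr_lborel_mirror[OF \<eta> dim] distr_lborel_uminus]) auto
    fix z assume z: "z \<bullet> \<eta> = 0" "z \<noteq> 0" "norm z < \<rho>"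
    then have z': "norm z < r" using \<epsilon> by simp
    show "\<bar>g1 z - g1 (?R z)\<bar> \<le> L * norm z powr (1+\<alpha>) \<and> \<bar>g2 z - g2 (?R z)\<bar> \<le> L * norm z powr (1+\<alpha>) \<or>
       \<bar>g1 z + g1 (?R z)\<bar> \<le> L * norm z powr (1+\<alpha>) \<and> \<bar>g2 z + g2 (?R z)\<bar> \<le> L * norm z powr (1+\<alpha>)"
      using g1_odd[OF z(1) z'] g2_odd[OF z(1) z'] by (simp add: R_eq z)
    show "\<bar>(g1 z - g2 z) + (g1 (?R z) - g2 (?R z))\<bar> \<le> L * \<omega> * norm z powr (1+\<alpha>)"
      using difference_odd[OF z(1) z'] by (simp add: R_eq z)
    show "\<bar>g1 z - g2 z\<bar> \<le> L * \<omega> * norm z" by (rule difference[OF z(1) z'])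
    have "(norm z powr (1+\<alpha>) + 0 powr \<alpha> * norm z) * max \<epsilon> (norm z) powr (-m) \<le> 2 * norm z powr (1+\<alpha>-m)"
      using z exponents m_eq dim \<epsilon> by (intro paired_weight_bound) auto
    then show "0 \<le> norm z powr (1+\<alpha>) \<and> norm z powr (1+\<alpha>) * max \<epsilon> (norm z) powr (-m) \<le> 2 * norm z powr (-(m - 1 - \<alpha>))"
      by (simp add: algebra_simps)
  qed (use dim m_eq exponents \<epsilon> L \<omega> \<eta> E1 E2 in
      \<open>auto simp: norm_mirror mirror_add mirror_scaleR mirror_self mirror_orthogonal\<close>)
  show ?thesis
    using near_potential_difference_le unfolding graph_const_def m_eq by (simp add: mult_ac)
qed

text \<open>Below the scale of the distance \<open>h\<close> to the cutting hyperplane the subgraphs are not cut and the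
  symmetry is the central one; above that scale a symmetry \<open>R\<close> respecting the cut is used.\<close>
lemma near_potential_difference_le_cut:
  fixes R :: "'a \<Rightarrow> 'a"
  assumes scales: "0 < \<epsilon>" "\<epsilon> \<le> h" "h \<le> r" and \<kappa>: "norm \<kappa> = 1" "\<kappa> \<bullet> \<eta> = 0"
    and R: "distr lborel borel R = lborel" "R \<in> borel \<rightarrow>\<^sub>M borel" "\<And>z u. R (z + u *\<^sub>R \<eta>) = R z + u *\<^sub>R \<eta>"
      "\<And>z. z \<bullet> \<eta> = 0 \<Longrightarrow> R z \<bullet> \<eta> = 0" "\<And>z. norm (R z) = norm z" "\<And>z. R z \<bullet> \<kappa> = z \<bullet> \<kappa>"
    and E1: "\<And>z. norm z < r \<Longrightarrow> p + z \<in> E1 \<longleftrightarrow> - h < z \<bullet> \<kappa> \<and> z \<bullet> \<eta> < g1 (perp \<eta> z)"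
    and E2: "\<And>z. norm z < r \<Longrightarrow> q + z \<in> E2 \<longleftrightarrow> - h < z \<bullet> \<kappa> \<and> z \<bullet> \<eta> < g2 (perp \<eta> z)"
  defines "w \<equiv> \<lambda>z. norm z powr (1+\<alpha>) + h powr \<alpha> * norm z"
  assumes g1_R: "\<And>z. z \<bullet> \<eta> = 0 \<Longrightarrow> norm z < r \<Longrightarrow> \<bar>g1 z - g1 (R z)\<bar> \<le> L * w z"
    and g2_R: "\<And>z. z \<bullet> \<eta> = 0 \<Longrightarrow> norm z < r \<Longrightarrow> \<bar>g2 z - g2 (R z)\<bar> \<le> L * w z"
    and difference_R: "\<And>z. z \<bullet> \<eta> = 0 \<Longrightarrow> norm z < r \<Longrightarrow> \<bar>(g1 z - g2 z) + (g1 (R z) - g2 (R z))\<bar> \<le> L * \<omega> * w z"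
  shows "\<bar>near_potential m \<epsilon> r E1 p - near_potential m \<epsilon> r E2 q\<bar> \<le> 2 * \<omega> * graph_const TYPE('a) s \<alpha> L * r powr (\<alpha> - s)"
proof -
  have h: "0 < h" using scales by simp
  have "\<bar>near_potential m \<epsilon> h E1 p - near_potential m \<epsilon> h E2 q\<bar> \<le> \<omega> * graph_const TYPE('a) s \<alpha> L * h powr (\<alpha> - s)"
  proof (rule near_potential_difference_le_uncut[OF scales])
    fix z :: 'a assume z: "norm z < h"
    have "\<bar>z \<bullet> \<kappa>\<bar> \<le> norm z" using Cauchy_Schwarz_ineq2[of z \<kappa>] \<kappa> by simp
    then have "- h < z \<bullet> \<kappa>" using z by linarith
    then show "p + z \<in> E1 \<longleftrightarrow> z \<bullet> \<eta> < g1 (perp \<eta> z)" "q + z \<in> E2 \<longleftrightarrow> z \<bullet> \<eta> < g2 (perp \<eta> z)"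
      using E1[of z] E2[of z] z scales by auto
  qed
  also have "\<dots> \<le> \<omega> * graph_const TYPE('a) s \<alpha> L * r powr (\<alpha> - s)"
    using scales exponents \<omega> graph_const_nonneg[where 'a='a, OF exponents(1,2) L]
    by (intro mult_left_mono powr_mono2) auto
  finally have below_h: "\<bar>near_potential m \<epsilon> h E1 p - near_potential m \<epsilon> h E2 q\<bar>
      \<le> \<omega> * graph_const TYPE('a) s \<alpha> L * r powr (\<alpha> - s)" .
  interpret paired_subgraphs m "m - 1 - \<alpha>" h r L \<omega> \<eta> R "\<lambda>z. - h < z \<bullet> \<kappa>" E1 E2 p q g1 g2 w
  proof
    fix z assume z: "z \<bullet> \<eta> = 0" "z \<noteq> 0" "norm z < r"
    have "w z * max h (norm z) powr (-m) \<le> 2 * norm z powr (1+\<alpha>-m)"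
      unfolding w_def using z exponents m_eq dim h by (intro paired_weight_bound) auto
    then show "0 \<le> w z \<and> w z * max h (norm z) powr (-m) \<le> 2 * norm z powr (-(m - 1 - \<alpha>))"
      using h by (simp add: w_def algebra_simps)
  next
    show "- h < (z + u *\<^sub>R \<eta>) \<bullet> \<kappa> \<longleftrightarrow> - h < z \<bullet> \<kappa>" for z u
      using \<kappa> by (simp add: inner_add_left inner_commute[of \<eta>])
  qed (use dim m_eq exponents h scales L \<omega> \<eta> R E1 E2 g1_R g2_R difference difference_R in auto)
  have above_h: "\<bar>near_potential m h r E1 p - near_potential m h r E2 q\<bar> \<le> \<omega> * graph_const TYPE('a) s \<alpha> L * r powr (\<alpha> - s)"
    using near_potential_difference_le unfolding graph_const_def m_eq by (simp add: mult_ac)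
  have "0 < m" using exponents m_eq by simp
  then show ?thesis
    using below_h above_h near_potential_add[OF scales \<open>0 < m\<close> E_measurable(1), of p]
      near_potential_add[OF scales \<open>0 < m\<close> E_measurable(2), of q] by linarith
qed

end

section \<open>The fractional mean curvature as a limit of potentials\<close>

text \<open>The even part about \<open>q\<close> of the numerator in the definition of the fractional mean curvature.\<close>
definition symmetrized_sign :: "'a::ab_group_add set \<Rightarrow> 'a \<Rightarrow> 'a \<Rightarrow> real" where
  "symmetrized_sign E q z = 1 - indicator E (q + z) - indicator E (q - z)"

lemma borel_measurable_symmetrized_sign [measurable]:
  fixes q :: "'a::euclidean_space"
  assumes [measurable]: "E \<in> sets borel"
  shows "symmetrized_sign E q \<in> borel_measurable borel"
  unfolding symmetrized_sign_def[abs_def] by measurable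

lemma abs_symmetrized_sign_le: "\<bar>symmetrized_sign E q z\<bar> \<le> 1"
  by (auto simp: symmetrized_sign_def indicator_def)

lemma symmetrized_sign_line_support:
  fixes q \<eta> z :: "'a::euclidean_space"
  assumes \<eta>: "norm \<eta> = 1" and z: "z \<bullet> \<eta> = 0" and in_ball: "norm (z + u *\<^sub>R \<eta>) < r"
    and graph: "\<And>z. norm z < r \<Longrightarrow> q + z \<in> E \<longleftrightarrow> z \<bullet> \<eta> < g (perp \<eta> z)"
    and nonzero: "symmetrized_sign E q (z + u *\<^sub>R \<eta>) \<noteq> 0"
  shows "u \<in> {min (g z) (- g (-z))..max (g z) (- g (-z))}"
proof -
  have "perp \<eta> (z + u *\<^sub>R \<eta>) = z" "(z + u *\<^sub>R \<eta>) \<bullet> \<eta> = u"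
    using z \<eta> by (auto simp: perp_add perp_scaleR perp_self perp_orthogonal inner_add_left norm_eq_1)
  then have "q + (z + u *\<^sub>R \<eta>) \<in> E \<longleftrightarrow> u < g z" "q - (z + u *\<^sub>R \<eta>) \<in> E \<longleftrightarrow> - u < g (-z)"
    using graph[of "z + u *\<^sub>R \<eta>"] graph[of "- (z + u *\<^sub>R \<eta>)"] in_ball
    unfolding perp_minus norm_minus_cancel inner_minus_left add_uminus_conv_diff by auto
  then show ?thesis using nonzero by (auto simp: symmetrized_sign_def indicator_def split: if_splits)
qed

lemma nn_integral_symmetrized_kernel_line:
  fixes q \<eta> z :: "'a::euclidean_space"
  assumes \<eta>: "norm \<eta> = 1" and L: "0 \<le> L" and m: "0 \<le> m" and z: "z \<bullet> \<eta> = 0" "z \<noteq> 0"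
    and graph: "\<And>z. norm z < r \<Longrightarrow> q + z \<in> E \<longleftrightarrow> z \<bullet> \<eta> < g (perp \<eta> z)"
    and g: "\<And>z. z \<bullet> \<eta> = 0 \<Longrightarrow> norm z < r \<Longrightarrow> \<bar>g z + g (-z)\<bar> \<le> L * (norm z)\<^sup>2"
  defines "h \<equiv> \<lambda>z. ennreal (norm (symmetrized_sign E q z * norm z powr (-m) * indicator (ball 0 r) z))"
  shows "(\<integral>\<^sup>+u. h (z + u *\<^sub>R \<eta>) \<partial>lborel) \<le> ennreal (L * (norm z powr (-(m-2)) * indicator {..<r} (norm z)))"
proof -
  have norm_le: "norm z \<le> norm (z + u *\<^sub>R \<eta>)" for u
    by (rule power2_le_imp_le) (simp_all add: norm_add_orthogonal_sq[OF \<eta> z(1)])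
  show ?thesis
  proof (cases "norm z < r")
    case False
    then have "h (z + u *\<^sub>R \<eta>) = 0" for u using norm_le[of u] by (simp add: h_def)
    then show ?thesis by (simp only: nn_integral_const) simp
  next
    case True
    define lo hi where "lo = min (g z) (- g (-z))" and "hi = max (g z) (- g (-z))"
    have "h (z + u *\<^sub>R \<eta>) \<le> ennreal (norm z powr (-m)) * indicator {lo..hi} u" for u
    proof (cases "norm (z + u *\<^sub>R \<eta>) < r \<and> symmetrized_sign E q (z + u *\<^sub>R \<eta>) \<noteq> 0")
      case True
      then have "u \<in> {lo..hi}"
        unfolding lo_def hi_def using symmetrized_sign_line_support[where g=g, OF \<eta> z(1) _ graph] by blast
      moreover have "norm (z + u *\<^sub>R \<eta>) powr (-m) \<le> norm z powr (-m)"
        using norm_le[of u] z m by (intro powr_mono2') auto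
      then have "norm (symmetrized_sign E q (z + u *\<^sub>R \<eta>) * norm (z + u *\<^sub>R \<eta>) powr (-m) * indicator (ball 0 r) (z + u *\<^sub>R \<eta>))
          \<le> 1 * norm z powr (-m) * 1"
        unfolding norm_mult using abs_symmetrized_sign_le by (intro mult_mono) (auto simp: indicator_def)
      ultimately show ?thesis by (simp add: h_def ennreal_leI)
    qed (auto simp: h_def indicator_def)
    then have "(\<integral>\<^sup>+u. h (z + u *\<^sub>R \<eta>) \<partial>lborel) \<le> (\<integral>\<^sup>+u. ennreal (norm z powr (-m)) * indicator {lo..hi} u \<partial>lborel)"
      by (intro nn_integral_mono)
    also have "\<dots> = ennreal (norm z powr (-m)) * ennreal (hi - lo)"
      by (subst nn_integral_cmult_indicator) (auto simp: lo_def hi_def)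
    also have "hi - lo = \<bar>g z + g (-z)\<bar>" by (simp add: hi_def lo_def)
    also have "ennreal (norm z powr (-m)) * ennreal \<bar>g z + g (-z)\<bar> \<le> ennreal (norm z powr (-m)) * ennreal (L * (norm z)\<^sup>2)"
      using g[OF z(1) True] by (intro mult_left_mono ennreal_leI) auto
    also have "\<dots> = ennreal (L * (norm z powr (-m) * norm z powr 2))"
      using L z by (simp add: ennreal_mult[symmetric] powr_numeral mult_ac)
    also have "norm z powr (-m) * norm z powr 2 = norm z powr (-(m-2))" unfolding powr_add[symmetric] by simp
    finally show ?thesis using True by simp
  qed
qed

lemma integrable_symmetrized_kernel:
  fixes q \<eta> :: "'a::euclidean_space"
  assumes dim: "2 \<le> DIM('a)"
    and m: "real DIM('a) < m" "m < real DIM('a) + 1" and E[measurable]: "E \<in> sets borel"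
    and \<eta>: "norm \<eta> = 1" and r: "0 < r" and L: "0 \<le> L"
    and graph: "\<And>z. norm z < r \<Longrightarrow> q + z \<in> E \<longleftrightarrow> z \<bullet> \<eta> < g (perp \<eta> z)"
    and g: "\<And>z. z \<bullet> \<eta> = 0 \<Longrightarrow> norm z < r \<Longrightarrow> \<bar>g z + g (-z)\<bar> \<le> L * (norm z)\<^sup>2"
  shows "integrable lborel (\<lambda>z. symmetrized_sign E q z * norm z powr (-m))"
proof -
  let ?W = "\<lambda>z. symmetrized_sign E q z * norm z powr (-m)"
  have [measurable]: "(\<lambda>z::'a. indicator (ball 0 r) z :: real) \<in> borel_measurable borel"
    "(\<lambda>z::'a. indicator (- ball 0 r) z :: real) \<in> borel_measurable borel"
    by (intro borel_measurable_indicator; simp)+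
  have "(\<integral>\<^sup>+z. ennreal (norm (?W z * indicator (ball 0 r) z)) \<partial>lborel)
      \<le> ennreal (L * lines_const TYPE('a) (m-2) * r powr (real DIM('a) - 1 - (m-2)))"
    using dim m by (intro nn_integral_bound_by_lines[OF dim _ _ r \<eta> _ L]
        nn_integral_symmetrized_kernel_line[OF \<eta> L _ _ _ graph g]) auto
  then have "integrable lborel (\<lambda>z. ?W z * indicator (ball 0 r) z)"
    by (intro integrableI_bounded) (auto intro: le_less_trans)
  moreover have "integrable lborel (\<lambda>z. ?W z * indicator (- ball 0 r) z)"
  proof (rule Bochner_Integration.integrable_bound)
    show "integrable lborel (\<lambda>z::'a. norm z powr (-m) * indicator (- ball 0 r) z)"
      by (rule integrable_powr_outside_ball[OF m(1) r])
    have "\<bar>symmetrized_sign E q z\<bar> * (norm z powr (-m) * indicator (- ball 0 r) z)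
        \<le> 1 * (norm z powr (-m) * indicator (- ball 0 r) z)" for z
      by (intro mult_right_mono abs_symmetrized_sign_le) auto
    then show "AE z in lborel. norm (?W z * indicator (- ball 0 r) z) \<le> norm (norm z powr (-m) * indicator (- ball 0 r) z)"
      by (intro AE_I2) (simp add: abs_mult mult.assoc)
  qed measurable
  ultimately have "integrable lborel (\<lambda>z. ?W z * indicator (ball 0 r) z + ?W z * indicator (- ball 0 r) z)"
    by (rule Bochner_Integration.integrable_add)
  moreover have "?W z * indicator (ball 0 r) z + ?W z * indicator (- ball 0 r) z = ?W z" for z
    by (auto simp: indicator_def)
  ultimately show ?thesis by simp
qed

lemma integral_symmetrized_sign_even:
  fixes f :: "'a::euclidean_space \<Rightarrow> real"
  assumes f: "integrable lborel f" "\<And>z. f (- z) = f z" and E[measurable]: "E \<in> sets borel"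
  shows "(LINT z|lborel. symmetrized_sign E q z * f z) = (LINT z|lborel. f z) - 2 * (LINT z|lborel. indicator E (q + z) * f z)"
proof -
  have [measurable]: "f \<in> borel_measurable borel" using f by simp
  note integrable = integrable_indicator_translate_times[OF f(1) E, of q]
  have "(LINT z|distr lborel borel uminus. indicator E (q - z) * f z) = (LINT z|lborel. indicator E (q - (- z)) * f (- z))"
    by (rule integral_distr) auto
  then have antipodal: "(LINT z|lborel. indicator E (q - z) * f z) = (LINT z|lborel. indicator E (q + z) * f z)"
    by (simp add: distr_lborel_uminus f)
  have "(LINT z|lborel. symmetrized_sign E q z * f z) = (LINT z|lborel. f z - indicator E (q + z) * f z - indicator E (q - z) * f z)"
    by (simp add: symmetrized_sign_def algebra_simps)
  also have "\<dots> = (LINT z|lborel. f z) - (LINT z|lborel. indicator E (q + z) * f z) - (LINT z|lborel. indicator E (q - z) * f z)"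
    using f integrable by (simp add: Bochner_Integration.integral_diff)
  finally show ?thesis using antipodal by simp
qed

lemma punctured_curvature_integral:
  fixes q :: "real^'n::finite"
  assumes m: "real CARD('n) < m" and E[measurable]: "E \<in> sets borel" and \<epsilon>: "0 < \<epsilon>"
  shows "(LINT x : - ball q \<epsilon> | lborel. (indicator (- E) x - indicator E x) / norm (x - q) powr m)
    = (LINT z|lborel. symmetrized_sign E q z * norm z powr (-m) * indicator (- ball 0 \<epsilon>) z)"
proof -
  let ?f = "\<lambda>z::real^'n. norm z powr (-m) * indicator (- ball 0 \<epsilon>) z"
  let ?F = "\<lambda>x. indicator (- ball q \<epsilon>) x * ((indicator (- E) x - indicator E x) / norm (x - q) powr m) :: real"
  have integrable_f: "integrable lborel ?f" using m \<epsilon> by (intro integrable_powr_outside_ball) auto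
  have "(\<lambda>x. indicator (- ball q \<epsilon>) x :: real) \<in> borel_measurable borel" "(\<lambda>x. indicator (- E) x :: real) \<in> borel_measurable borel"
    by (intro borel_measurable_indicator; simp)+
  then have F_measurable: "?F \<in> borel_measurable borel"
    by (intro borel_measurable_times borel_measurable_divide borel_measurable_diff) auto
  have "(LINT x : - ball q \<epsilon> | lborel. (indicator (- E) x - indicator E x) / norm (x - q) powr m) = (LINT x|lborel. ?F x)"
    by (simp add: set_lebesgue_integral_def)
  also have "\<dots> = (LINT x|distr lborel borel ((+) q). ?F x)" by (simp only: lborel_distr_plus)
  also have "\<dots> = (LINT z|lborel. ?F (q + z))" using F_measurable by (intro integral_distr) auto
  also have "\<dots> = (LINT z|lborel. ?f z - 2 * (indicator E (q + z) * ?f z))"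
    unfolding powr_minus_divide
    by (intro Bochner_Integration.integral_cong refl) (auto simp: indicator_def dist_norm)
  also have "\<dots> = (LINT z|lborel. ?f z) - 2 * (LINT z|lborel. indicator E (q + z) * ?f z)"
    using integrable_f integrable_indicator_translate_times(1)[OF integrable_f E]
    by (subst Bochner_Integration.integral_diff) auto
  also have "\<dots> = (LINT z|lborel. symmetrized_sign E q z * ?f z)"
    by (rule integral_symmetrized_sign_even[symmetric]) (use integrable_f in \<open>auto simp: indicator_def\<close>)
  finally show ?thesis by (simp add: mult.assoc)
qed

lemma frac_mean_curv_eq:
  fixes q :: "real^'n::finite"
  assumes s: "0 < s" and E: "E \<in> sets borel"
    and integrable: "integrable lborel (\<lambda>z. symmetrized_sign E q z * norm z powr (-(real CARD('n) + s)))"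
  shows "frac_mean_curv s E q = (LINT z|lborel. symmetrized_sign E q z * norm z powr (-(real CARD('n) + s)))"
proof -
  define m where "m = real CARD('n) + s"
  define W where "W = (\<lambda>z. symmetrized_sign E q z * norm z powr (-m))"
  let ?I = "\<lambda>\<epsilon>. LINT x : - ball q \<epsilon> | lborel. (indicator (- E) x - indicator E x) / norm (x - q) powr m"
  have W: "integrable lborel W" using integrable by (simp add: W_def m_def)
  have "(?I \<longlongrightarrow> (LINT z|lborel. W z)) (at_right 0)"
  proof (rule tendsto_at_right_sequentially[of 0 1])
    fix \<epsilon> :: "nat \<Rightarrow> real" assume \<epsilon>: "\<And>j. 0 < \<epsilon> j" "\<And>j. \<epsilon> j < 1" "decseq \<epsilon>" "\<epsilon> \<longlonglongrightarrow> 0"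
    have "(\<lambda>j. LINT z|lborel. W z * indicator (- ball 0 (\<epsilon> j)) z) \<longlonglongrightarrow> (LINT z|lborel. W z)"
    proof (rule integral_dominated_convergence[where w="\<lambda>z. \<bar>W z\<bar>"])
      show "AE z in lborel. (\<lambda>j. W z * indicator (- ball 0 (\<epsilon> j)) z) \<longlonglongrightarrow> W z"
        using AE_lborel_singleton[of 0]
      proof (rule eventually_mono)
        fix z :: "real^'n" assume "z \<noteq> 0"
        then have "eventually (\<lambda>j. \<epsilon> j < norm z) sequentially" using \<epsilon>(4) by (intro order_tendstoD(2)) auto
        then have "eventually (\<lambda>j. W z * indicator (- ball 0 (\<epsilon> j)) z = W z) sequentially"
          by (rule eventually_mono) (auto simp: indicator_def)
        then show "(\<lambda>j. W z * indicator (- ball 0 (\<epsilon> j)) z) \<longlonglongrightarrow> W z" by (rule tendsto_eventually)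
      qed
      have "(\<lambda>x::real^'n. indicator (- ball 0 (\<epsilon> j)) x :: real) \<in> borel_measurable borel" for j
        by (intro borel_measurable_indicator) auto
      then show "(\<lambda>z. W z * indicator (- ball 0 (\<epsilon> j)) z) \<in> borel_measurable lborel" for j using W by simp
    qed (use W in \<open>auto simp: indicator_def\<close>)
    then show "(\<lambda>j. ?I (\<epsilon> j)) \<longlonglongrightarrow> (LINT z|lborel. W z)"
      using punctured_curvature_integral[OF _ E \<epsilon>(1), of m q] s by (simp add: m_def W_def)
  qed simp
  then have "Lim (at_right 0) ?I = (LINT z|lborel. W z)" by (intro tendsto_Lim) simp_all
  then show ?thesis by (simp add: frac_mean_curv_def m_def W_def)
qed

lemma trunc_potential_tendsto_frac_mean_curv:
  fixes q :: "real^'n::finite"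
  assumes s: "0 < s" and E[measurable]: "E \<in> sets borel" and \<epsilon>: "\<And>j. 0 < \<epsilon> j" "\<epsilon> \<longlonglongrightarrow> 0"
  defines "m \<equiv> real CARD('n) + s"
  assumes integrable: "integrable lborel (\<lambda>z. symmetrized_sign E q z * norm z powr (-m))"
  shows "(\<lambda>j. (LINT z|lborel. trunc_kernel m (\<epsilon> j) (z::real^'n)) - 2 * trunc_potential m (\<epsilon> j) E q)
    \<longlonglongrightarrow> frac_mean_curv s E q"
proof -
  let ?W = "\<lambda>z. symmetrized_sign E q z * norm z powr (-m)"
  have m: "real DIM(real^'n) < m" "0 < m" using s by (simp_all add: m_def)
  have "(\<lambda>j. LINT z|lborel. symmetrized_sign E q z * trunc_kernel m (\<epsilon> j) z) \<longlonglongrightarrow> (LINT z|lborel. ?W z)"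
  proof (rule integral_dominated_convergence[where w="\<lambda>z. \<bar>?W z\<bar>"])
    show "AE z in lborel. (\<lambda>j. symmetrized_sign E q z * trunc_kernel m (\<epsilon> j) z) \<longlonglongrightarrow> ?W z"
      using AE_lborel_singleton[of 0]
    proof (rule eventually_mono)
      fix z :: "real^'n" assume "z \<noteq> 0"
      then have "eventually (\<lambda>j. \<epsilon> j < norm z) sequentially" using \<epsilon>(2) by (intro order_tendstoD(2)) auto
      then have "eventually (\<lambda>j. symmetrized_sign E q z * trunc_kernel m (\<epsilon> j) z = ?W z) sequentially"
        by (rule eventually_mono) (simp add: trunc_kernel_outside less_imp_le[OF \<epsilon>(1)])
      then show "(\<lambda>j. symmetrized_sign E q z * trunc_kernel m (\<epsilon> j) z) \<longlonglongrightarrow> ?W z" by (rule tendsto_eventually)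
    qed
    show "AE z in lborel. norm (symmetrized_sign E q z * trunc_kernel m (\<epsilon> j) z) \<le> \<bar>?W z\<bar>" for j
      using AE_lborel_singleton[of 0]
      by (rule eventually_mono)
        (simp add: abs_mult trunc_kernel_nonneg[OF \<epsilon>(1) m(2)] trunc_kernel_le_powr[OF \<epsilon>(1) m(2)] mult_left_mono)
    have [measurable]: "(\<lambda>z::real^'n. trunc_kernel m (\<epsilon> j) z) \<in> borel_measurable borel" for j
      by (rule borel_measurable_trunc_kernel[OF \<epsilon>(1)]) simp
    show "(\<lambda>z. symmetrized_sign E q z * trunc_kernel m (\<epsilon> j) z) \<in> borel_measurable lborel" for j by measurable
  qed (use integrable in auto)
  moreover have "(LINT z|lborel. symmetrized_sign E q z * trunc_kernel m (\<epsilon> j) z)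
      = (LINT z|lborel. trunc_kernel m (\<epsilon> j) (z::real^'n)) - 2 * trunc_potential m (\<epsilon> j) E q" for j
    unfolding trunc_potential_def
    by (rule integral_symmetrized_sign_even[OF integrable_trunc_kernel[OF m(1) \<epsilon>(1)] _ E]) (simp add: trunc_kernel_def)
  ultimately show ?thesis
    using frac_mean_curv_eq[OF s E integrable[unfolded m_def]] by (simp add: m_def)
qed

section \<open>Chords and the critical level\<close>

definition chord :: "'a::real_normed_vector set \<Rightarrow> 'a \<Rightarrow> 'a \<Rightarrow> 'a \<Rightarrow> bool" where
  "chord E e q p \<longleftrightarrow> (\<exists>l>0. p = q + l *\<^sub>R e \<and> q \<notin> E \<and> p \<notin> E \<and> (\<forall>t. 0 < t \<and> t < l \<longrightarrow> q + t *\<^sub>R e \<in> E))"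

lemma ray_exit:
  fixes E :: "'a::real_normed_vector set"
  assumes E: "open E" "bounded E" and x: "x \<in> E" and e: "norm e = 1"
  obtains t where "0 < t" "x + t *\<^sub>R e \<notin> E" "\<And>u. 0 \<le> u \<Longrightarrow> u < t \<Longrightarrow> x + u *\<^sub>R e \<in> E"
    "\<And>u. 0 \<le> u \<Longrightarrow> x + u *\<^sub>R e \<notin> E \<Longrightarrow> t \<le> u"
proof -
  define S where "S = {u. 0 \<le> u \<and> x + u *\<^sub>R e \<notin> E}"
  have "S = {0..} \<inter> (\<lambda>u. x + u *\<^sub>R e) -` (- E)" by (auto simp: S_def)
  then have closed: "closed S"
    using E(1) by (auto intro!: closed_Int closed_vimage continuous_intros)
  obtain B where B: "\<And>y. y \<in> E \<Longrightarrow> norm y \<le> B" using E(2) by (auto simp: bounded_iff)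
  have nonempty: "\<bar>B\<bar> + norm x + 1 \<in> S"
  proof -
    have "norm ((\<bar>B\<bar> + norm x + 1) *\<^sub>R e) \<le> norm (x + (\<bar>B\<bar> + norm x + 1) *\<^sub>R e) + norm x"
      using norm_triangle_ineq4[of "x + (\<bar>B\<bar> + norm x + 1) *\<^sub>R e" x] by simp
    then have "norm (x + (\<bar>B\<bar> + norm x + 1) *\<^sub>R e) > B" using e by simp
    then show ?thesis using B by (force simp: S_def)
  qed
  have bdd: "bdd_below S" by (auto simp: S_def bdd_below_def)
  have Inf_mem: "Inf S \<in> S" using closed_contains_Inf[OF _ bdd closed] nonempty by blast
  show ?thesis
  proof (rule that[of "Inf S"])
    show "0 < Inf S" using Inf_mem x by (cases "Inf S = 0") (auto simp: S_def)
    show "x + Inf S *\<^sub>R e \<notin> E" using Inf_mem by (auto simp: S_def)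
    show "x + u *\<^sub>R e \<in> E" if "0 \<le> u" "u < Inf S" for u
      using cInf_lower[OF _ bdd, of u] that by (auto simp: S_def)
    show "Inf S \<le> u" if "0 \<le> u" "x + u *\<^sub>R e \<notin> E" for u
      using cInf_lower[OF _ bdd, of u] that by (auto simp: S_def)
  qed
qed

lemma chord_through:
  fixes E :: "'a::real_normed_vector set"
  assumes E: "open E" "bounded E" and x: "x \<in> E" and e: "norm e = 1"
  obtains t1 t2 where "0 < t1" "0 < t2" "chord E e (x - t1 *\<^sub>R e) (x + t2 *\<^sub>R e)"
    "\<And>u. 0 \<le> u \<Longrightarrow> x - u *\<^sub>R e \<notin> E \<Longrightarrow> t1 \<le> u"
proof -
  obtain t2 where t2: "0 < t2" "x + t2 *\<^sub>R e \<notin> E" "\<And>u. 0 \<le> u \<Longrightarrow> u < t2 \<Longrightarrow> x + u *\<^sub>R e \<in> E"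
    using ray_exit[OF E x e] by metis
  have "norm (- e) = 1" using e by simp
  then obtain t1 where t1: "0 < t1" "x + t1 *\<^sub>R (- e) \<notin> E" "\<And>u. 0 \<le> u \<Longrightarrow> u < t1 \<Longrightarrow> x + u *\<^sub>R (- e) \<in> E"
    "\<And>u. 0 \<le> u \<Longrightarrow> x + u *\<^sub>R (- e) \<notin> E \<Longrightarrow> t1 \<le> u"
    using ray_exit[OF E x] by metis
  have "chord E e (x - t1 *\<^sub>R e) (x + t2 *\<^sub>R e)"
    unfolding chord_def
  proof (intro exI[of _ "t1 + t2"] conjI allI impI)
    fix t assume t: "0 < t \<and> t < t1 + t2"
    show "x - t1 *\<^sub>R e + t *\<^sub>R e \<in> E"
    proof (cases "t < t1")
      case True
      then have "x + (t1 - t) *\<^sub>R (- e) \<in> E" using t by (intro t1(3)) auto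
      then show ?thesis by (simp add: algebra_simps)
    next
      case False
      then have "x + (t - t1) *\<^sub>R e \<in> E" using t by (intro t2(3)) auto
      then show ?thesis by (simp add: algebra_simps)
    qed
  qed (use t1 t2 in \<open>auto simp: algebra_simps\<close>)
  then show ?thesis using that[OF t1(1) t2(1)] t1(4) by simp
qed

lemma chord_frontier:
  fixes E :: "'a::real_normed_vector set"
  assumes E: "open E" and chord: "chord E e q p"
  shows "q \<in> frontier E" "p \<in> frontier E"
proof -
  obtain l where l: "0 < l" "p = q + l *\<^sub>R e" "q \<notin> E" "p \<notin> E" "\<And>t. 0 < t \<Longrightarrow> t < l \<Longrightarrow> q + t *\<^sub>R e \<in> E"
    using chord by (auto simp: chord_def)
  have limit_in_closure: "x \<in> closure E"
    if "((\<lambda>t. q + t *\<^sub>R e) \<longlongrightarrow> x) F" "eventually (\<lambda>t. q + t *\<^sub>R e \<in> E) F" "F \<noteq> bot" for x and F :: "real filter"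
  proof -
    have "eventually (\<lambda>t. q + t *\<^sub>R e \<in> closure E) F"
      using that(2) by (rule eventually_mono) (use closure_subset in auto)
    then show ?thesis by (rule Lim_in_closed_set[OF closed_closure _ that(3,1)])
  qed
  have "q \<in> closure E"
  proof (rule limit_in_closure[of _ "at_right 0"])
    have "((\<lambda>t. q + t *\<^sub>R e) \<longlongrightarrow> q + 0 *\<^sub>R e) (at_right 0)" by (intro tendsto_intros)
    then show "((\<lambda>t. q + t *\<^sub>R e) \<longlongrightarrow> q) (at_right 0)" by simp
    show "eventually (\<lambda>t. q + t *\<^sub>R e \<in> E) (at_right 0)"
      using l by (auto simp: eventually_at_right[of 0 1] intro!: exI[of _ l])
  qed simp
  moreover have "p \<in> closure E"
  proof (rule limit_in_closure[of _ "at_left l"])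
    show "((\<lambda>t. q + t *\<^sub>R e) \<longlongrightarrow> p) (at_left l)" unfolding l(2) by (intro tendsto_intros)
    show "eventually (\<lambda>t. q + t *\<^sub>R e \<in> E) (at_left l)"
      using l by (auto simp: eventually_at_left[of 0 l] intro!: exI[of _ 0])
  qed simp
  ultimately show "q \<in> frontier E" "p \<in> frontier E"
    using l E by (auto simp: frontier_def interior_open)
qed

lemma chord_inner:
  assumes chord: "chord E e q p" and w: "e \<bullet> w = 0" and E: "\<And>x. x \<in> E \<Longrightarrow> 0 < x \<bullet> w"
  shows "0 < q \<bullet> w" "p \<bullet> w = q \<bullet> w"
proof -
  obtain l where l: "0 < l" "p = q + l *\<^sub>R e" "\<And>t. 0 < t \<Longrightarrow> t < l \<Longrightarrow> q + t *\<^sub>R e \<in> E"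
    using chord by (auto simp: chord_def)
  have "0 < (q + (l/2) *\<^sub>R e) \<bullet> w" using l by (intro E) auto
  then show "0 < q \<bullet> w" "p \<bullet> w = q \<bullet> w" using w l by (auto simp: inner_add_left)
qed

lemma chord_length:
  assumes "chord E e q p" "norm e = 1"
  shows "0 < (p - q) \<bullet> e" "p = q + ((p - q) \<bullet> e) *\<^sub>R e"
  using assms by (auto simp: chord_def norm_eq_1)

lemma chord_limit:
  fixes E :: "'a::real_inner set"
  assumes chords: "\<And>j::nat. chord E e (qs j) (ps j)" and e: "norm e = 1" and qs: "qs \<longlonglongrightarrow> q" and ps: "ps \<longlonglongrightarrow> p"
  shows "0 \<le> (p - q) \<bullet> e" "p = q + ((p - q) \<bullet> e) *\<^sub>R e"
proof -
  have length_lim: "(\<lambda>j. (ps j - qs j) \<bullet> e) \<longlonglongrightarrow> (p - q) \<bullet> e" by (intro tendsto_intros qs ps)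
  then show "0 \<le> (p - q) \<bullet> e"
    using chord_length(1)[OF chords e] by (intro LIMSEQ_le_const) (auto intro: less_imp_le)
  have "(\<lambda>j. qs j + ((ps j - qs j) \<bullet> e) *\<^sub>R e) \<longlonglongrightarrow> q + ((p - q) \<bullet> e) *\<^sub>R e"
    by (intro tendsto_intros qs length_lim)
  then have "ps \<longlonglongrightarrow> q + ((p - q) \<bullet> e) *\<^sub>R e" unfolding chord_length(2)[OF chords e, symmetric] .
  then show "p = q + ((p - q) \<bullet> e) *\<^sub>R e" by (rule LIMSEQ_unique[OF ps])
qed

definition chord_midpoints :: "'a::real_inner set \<Rightarrow> 'a \<Rightarrow> real set" where
  "chord_midpoints E e = {(q + p) \<bullet> e / 2 | q p. chord E e q p}"

definition critical_level :: "'a::real_inner set \<Rightarrow> 'a \<Rightarrow> real" where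
  "critical_level E e = Sup (chord_midpoints E e)"

lemma chord_closure:
  fixes E :: "'a::real_inner set"
  shows "open E \<Longrightarrow> chord E e q p \<Longrightarrow> q \<in> closure E \<and> p \<in> closure E"
  using chord_frontier[of E e q p] by (simp add: frontier_def)

lemma bdd_above_chord_midpoints:
  assumes E: "open E" "bounded E" and e: "norm e = 1"
  shows "bdd_above (chord_midpoints E e)"
proof -
  obtain B where B: "\<And>y. y \<in> closure E \<Longrightarrow> norm y \<le> B"
    using bounded_closure[OF E(2)] by (auto simp: bounded_iff)
  show ?thesis
  proof (rule bdd_aboveI[of _ B])
    fix x assume "x \<in> chord_midpoints E e"
    then obtain q p where x: "x = (q + p) \<bullet> e / 2" "chord E e q p" by (auto simp: chord_midpoints_def)
    have "norm (q + p) \<le> B + B" using chord_closure[OF E(1) x(2)] B norm_triangle_mono by blast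
    moreover have "(q + p) \<bullet> e \<le> norm (q + p)" using Cauchy_Schwarz_ineq2[of "q+p" e] e by simp
    ultimately show "x \<le> B" using x by simp
  qed
qed

lemma chord_midpoint_le_critical_level:
  assumes "open E" "bounded E" "norm e = 1" "chord E e q p"
  shows "(q + p) \<bullet> e / 2 \<le> critical_level E e"
  unfolding critical_level_def using assms
  by (intro cSup_upper bdd_above_chord_midpoints) (auto simp: chord_midpoints_def)

lemma reflection_beyond_critical_level:
  fixes E :: "(real^'n::finite) set"
  assumes E: "open E" "bounded E" and e: "norm e = 1" and x: "x \<in> E" "critical_level E e < x \<bullet> e"
  shows "reflection e (critical_level E e) x \<in> E"
proof (rule ccontr)
  assume "reflection e (critical_level E e) x \<notin> E"
  moreover obtain t1 t2 where t: "0 < t1" "0 < t2" "chord E e (x - t1 *\<^sub>R e) (x + t2 *\<^sub>R e)"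
    "\<And>u. 0 \<le> u \<Longrightarrow> x - u *\<^sub>R e \<notin> E \<Longrightarrow> t1 \<le> u" using chord_through[OF E x(1) e] by metis
  ultimately have "t1 \<le> 2 * (x \<bullet> e - critical_level E e)" using x by (intro t(4)) (auto simp: reflection_def)
  moreover have "((x - t1 *\<^sub>R e) + (x + t2 *\<^sub>R e)) \<bullet> e = 2 * (x \<bullet> e) - t1 + t2"
    using e by (simp only: inner_add_left inner_diff_left inner_scaleR_left) (simp add: norm_eq_1)
  ultimately show False
    using chord_midpoint_le_critical_level[OF E e t(3)] t(2) by simp
qed

lemma chords_tendsto_critical_level:
  assumes E: "open E" "bounded E" "E \<noteq> {}" and e: "norm e = 1"
  obtains qs ps where "\<And>j::nat. chord E e (qs j) (ps j)" "(\<lambda>j. (qs j + ps j) \<bullet> e / 2) \<longlonglongrightarrow> critical_level E e"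
proof -
  let ?c = "critical_level E e"
  obtain x where "x \<in> E" using E(3) by blast
  then obtain q p where "chord E e q p" using chord_through[OF E(1,2) _ e] by metis
  then have "chord_midpoints E e \<noteq> {}" unfolding chord_midpoints_def by blast
  then have "\<exists>x\<in>chord_midpoints E e. ?c - inverse (real (Suc j)) < x" for j
    unfolding critical_level_def using bdd_above_chord_midpoints[OF E(1,2) e]
    by (subst less_cSup_iff[symmetric]) auto
  then have "\<exists>q p. chord E e q p \<and> ?c - inverse (real (Suc j)) < (q + p) \<bullet> e / 2" for j
    unfolding chord_midpoints_def by blast
  then obtain qs ps
    where chords: "\<And>j. chord E e (qs j) (ps j)" "\<And>j. ?c - inverse (real (Suc j)) < (qs j + ps j) \<bullet> e / 2"
    by metis
  have "(\<lambda>j. (qs j + ps j) \<bullet> e / 2) \<longlonglongrightarrow> ?c"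
  proof (rule tendsto_sandwich[of "\<lambda>j. ?c - inverse (real (Suc j))" _ _ "\<lambda>_. ?c"])
    show "(\<lambda>j. ?c - inverse (real (Suc j))) \<longlonglongrightarrow> ?c"
      using tendsto_diff[OF tendsto_const[of ?c] LIMSEQ_inverse_real_of_nat] by simp
  qed (use chord_midpoint_le_critical_level[OF E(1,2) e chords(1)] less_imp_le[OF chords(2)]
      in \<open>auto intro!: always_eventually\<close>)
  then show ?thesis using that chords(1) by blast
qed

lemma critical_chords:
  fixes E :: "'a::euclidean_space set"
  assumes E: "open E" "bounded E" "E \<noteq> {}" and e: "norm e = 1"
  obtains qs ps q p where "\<And>j::nat. chord E e (qs j) (ps j)" "qs \<longlonglongrightarrow> q" "ps \<longlonglongrightarrow> p"
    "(q + p) \<bullet> e = 2 * critical_level E e"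
proof -
  obtain qs ps where chords: "\<And>j::nat. chord E e (qs j) (ps j)"
    and lim: "(\<lambda>j. (qs j + ps j) \<bullet> e / 2) \<longlonglongrightarrow> critical_level E e"
    using chords_tendsto_critical_level[OF E e] by blast
  have "compact (closure E \<times> closure E)" using E(2) by (intro compact_Times) (auto simp: compact_closure)
  moreover have "\<forall>j. (qs j, ps j) \<in> closure E \<times> closure E" using chord_closure[OF E(1) chords] by auto
  ultimately obtain l r where l: "strict_mono r" "((\<lambda>j. (qs j, ps j)) \<circ> r) \<longlonglongrightarrow> l"
    by (elim seq_compactE[OF compact_imp_seq_compact])
  have q: "(\<lambda>j. qs (r j)) \<longlonglongrightarrow> fst l" and p: "(\<lambda>j. ps (r j)) \<longlonglongrightarrow> snd l"
    using tendsto_fst[OF l(2)] tendsto_snd[OF l(2)] by (auto simp: o_def)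
  have "(\<lambda>j. (qs (r j) + ps (r j)) \<bullet> e / 2) \<longlonglongrightarrow> (fst l + snd l) \<bullet> e / 2"
    by (intro tendsto_intros q p) simp
  moreover have "(\<lambda>j. (qs (r j) + ps (r j)) \<bullet> e / 2) \<longlonglongrightarrow> critical_level E e"
    using LIMSEQ_subseq_LIMSEQ[OF lim l(1)] by (simp add: o_def)
  ultimately have "(fst l + snd l) \<bullet> e / 2 = critical_level E e" by (rule LIMSEQ_unique)
  then show ?thesis using that[of "\<lambda>j. qs (r j)" "\<lambda>j. ps (r j)" "fst l" "snd l"] chords q p by simp
qed

section \<open>Moving planes\<close>

lemma reflection_eq_mirror: "reflection e c x = mirror e x + (2 * c) *\<^sub>R e"
  by (simp add: reflection_def mirror_def algebra_simps)

lemma reflection_add: "reflection e c (x + z) = reflection e c x + mirror e z"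
  by (simp add: reflection_eq_mirror mirror_add)

lemma reflection_inner: "norm e = 1 \<Longrightarrow> reflection e c x \<bullet> e = 2 * c - x \<bullet> e"
  by (simp add: reflection_def inner_diff_left norm_eq_1)

lemma reflection_reflection: "norm e = 1 \<Longrightarrow> reflection e c (reflection e c x) = x"
  using reflection_inner[of e c x]
  by (simp add: reflection_def[of e c "reflection e c x"]) (simp add: reflection_def algebra_simps)

lemma reflection_fixed: "x \<bullet> e = c \<Longrightarrow> reflection e c x = x"
  by (simp add: reflection_def)

lemma norm_reflection_diff: "norm e = 1 \<Longrightarrow> norm (reflection e c x - reflection e c y) = norm (x - y)"
  by (simp add: reflection_eq_mirror norm_mirror flip: mirror_diff)

lemma borel_measurable_reflection [measurable]: "reflection e c \<in> borel \<rightarrow>\<^sub>M borel"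
  unfolding reflection_def by measurable

lemma borel_reflection_vimage [measurable]: "E \<in> sets borel \<Longrightarrow> {x. reflection e c x \<in> E} \<in> sets borel"
  using measurable_sets[OF borel_measurable_reflection] by (simp add: vimage_def)

lemma reflection_image_eq_vimage: "norm e = 1 \<Longrightarrow> reflection e c ` E = {x. reflection e c x \<in> E}"
  by (auto simp: reflection_reflection intro: image_eqI[where x="reflection e c _"])

lemma distr_lborel_reflection:
  fixes e :: "real^'n::finite"
  assumes "norm e = 1" "2 \<le> CARD('n)"
  shows "distr lborel borel (reflection e c) = lborel"
proof -
  have "distr lborel borel (\<lambda>x. (2 * c) *\<^sub>R e + mirror e x) = lborel"
    using assms by (intro distr_lborel_compose[OF distr_lborel_mirror lborel_distr_plus]) auto
  moreover have "(\<lambda>x. (2 * c) *\<^sub>R e + mirror e x) = reflection e c"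
    by (simp add: fun_eq_iff reflection_eq_mirror add.commute)
  ultimately show ?thesis by simp
qed

lemma trunc_potential_reflection:
  fixes e :: "real^'n::finite"
  assumes e: "norm e = 1" "2 \<le> CARD('n)" and E[measurable]: "E \<in> sets borel" and \<rho>: "0 < \<rho>"
  shows "trunc_potential m \<rho> {x. reflection e c x \<in> E} (reflection e c p) = trunc_potential m \<rho> E p"
proof -
  have [measurable]: "(\<lambda>z::real^'n. trunc_kernel m \<rho> z) \<in> borel_measurable borel"
    by (rule borel_measurable_trunc_kernel[OF \<rho>]) simp
  have "trunc_potential m \<rho> E p = (LINT z|distr lborel borel (mirror e). indicator E (p + z) * trunc_kernel m \<rho> z)"
    using distr_lborel_mirror[OF e(1)] e(2) by (simp add: trunc_potential_def)
  also have "\<dots> = (LINT z|lborel. indicator E (p + mirror e z) * trunc_kernel m \<rho> (mirror e z))"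
    by (rule integral_distr) measurable
  also have "\<dots> = trunc_potential m \<rho> {x. reflection e c x \<in> E} (reflection e c p)"
    unfolding trunc_potential_def
    by (intro Bochner_Integration.integral_cong refl)
      (simp add: indicator_def reflection_add reflection_reflection[OF e(1)] trunc_kernel_def norm_mirror[OF e(1)])
  finally show ?thesis ..
qed

lemma mirror_maps_unit_vector:
  assumes "norm a = 1" "norm b = 1" "a \<noteq> b"
  shows "mirror ((1 / norm (a - b)) *\<^sub>R (a - b)) a = b"
proof -
  let ?w = "a - b"
  have "?w \<bullet> ?w = 2 * (a \<bullet> ?w)"
    using assms by (simp add: inner_diff_left inner_diff_right inner_commute norm_eq_1)
  moreover have "?w \<bullet> ?w \<noteq> 0" using assms by simp
  moreover have "mirror ((1 / norm ?w) *\<^sub>R ?w) a = a - (2 * (a \<bullet> ?w) / (?w \<bullet> ?w)) *\<^sub>R ?w"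
    by (simp add: mirror_def norm_eq_sqrt_inner)
  ultimately show ?thesis by simp
qed

lemma involution_to_axis:
  fixes e :: "real^'n::finite"
  assumes e: "norm e = 1" "2 \<le> CARD('n)"
  obtains T where "distr lborel borel T = lborel" "T \<in> borel \<rightarrow>\<^sub>M borel" "\<And>x. T (T x) = x"
    "\<And>x y. norm (T x - T y) = norm (x - y)" "\<And>x. T x $ i = x \<bullet> e"
proof (cases "e = axis i 1")
  case True
  then show ?thesis using that[of "\<lambda>x. x"] by (simp add: inner_axis distr_id2)
next
  case False
  define v where "v = (1 / norm (e - axis i 1)) *\<^sub>R (e - axis i 1)"
  have v: "norm v = 1" using False by (simp add: v_def)
  show ?thesis
  proof (rule that[of "mirror v"])
    show "distr lborel borel (mirror v) = lborel" using e by (intro distr_lborel_mirror[OF v]) simp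
    show "norm (mirror v x - mirror v y) = norm (x - y)" for x y
      by (simp add: norm_mirror v flip: mirror_diff)
    fix x
    have "mirror v e = axis i 1"
      unfolding v_def using e False by (intro mirror_maps_unit_vector) (auto simp: norm_axis_1)
    then have "mirror v x $ i = mirror v x \<bullet> mirror v e" by (simp add: inner_axis)
    then show "mirror v x $ i = x \<bullet> e" by (simp add: mirror_inner[OF v])
  qed (use v in \<open>simp_all add: mirror_mirror\<close>)
qed

lemma measure_axis_slab_le:
  fixes S :: "(real^'n::finite) set"
  assumes S: "S \<in> sets borel" and d: "0 \<le> d" "\<And>x y j. x \<in> S \<Longrightarrow> y \<in> S \<Longrightarrow> \<bar>x $ j - y $ j\<bar> \<le> d"
    and t: "0 \<le> t" "\<And>x. x \<in> S \<Longrightarrow> c \<le> x $ i \<and> x $ i \<le> c + t"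
  shows "measure lborel S \<le> t * d ^ (CARD('n) - 1)"
proof (cases "S = {}")
  case False
  then obtain x0 where x0: "x0 \<in> S" by blast
  define lo where "lo = (\<lambda>j. Inf ((\<lambda>x. x $ j) ` S))"
  have bdd: "bdd_below ((\<lambda>x. x $ j) ` S)" for j
    using d(2)[OF _ x0, of _ j] by (intro bdd_belowI2[of _ "x0 $ j - d"]) (smt (verit))
  have lo: "lo j \<le> x $ j" "x $ j \<le> lo j + d" if "x \<in> S" for x j
  proof -
    show "lo j \<le> x $ j" unfolding lo_def using that by (intro cInf_lower bdd) auto
    have "x $ j - d \<le> y $ j" if "y \<in> S" for y using d(2)[OF \<open>x \<in> S\<close> that, of j] by linarith
    then have "x $ j - d \<le> lo j" unfolding lo_def using x0 by (intro cInf_greatest) auto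
    then show "x $ j \<le> lo j + d" by simp
  qed
  define l u where "l = (\<chi> j. if j = i then c else lo j)" and "u = (\<chi> j. if j = i then c + t else lo j + d)"
  have subset: "S \<subseteq> cbox l u" using lo t by (auto simp: l_def u_def mem_box_cart)
  then have nonempty: "cbox l u \<noteq> {}" using x0 by blast
  have "measure lborel S \<le> measure lborel (cbox l u)"
    using subset S emeasure_bounded_finite[OF bounded_cbox, of l u]
    by (intro measure_mono_fmeasurable) (auto simp: fmeasurable_def infinity_ennreal_def)
  also have "\<dots> = (\<Prod>j\<in>UNIV. u $ j - l $ j)" using content_cbox_cart[OF nonempty] by simp
  also have "\<dots> = (u $ i - l $ i) * (\<Prod>j\<in>UNIV - {i}. u $ j - l $ j)" by (rule prod.remove) auto
  also have "(\<Prod>j\<in>UNIV - {i}. u $ j - l $ j) = (\<Prod>j\<in>UNIV - {i}. d)"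
    by (intro prod.cong refl) (auto simp: l_def u_def)
  also have "\<dots> = d ^ (CARD('n) - 1)" by (simp add: card_Diff_singleton)
  finally show ?thesis by (simp add: l_def u_def)
qed (use d t in simp)

lemma measure_slab_le:
  fixes e :: "real^'n::finite"
  assumes e: "norm e = 1" "2 \<le> CARD('n)" and S[measurable]: "S \<in> sets borel"
    and d: "0 \<le> d" "\<And>x y. x \<in> S \<Longrightarrow> y \<in> S \<Longrightarrow> norm (x - y) \<le> d"
    and t: "0 \<le> t" "\<And>x. x \<in> S \<Longrightarrow> c \<le> x \<bullet> e \<and> x \<bullet> e \<le> c + t"
  shows "measure lborel S \<le> t * d ^ (CARD('n) - 1)"
proof -
  define i :: 'n where "i = undefined"
  obtain T where T: "distr lborel borel T = lborel" and [measurable]: "T \<in> borel \<rightarrow>\<^sub>M borel"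
    and T_T: "\<And>x. T (T x) = x"
    and T_isometry: "\<And>x y. norm (T x - T y) = norm (x - y)" and T_axis: "\<And>x. T x $ i = x \<bullet> e"
    using involution_to_axis[OF e] by metis
  have "measure lborel S = measure (distr lborel borel T) S" by (simp add: T)
  also have "\<dots> = measure lborel (T -` S)" by (subst measure_distr) auto
  also have "\<dots> \<le> t * d ^ (CARD('n) - 1)"
  proof (rule measure_axis_slab_le[where i=i and c=c])
    show "T -` S \<in> sets borel" using measurable_sets[of T borel borel S] by simp
    show "\<bar>x $ j - y $ j\<bar> \<le> d" if "x \<in> T -` S" "y \<in> T -` S" for x y j
      using d(2)[of "T x" "T y"] component_le_norm_cart[of "x - y" j] that by (simp add: T_isometry)
    show "c \<le> x $ i \<and> x $ i \<le> c + t" if "x \<in> T -` S" for x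
      using t(2)[of "T x"] T_axis[of "T x"] that by (simp add: T_T)
  qed (use d t in auto)
  finally show ?thesis .
qed

lemma fmeasurable_lborel_bounded:
  fixes S :: "'a::euclidean_space set"
  shows "bounded S \<Longrightarrow> S \<in> sets borel \<Longrightarrow> S \<in> fmeasurable lborel"
  using emeasure_bounded_finite[of S] by (auto simp: fmeasurable_def infinity_ennreal_def)

text \<open>At least half of the volume of \<open>A\<close> lies at distance at least \<open>t\<close> from the plane, where \<open>t\<close> is chosen
  such that the slab of width \<open>t\<close> has at most half of the volume.\<close>
lemma measure_sq_le_moment:
  fixes e :: "real^'n::finite"
  assumes e: "norm e = 1" "2 \<le> CARD('n)" and A: "A \<in> sets borel" "bounded A"
    and d: "0 < d" "\<And>x y. x \<in> A \<Longrightarrow> y \<in> A \<Longrightarrow> norm (x - y) \<le> d"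
    and c: "\<And>x. x \<in> A \<Longrightarrow> x \<bullet> e < c" and integrable: "integrable lborel (\<lambda>x. indicator A x * (c - x \<bullet> e))"
  shows "(measure lborel A)\<^sup>2 \<le> 4 * d ^ (CARD('n) - 1) * (LINT x|lborel. indicator A x * (c - x \<bullet> e))"
proof -
  define V where "V = measure lborel A"
  define D where "D = d ^ (CARD('n) - 1)"
  define t where "t = V / (2 * D)"
  have D: "0 < D" using d by (simp add: D_def)
  have t: "0 \<le> t" using D by (simp add: t_def V_def)
  define slab where "slab = A \<inter> {x. c - t < x \<bullet> e}"
  have slab: "slab \<in> sets borel" "slab \<subseteq> A" unfolding slab_def using A by auto
  have "measure lborel slab \<le> t * D"
    unfolding D_def using d c
    by (intro measure_slab_le[OF e slab(1) _ _ t, where c="c - t"]) (force simp: slab_def less_imp_le)+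
  moreover have "measure lborel (A - slab) = V - measure lborel slab"
    unfolding V_def using slab A fmeasurable_lborel_bounded[OF A(2,1)]
    by (intro measure_Diff) (auto simp: fmeasurable_def infinity_ennreal_def)
  moreover have "V - t * D = V / 2" using D by (simp add: t_def)
  ultimately have "V / 2 \<le> measure lborel (A - slab)" by linarith
  then have "t * (V / 2) \<le> t * measure lborel (A - slab)" using t by (intro mult_left_mono)
  also have "\<dots> = (LINT x|lborel. t * indicator (A - slab) x)" by simp
  also have "\<dots> \<le> (LINT x|lborel. indicator A x * (c - x \<bullet> e))"
  proof (rule integral_mono[OF _ integrable])
    show "integrable lborel (\<lambda>x. t * indicator (A - slab) x)"
      using fmeasurable_lborel_bounded[of "A - slab"] A slab bounded_subset[OF A(2), of "A - slab"]
      by (intro integrable_mult_right integrable_real_indicator) (auto simp: fmeasurable_def)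
    show "t * indicator (A - slab) x \<le> indicator A x * (c - x \<bullet> e)" for x
      using c[of x] by (auto simp: indicator_def slab_def)
  qed
  finally have "V\<^sup>2 / (4 * D) \<le> (LINT x|lborel. indicator A x * (c - x \<bullet> e))"
    by (simp add: t_def power2_eq_square)
  then show ?thesis using D by (simp add: V_def D_def field_simps)
qed

definition trunc_kernel_slope :: "real \<Rightarrow> real \<Rightarrow> 'a::real_normed_vector \<Rightarrow> real" where
  "trunc_kernel_slope m \<rho> z = trunc_powr_slope (m/2) (\<rho>\<^sup>2) ((norm z)\<^sup>2)"

lemma continuous_on_trunc_kernel_slope [continuous_intros]:
  assumes "0 < \<rho>" "continuous_on S f"
  shows "continuous_on S (\<lambda>x. trunc_kernel_slope m \<rho> (f x))"
  unfolding trunc_kernel_slope_def using assms by (intro continuous_intros) auto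

lemma borel_measurable_trunc_kernel_slope:
  fixes f :: "'b \<Rightarrow> 'a::euclidean_space"
  assumes "0 < \<rho>" "f \<in> borel_measurable M"
  shows "(\<lambda>x. trunc_kernel_slope m \<rho> (f x)) \<in> borel_measurable M"
  using assms by (intro measurable_compose[OF assms(2)] borel_measurable_continuous_onI continuous_intros)

lemma trunc_kernel_slope_nonneg: "0 < m \<Longrightarrow> 0 \<le> trunc_kernel_slope m \<rho> z"
  by (simp add: trunc_kernel_slope_def trunc_powr_slope_nonneg)

lemma trunc_kernel_slope_antimono:
  "0 < \<rho> \<Longrightarrow> 0 < m \<Longrightarrow> norm y \<le> norm z \<Longrightarrow> trunc_kernel_slope m \<rho> z \<le> trunc_kernel_slope m \<rho> y"
  unfolding trunc_kernel_slope_def by (intro trunc_powr_slope_antimono) (auto intro: power_mono)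

lemma abs_trunc_kernel_slope_le: "0 < \<rho> \<Longrightarrow> 0 < m \<Longrightarrow> \<bar>trunc_kernel_slope m \<rho> z\<bar> \<le> trunc_kernel_slope m \<rho> 0"
  using trunc_kernel_slope_antimono[of \<rho> m 0 z] trunc_kernel_slope_nonneg[of m \<rho> z]
  by (simp add: trunc_kernel_slope_def)

lemma trunc_kernel_slope_ge:
  assumes "0 < \<rho>" "\<rho> \<le> d" "0 < m" "norm z \<le> d"
  shows "m/2 * d powr (-m - 2) \<le> trunc_kernel_slope m \<rho> z"
proof -
  have exponent: "-((m + 2)/2) = -(m/2) - 1" "-(m + 2) = -m - 2" by (simp_all add: field_simps)
  have "d powr (-m - 2) = (d\<^sup>2) powr (-(m/2) - 1)"
    using power2_powr_half[of d "m + 2"] assms unfolding exponent by simp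
  then have "m/2 * d powr (-m - 2) = trunc_powr_slope (m/2) (\<rho>\<^sup>2) (d\<^sup>2)"
    using assms by (simp add: trunc_powr_slope_def max_def power_mono)
  also have "\<dots> \<le> trunc_kernel_slope m \<rho> z"
    unfolding trunc_kernel_slope_def using assms by (intro trunc_powr_slope_antimono) (auto intro: power_mono)
  finally show ?thesis .
qed

lemma trunc_kernel_ge_tangent:
  "0 < \<rho> \<Longrightarrow> 0 < m \<Longrightarrow>
    trunc_kernel m \<rho> y + trunc_kernel_slope m \<rho> y * ((norm y)\<^sup>2 - (norm x)\<^sup>2) \<le> trunc_kernel m \<rho> x"
  using trunc_powr_ge_tangent[of "\<rho>\<^sup>2" "m/2"] by (simp add: trunc_kernel_def trunc_kernel_slope_def)

lemma norm_sq_difference: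
  fixes p q x :: "'a::real_inner"
  shows "(norm (x - p))\<^sup>2 - (norm (x - q))\<^sup>2 = (p - q) \<bullet> (p + q - 2 *\<^sub>R x)"
  by (simp add: power2_norm_eq_inner inner_simps inner_commute algebra_simps)

lemma trunc_kernel_difference_ge:
  assumes "0 < \<rho>" "0 < m"
  shows "trunc_kernel_slope m \<rho> (x - p) * ((p - q) \<bullet> (p + q - 2 *\<^sub>R x)) \<le> trunc_kernel m \<rho> (x - q) - trunc_kernel m \<rho> (x - p)"
  using trunc_kernel_ge_tangent[OF assms, of "x - p" "x - q"] by (simp add: norm_sq_difference)

lemma abs_slope_inner_le:
  assumes "0 < \<rho>" "0 < m"
  shows "\<bar>trunc_kernel_slope m \<rho> (x - p) * (u \<bullet> (w - 2 *\<^sub>R x))\<bar>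
    \<le> trunc_kernel_slope m \<rho> (0::'a::real_inner) * (norm u * (norm w + 2 * norm x))" (is "_ \<le> ?S * _")
proof -
  have "norm u * norm (w - 2 *\<^sub>R x) \<le> norm u * (norm w + 2 * norm x)"
    using norm_triangle_ineq4[of w "2 *\<^sub>R x"] by (intro mult_left_mono) auto
  then have "\<bar>u \<bullet> (w - 2 *\<^sub>R x)\<bar> \<le> norm u * (norm w + 2 * norm x)"
    using Cauchy_Schwarz_ineq2 order_trans by blast
  then show ?thesis
    unfolding abs_mult
    using abs_trunc_kernel_slope_le[OF assms, of "x - p"] trunc_kernel_slope_nonneg[OF assms(2), of \<rho> "0::'a"]
    by (intro mult_mono) auto
qed

lemma norm_diff_closure_le_diameter:
  fixes E :: "'a::euclidean_space set"
  assumes "bounded E" "x \<in> E" "p \<in> closure E"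
  shows "norm (x - p) \<le> diameter E"
proof -
  have "dist x p \<le> diameter (closure E)"
    using assms closure_subset by (intro diameter_bounded_bound bounded_closure) auto
  then show ?thesis using diameter_closure[OF assms(1)] by (simp add: dist_norm)
qed

locale moving_plane =
  fixes m :: real and e :: "real^'n::finite" and lam :: real and E :: "(real^'n) set"
  assumes dim: "2 \<le> CARD('n)" and m_pos: "0 < m" and e_unit: "norm e = 1"
    and open_E: "open E" and bounded_E: "bounded E" and diameter_pos: "0 < diameter E"
    and reflection_mem: "\<And>x. x \<in> E \<Longrightarrow> lam < x \<bullet> e \<Longrightarrow> reflection e lam x \<in> E"
begin

definition unreflected :: "(real^'n) set" where
  "unreflected = {x\<in>E. x \<bullet> e < lam \<and> reflection e lam x \<notin> E}"

definition moment :: real where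
  "moment = (LINT x|lborel. indicator unreflected x * (lam - x \<bullet> e))"

definition defect :: real where
  "defect = m * diameter E powr (-m - 2) * moment"

lemma borel_E [measurable]: "E \<in> sets borel"
  using open_E by simp

lemma unreflected_subset: "unreflected \<subseteq> E"
  by (auto simp: unreflected_def)

lemma borel_unreflected [measurable]: "unreflected \<in> sets borel"
proof -
  have "unreflected = E \<inter> {x. x \<bullet> e < lam} \<inter> (- {x. reflection e lam x \<in> E})" by (auto simp: unreflected_def)
  moreover have "{x. x \<bullet> e < lam} \<in> sets borel" by auto
  ultimately show ?thesis
    using borel_E borel_comp[OF borel_reflection_vimage[OF borel_E]] by (simp only: sets.Int)
qed

lemma bounded_unreflected: "bounded unreflected"
  by (rule bounded_subset[OF bounded_E unreflected_subset])

lemma height_bounded: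
  obtains r where "\<And>x. x \<in> E \<Longrightarrow> \<bar>lam - x \<bullet> e\<bar> \<le> r"
proof -
  obtain r where r: "\<And>x. x \<in> E \<Longrightarrow> norm x \<le> r" using bounded_E by (auto simp: bounded_iff)
  have "\<bar>lam - x \<bullet> e\<bar> \<le> \<bar>lam\<bar> + r" if "x \<in> E" for x
    using Cauchy_Schwarz_ineq2[of x e] e_unit r[OF that] by simp
  then show ?thesis by (rule that)
qed

lemma integrable_height:
  assumes "S \<subseteq> E" "S \<in> sets borel"
  shows "integrable lborel (\<lambda>x. indicator S x * (lam - x \<bullet> e))"
proof -
  obtain r where "\<And>x. x \<in> E \<Longrightarrow> \<bar>lam - x \<bullet> e\<bar> \<le> r" using height_bounded by blast
  then show ?thesis
    using assms bounded_subset[OF bounded_E] by (intro integrable_indicator_times_bounded[where K=r]) auto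
qed

text \<open>The part of \<open>E\<close> beyond the plane and its mirror image cancel.\<close>
lemma integral_odd:
  fixes \<phi> :: "real^'n \<Rightarrow> real"
  assumes \<phi>: "integrable lborel (\<lambda>x. indicator E x * \<phi> x)" and odd: "\<And>x. \<phi> (reflection e lam x) = - \<phi> x"
    and [measurable]: "\<phi> \<in> borel_measurable borel"
  shows "(LINT x|lborel. indicator E x * \<phi> x) = (LINT x|lborel. indicator unreflected x * \<phi> x)"
proof -
  define beyond where "beyond = {x\<in>E. lam < x \<bullet> e}"
  define image where "image = {x\<in>E. x \<bullet> e < lam \<and> reflection e lam x \<in> E}"
  have "{x. x \<bullet> e < lam} \<in> sets borel" "{x. lam < x \<bullet> e} \<in> sets borel" by auto
  moreover have "beyond = E \<inter> {x. lam < x \<bullet> e}" "image = E \<inter> {x. x \<bullet> e < lam} \<inter> {x. reflection e lam x \<in> E}"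
    by (auto simp: beyond_def image_def)
  ultimately have [measurable]: "beyond \<in> sets borel" "image \<in> sets borel" by auto
  have integrable: "integrable lborel (\<lambda>x. indicator S x * \<phi> x)" if "S \<subseteq> E" "S \<in> sets borel" for S
    using that by (intro Bochner_Integration.integrable_bound[OF \<phi>] AE_I2) (auto simp: indicator_def)
  have zero: "\<phi> x = 0" if "x \<bullet> e = lam" for x using odd[of x] reflection_fixed[OF that] by simp
  have "(LINT x|lborel. indicator image x * \<phi> x) = (LINT x|distr lborel borel (reflection e lam). indicator image x * \<phi> x)"
    by (simp only: distr_lborel_reflection[OF e_unit dim])
  also have "\<dots> = (LINT x|lborel. indicator image (reflection e lam x) * \<phi> (reflection e lam x))"
    by (rule integral_distr) measurable
  also have "\<dots> = (LINT x|lborel. - (indicator beyond x * \<phi> x))"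
  proof (intro Bochner_Integration.integral_cong refl)
    fix x
    have "reflection e lam x \<in> image \<longleftrightarrow> x \<in> beyond"
      using reflection_mem[of x]
      by (auto simp: image_def beyond_def reflection_inner[OF e_unit] reflection_reflection[OF e_unit])
    then show "indicator image (reflection e lam x) * \<phi> (reflection e lam x) = - (indicator beyond x * \<phi> x)"
      by (simp add: odd indicator_def)
  qed
  finally have image: "(LINT x|lborel. indicator image x * \<phi> x) = - (LINT x|lborel. indicator beyond x * \<phi> x)"
    by simp
  have "(LINT x|lborel. indicator E x * \<phi> x)
      = (LINT x|lborel. indicator unreflected x * \<phi> x + indicator beyond x * \<phi> x + indicator image x * \<phi> x)"
  proof (intro Bochner_Integration.integral_cong refl)
    fix x show "indicator E x * \<phi> x = indicator unreflected x * \<phi> x + indicator beyond x * \<phi> x + indicator image x * \<phi> x"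
      using zero[of x]
      by (cases "x \<bullet> e" lam rule: linorder_cases) (auto simp: unreflected_def beyond_def image_def indicator_def)
  qed
  also have "\<dots> = (LINT x|lborel. indicator unreflected x * \<phi> x)"
    using integrable[of unreflected] integrable[of beyond] integrable[of image] image unreflected_subset
    by (simp add: beyond_def image_def)
  finally show ?thesis .
qed

lemma symdiff_reflection_subset:
  "symdiff E (reflection e lam ` E) \<subseteq> unreflected \<union> {x. reflection e lam x \<in> unreflected}"
proof
  fix x assume x: "x \<in> symdiff E (reflection e lam ` E)"
  show "x \<in> unreflected \<union> {x. reflection e lam x \<in> unreflected}"
  proof (cases "x \<in> E")
    case True
    then have "reflection e lam x \<notin> E"
      using x by (auto simp: symdiff_def reflection_image_eq_vimage[OF e_unit])
    then show ?thesis
      using True reflection_mem[OF True] reflection_fixed[of x e lam]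
      by (cases "x \<bullet> e" lam rule: linorder_cases) (auto simp: unreflected_def)
  next
    case False
    then have mem: "reflection e lam x \<in> E"
      using x by (auto simp: symdiff_def reflection_image_eq_vimage[OF e_unit])
    then show ?thesis
      using False reflection_mem[OF mem] reflection_fixed[of "reflection e lam x" e lam]
      by (cases "reflection e lam x \<bullet> e" lam rule: linorder_cases)
        (auto simp: unreflected_def reflection_reflection[OF e_unit])
  qed
qed

lemma measure_symdiff_reflection_le:
  "measure lebesgue (symdiff E (reflection e lam ` E)) \<le> 2 * measure lborel unreflected"
proof -
  let ?A' = "{x. reflection e lam x \<in> unreflected}"
  have A'[measurable]: "?A' \<in> sets borel" by (rule borel_reflection_vimage[OF borel_unreflected])
  have "emeasure (distr lborel borel (reflection e lam)) unreflected = emeasure lborel ?A'"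
    by (subst emeasure_distr) (auto simp: vimage_def)
  then have "emeasure lborel ?A' = emeasure lborel unreflected"
    by (simp add: distr_lborel_reflection[OF e_unit dim])
  then have A': "?A' \<in> fmeasurable lborel" "measure lborel ?A' = measure lborel unreflected"
    using fmeasurable_lborel_bounded[OF bounded_unreflected borel_unreflected]
    by (auto simp: fmeasurable_def measure_def)
  have symdiff_borel: "symdiff E (reflection e lam ` E) \<in> sets borel"
    using borel_reflection_vimage[OF borel_E] borel_E
    by (auto simp: symdiff_def reflection_image_eq_vimage[OF e_unit])
  then have "measure lebesgue (symdiff E (reflection e lam ` E)) = measure lborel (symdiff E (reflection e lam ` E))" by simp
  also have "\<dots> \<le> measure lborel (unreflected \<union> ?A')"
    using symdiff_reflection_subset symdiff_borel A'(1) fmeasurable_lborel_bounded[OF bounded_unreflected borel_unreflected]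
    by (intro measure_mono_fmeasurable fmeasurable.Un) auto
  also have "\<dots> \<le> measure lborel unreflected + measure lborel ?A'" by (intro measure_Un_le) auto
  finally show ?thesis using A'(2) by simp
qed

lemma moment_nonneg: "0 \<le> moment"
  unfolding moment_def by (intro integral_nonneg_AE AE_I2) (auto simp: unreflected_def indicator_def)

lemma measure_unreflected_sq_le: "(measure lborel unreflected)\<^sup>2 \<le> 4 * diameter E ^ (CARD('n) - 1) * moment"
  unfolding moment_def
proof (rule measure_sq_le_moment[OF e_unit dim borel_unreflected bounded_unreflected diameter_pos])
  show "norm (x - y) \<le> diameter E" if "x \<in> unreflected" "y \<in> unreflected" for x y
    using diameter_bounded_bound[OF bounded_E, of x y] that unreflected_subset by (auto simp: dist_norm)
qed (auto simp: unreflected_def intro!: integrable_height[unfolded unreflected_def] borel_unreflected[unfolded unreflected_def])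

lemma measure_symdiff_reflection_le_defect:
  assumes m: "m = real CARD('n) + s" and K: "2 * defect \<le> K"
  shows "measure lebesgue (symdiff E (reflection e lam ` E))
    \<le> 3 * sqrt (5 / (2 * m)) * diameter E ^ CARD('n) * sqrt (diameter E powr (s + 1) * K)"
proof -
  let ?n = "CARD('n)"
  define d where "d = diameter E"
  have d: "0 < d" using diameter_pos by (simp add: d_def)
  have K_nonneg: "0 \<le> K"
    using K moment_nonneg m_pos by (simp add: defect_def) (smt (verit) mult_nonneg_nonneg powr_ge_zero)
  have "moment * (2 * m) = 2 * defect * d powr (m + 2)"
    using d powr_add[of d "- m - 2" "m + 2"] by (simp add: defect_def d_def mult_ac)
  also have "\<dots> \<le> K * d powr (m + 2)" using K by (intro mult_right_mono) auto
  also have "d powr (m + 2) = d ^ (?n + 1) * d powr (s + 1)"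
    using d powr_realpow[of d "?n + 1"] powr_add[of d "real ?n + 1" "s + 1"] by (simp add: m algebra_simps)
  finally have moment_le: "moment \<le> K * (d ^ (?n + 1) * d powr (s + 1)) / (2 * m)"
    using m_pos by (simp add: field_simps)
  have "(2 * measure lborel unreflected)\<^sup>2 \<le> 16 * d ^ (?n - 1) * moment"
    using measure_unreflected_sq_le by (simp add: power_mult_distrib mult_ac d_def)
  also have "\<dots> \<le> 16 * d ^ (?n - 1) * (K * (d ^ (?n + 1) * d powr (s + 1)) / (2 * m))"
    using moment_le d by (intro mult_left_mono) auto
  also have "\<dots> = 8 / m * (d ^ (?n - 1) * d ^ (?n + 1)) * (d powr (s + 1) * K)" by (simp add: field_simps)
  also have "d ^ (?n - 1) * d ^ (?n + 1) = (d ^ ?n)\<^sup>2"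
    unfolding power_add[symmetric] power_mult[symmetric]
    using dim by (intro arg_cong[where f="\<lambda>k. d ^ k"]) simp
  also have "8 / m * (d ^ ?n)\<^sup>2 * (d powr (s + 1) * K) \<le> 45 / (2 * m) * (d ^ ?n)\<^sup>2 * (d powr (s + 1) * K)"
    using K_nonneg m_pos by (intro mult_right_mono) (auto simp: field_simps)
  also have "\<dots> = (3 * sqrt (5 / (2 * m)) * d ^ ?n * sqrt (d powr (s + 1) * K))\<^sup>2"
    using K_nonneg m_pos by (simp add: power_mult_distrib)
  finally have "2 * measure lborel unreflected \<le> 3 * sqrt (5 / (2 * m)) * d ^ ?n * sqrt (d powr (s + 1) * K)"
    by (rule power2_le_imp_le) (use K_nonneg m_pos d in simp)
  then show ?thesis using measure_symdiff_reflection_le by (simp add: d_def)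
qed

lemma integrable_slope_inner:
  assumes S: "S \<subseteq> E" "S \<in> sets borel" and \<rho>: "0 < \<rho>"
  shows "integrable lborel (\<lambda>x. indicator S x * (trunc_kernel_slope m \<rho> (x - p) * (u \<bullet> (w - 2 *\<^sub>R x))))"
proof -
  obtain r where r: "\<And>x. x \<in> E \<Longrightarrow> norm x \<le> r" using bounded_E by (auto simp: bounded_iff)
  show ?thesis
  proof (rule integrable_indicator_times_bounded[OF S(2) bounded_subset[OF bounded_E S(1)]])
    show "(\<lambda>x. trunc_kernel_slope m \<rho> (x - p) * (u \<bullet> (w - 2 *\<^sub>R x))) \<in> borel_measurable borel"
      by (intro borel_measurable_times borel_measurable_trunc_kernel_slope[OF \<rho>]) auto
    fix x assume "x \<in> S"
    then have "trunc_kernel_slope m \<rho> (0::real^'n) * (norm u * (norm w + 2 * norm x))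
        \<le> trunc_kernel_slope m \<rho> (0::real^'n) * (norm u * (norm w + 2 * r))"
      using r[of x] S(1) trunc_kernel_slope_nonneg[OF m_pos] by (intro mult_left_mono) auto
    then show "\<bar>trunc_kernel_slope m \<rho> (x - p) * (u \<bullet> (w - 2 *\<^sub>R x))\<bar>
        \<le> trunc_kernel_slope m \<rho> (0::real^'n) * (norm u * (norm w + 2 * r))"
      using abs_slope_inner_le[OF \<rho> m_pos] order_trans by blast
  qed
qed

lemma integrable_slope_height:
  assumes "S \<subseteq> E" "S \<in> sets borel" "0 < \<rho>"
  shows "integrable lborel (\<lambda>x. indicator S x * (trunc_kernel_slope m \<rho> (x - p) * (2 * (lam - x \<bullet> e))))"
proof -
  have "e \<bullet> ((2 * lam) *\<^sub>R e - 2 *\<^sub>R x) = 2 * (lam - x \<bullet> e)" for x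
    using e_unit by (simp add: inner_diff_right inner_commute[of e x] norm_eq_1)
  then show ?thesis using integrable_slope_inner[OF assms, of p e "(2 * lam) *\<^sub>R e"] by (simp only:)
qed

lemma defect_le_integral:
  assumes p: "p \<in> closure E" and \<rho>: "0 < \<rho>" "\<rho> \<le> diameter E"
  shows "defect \<le> (LINT x|lborel. indicator unreflected x * (trunc_kernel_slope m \<rho> (x - p) * (2 * (lam - x \<bullet> e))))"
proof -
  let ?c = "m * diameter E powr (-m - 2)"
  have "defect = (LINT x|lborel. ?c * (indicator unreflected x * (lam - x \<bullet> e)))"
    unfolding defect_def moment_def by (rule integral_mult_right_zero[symmetric])
  also have "\<dots> \<le> (LINT x|lborel. indicator unreflected x * (trunc_kernel_slope m \<rho> (x - p) * (2 * (lam - x \<bullet> e))))"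
  proof (rule integral_mono)
    show "integrable lborel (\<lambda>x. ?c * (indicator unreflected x * (lam - x \<bullet> e)))"
      by (intro integrable_mult_right integrable_height unreflected_subset borel_unreflected)
    fix x
    show "?c * (indicator unreflected x * (lam - x \<bullet> e))
      \<le> indicator unreflected x * (trunc_kernel_slope m \<rho> (x - p) * (2 * (lam - x \<bullet> e)))"
    proof (cases "x \<in> unreflected")
      case True
      then have x: "x \<in> E" "0 < lam - x \<bullet> e" by (auto simp: unreflected_def)
      have "m/2 * diameter E powr (-m - 2) \<le> trunc_kernel_slope m \<rho> (x - p)"
        by (rule trunc_kernel_slope_ge[OF \<rho> m_pos norm_diff_closure_le_diameter[OF bounded_E x(1) p]])
      then have "m/2 * diameter E powr (-m - 2) * (2 * (lam - x \<bullet> e)) \<le> trunc_kernel_slope m \<rho> (x - p) * (2 * (lam - x \<bullet> e))"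
        using x by (intro mult_right_mono) auto
      moreover have "m/2 * D * (2 * h) = m * D * h" for D h by simp
      ultimately have "?c * (lam - x \<bullet> e) \<le> trunc_kernel_slope m \<rho> (x - p) * (2 * (lam - x \<bullet> e))"
        by (simp only:)
      then show ?thesis unfolding indicator_simps(1)[OF True] mult_1 .
    qed simp
  qed (intro integrable_slope_height unreflected_subset borel_unreflected \<rho>)
  finally show ?thesis .
qed

lemma potential_difference_eq:
  fixes p q :: "real^'n"
  assumes \<rho>: "0 < \<rho>"
  defines "\<phi> \<equiv> \<lambda>x. trunc_kernel m \<rho> (x - q) - trunc_kernel m \<rho> (x - p)"
  shows "integrable lborel (\<lambda>x. indicator E x * \<phi> x)"
    and "(LINT x|lborel. indicator E x * \<phi> x) = trunc_potential m \<rho> E q - trunc_potential m \<rho> E p"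
proof -
  note integrable_kernel = integrable_indicator_trunc_kernel_diff[OF borel_E bounded_E \<rho> m_pos]
  show "integrable lborel (\<lambda>x. indicator E x * \<phi> x)"
    using Bochner_Integration.integrable_diff[OF integrable_kernel[of q] integrable_kernel[of p]]
    by (simp add: \<phi>_def right_diff_distrib)
  show "(LINT x|lborel. indicator E x * \<phi> x) = trunc_potential m \<rho> E q - trunc_potential m \<rho> E p"
    using integrable_kernel[of q] integrable_kernel[of p]
    by (simp add: trunc_potential_alt[OF borel_E \<rho>] \<phi>_def right_diff_distrib)
qed

lemma potential_difference_ge_distinct:
  assumes p: "p = q + l *\<^sub>R e" "p \<in> closure E" and l: "0 < l" and midpoint: "(q + p) \<bullet> e = 2 * lam"
    and \<rho>: "0 < \<rho>" "\<rho> \<le> diameter E"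
  shows "defect * l \<le> trunc_potential m \<rho> E q - trunc_potential m \<rho> E p"
proof -
  define \<phi> where "\<phi> = (\<lambda>x. trunc_kernel m \<rho> (x - q) - trunc_kernel m \<rho> (x - p))"
  define \<psi> where "\<psi> = (\<lambda>x. trunc_kernel_slope m \<rho> (x - p) * (2 * (lam - x \<bullet> e)))"
  have qe: "q \<bullet> e = lam - l/2"
    using midpoint e_unit unfolding p(1) inner_add_left inner_scaleR_left by (simp add: norm_eq_1)
  have mirror_q: "reflection e lam q = p" unfolding reflection_def qe p(1) by simp
  then have mirror_p: "reflection e lam p = q" using reflection_reflection[OF e_unit, of lam q] by simp
  have \<phi>_measurable: "\<phi> \<in> borel_measurable borel"
    unfolding \<phi>_def by (intro borel_measurable_diff borel_measurable_trunc_kernel[OF \<rho>(1)]) auto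
  have \<phi>_integrable: "integrable lborel (\<lambda>x. indicator E x * \<phi> x)"
    unfolding \<phi>_def by (rule potential_difference_eq(1)[OF \<rho>(1)])
  have \<phi>_odd: "\<phi> (reflection e lam x) = - \<phi> x" for x
    using norm_reflection_diff[OF e_unit, of lam x p] norm_reflection_diff[OF e_unit, of lam x q]
    by (simp add: \<phi>_def mirror_q mirror_p trunc_kernel_def)
  have "l * \<psi> x \<le> \<phi> x" for x
  proof -
    have "e \<bullet> (p + q - 2 *\<^sub>R x) = 2 * (lam - x \<bullet> e)"
      using midpoint by (simp add: inner_add_left inner_add_right inner_diff_right inner_commute[of e])
    then have "(p - q) \<bullet> (p + q - 2 *\<^sub>R x) = l * (2 * (lam - x \<bullet> e))" using p(1) by simp
    then show ?thesis
      using trunc_kernel_difference_ge[OF \<rho>(1) m_pos, of x p q] unfolding \<phi>_def \<psi>_def by (simp only: mult_ac)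
  qed
  moreover have "integrable lborel (\<lambda>x. indicator unreflected x * \<phi> x)"
    using integrable_mult_indicator[OF _ \<phi>_integrable, of unreflected] unreflected_subset
    by (simp add: indicator_inter_arith[symmetric] mult.assoc[symmetric] Int_absorb2)
  moreover have "integrable lborel (\<lambda>x. indicator unreflected x * \<psi> x)"
    unfolding \<psi>_def by (rule integrable_slope_height[OF unreflected_subset borel_unreflected \<rho>(1)])
  ultimately have "(LINT x|lborel. l * (indicator unreflected x * \<psi> x)) \<le> (LINT x|lborel. indicator unreflected x * \<phi> x)"
    by (intro integral_mono integrable_mult_right) (auto simp: indicator_def)
  moreover have "defect \<le> (LINT x|lborel. indicator unreflected x * \<psi> x)"
    unfolding \<psi>_def by (rule defect_le_integral[OF p(2) \<rho>])
  from mult_left_mono[OF this, of l] l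
  have "l * defect \<le> (LINT x|lborel. l * (indicator unreflected x * \<psi> x))" by simp
  ultimately have "l * defect \<le> (LINT x|lborel. indicator unreflected x * \<phi> x)" by linarith
  also have "\<dots> = (LINT x|lborel. indicator E x * \<phi> x)"
    by (rule integral_odd[OF \<phi>_integrable \<phi>_odd \<phi>_measurable, symmetric])
  also have "\<dots> = trunc_potential m \<rho> E q - trunc_potential m \<rho> E p"
    unfolding \<phi>_def by (rule potential_difference_eq(2)[OF \<rho>(1)])
  finally show ?thesis by (simp add: mult.commute)
qed

lemma defect_le_integral_on_plane:
  assumes p: "p \<in> closure E" "p \<bullet> e = lam" and \<rho>: "0 < \<rho>" "\<rho> \<le> diameter E"
  shows "defect \<le> (LINT x|lborel. indicator E x * (trunc_kernel_slope m \<rho> (x - p) * (2 * (lam - x \<bullet> e))))"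
proof -
  define \<psi> where "\<psi> = (\<lambda>x. trunc_kernel_slope m \<rho> (x - p) * (2 * (lam - x \<bullet> e)))"
  have "\<psi> (reflection e lam x) = - \<psi> x" for x
    using norm_reflection_diff[OF e_unit, of lam x p] reflection_fixed[OF p(2)]
    by (simp add: \<psi>_def trunc_kernel_slope_def reflection_inner[OF e_unit] algebra_simps)
  moreover have "\<psi> \<in> borel_measurable borel"
    unfolding \<psi>_def by (intro borel_measurable_times borel_measurable_trunc_kernel_slope[OF \<rho>(1)]) auto
  moreover have "integrable lborel (\<lambda>x. indicator E x * \<psi> x)"
    unfolding \<psi>_def by (intro integrable_slope_height borel_E \<rho>) simp
  ultimately have "(LINT x|lborel. indicator E x * \<psi> x) = (LINT x|lborel. indicator unreflected x * \<psi> x)"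
    by (intro integral_odd)
  then show ?thesis using defect_le_integral[OF p(1) \<rho>] by (simp add: \<psi>_def)
qed

lemma slope_integral_tendsto:
  assumes ps: "ps \<longlonglongrightarrow> p" and sums: "cs \<longlonglongrightarrow> p + p" and us: "us \<longlonglongrightarrow> e" and p: "p \<bullet> e = lam" and \<rho>: "0 < \<rho>"
  defines "F \<equiv> \<lambda>j x. trunc_kernel_slope m \<rho> (x - ps j) * (us j \<bullet> (cs j - 2 *\<^sub>R x))"
  shows "(\<lambda>j. LINT x|lborel. indicator E x * F j x)
      \<longlonglongrightarrow> (LINT x|lborel. indicator E x * (trunc_kernel_slope m \<rho> (x - p) * (2 * (lam - x \<bullet> e))))"
proof -
  obtain U where U: "\<And>j. norm (us j) \<le> U"
    using convergent_imp_Bseq[of us] us by (auto simp: convergent_def Bseq_def)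
  obtain V where V: "\<And>j. norm (cs j) \<le> V"
    using convergent_imp_Bseq[of cs] sums by (auto simp: convergent_def Bseq_def)
  obtain r where r: "\<And>x. x \<in> E \<Longrightarrow> norm x \<le> r" using bounded_E by (auto simp: bounded_iff)
  define W where "W = trunc_kernel_slope m \<rho> (0::real^'n) * (U * (V + 2 * r))"
  have F_le: "\<bar>F j x\<bar> \<le> W" if "x \<in> E" for j x
  proof -
    have "norm (us j) * (norm (cs j) + 2 * norm x) \<le> U * (V + 2 * r)"
      using U[of j] V[of j] r[OF that] order_trans[OF norm_ge_zero U[of j]] by (intro mult_mono add_mono) auto
    then show ?thesis
      unfolding F_def W_def using abs_slope_inner_le[OF \<rho> m_pos, of x "ps j" "us j" "cs j"]
        mult_left_mono[OF _ trunc_kernel_slope_nonneg[OF m_pos]] order_trans by blast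
  qed
  have "continuous_on UNIV (trunc_kernel_slope m \<rho> :: real^'n \<Rightarrow> real)"
    by (rule continuous_on_trunc_kernel_slope[OF \<rho> continuous_on_id])
  then have cont: "isCont (trunc_kernel_slope m \<rho>) z" for z :: "real^'n"
    by (simp add: continuous_on_eq_continuous_at)
  have F_lim: "(\<lambda>j. F j x) \<longlonglongrightarrow> trunc_kernel_slope m \<rho> (x - p) * (2 * (lam - x \<bullet> e))" for x
  proof -
    have "(\<lambda>j. F j x) \<longlonglongrightarrow> trunc_kernel_slope m \<rho> (x - p) * (e \<bullet> (p + p - 2 *\<^sub>R x))"
      unfolding F_def
      by (intro tendsto_mult isCont_tendsto_compose[OF cont] tendsto_diff tendsto_const tendsto_inner us sums ps)
    also have "e \<bullet> (p + p - 2 *\<^sub>R x) = 2 * (lam - x \<bullet> e)"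
      using p by (simp only: inner_add_right inner_diff_right inner_scaleR_right inner_commute[of e]) simp
    finally show ?thesis .
  qed
  show "(\<lambda>j. LINT x|lborel. indicator E x * F j x)
      \<longlonglongrightarrow> (LINT x|lborel. indicator E x * (trunc_kernel_slope m \<rho> (x - p) * (2 * (lam - x \<bullet> e))))"
  proof (rule integral_dominated_convergence[where w="\<lambda>x. indicator E x * W"])
    show "integrable lborel (\<lambda>x. indicator E x * W)"
      by (rule integrable_indicator_times_bounded[OF borel_E bounded_E, where K="\<bar>W\<bar>"]) auto
    show "AE x in lborel. (\<lambda>j. indicator E x * F j x) \<longlonglongrightarrow> indicator E x * (trunc_kernel_slope m \<rho> (x - p) * (2 * (lam - x \<bullet> e)))"
      by (rule AE_I2, rule tendsto_mult[OF tendsto_const F_lim])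
    show "AE x in lborel. norm (indicator E x * F j x) \<le> indicator E x * W" for j
      using F_le by (intro AE_I2) (auto simp: indicator_def)
  qed (auto simp only: F_def intro!: borel_measurable_integrable integrable_slope_inner integrable_slope_height borel_E \<rho>)
qed

lemma potential_difference_ge_merging:
  assumes lim: "ps \<longlonglongrightarrow> p" "qs \<longlonglongrightarrow> p" and p: "p \<in> closure E" "p \<bullet> e = lam"
    and l: "\<And>j. 0 < l j" "(\<lambda>j. (1 / l j) *\<^sub>R (ps j - qs j)) \<longlonglongrightarrow> e"
    and \<rho>: "0 < \<rho>" "\<rho> \<le> diameter E" and \<delta>: "0 < \<delta>"
  shows "eventually (\<lambda>j. (defect - \<delta>) * l j \<le> trunc_potential m \<rho> E (qs j) - trunc_potential m \<rho> E (ps j)) sequentially"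
proof -
  define F :: "nat \<Rightarrow> real^'n \<Rightarrow> real"
    where "F = (\<lambda>j x. trunc_kernel_slope m \<rho> (x - ps j) * (((1 / l j) *\<^sub>R (ps j - qs j)) \<bullet> (ps j + qs j - 2 *\<^sub>R x)))"
  have "eventually (\<lambda>j. defect - \<delta> < (LINT x|lborel. indicator E x * F j x)) sequentially"
  proof (rule order_tendstoD(1))
    show "(\<lambda>j. LINT x|lborel. indicator E x * F j x)
      \<longlonglongrightarrow> (LINT x|lborel. indicator E x * (trunc_kernel_slope m \<rho> (x - p) * (2 * (lam - x \<bullet> e))))"
      unfolding F_def by (rule slope_integral_tendsto[OF lim(1) tendsto_add[OF lim] l(2) p(2) \<rho>(1)])
    show "defect - \<delta> < (LINT x|lborel. indicator E x * (trunc_kernel_slope m \<rho> (x - p) * (2 * (lam - x \<bullet> e))))"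
      using defect_le_integral_on_plane[OF p \<rho>] \<delta> by linarith
  qed
  then show ?thesis
  proof (rule eventually_mono)
    fix j assume "defect - \<delta> < (LINT x|lborel. indicator E x * F j x)"
    then have "(defect - \<delta>) * l j \<le> l j * (LINT x|lborel. indicator E x * F j x)"
      using l(1)[of j] by (simp add: mult.commute)
    also have "\<dots> = (LINT x|lborel. l j * (indicator E x * F j x))"
      by (rule integral_mult_right_zero[symmetric])
    also have "\<dots> \<le> (LINT x|lborel. indicator E x * (trunc_kernel m \<rho> (x - qs j) - trunc_kernel m \<rho> (x - ps j)))"
    proof (rule integral_mono)
      show "integrable lborel (\<lambda>x. l j * (indicator E x * F j x))"
        unfolding F_def by (intro integrable_mult_right integrable_slope_inner borel_E \<rho> subset_refl)
      show "integrable lborel (\<lambda>x. indicator E x * (trunc_kernel m \<rho> (x - qs j) - trunc_kernel m \<rho> (x - ps j)))"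
        by (rule potential_difference_eq(1)[OF \<rho>(1)])
      fix x
      have "l j * F j x \<le> trunc_kernel m \<rho> (x - qs j) - trunc_kernel m \<rho> (x - ps j)"
        using trunc_kernel_difference_ge[OF \<rho>(1) m_pos, of x "ps j" "qs j"] l(1)[of j] by (simp add: F_def)
      then show "l j * (indicator E x * F j x) \<le> indicator E x * (trunc_kernel m \<rho> (x - qs j) - trunc_kernel m \<rho> (x - ps j))"
        by (auto simp: indicator_def)
    qed
    also have "\<dots> = trunc_potential m \<rho> E (qs j) - trunc_potential m \<rho> E (ps j)"
      by (rule potential_difference_eq(2)[OF \<rho>(1)])
    finally show "(defect - \<delta>) * l j \<le> trunc_potential m \<rho> E (qs j) - trunc_potential m \<rho> E (ps j)" .
  qed
qed

end

section \<open>Local graphs\<close>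

lemma norm_add_scaleR_le:
  fixes y v :: "'a::real_normed_vector"
  assumes "0 \<le> t" "t \<le> 1"
  shows "norm (y + t *\<^sub>R v) \<le> norm y + norm v"
proof -
  have "norm (t *\<^sub>R v) \<le> norm v" using assms mult_right_mono[of t 1 "norm v"] by simp
  then show ?thesis using norm_triangle_ineq[of y "t *\<^sub>R v"] by linarith
qed

lemma has_real_derivative_along_line:
  fixes F :: "'a::real_normed_vector \<Rightarrow> real"
  assumes "(F has_derivative F') (at (x + t *\<^sub>R v))"
  shows "((\<lambda>t. F (x + t *\<^sub>R v)) has_real_derivative F' v) (at t)"
proof -
  have "((\<lambda>t. x + t *\<^sub>R v) has_derivative (\<lambda>h. h *\<^sub>R v)) (at t)" by (auto intro!: derivative_eq_intros)
  then have "((\<lambda>t. F (x + t *\<^sub>R v)) has_derivative (\<lambda>h. F' (h *\<^sub>R v))) (at t)"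
    using assms by (rule has_derivative_compose)
  moreover have "F' (h *\<^sub>R v) = F' v * h" for h
    using linear_cmul[OF has_derivative_linear[OF assms], of h v] by simp
  ultimately show ?thesis by (simp add: has_field_derivative_def mult_commute_abs)
qed

lemma mean_value_along_line:
  fixes F :: "'a::real_normed_vector \<Rightarrow> real"
  assumes "\<And>t. 0 \<le> t \<Longrightarrow> t \<le> 1 \<Longrightarrow> (F has_derivative F' (x + t *\<^sub>R v)) (at (x + t *\<^sub>R v))"
  obtains t where "0 < t" "t < 1" "F (x + v) - F x = F' (x + t *\<^sub>R v) v"
  using MVT2[of 0 1 "\<lambda>t. F (x + t *\<^sub>R v)" "\<lambda>t. F' (x + t *\<^sub>R v) v"] has_real_derivative_along_line[OF assms]
  by auto

definition mixed_difference :: "('a::real_vector \<Rightarrow> real) \<Rightarrow> 'a \<Rightarrow> 'a \<Rightarrow> 'a \<Rightarrow> real" where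
  "mixed_difference G d z y = (G (y + d + z) - G (y + d)) - (G (y + z) - G y)"

lemma mixed_difference_commute: "mixed_difference G d z y = mixed_difference G z d y"
  by (simp add: mixed_difference_def add_ac)

lemma mixed_difference_zero: "mixed_difference G d 0 y = 0"
  by (simp add: mixed_difference_def)

definition recentered :: "('a::real_vector \<Rightarrow> real) \<Rightarrow> 'a \<Rightarrow> 'a \<Rightarrow> real" where
  "recentered G y z = G (y + z) - G y"

lemma recentered_diff: "recentered G (y + d) z - recentered G y z = mixed_difference G d z y"
  by (simp add: recentered_def mixed_difference_def)

definition graph_lift :: "'a::real_vector \<Rightarrow> ('a \<Rightarrow> real) \<Rightarrow> 'a \<Rightarrow> 'a" where
  "graph_lift \<eta> G y = y + G y *\<^sub>R \<eta>"

text \<open>A function of class \<open>C\<^sup>2\<^sup>,\<^sup>\<alpha>\<close> on the hyperplane orthogonal to \<open>\<eta>\<close>, extended constantly along \<open>\<eta>\<close>;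
  \<open>B\<close> is its second derivative.\<close>
locale C2alpha_graph =
  fixes \<alpha> r \<Lambda> :: real and \<eta> :: "'a::euclidean_space" and G :: "'a \<Rightarrow> real"
    and G' :: "'a \<Rightarrow> 'a \<Rightarrow> real" and B :: "'a \<Rightarrow> 'a \<Rightarrow> 'a \<Rightarrow> real"
  assumes \<alpha>: "0 < \<alpha>" "\<alpha> \<le> 1" and r: "0 < r" "r \<le> 1" and \<Lambda>: "0 \<le> \<Lambda>" and \<eta>: "norm \<eta> = 1"
    and G_perp: "\<And>y. G (perp \<eta> y) = G y" and G0: "G 0 = 0"
    and deriv: "\<And>y. norm y < r \<Longrightarrow> (G has_derivative G' y) (at y)"
    and taylor: "\<And>y z y0 v. norm y < r \<Longrightarrow> norm (y + z) < r \<Longrightarrow> norm y0 < r \<Longrightarrow>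
       \<bar>G' (y + z) v - G' y v - B y0 z v\<bar> \<le> \<Lambda> * (norm (y - y0) + norm z) powr \<alpha> * norm z * norm v"
    and B_bound: "\<And>y z v. norm y < r \<Longrightarrow> \<bar>B y z v\<bar> \<le> \<Lambda> * norm z * norm v"
    and B_add: "\<And>y z1 z2 v. norm y < r \<Longrightarrow> B y (z1 + z2) v = B y z1 v + B y z2 v"
    and B_scale: "\<And>y z v c. norm y < r \<Longrightarrow> B y (c *\<^sub>R z) v = c * B y z v"
    and B_scale_right: "\<And>y z v c. norm y < r \<Longrightarrow> B y z (c *\<^sub>R v) = c * B y z v"
begin

lemma B_minus: "norm y < r \<Longrightarrow> B y (- z) v = - B y z v"
  using B_scale[of y "-1" z v] by simp

lemma G'_linear: "norm y < r \<Longrightarrow> linear (G' y)"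
  using deriv has_derivative_linear by blast

lemma continuous_G: "norm y < r \<Longrightarrow> isCont G y"
  using deriv has_derivative_continuous by blast

lemma G_perp_add: "G (y + perp \<eta> z) = G (y + z)"
  using G_perp[of "y + perp \<eta> z"] G_perp[of "y + z"] by (simp add: perp_add perp_perp \<eta>)

lemma G_shift: "G (z + t *\<^sub>R \<eta>) = G z"
  using G_perp[of "z + t *\<^sub>R \<eta>"] G_perp[of z] \<eta> by (simp add: perp_add perp_scaleR perp_self)

lemma deriv_translate:
  assumes "norm (x + z) < r"
  shows "((\<lambda>x. G (x + z)) has_derivative G' (x + z)) (at x)"
  by (rule has_derivative_compose[where f="\<lambda>x. x + z" and f'="\<lambda>h. h" and g=G and g'="G' (x + z)"])
    (auto intro!: derivative_eq_intros deriv assms)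

lemma G'_lipschitz:
  assumes "norm y < r" "norm (y + z) < r"
  shows "\<bar>G' (y + z) v - G' y v\<bar> \<le> 3 * \<Lambda> * norm z * norm v"
proof -
  have "norm z \<le> norm (y + z) + norm y" using norm_triangle_ineq4[of "y + z" y] by simp
  then have z: "norm z \<le> 2" using assms r by linarith
  have "norm z powr \<alpha> \<le> 2"
  proof (cases "norm z \<le> 1")
    case True
    then have "norm z powr \<alpha> \<le> 1 powr \<alpha>" using \<alpha> by (intro powr_mono2) auto
    then show ?thesis by simp
  next
    case False
    then have "norm z powr \<alpha> \<le> norm z powr 1" using \<alpha> by (intro powr_mono) auto
    then show ?thesis using z False by simp
  qed
  then have "\<Lambda> * (norm (y - y) + norm z) powr \<alpha> * norm z * norm v \<le> \<Lambda> * 2 * norm z * norm v"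
    using \<Lambda> by (intro mult_right_mono mult_left_mono) auto
  then show ?thesis using taylor[OF assms assms(1), of v] B_bound[OF assms(1), of z v] by (simp add: mult_ac)
qed

lemma G_increment:
  assumes "norm y + norm v < r" "norm y0 < r"
  shows "\<bar>G (y + v) - G y - G' y0 v\<bar> \<le> 3 * \<Lambda> * (norm (y - y0) + norm v) * norm v"
proof -
  have in_ball: "norm (y + t *\<^sub>R v) < r" if "0 \<le> t" "t \<le> 1" for t
    using norm_add_scaleR_le[OF that, of y v] assms by linarith
  obtain t where t: "0 < t" "t < 1" "G (y + v) - G y = G' (y + t *\<^sub>R v) v"
    using mean_value_along_line[of G G' y v, OF deriv[OF in_ball]] by blast
  define x where "x = (y - y0) + t *\<^sub>R v"
  have x: "y + t *\<^sub>R v = y0 + x" "norm (y0 + x) < r" using in_ball[of t] t by (simp_all add: x_def)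
  have "\<bar>G (y + v) - G y - G' y0 v\<bar> \<le> 3 * \<Lambda> * norm x * norm v"
    unfolding t(3) x(1) using assms(2) x(2) by (rule G'_lipschitz)
  also have "\<dots> \<le> 3 * \<Lambda> * (norm (y - y0) + norm v) * norm v"
    unfolding x_def
    using \<Lambda> norm_add_scaleR_le[of t "y - y0" v] t by (intro mult_right_mono mult_left_mono) auto
  finally show ?thesis .
qed

lemma G_second_difference:
  assumes "norm y + norm z < r"
  shows "\<bar>G (y + z) + G (y - z) - 2 * G y\<bar> \<le> 6 * \<Lambda> * (norm z)\<^sup>2"
proof -
  have y: "norm y < r" using assms norm_ge_zero[of z] by linarith
  have "\<bar>G (y + z) - G y - G' y z\<bar> \<le> 3 * \<Lambda> * (norm z)\<^sup>2"
    using G_increment[of y z y] assms y by (simp add: power2_eq_square mult_ac)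
  moreover have "\<bar>G (y - z) - G y + G' y z\<bar> \<le> 3 * \<Lambda> * (norm z)\<^sup>2"
    using G_increment[of y "- z" y] assms y linear_neg[OF G'_linear[OF y], of z]
    by (simp add: power2_eq_square mult_ac)
  ultimately show ?thesis by linarith
qed

lemma mixed_difference_mean_value:
  assumes "norm y + norm d + norm z < r" "norm y + norm d + norm w < r"
  obtains x where "norm x \<le> norm y + norm d" "norm (x - y) \<le> norm d"
    "norm x < r" "norm (x + z) < r" "norm (x + w) < r"
    "mixed_difference G d z y + mixed_difference G d w y = (G' (x + z) d - G' x d) + (G' (x + w) d - G' x d)"
proof -
  define F where "F x = (G (x + z) - G x) + (G (x + w) - G x)" for x
  define F' where "F' x h = (G' (x + z) h - G' x h) + (G' (x + w) h - G' x h)" for x h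
  have in_ball: "norm x < r" "norm (x + z) < r" "norm (x + w) < r" if "norm x \<le> norm y + norm d" for x
    using that assms norm_ge_zero[of z] norm_triangle_ineq[of x z] norm_triangle_ineq[of x w] by linarith+
  have "(F has_derivative F' (y + t *\<^sub>R d)) (at (y + t *\<^sub>R d))" if "0 \<le> t" "t \<le> 1" for t
    unfolding F_def F'_def using in_ball[OF norm_add_scaleR_le[OF that]]
    by (intro has_derivative_add has_derivative_diff deriv_translate deriv)
  then obtain t where t: "0 < t" "t < 1" "F (y + d) - F y = F' (y + t *\<^sub>R d) d"
    using mean_value_along_line[of F F' y d] by blast
  have x: "norm (y + t *\<^sub>R d) \<le> norm y + norm d" "norm ((y + t *\<^sub>R d) - y) \<le> norm d"
    using norm_add_scaleR_le[of t y d] norm_add_scaleR_le[of t 0 d] t by simp_all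
  show ?thesis
    by (rule that[OF x in_ball[OF x(1)]]) (use t(3) in \<open>simp add: F_def F'_def mixed_difference_def\<close>)
qed

lemma mixed_difference_le:
  assumes "norm y + norm d + norm z < r"
  shows "\<bar>mixed_difference G d z y\<bar> \<le> 3 * \<Lambda> * norm d * norm z"
proof -
  have "norm y + norm d + norm (0::'a) < r" using assms norm_ge_zero[of z] unfolding norm_zero by linarith
  from mixed_difference_mean_value[OF assms this] obtain x where
    x: "norm x < r" "norm (x + z) < r" "mixed_difference G d z y = G' (x + z) d - G' x d"
    unfolding mixed_difference_zero by auto
  show ?thesis unfolding x(3) using G'_lipschitz[OF x(1,2), of d] by (simp add: mult_ac)
qed

lemma mixed_difference_symmetrized_le:
  assumes "norm y + norm d + norm z < r"
  shows "\<bar>mixed_difference G d z y + mixed_difference G d (- z) y\<bar> \<le> 2 * \<Lambda> * norm d * norm z powr (1 + \<alpha>)"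
proof -
  have "norm y + norm d + norm (- z) < r" using assms by simp
  from mixed_difference_mean_value[OF assms this] obtain x where
    x: "norm x < r" "norm (x + z) < r" "norm (x + - z) < r" and
    eq: "mixed_difference G d z y + mixed_difference G d (- z) y = (G' (x + z) d - G' x d) + (G' (x + - z) d - G' x d)"
    by blast
  have "\<bar>G' (x + z) d - G' x d - B x z d\<bar> \<le> \<Lambda> * norm z powr \<alpha> * norm z * norm d"
    using taylor[OF x(1,2,1), of d] by simp
  moreover have "\<bar>G' (x + - z) d - G' x d + B x z d\<bar> \<le> \<Lambda> * norm z powr \<alpha> * norm z * norm d"
    using taylor[OF x(1,3,1), of d] unfolding B_minus[OF x(1)] by simp
  ultimately have "\<bar>mixed_difference G d z y + mixed_difference G d (- z) y\<bar> \<le> 2 * (\<Lambda> * norm z powr \<alpha> * norm z * norm d)"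
    unfolding eq by linarith
  moreover have "norm z powr (1 + \<alpha>) = norm z powr \<alpha> * norm z" by (cases "z = 0") (simp_all add: powr_add)
  ultimately show ?thesis by (simp add: mult_ac)
qed

lemma mixed_difference_approx:
  assumes "norm y + norm d + norm z < r" "norm y0 < r"
  shows "\<bar>mixed_difference G d z y - B y0 z d\<bar> \<le> \<Lambda> * (norm (y - y0) + norm d + norm z) powr \<alpha> * norm z * norm d"
proof -
  have "norm y + norm d + norm (0::'a) < r" using assms norm_ge_zero[of z] unfolding norm_zero by linarith
  from mixed_difference_mean_value[OF assms(1) this] obtain x where x: "norm (x - y) \<le> norm d"
    "norm x < r" "norm (x + z) < r" "mixed_difference G d z y = G' (x + z) d - G' x d"
    unfolding mixed_difference_zero by auto
  have "norm (x - y0) \<le> norm (y - y0) + norm d" using norm_triangle_ineq[of "x - y" "y - y0"] x(1) by simp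
  then have "\<Lambda> * (norm (x - y0) + norm z) powr \<alpha> * norm z * norm d
      \<le> \<Lambda> * (norm (y - y0) + norm d + norm z) powr \<alpha> * norm z * norm d"
    using \<Lambda> \<alpha> by (intro mult_right_mono mult_left_mono powr_mono2) auto
  then show ?thesis unfolding x(4) using taylor[OF x(2,3) assms(2), of d] by linarith
qed

lemma mixed_difference_cancel:
  assumes "norm y + norm d + norm z < r" and w: "norm w = norm z" "B 0 (z + w) d = 0"
  shows "\<bar>mixed_difference G d z y + mixed_difference G d w y\<bar>
    \<le> 2 * \<Lambda> * (norm y + norm d + norm z) powr \<alpha> * norm d * norm z"
proof -
  have zero: "norm (0::'a) < r" using r by simp
  have "B 0 z d + B 0 w d = 0" using B_add[OF zero, of z w d] w(2) by simp
  then have "\<bar>mixed_difference G d z y + mixed_difference G d w y\<bar>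
      \<le> 2 * (\<Lambda> * (norm y + norm d + norm z) powr \<alpha> * norm z * norm d)"
    using mixed_difference_approx[OF assms(1) zero] mixed_difference_approx[of y d w 0] assms(1) w(1) zero
    by (simp add: abs_le_iff)
  then show ?thesis by (simp add: mult_ac)
qed

lemma B_symmetric: "B 0 z v = B 0 v z"
proof -
  define N where "N = norm z + norm v"
  have zero: "norm (0::'a) < r" using r by simp
  have approx: "\<bar>mixed_difference G (t *\<^sub>R b) (t *\<^sub>R a) 0 - t\<^sup>2 * B 0 a b\<bar> \<le> t\<^sup>2 * (\<Lambda> * (t * (norm a + norm b)) powr \<alpha> * norm a * norm b)"
    if "0 < t" "t * (norm a + norm b) < r" for t a b
    using mixed_difference_approx[of 0 "t *\<^sub>R b" "t *\<^sub>R a" 0] that zero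
    by (simp add: B_scale[OF zero] B_scale_right[OF zero] power2_eq_square algebra_simps)
  have le: "\<bar>B 0 z v - B 0 v z\<bar> \<le> 2 * \<Lambda> * (t * N) powr \<alpha> * norm z * norm v" if t: "0 < t" "t * N < r" for t
  proof -
    have "\<bar>t\<^sup>2 * B 0 z v - t\<^sup>2 * B 0 v z\<bar> \<le> t\<^sup>2 * (2 * \<Lambda> * (t * N) powr \<alpha> * norm z * norm v)"
      using approx[of t z v] approx[of t v z] t mixed_difference_commute[of G "t *\<^sub>R v" "t *\<^sub>R z" 0]
      by (simp add: N_def add.commute mult_ac)
    then have "t\<^sup>2 * \<bar>B 0 z v - B 0 v z\<bar> \<le> t\<^sup>2 * (2 * \<Lambda> * (t * N) powr \<alpha> * norm z * norm v)"
      by (simp add: abs_mult flip: right_diff_distrib)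
    then show ?thesis using t by simp
  qed
  have vanish: "((\<lambda>t. t * N) \<longlongrightarrow> 0) (at_right 0)" by (rule tendsto_eq_intros refl | simp)+
  have "((\<lambda>t. (t * N) powr \<alpha>) \<longlongrightarrow> 0) (at_right 0)"
    using \<alpha>
    by (intro tendsto_zero_powrI[OF vanish tendsto_const] eventually_mono[OF eventually_at_right_less[of 0]])
      (simp_all add: N_def)
  then have lim: "((\<lambda>t. 2 * \<Lambda> * (t * N) powr \<alpha> * norm z * norm v) \<longlongrightarrow> 2 * \<Lambda> * 0 * norm z * norm v) (at_right 0)"
    by (intro tendsto_mult tendsto_const)
  have "eventually (\<lambda>t. \<bar>B 0 z v - B 0 v z\<bar> \<le> 2 * \<Lambda> * (t * N) powr \<alpha> * norm z * norm v) (at_right 0)"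
    using eventually_at_right_less[of 0] order_tendstoD(2)[OF vanish r(1)] by eventually_elim (rule le)
  from tendsto_lowerbound[OF lim this] show ?thesis by simp
qed

lemma secants_tangent:
  assumes e: "norm e = 1" and w: "w \<longlonglongrightarrow> 0" and l: "\<And>j::nat. 0 < l j" "l \<longlonglongrightarrow> 0"
    and on_graph: "\<And>j. norm (w j) + l j < r \<Longrightarrow> w j \<bullet> \<eta> = G (w j)"
      "\<And>j. norm (w j) + l j < r \<Longrightarrow> (w j + l j *\<^sub>R e) \<bullet> \<eta> = G (w j + l j *\<^sub>R e)"
  shows "e \<bullet> \<eta> = G' 0 e"
proof -
  have vanish: "(\<lambda>j. norm (w j) + l j) \<longlonglongrightarrow> 0" using tendsto_add[OF tendsto_norm_zero[OF w] l(2)] by simp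
  have le: "\<bar>e \<bullet> \<eta> - G' 0 e\<bar> \<le> 3 * \<Lambda> * (norm (w j) + l j)" if j: "norm (w j) + l j < r" for j
  proof -
    have norm_l: "norm (l j *\<^sub>R e) = l j" using e l(1)[of j] by simp
    have scale: "G' 0 (l j *\<^sub>R e) = l j * G' 0 e" using G'_linear[of 0] r by (simp add: linear_scale)
    have "G (w j + l j *\<^sub>R e) - G (w j) = l j * (e \<bullet> \<eta>)"
      using on_graph[OF j] by (simp add: inner_add_left)
    then have "\<bar>l j * (e \<bullet> \<eta>) - l j * G' 0 e\<bar> \<le> 3 * \<Lambda> * (norm (w j) + l j) * l j"
      using G_increment[of "w j" "l j *\<^sub>R e" 0] j r unfolding norm_l scale by simp
    moreover have "\<bar>l j * (e \<bullet> \<eta>) - l j * G' 0 e\<bar> = \<bar>e \<bullet> \<eta> - G' 0 e\<bar> * l j"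
      using l(1)[of j] by (simp add: abs_mult mult.commute flip: right_diff_distrib)
    ultimately show ?thesis using l(1)[of j] by simp
  qed
  have "(\<lambda>j. 3 * \<Lambda> * (norm (w j) + l j)) \<longlonglongrightarrow> 3 * \<Lambda> * 0" by (intro tendsto_mult tendsto_const vanish)
  moreover have "eventually (\<lambda>j. \<bar>e \<bullet> \<eta> - G' 0 e\<bar> \<le> 3 * \<Lambda> * (norm (w j) + l j)) sequentially"
    using order_tendstoD(2)[OF vanish r(1)] by (rule eventually_mono) (rule le)
  ultimately have "\<bar>e \<bullet> \<eta> - G' 0 e\<bar> \<le> 3 * \<Lambda> * 0" by (rule tendsto_lowerbound) simp
  then show ?thesis by simp
qed

lemma graph_lift_tendsto:
  assumes "(y \<longlongrightarrow> y0) F" "norm y0 < r"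
  shows "((\<lambda>t. graph_lift \<eta> G (y t)) \<longlongrightarrow> graph_lift \<eta> G y0) F"
  unfolding graph_lift_def
  by (intro tendsto_add tendsto_scaleR tendsto_const assms(1) isCont_tendsto_compose[OF continuous_G[OF assms(2)]])

lemma graph_lift_tendsto_zero:
  assumes "(y \<longlongrightarrow> 0) F"
  shows "((\<lambda>t. graph_lift \<eta> G (y t)) \<longlongrightarrow> 0) F"
  using graph_lift_tendsto[OF assms] r by (simp add: graph_lift_def G0)

lemma graph_lift_inner: "y \<bullet> \<eta> = 0 \<Longrightarrow> graph_lift \<eta> G y \<bullet> \<eta> = G (graph_lift \<eta> G y)"
  using \<eta> by (simp add: graph_lift_def G_shift inner_add_left norm_eq_1)

lemma recentered_perp: "recentered G y (perp \<eta> z) = recentered G y z"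
  by (simp add: recentered_def G_perp_add)

lemma recentered_graph_lift: "recentered G (graph_lift \<eta> G y) z = recentered G y z"
  using G_shift[of "y + z" "G y"] G_shift[of y "G y"] by (simp add: recentered_def graph_lift_def add_ac)

end

lemma C2alpha_graph_subset:
  assumes "C2alpha_graph \<alpha> r \<Lambda> \<eta> G G' B" "0 < r'" "r' \<le> r"
  shows "C2alpha_graph \<alpha> r' \<Lambda> \<eta> G G' B"
proof -
  interpret C2alpha_graph \<alpha> r \<Lambda> \<eta> G G' B by fact
  show ?thesis
    using \<alpha> r \<Lambda> \<eta> G_perp G0 deriv taylor B_bound B_add B_scale B_scale_right assms(2,3) by unfold_locales auto
qed

lemma C2alpha_graph_mirror:
  fixes \<eta> e :: "'a::euclidean_space"
  assumes graph: "C2alpha_graph \<alpha> r \<Lambda> \<eta> G G' B" and e: "norm e = 1"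
  shows "C2alpha_graph \<alpha> r \<Lambda> (mirror e \<eta>) (\<lambda>y. G (mirror e y)) (\<lambda>y v. G' (mirror e y) (mirror e v))
     (\<lambda>y z v. B (mirror e y) (mirror e z) (mirror e v))"
proof -
  interpret C2alpha_graph \<alpha> r \<Lambda> \<eta> G G' B by (rule graph)
  note norm_mirror = norm_mirror[OF e]
  show ?thesis
  proof
    show "0 < \<alpha>" "\<alpha> \<le> 1" "0 < r" "r \<le> 1" "0 \<le> \<Lambda>" by (fact \<alpha> r \<Lambda>)+
    show "norm (mirror e \<eta>) = 1" using \<eta> by (simp add: norm_mirror)
    show "G (mirror e 0) = 0" using G0 by (simp add: mirror_def)
    show "G (mirror e (perp (mirror e \<eta>) y)) = G (mirror e y)" for y
    proof -
      have "y \<bullet> mirror e \<eta> = mirror e y \<bullet> \<eta>"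
        using mirror_inner[OF e, of y "mirror e \<eta>"] by (simp add: mirror_mirror[OF e])
      then have "mirror e (perp (mirror e \<eta>) y) = perp \<eta> (mirror e y)"
        by (simp add: perp_def mirror_diff mirror_scaleR mirror_mirror[OF e])
      then show ?thesis by (simp add: G_perp)
    qed
    show "((\<lambda>y. G (mirror e y)) has_derivative (\<lambda>v. G' (mirror e y) (mirror e v))) (at y)"
      if "norm y < r" for y
    proof -
      have "linear (mirror e)" by (intro linearI) (simp_all add: mirror_add mirror_scaleR)
      then have "(mirror e has_derivative mirror e) (at y)"
        by (intro bounded_linear_imp_has_derivative) (simp add: linear_conv_bounded_linear)
      then show ?thesis by (rule has_derivative_compose) (rule deriv, simp add: norm_mirror that)
    qed
    show "\<bar>G' (mirror e (y + z)) (mirror e v) - G' (mirror e y) (mirror e v) - B (mirror e y0) (mirror e z) (mirror e v)\<bar>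
       \<le> \<Lambda> * (norm (y - y0) + norm z) powr \<alpha> * norm z * norm v"
      if "norm y < r" "norm (y + z) < r" "norm y0 < r" for y z y0 v
    proof -
      have "norm (mirror e y) < r" "norm (mirror e y + mirror e z) < r" "norm (mirror e y0) < r"
        using that by (simp_all add: norm_mirror flip: mirror_add)
      from taylor[OF this, of "mirror e v"] show ?thesis
        by (simp add: mirror_add norm_mirror flip: mirror_diff)
    qed
    show "\<bar>B (mirror e y) (mirror e z) (mirror e v)\<bar> \<le> \<Lambda> * norm z * norm v" if "norm y < r" for y z v
      using B_bound[of "mirror e y" "mirror e z" "mirror e v"] that by (simp add: norm_mirror)
  qed (simp_all add: norm_mirror mirror_add mirror_scaleR B_add B_scale B_scale_right)
qed

section \<open>Implicitly defined graphs\<close>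

definition bounded_hoelder :: "real \<Rightarrow> 'a::real_normed_vector set \<Rightarrow> real \<Rightarrow> ('a \<Rightarrow> real) \<Rightarrow> bool" where
  "bounded_hoelder \<alpha> S K a \<longleftrightarrow> 0 \<le> K \<and> (\<forall>y\<in>S. \<bar>a y\<bar> \<le> K) \<and> (\<forall>y\<in>S. \<forall>z\<in>S. \<bar>a y - a z\<bar> \<le> K * norm (y - z) powr \<alpha>)"

lemma bounded_hoelderI:
  assumes "0 \<le> K" "\<And>y. y \<in> S \<Longrightarrow> \<bar>a y\<bar> \<le> K"
    "\<And>y z. y \<in> S \<Longrightarrow> z \<in> S \<Longrightarrow> \<bar>a y - a z\<bar> \<le> K * norm (y - z) powr \<alpha>"
  shows "bounded_hoelder \<alpha> S K a"
  using assms by (auto simp: bounded_hoelder_def)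

lemma bounded_hoelder_mult:
  assumes a: "bounded_hoelder \<alpha> S K a" and b: "bounded_hoelder \<alpha> S L b"
  shows "bounded_hoelder \<alpha> S (2 * K * L) (\<lambda>y. a y * b y)"
proof (rule bounded_hoelderI)
  have nonneg: "0 \<le> K" "0 \<le> L" using a b by (auto simp: bounded_hoelder_def)
  then show "0 \<le> 2 * K * L" by simp
  fix y assume y: "y \<in> S"
  have "\<bar>a y * b y\<bar> \<le> K * L"
    unfolding abs_mult using a b y nonneg by (intro mult_mono) (auto simp: bounded_hoelder_def)
  also have "\<dots> \<le> 2 * K * L" using nonneg by simp
  finally show "\<bar>a y * b y\<bar> \<le> 2 * K * L" .
  fix z assume z: "z \<in> S"
  have "a y * b y - a z * b z = a y * (b y - b z) + (a y - a z) * b z" by (simp add: algebra_simps)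
  also have "\<bar>\<dots>\<bar> \<le> \<bar>a y\<bar> * \<bar>b y - b z\<bar> + \<bar>a y - a z\<bar> * \<bar>b z\<bar>"
    using abs_triangle_ineq[of "a y * (b y - b z)" "(a y - a z) * b z"] by (simp add: abs_mult)
  also have "\<dots> \<le> K * (L * norm (y - z) powr \<alpha>) + (K * norm (y - z) powr \<alpha>) * L"
    using a b y z nonneg by (intro add_mono mult_mono) (auto simp: bounded_hoelder_def)
  finally show "\<bar>a y * b y - a z * b z\<bar> \<le> 2 * K * L * norm (y - z) powr \<alpha>" by (simp add: mult_ac)
qed

lemma bounded_hoelder_add:
  assumes a: "bounded_hoelder \<alpha> S K a" and b: "bounded_hoelder \<alpha> S L b"
  shows "bounded_hoelder \<alpha> S (K + L) (\<lambda>y. a y + b y)"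
proof (rule bounded_hoelderI)
  show "0 \<le> K + L" using a b by (auto simp: bounded_hoelder_def)
  fix y assume y: "y \<in> S"
  show "\<bar>a y + b y\<bar> \<le> K + L"
    using a b y abs_triangle_ineq[of "a y" "b y"] by (force simp: bounded_hoelder_def)
  fix z assume z: "z \<in> S"
  have "\<bar>a y - a z\<bar> \<le> K * norm (y - z) powr \<alpha>" "\<bar>b y - b z\<bar> \<le> L * norm (y - z) powr \<alpha>"
    using a b y z by (auto simp: bounded_hoelder_def)
  then show "\<bar>a y + b y - (a z + b z)\<bar> \<le> (K + L) * norm (y - z) powr \<alpha>"
    unfolding distrib_right by linarith
qed

lemma bounded_hoelder_minus: "bounded_hoelder \<alpha> S K a \<Longrightarrow> bounded_hoelder \<alpha> S K (\<lambda>y. - a y)"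
  by (auto simp: bounded_hoelder_def abs_minus_commute)

lemma bounded_hoelder_inverse:
  assumes a: "bounded_hoelder \<alpha> S K a" and c: "0 < c" "\<And>y. y \<in> S \<Longrightarrow> c \<le> a y"
  shows "bounded_hoelder \<alpha> S (1 / c + K / c\<^sup>2) (\<lambda>y. 1 / a y)"
proof (rule bounded_hoelderI)
  have K: "0 \<le> K" using a by (auto simp: bounded_hoelder_def)
  then show "0 \<le> 1 / c + K / c\<^sup>2" using c by simp
  have pos: "0 < a y" if "y \<in> S" for y using c that less_le_trans by blast
  have inverse_le: "\<bar>1 / a y\<bar> \<le> 1 / c" if "y \<in> S" for y
    using c(1) c(2)[OF that] pos[OF that] by (simp add: frac_le)
  fix y assume y: "y \<in> S"
  show "\<bar>1 / a y\<bar> \<le> 1 / c + K / c\<^sup>2" by (rule order_trans[OF inverse_le[OF y]]) (simp add: K)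
  fix z assume z: "z \<in> S"
  have "1 / a y - 1 / a z = (a z - a y) * (1 / a y) * (1 / a z)"
    using pos[OF y] pos[OF z] by (simp add: field_simps)
  then have "\<bar>1 / a y - 1 / a z\<bar> = \<bar>a y - a z\<bar> * \<bar>1 / a y\<bar> * \<bar>1 / a z\<bar>"
    by (simp add: abs_mult abs_minus_commute)
  also have "\<dots> \<le> (K * norm (y - z) powr \<alpha>) * (1 / c) * (1 / c)"
    using a y z K inverse_le[OF y] inverse_le[OF z] c by (intro mult_mono) (auto simp: bounded_hoelder_def)
  also have "\<dots> = K / c\<^sup>2 * norm (y - z) powr \<alpha>" by (simp add: power2_eq_square)
  also have "\<dots> \<le> (1 / c + K / c\<^sup>2) * norm (y - z) powr \<alpha>" using c by (intro mult_right_mono) auto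
  finally show "\<bar>1 / a y - 1 / a z\<bar> \<le> (1 / c + K / c\<^sup>2) * norm (y - z) powr \<alpha>" .
qed

definition uniformly_hoelder :: "real \<Rightarrow> 'a::real_normed_vector set \<Rightarrow> 'i set \<Rightarrow> ('i \<Rightarrow> 'a \<Rightarrow> real) \<Rightarrow> bool" where
  "uniformly_hoelder \<alpha> S I a \<longleftrightarrow> (\<exists>K. \<forall>i\<in>I. bounded_hoelder \<alpha> S K (a i))"

lemma uniformly_hoelderI: "(\<And>i. i \<in> I \<Longrightarrow> bounded_hoelder \<alpha> S K (a i)) \<Longrightarrow> uniformly_hoelder \<alpha> S I a"
  by (auto simp: uniformly_hoelder_def)

lemma uniformly_hoelder_mult:
  assumes "uniformly_hoelder \<alpha> S I a" "uniformly_hoelder \<alpha> S I b"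
  shows "uniformly_hoelder \<alpha> S I (\<lambda>i y. a i y * b i y)"
  using assms bounded_hoelder_mult unfolding uniformly_hoelder_def by blast

lemma uniformly_hoelder_add:
  assumes "uniformly_hoelder \<alpha> S I a" "uniformly_hoelder \<alpha> S I b"
  shows "uniformly_hoelder \<alpha> S I (\<lambda>i y. a i y + b i y)"
  using assms bounded_hoelder_add unfolding uniformly_hoelder_def by blast

lemma uniformly_hoelder_minus:
  assumes "uniformly_hoelder \<alpha> S I a"
  shows "uniformly_hoelder \<alpha> S I (\<lambda>i y. - a i y)"
  using assms bounded_hoelder_minus unfolding uniformly_hoelder_def by blast

lemma uniformly_hoelder_inverse:
  assumes "uniformly_hoelder \<alpha> S I a" "0 < c" "\<And>i y. i \<in> I \<Longrightarrow> y \<in> S \<Longrightarrow> c \<le> a i y"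
  shows "uniformly_hoelder \<alpha> S I (\<lambda>i y. 1 / a i y)"
  using assms bounded_hoelder_inverse unfolding uniformly_hoelder_def by metis

lemma uniformly_hoelder_reindex:
  assumes "uniformly_hoelder \<alpha> S J a" "\<And>i. i \<in> I \<Longrightarrow> g i \<in> J"
  shows "uniformly_hoelder \<alpha> S I (\<lambda>i. a (g i))"
  using assms unfolding uniformly_hoelder_def by blast

lemma uniformly_hoelder_cong:
  assumes "uniformly_hoelder \<alpha> S I a" "\<And>i y. i \<in> I \<Longrightarrow> y \<in> S \<Longrightarrow> b i y = a i y"
  shows "uniformly_hoelder \<alpha> S I b"
  using assms unfolding uniformly_hoelder_def bounded_hoelder_def by metis

lemma le_double_powr:
  fixes t \<alpha> :: real
  assumes "0 \<le> t" "t \<le> 2" "0 < \<alpha>" "\<alpha> \<le> 1"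
  shows "t \<le> 2 * t powr \<alpha>"
proof (cases "t \<le> 1")
  case True
  then have "t \<le> t powr \<alpha>" using assms powr_mono'[of \<alpha> 1 t] by simp
  then show ?thesis using assms by simp
next
  case False
  then have "1 \<le> t powr \<alpha>" using assms ge_one_powr_ge_zero by auto
  then show ?thesis using assms by linarith
qed

lemma homogeneous_bound:
  fixes b :: "'a::real_normed_vector \<Rightarrow> 'a \<Rightarrow> real"
  assumes scale: "\<And>c w v. b (c *\<^sub>R w) v = c * b w v" "\<And>c w v. b w (c *\<^sub>R v) = c * b w v"
    and unit: "\<And>w v. norm w \<le> 1 \<Longrightarrow> norm v \<le> 1 \<Longrightarrow> \<bar>b w v\<bar> \<le> C"
  shows "\<bar>b w v\<bar> \<le> C * norm w * norm v"
proof -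
  have eq: "b w v = norm w * norm v * b (sgn w) (sgn v)"
  proof (cases "w = 0 \<or> v = 0")
    case True
    then show ?thesis using scale(1)[of 0 w v] scale(2)[of w 0 v] by auto
  qed (auto simp: sgn_div_norm scale field_simps)
  have "\<bar>b (sgn w) (sgn v)\<bar> \<le> C" by (intro unit) (simp_all add: norm_sgn)
  from mult_left_mono[OF this, of "norm w * norm v"] show ?thesis by (subst eq) (simp add: abs_mult mult_ac)
qed

locale C2alpha_function =
  fixes \<alpha> K R :: real and p :: "'a::euclidean_space" and f :: "'a \<Rightarrow> real"
    and f' :: "'a \<Rightarrow> 'a \<Rightarrow> real" and f'' :: "'a \<Rightarrow> 'a \<Rightarrow> 'a \<Rightarrow> real"
  assumes \<alpha>: "0 < \<alpha>" "\<alpha> \<le> 1" and R: "0 < R" and K: "0 \<le> K"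
    and deriv: "\<And>x. x \<in> ball p R \<Longrightarrow> (f has_derivative f' x) (at x)"
    and deriv2: "\<And>x v. x \<in> ball p R \<Longrightarrow> ((\<lambda>x. f' x v) has_derivative (\<lambda>w. f'' x w v)) (at x)"
    and linear_f'': "\<And>x w. x \<in> ball p R \<Longrightarrow> linear (f'' x w)"
    and hoelder: "\<And>x y w v. x \<in> ball p R \<Longrightarrow> y \<in> ball p R \<Longrightarrow>
      \<bar>f'' x w v - f'' y w v\<bar> \<le> K * norm (x - y) powr \<alpha> * norm w * norm v"
    and f''_le: "\<And>x w v. x \<in> ball p R \<Longrightarrow> \<bar>f'' x w v\<bar> \<le> K * norm w * norm v"
begin

lemma p_in_ball: "p \<in> ball p R"
  using R by simp

lemma linear_f': "x \<in> ball p R \<Longrightarrow> linear (f' x)"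
  using deriv has_derivative_linear by blast

lemma f'_lipschitz:
  assumes "x \<in> ball p R" "y \<in> ball p R"
  shows "\<bar>f' x v - f' y v\<bar> \<le> K * norm v * norm (x - y)"
proof -
  have "norm (f' x v - f' y v) \<le> (K * norm v) * norm (x - y)"
  proof (rule differentiable_bound[OF convex_ball[of p R] _ _ assms])
    show "((\<lambda>x. f' x v) has_derivative (\<lambda>w. f'' x w v)) (at x within ball p R)" if "x \<in> ball p R" for x
      using deriv2[OF that] by (rule has_derivative_at_withinI)
    show "onorm (\<lambda>w. f'' x w v) \<le> K * norm v" if "x \<in> ball p R" for x
      using f''_le[OF that, of _ v] by (intro onorm_bound) (auto simp: K mult_ac)
  qed
  then show ?thesis by simp
qed

definition gradient_bound :: real where
  "gradient_bound = onorm (f' p) + K * R + 1"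

lemma gradient_bound_pos: "0 < gradient_bound"
  using onorm_pos_le[OF has_derivative_bounded_linear[OF deriv[OF p_in_ball]]] K R
  by (simp add: gradient_bound_def add_nonneg_pos)

lemma f'_le:
  assumes "x \<in> ball p R"
  shows "\<bar>f' x v\<bar> \<le> gradient_bound * norm v"
proof -
  have "\<bar>f' x v - f' p v\<bar> \<le> K * norm v * norm (x - p)" by (rule f'_lipschitz[OF assms p_in_ball])
  also have "\<dots> \<le> K * norm v * R"
    using assms K by (intro mult_left_mono) (auto simp: dist_norm norm_minus_commute)
  finally have "\<bar>f' x v - f' p v\<bar> \<le> K * norm v * R" .
  moreover have "\<bar>f' p v\<bar> \<le> onorm (f' p) * norm v"
    using onorm[OF has_derivative_bounded_linear[OF deriv[OF p_in_ball]], of v] by simp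
  moreover have "gradient_bound * norm v = onorm (f' p) * norm v + K * norm v * R + norm v"
    by (simp add: gradient_bound_def algebra_simps)
  ultimately show ?thesis using norm_ge_zero[of v] by linarith
qed

lemma f_lipschitz:
  assumes "x \<in> ball p R" "y \<in> ball p R"
  shows "\<bar>f x - f y\<bar> \<le> gradient_bound * norm (x - y)"
proof -
  have "norm (f x - f y) \<le> gradient_bound * norm (x - y)"
  proof (rule differentiable_bound[OF convex_ball[of p R] _ _ assms])
    show "(f has_derivative f' x) (at x within ball p R)" if "x \<in> ball p R" for x
      using deriv[OF that] by (rule has_derivative_at_withinI)
    show "onorm (f' x) \<le> gradient_bound" if "x \<in> ball p R" for x
      using f'_le[OF that] gradient_bound_pos by (intro onorm_bound) auto
  qed
  then show ?thesis by simp
qed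

lemma taylor_first_order:
  assumes "x \<in> ball p R" "y \<in> ball p R" "f x = f y"
  shows "\<bar>f' x (y - x)\<bar> \<le> K * (norm (y - x))\<^sup>2"
proof -
  have segment: "x + t *\<^sub>R (y - x) \<in> ball p R" if "0 \<le> t" "t \<le> 1" for t
    using convexD_alt[OF convex_ball assms(1,2) that] by (simp add: algebra_simps)
  obtain t where t: "0 < t" "t < 1" "f (x + (y - x)) - f x = f' (x + t *\<^sub>R (y - x)) (y - x)"
    using mean_value_along_line[of f f' x "y - x", OF deriv[OF segment]] by blast
  then have "\<bar>f' x (y - x)\<bar> = \<bar>f' (x + t *\<^sub>R (y - x)) (y - x) - f' x (y - x)\<bar>" using assms(3) by simp
  also have "\<dots> \<le> K * norm (y - x) * norm (x + t *\<^sub>R (y - x) - x)"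
    using t by (intro f'_lipschitz segment assms(1)) auto
  also have "\<dots> \<le> K * norm (y - x) * norm (y - x)"
    using t K norm_add_scaleR_le[of t 0 "y - x"] by (intro mult_left_mono) auto
  finally show ?thesis by (simp add: power2_eq_square mult_ac)
qed

end

locale implicit_graph = C2alpha_function \<alpha> K R p f f' f''
  for \<alpha> K R :: real and p :: "'a::euclidean_space" and f :: "'a \<Rightarrow> real"
    and f' :: "'a \<Rightarrow> 'a \<Rightarrow> real" and f'' :: "'a \<Rightarrow> 'a \<Rightarrow> 'a \<Rightarrow> real" +
  fixes \<eta> :: 'a
  assumes \<eta>: "norm \<eta> = 1" and zero: "f p = 0" and transversal: "0 < f' p \<eta>"
begin

definition slope :: real where
  "slope = f' p \<eta> / 2"

definition width :: real where
  "width = min R (slope / (K + 1))"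

definition height :: real where
  "height = width / 2"

definition radius :: real where
  "radius = min (min 1 height) (slope * height / (2 * gradient_bound))"

lemma slope_pos: "0 < slope"
  using transversal by (simp add: slope_def)

lemma width_bounds: "0 < width" "width \<le> R"
  using R K slope_pos by (auto simp: width_def)

lemma height_pos: "0 < height"
  using width_bounds by (simp add: height_def)

lemma ball_width_subset: "x \<in> ball p width \<Longrightarrow> x \<in> ball p R"
  using width_bounds by auto

lemma radius_bounds: "0 < radius" "radius \<le> 1" "radius \<le> height" "gradient_bound * radius < slope * height"
proof -
  show "0 < radius" "radius \<le> 1" "radius \<le> height"
    using height_pos slope_pos gradient_bound_pos by (auto simp: radius_def)
  have "gradient_bound * radius \<le> gradient_bound * (slope * height / (2 * gradient_bound))"
    using gradient_bound_pos by (intro mult_left_mono) (auto simp: radius_def)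
  also have "\<dots> < slope * height" using gradient_bound_pos height_pos slope_pos by simp
  finally show "gradient_bound * radius < slope * height" .
qed

lemma slope_le:
  assumes "x \<in> ball p width"
  shows "slope \<le> f' x \<eta>"
proof -
  have "\<bar>f' x \<eta> - f' p \<eta>\<bar> \<le> K * norm \<eta> * norm (x - p)"
    by (rule f'_lipschitz[OF ball_width_subset[OF assms] p_in_ball])
  also have "\<dots> = K * norm (x - p)" by (simp add: \<eta>)
  also have "\<dots> \<le> K * (slope / (K + 1))"
    using assms K by (intro mult_left_mono) (auto simp: width_def dist_norm norm_minus_commute)
  also have "\<dots> \<le> slope" using K slope_pos by (simp add: field_simps)
  finally show ?thesis unfolding slope_def by linarith
qed

lemma increase_along_\<eta>:
  assumes x: "x \<in> ball p width" "x + u *\<^sub>R \<eta> \<in> ball p width" and u: "0 \<le> u"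
  shows "f x + slope * u \<le> f (x + u *\<^sub>R \<eta>)"
proof -
  have segment: "x + t *\<^sub>R (u *\<^sub>R \<eta>) \<in> ball p width" if "0 \<le> t" "t \<le> 1" for t
    using convexD_alt[OF convex_ball x that] by (simp add: algebra_simps)
  obtain t where t: "0 < t" "t < 1" "f (x + u *\<^sub>R \<eta>) - f x = f' (x + t *\<^sub>R (u *\<^sub>R \<eta>)) (u *\<^sub>R \<eta>)"
    using mean_value_along_line[of f f' x "u *\<^sub>R \<eta>", OF deriv[OF ball_width_subset[OF segment]]] by blast
  have "f' (x + t *\<^sub>R (u *\<^sub>R \<eta>)) (u *\<^sub>R \<eta>) = u * f' (x + t *\<^sub>R (u *\<^sub>R \<eta>)) \<eta>"
    using linear_cmul[OF linear_f'[OF ball_width_subset[OF segment[of t]]]] t by simp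
  moreover have "u * slope \<le> u * f' (x + t *\<^sub>R (u *\<^sub>R \<eta>)) \<eta>"
    using slope_le[OF segment[of t]] t u by (intro mult_left_mono) auto
  ultimately show ?thesis using t(3) by (simp add: mult.commute)
qed

lemma cylinder_in_ball:
  assumes "norm y < radius" "\<bar>u\<bar> \<le> height"
  shows "p + perp \<eta> y + u *\<^sub>R \<eta> \<in> ball p width"
proof -
  have "norm (perp \<eta> y + u *\<^sub>R \<eta>) \<le> norm (perp \<eta> y) + norm (u *\<^sub>R \<eta>)" by (rule norm_triangle_ineq)
  also have "\<dots> < radius + height" using assms norm_perp_le[OF \<eta>, of y] \<eta> by simp
  finally have "norm (perp \<eta> y + u *\<^sub>R \<eta>) < width" using radius_bounds by (simp add: height_def)
  moreover have "p - (p + perp \<eta> y + u *\<^sub>R \<eta>) = - (perp \<eta> y + u *\<^sub>R \<eta>)" by simp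
  ultimately show ?thesis by (simp only: mem_ball dist_norm norm_minus_cancel)
qed

lemma increase_on_cylinder:
  assumes "norm y < radius" "\<bar>u\<bar> \<le> height" "\<bar>v\<bar> \<le> height" "u \<le> v"
  shows "f (p + perp \<eta> y + u *\<^sub>R \<eta>) + slope * (v - u) \<le> f (p + perp \<eta> y + v *\<^sub>R \<eta>)"
proof -
  have shift: "p + perp \<eta> y + u *\<^sub>R \<eta> + (v - u) *\<^sub>R \<eta> = p + perp \<eta> y + v *\<^sub>R \<eta>" by (simp add: algebra_simps)
  show ?thesis
    using increase_along_\<eta>[of "p + perp \<eta> y + u *\<^sub>R \<eta>" "v - u", unfolded shift,
        OF cylinder_in_ball[OF assms(1,2)] cylinder_in_ball[OF assms(1,3)]] assms(4) by simp
qed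

lemma strictly_increasing_on_cylinder:
  assumes "norm y < radius" "\<bar>u\<bar> \<le> height" "\<bar>v\<bar> \<le> height" "u < v"
  shows "f (p + perp \<eta> y + u *\<^sub>R \<eta>) < f (p + perp \<eta> y + v *\<^sub>R \<eta>)"
  using increase_on_cylinder[OF assms(1-3)] assms(4) mult_pos_pos[OF slope_pos, of "v - u"] by simp

lemma zero_exists:
  assumes y: "norm y < radius"
  obtains u where "\<bar>u\<bar> < height" "f (p + perp \<eta> y + u *\<^sub>R \<eta>) = 0"
proof -
  define \<phi> where "\<phi> u = f (p + perp \<eta> y + u *\<^sub>R \<eta>)" for u
  have "p + perp \<eta> y \<in> ball p R" using ball_width_subset[OF cylinder_in_ball[OF y, of 0]] height_pos by simp
  then have "\<bar>f (p + perp \<eta> y) - f p\<bar> \<le> gradient_bound * norm (p + perp \<eta> y - p)"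
    by (rule f_lipschitz[OF _ p_in_ball])
  also have "\<dots> \<le> gradient_bound * radius"
    using y norm_perp_le[OF \<eta>, of y] gradient_bound_pos by (intro mult_left_mono) auto
  finally have "\<bar>\<phi> 0\<bar> < slope * height" using zero radius_bounds by (simp add: \<phi>_def)
  moreover have "\<phi> 0 + slope * height \<le> \<phi> height" "\<phi> (- height) + slope * height \<le> \<phi> 0"
    using increase_on_cylinder[OF y, of 0 height] increase_on_cylinder[OF y, of "- height" 0] height_pos
    unfolding \<phi>_def by simp_all
  ultimately have signs: "\<phi> (- height) < 0" "0 < \<phi> height" by linarith+
  have continuous: "continuous_on (ball p R) f"
    using deriv by (intro continuous_at_imp_continuous_on ballI has_derivative_continuous) auto
  have "(\<lambda>u. p + perp \<eta> y + u *\<^sub>R \<eta>) ` {- height..height} \<subseteq> ball p R"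
    by (intro image_subsetI ball_width_subset[OF cylinder_in_ball[OF y]]) auto
  then have "continuous_on {- height..height} \<phi>"
    unfolding \<phi>_def by (rule continuous_on_compose2[OF continuous, rotated]) (intro continuous_intros)
  then obtain u where u: "- height \<le> u" "u \<le> height" "\<phi> u = 0"
    using IVT'[of \<phi> "- height" 0 height] signs height_pos by auto
  then have "u \<noteq> height" "u \<noteq> - height" using signs by auto
  then show ?thesis using u by (intro that[of u]) (auto simp: \<phi>_def)
qed

definition graph_height :: "'a \<Rightarrow> real" where
  "graph_height y = (SOME u. \<bar>u\<bar> < height \<and> f (p + perp \<eta> y + u *\<^sub>R \<eta>) = 0)"

definition graph_point :: "'a \<Rightarrow> 'a" where
  "graph_point y = p + perp \<eta> y + graph_height y *\<^sub>R \<eta>"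

lemma graph_height:
  assumes "norm y < radius"
  shows "\<bar>graph_height y\<bar> < height" "f (graph_point y) = 0"
proof -
  have "\<exists>u. \<bar>u\<bar> < height \<and> f (p + perp \<eta> y + u *\<^sub>R \<eta>) = 0" using zero_exists[OF assms] by metis
  from someI_ex[OF this] show "\<bar>graph_height y\<bar> < height" "f (graph_point y) = 0"
    by (simp_all add: graph_height_def graph_point_def)
qed

lemma graph_height_perp: "graph_height (perp \<eta> y) = graph_height y"
  by (simp add: graph_height_def perp_perp[OF \<eta>])

lemma graph_point_in_ball:
  assumes "norm y < radius"
  shows "graph_point y \<in> ball p width" "graph_point y \<in> ball p R"
  using cylinder_in_ball[OF assms, of "graph_height y"] ball_width_subset graph_height(1)[OF assms]
  by (simp_all add: graph_point_def)

lemma sign_iff_graph_height: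
  assumes "norm z < radius"
  shows "f (p + z) < 0 \<longleftrightarrow> z \<bullet> \<eta> < graph_height z" "f (p + z) = 0 \<longleftrightarrow> z \<bullet> \<eta> = graph_height z"
proof -
  have split: "p + z = p + perp \<eta> z + (z \<bullet> \<eta>) *\<^sub>R \<eta>" by (simp add: perp_def)
  have z: "\<bar>z \<bullet> \<eta>\<bar> \<le> height" using Cauchy_Schwarz_ineq2[of z \<eta>] \<eta> assms radius_bounds by simp
  have G: "\<bar>graph_height z\<bar> \<le> height" "f (p + perp \<eta> z + graph_height z *\<^sub>R \<eta>) = 0"
    using graph_height[OF assms] by (simp_all add: graph_point_def)
  show "f (p + z) < 0 \<longleftrightarrow> z \<bullet> \<eta> < graph_height z" "f (p + z) = 0 \<longleftrightarrow> z \<bullet> \<eta> = graph_height z"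
    unfolding arg_cong[OF split, of f]
    using strictly_increasing_on_cylinder[OF assms z G(1)] strictly_increasing_on_cylinder[OF assms G(1) z] G(2)
    by (cases "z \<bullet> \<eta>" "graph_height z" rule: linorder_cases, auto)+
qed

lemma graph_height_zero: "graph_height 0 = 0"
  using sign_iff_graph_height(2)[of 0] radius_bounds zero by simp

definition graph_lipschitz :: real where
  "graph_lipschitz = gradient_bound / slope"

lemma graph_lipschitz_nonneg: "0 \<le> graph_lipschitz"
  using gradient_bound_pos slope_pos by (simp add: graph_lipschitz_def)

lemma graph_height_lipschitz:
  assumes "norm y < radius" "norm z < radius"
  shows "\<bar>graph_height y - graph_height z\<bar> \<le> graph_lipschitz * norm (y - z)"
proof -
  have "graph_height y - graph_height z \<le> graph_lipschitz * norm (y - z)"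
    if y: "norm y < radius" and z: "norm z < radius" and le: "graph_height z \<le> graph_height y" for y z
  proof -
    define x where "x = p + perp \<eta> y + graph_height z *\<^sub>R \<eta>"
    have heights: "\<bar>graph_height z\<bar> \<le> height" "\<bar>graph_height y\<bar> \<le> height"
      using graph_height(1)[OF z] graph_height(1)[OF y] by auto
    have x: "x \<in> ball p R" unfolding x_def by (rule ball_width_subset[OF cylinder_in_ball[OF y heights(1)]])
    have "f x + slope * (graph_height y - graph_height z) \<le> f (graph_point y)"
      unfolding x_def graph_point_def by (rule increase_on_cylinder[OF y heights le])
    then have "slope * (graph_height y - graph_height z) \<le> f (graph_point z) - f x"
      using graph_height(2)[OF y] graph_height(2)[OF z] by simp
    also have "\<dots> \<le> gradient_bound * norm (graph_point z - x)"
      using f_lipschitz[OF graph_point_in_ball(2)[OF z] x] by linarith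
    also have "graph_point z - x = perp \<eta> (z - y)" by (simp add: graph_point_def x_def perp_diff)
    also have "gradient_bound * norm (perp \<eta> (z - y)) \<le> gradient_bound * norm (y - z)"
      using gradient_bound_pos norm_perp_le[OF \<eta>, of "z - y"]
      by (intro mult_left_mono) (auto simp: norm_minus_commute)
    finally show ?thesis using slope_pos by (simp add: graph_lipschitz_def field_simps)
  qed
  from this[OF assms] this[OF assms(2,1)] show ?thesis
    by (cases "graph_height z \<le> graph_height y") (auto simp: norm_minus_commute)
qed

lemma graph_point_diff: "graph_point z - graph_point y = perp \<eta> (z - y) + (graph_height z - graph_height y) *\<^sub>R \<eta>"
  by (simp add: graph_point_def perp_diff algebra_simps)

lemma graph_point_lipschitz:
  assumes "norm y < radius" "norm z < radius"
  shows "norm (graph_point z - graph_point y) \<le> (1 + graph_lipschitz) * norm (z - y)"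
proof -
  have "norm (graph_point z - graph_point y) \<le> norm (perp \<eta> (z - y)) + \<bar>graph_height z - graph_height y\<bar>"
    unfolding graph_point_diff
    using norm_triangle_ineq[of "perp \<eta> (z - y)" "(graph_height z - graph_height y) *\<^sub>R \<eta>"] \<eta> by simp
  then show ?thesis
    using norm_perp_le[OF \<eta>, of "z - y"] graph_height_lipschitz[OF assms(2,1)] by (simp add: algebra_simps)
qed

lemma transversal_graph_point: "norm y < radius \<Longrightarrow> slope \<le> f' (graph_point y) \<eta>"
  by (rule slope_le[OF graph_point_in_ball(1)])

definition graph_slope :: "'a \<Rightarrow> 'a \<Rightarrow> real" where
  "graph_slope y v = - f' (graph_point y) (perp \<eta> v) / f' (graph_point y) \<eta>"

lemma linear_graph_slope:
  assumes "norm y < radius"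
  shows "linear (graph_slope y)"
proof -
  note linear = linear_f'[OF graph_point_in_ball(2)[OF assms]]
  show ?thesis unfolding graph_slope_def
    by (intro linearI)
      (simp_all add: perp_add perp_scaleR linear_add[OF linear] linear_cmul[OF linear] add_divide_distrib diff_divide_distrib)
qed

lemma graph_height_remainder_le:
  assumes y: "norm y < radius" and z: "norm z < radius"
  shows "\<bar>graph_height z - graph_height y - graph_slope y (z - y)\<bar> \<le> K * (1 + graph_lipschitz)\<^sup>2 / slope * (norm (z - y))\<^sup>2"
    (is "\<bar>?rest\<bar> \<le> ?C / slope * _")
proof -
  define D where "D = f' (graph_point y) \<eta>"
  have D: "slope \<le> D" "0 < D" using transversal_graph_point[OF y] slope_pos by (simp_all add: D_def)
  note linear = linear_f'[OF graph_point_in_ball(2)[OF y]]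
  have "f' (graph_point y) (graph_point z - graph_point y)
      = f' (graph_point y) (perp \<eta> (z - y)) + (graph_height z - graph_height y) * D"
    unfolding graph_point_diff D_def by (simp add: linear_add[OF linear] linear_cmul[OF linear])
  also have "\<dots> = ?rest * D" using D by (simp add: graph_slope_def D_def[symmetric] field_simps)
  finally have "\<bar>?rest\<bar> * D = \<bar>f' (graph_point y) (graph_point z - graph_point y)\<bar>"
    using D by (simp add: abs_mult)
  also have "\<dots> \<le> K * (norm (graph_point z - graph_point y))\<^sup>2"
    using graph_height(2)[OF y] graph_height(2)[OF z] graph_point_in_ball(2)[OF y] graph_point_in_ball(2)[OF z]
    by (intro taylor_first_order) auto
  also have "\<dots> \<le> K * ((1 + graph_lipschitz) * norm (z - y))\<^sup>2"
    using K graph_point_lipschitz[OF y z] by (intro mult_left_mono power_mono) auto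
  finally have "\<bar>?rest\<bar> * D \<le> ?C * (norm (z - y))\<^sup>2" by (simp add: power_mult_distrib mult_ac)
  then have "\<bar>?rest\<bar> * slope \<le> ?C * (norm (z - y))\<^sup>2" using mult_left_mono[OF D(1), of "\<bar>?rest\<bar>"] by simp
  then show ?thesis using slope_pos by (simp add: field_simps)
qed

lemma graph_height_has_derivative:
  assumes y: "norm y < radius"
  shows "(graph_height has_derivative graph_slope y) (at y)"
proof (rule has_derivativeI_sandwich[where e="radius - norm y"
      and H="\<lambda>z. K * (1 + graph_lipschitz)\<^sup>2 / slope * norm (z - y)"])
  show "0 < radius - norm y" using y by simp
  show "bounded_linear (graph_slope y)"
    using linear_graph_slope[OF y] by (simp add: linear_conv_bounded_linear)
  show "((\<lambda>z. K * (1 + graph_lipschitz)\<^sup>2 / slope * norm (z - y)) \<longlongrightarrow> 0) (at y)"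
    by (rule tendsto_eq_intros refl | simp)+
  fix z assume z: "z \<noteq> y" "dist z y < radius - norm y"
  then have "norm z < radius" using norm_triangle_ineq2[of z y] by (simp add: dist_norm)
  from graph_height_remainder_le[OF y this]
  show "norm (graph_height z - graph_height y - graph_slope y (z - y)) / norm (z - y)
      \<le> K * (1 + graph_lipschitz)\<^sup>2 / slope * norm (z - y)"
    using z by (simp add: divide_le_eq power2_eq_square mult_ac)
qed

lemma graph_point_has_derivative:
  assumes "norm y < radius"
  shows "(graph_point has_derivative (\<lambda>w. perp \<eta> w + graph_slope y w *\<^sub>R \<eta>)) (at y)"
proof -
  have "linear (perp \<eta>)" by (intro linearI) (simp_all add: perp_add perp_scaleR)
  then have "(perp \<eta> has_derivative perp \<eta>) (at y)"
    by (intro bounded_linear_imp_has_derivative) (simp add: linear_conv_bounded_linear)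
  then show ?thesis unfolding graph_point_def[abs_def] using graph_height_has_derivative[OF assms]
    by (auto intro!: derivative_eq_intros simp: fun_eq_iff)
qed

definition hessian_along_graph :: "'a \<Rightarrow> 'a \<Rightarrow> 'a \<Rightarrow> real" where
  "hessian_along_graph y w v = f'' (graph_point y) (perp \<eta> w + graph_slope y w *\<^sub>R \<eta>) v"

definition graph_hessian :: "'a \<Rightarrow> 'a \<Rightarrow> 'a \<Rightarrow> real" where
  "graph_hessian y w v = - ((hessian_along_graph y w (perp \<eta> v) * f' (graph_point y) \<eta>
      - f' (graph_point y) (perp \<eta> v) * hessian_along_graph y w \<eta>) * (1 / f' (graph_point y) \<eta>) * (1 / f' (graph_point y) \<eta>))"

lemma graph_slope_has_derivative:
  assumes "norm y < radius"
  shows "((\<lambda>y. graph_slope y v) has_derivative (\<lambda>w. graph_hessian y w v)) (at y)"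
proof -
  have along: "((\<lambda>y. f' (graph_point y) v) has_derivative (\<lambda>w. hessian_along_graph y w v)) (at y)" for v
    unfolding hessian_along_graph_def
    by (rule has_derivative_compose[OF graph_point_has_derivative[OF assms] deriv2[OF graph_point_in_ball(2)[OF assms]]])
  have "f' (graph_point y) \<eta> \<noteq> 0" using transversal_graph_point[OF assms] slope_pos by simp
  then have "((\<lambda>y. - (f' (graph_point y) (perp \<eta> v) / f' (graph_point y) \<eta>)) has_derivative
      (\<lambda>w. - ((hessian_along_graph y w (perp \<eta> v) * f' (graph_point y) \<eta>
        - f' (graph_point y) (perp \<eta> v) * hessian_along_graph y w \<eta>) / (f' (graph_point y) \<eta> * f' (graph_point y) \<eta>)))) (at y)"
    by (intro has_derivative_minus has_derivative_divide' along)
  then show ?thesis by (simp add: graph_slope_def graph_hessian_def)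
qed

lemma graph_hessian_scale:
  assumes "norm y < radius"
  shows "graph_hessian y (c *\<^sub>R w) v = c * graph_hessian y w v" "graph_hessian y w (c *\<^sub>R v) = c * graph_hessian y w v"
proof -
  show "graph_hessian y (c *\<^sub>R w) v = c * graph_hessian y w v"
    using linear_cmul[OF has_derivative_linear[OF graph_slope_has_derivative[OF assms]]] by simp
  have "hessian_along_graph y w (perp \<eta> (c *\<^sub>R v)) = c * hessian_along_graph y w (perp \<eta> v)"
    using linear_cmul[OF linear_f''[OF graph_point_in_ball(2)[OF assms]]]
    by (simp add: hessian_along_graph_def perp_scaleR)
  moreover have "f' (graph_point y) (perp \<eta> (c *\<^sub>R v)) = c * f' (graph_point y) (perp \<eta> v)"
    using linear_cmul[OF linear_f'[OF graph_point_in_ball(2)[OF assms]]] by (simp add: perp_scaleR)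
  ultimately show "graph_hessian y w (c *\<^sub>R v) = c * graph_hessian y w v"
    by (simp add: graph_hessian_def algebra_simps)
qed

lemma uniformly_hoelder_gradient: "uniformly_hoelder \<alpha> (ball 0 radius) (cball 0 1) (\<lambda>v y. f' (graph_point y) v)"
proof (rule uniformly_hoelderI[where K="gradient_bound + 2 * K * (1 + graph_lipschitz)"], rule bounded_hoelderI)
  fix v :: 'a assume "v \<in> cball 0 1"
  then have v: "norm v \<le> 1" by simp
  have second: "0 \<le> 2 * K * (1 + graph_lipschitz)" using K graph_lipschitz_nonneg by simp
  then show "0 \<le> gradient_bound + 2 * K * (1 + graph_lipschitz)" using gradient_bound_pos by simp
  fix y :: 'a assume y: "y \<in> ball 0 radius"
  have "\<bar>f' (graph_point y) v\<bar> \<le> gradient_bound * norm v" using f'_le[OF graph_point_in_ball(2)] y by simp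
  also have "\<dots> \<le> gradient_bound" using v gradient_bound_pos by simp
  finally show "\<bar>f' (graph_point y) v\<bar> \<le> gradient_bound + 2 * K * (1 + graph_lipschitz)"
    using second by linarith
  fix z :: 'a assume z: "z \<in> ball 0 radius"
  have "\<bar>f' (graph_point y) v - f' (graph_point z) v\<bar> \<le> K * norm v * norm (graph_point y - graph_point z)"
    using f'_lipschitz[OF graph_point_in_ball(2) graph_point_in_ball(2)] y z by simp
  also have "\<dots> \<le> K * 1 * ((1 + graph_lipschitz) * (2 * norm (y - z) powr \<alpha>))"
  proof (intro mult_mono v order_trans[OF graph_point_lipschitz])
    show "norm (y - z) \<le> 2 * norm (y - z) powr \<alpha>"
      using y z radius_bounds \<alpha> norm_triangle_ineq4[of y z] by (intro le_double_powr) auto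
  qed (use K graph_lipschitz_nonneg y z in auto)
  also have "\<dots> \<le> (gradient_bound + 2 * K * (1 + graph_lipschitz)) * norm (y - z) powr \<alpha>"
    using gradient_bound_pos by (simp add: algebra_simps)
  finally show "\<bar>f' (graph_point y) v - f' (graph_point z) v\<bar>
      \<le> (gradient_bound + 2 * K * (1 + graph_lipschitz)) * norm (y - z) powr \<alpha>" .
qed

lemma uniformly_hoelder_hessian:
  "uniformly_hoelder \<alpha> (ball 0 radius) (cball 0 1 \<times> cball 0 1) (\<lambda>i y. f'' (graph_point y) (fst i) (snd i))"
proof (rule uniformly_hoelderI[where K="K * (1 + graph_lipschitz)"], rule bounded_hoelderI)
  fix i :: "'a \<times> 'a" assume "i \<in> cball 0 1 \<times> cball 0 1"
  then have i: "norm (fst i) * norm (snd i) \<le> 1" using mult_mono[of "norm (fst i)" 1 "norm (snd i)" 1] by auto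
  show "0 \<le> K * (1 + graph_lipschitz)" using K graph_lipschitz_nonneg by simp
  fix y :: 'a assume y: "y \<in> ball 0 radius"
  have "\<bar>f'' (graph_point y) (fst i) (snd i)\<bar> \<le> K * (norm (fst i) * norm (snd i))"
    using f''_le[OF graph_point_in_ball(2)] y by (simp add: mult.assoc)
  also have "\<dots> \<le> K * (1 + graph_lipschitz)" using i K graph_lipschitz_nonneg by (intro mult_left_mono) auto
  finally show "\<bar>f'' (graph_point y) (fst i) (snd i)\<bar> \<le> K * (1 + graph_lipschitz)" .
  fix z :: 'a assume z: "z \<in> ball 0 radius"
  have "norm (graph_point y - graph_point z) powr \<alpha> \<le> ((1 + graph_lipschitz) * norm (y - z)) powr \<alpha>"
    using graph_point_lipschitz[of z y] y z \<alpha> by (intro powr_mono2) auto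
  also have "\<dots> = (1 + graph_lipschitz) powr \<alpha> * norm (y - z) powr \<alpha>"
    using graph_lipschitz_nonneg by (simp add: powr_mult)
  also have "\<dots> \<le> (1 + graph_lipschitz) powr 1 * norm (y - z) powr \<alpha>"
    using graph_lipschitz_nonneg \<alpha> by (intro mult_right_mono powr_mono) auto
  finally have dist: "norm (graph_point y - graph_point z) powr \<alpha> \<le> (1 + graph_lipschitz) * norm (y - z) powr \<alpha>"
    using graph_lipschitz_nonneg by simp
  have "\<bar>f'' (graph_point y) (fst i) (snd i) - f'' (graph_point z) (fst i) (snd i)\<bar>
      \<le> (K * norm (graph_point y - graph_point z) powr \<alpha>) * (norm (fst i) * norm (snd i))"
    using hoelder[OF graph_point_in_ball(2) graph_point_in_ball(2)] y z by (simp add: mult.assoc)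
  also have "\<dots> \<le> (K * ((1 + graph_lipschitz) * norm (y - z) powr \<alpha>)) * 1"
    using K graph_lipschitz_nonneg dist i by (intro mult_mono mult_left_mono) auto
  finally show "\<bar>f'' (graph_point y) (fst i) (snd i) - f'' (graph_point z) (fst i) (snd i)\<bar>
      \<le> K * (1 + graph_lipschitz) * norm (y - z) powr \<alpha>" by (simp add: mult.assoc)
qed

lemma norm_perp_le_one: "norm v \<le> 1 \<Longrightarrow> norm (perp \<eta> v) \<le> 1"
  using norm_perp_le[OF \<eta>, of v] by simp

lemma uniformly_hoelder_inverse_transversal: "uniformly_hoelder \<alpha> (ball 0 radius) I (\<lambda>i y. 1 / f' (graph_point y) \<eta>)"
  by (rule uniformly_hoelder_inverse[OF uniformly_hoelder_reindex[OF uniformly_hoelder_gradient, of I "\<lambda>_. \<eta>"] slope_pos])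
    (use \<eta> transversal_graph_point in auto)

lemma uniformly_hoelder_graph_slope: "uniformly_hoelder \<alpha> (ball 0 radius) (cball 0 1) (\<lambda>w y. graph_slope y w)"
proof (rule uniformly_hoelder_cong)
  show "uniformly_hoelder \<alpha> (ball 0 radius) (cball 0 1) (\<lambda>w y. - (f' (graph_point y) (perp \<eta> w) * (1 / f' (graph_point y) \<eta>)))"
    by (intro uniformly_hoelder_minus uniformly_hoelder_mult uniformly_hoelder_inverse_transversal
        uniformly_hoelder_reindex[OF uniformly_hoelder_gradient]) (simp add: norm_perp_le_one)
qed (simp add: graph_slope_def)

lemma uniformly_hoelder_hessian_along_graph:
  "uniformly_hoelder \<alpha> (ball 0 radius) (cball 0 1 \<times> cball 0 1) (\<lambda>i y. hessian_along_graph y (fst i) (snd i))"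
proof (rule uniformly_hoelder_cong)
  let ?I = "cball (0::'a) 1 \<times> cball (0::'a) 1"
  have "uniformly_hoelder \<alpha> (ball 0 radius) ?I (\<lambda>i y. f'' (graph_point y) (perp \<eta> (fst i)) (snd i))"
    using uniformly_hoelder_reindex[OF uniformly_hoelder_hessian, of ?I "\<lambda>i. (perp \<eta> (fst i), snd i)"] norm_perp_le_one by auto
  moreover have "uniformly_hoelder \<alpha> (ball 0 radius) ?I (\<lambda>i y. graph_slope y (fst i))"
    using uniformly_hoelder_reindex[OF uniformly_hoelder_graph_slope, of ?I fst] by auto
  moreover have "uniformly_hoelder \<alpha> (ball 0 radius) ?I (\<lambda>i y. f'' (graph_point y) \<eta> (snd i))"
    using uniformly_hoelder_reindex[OF uniformly_hoelder_hessian, of ?I "\<lambda>i. (\<eta>, snd i)"] \<eta> by auto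
  ultimately show "uniformly_hoelder \<alpha> (ball 0 radius) ?I (\<lambda>i y. f'' (graph_point y) (perp \<eta> (fst i)) (snd i)
      + graph_slope y (fst i) * f'' (graph_point y) \<eta> (snd i))"
    by (intro uniformly_hoelder_add uniformly_hoelder_mult)
  fix i :: "'a \<times> 'a" and y :: 'a assume "y \<in> ball 0 radius"
  then have "linear (\<lambda>w. f'' (graph_point y) w (snd i))"
    using has_derivative_linear[OF deriv2[OF graph_point_in_ball(2)]] by simp
  from linear_add[OF this] linear_cmul[OF this]
  show "hessian_along_graph y (fst i) (snd i)
      = f'' (graph_point y) (perp \<eta> (fst i)) (snd i) + graph_slope y (fst i) * f'' (graph_point y) \<eta> (snd i)"
    by (simp add: hessian_along_graph_def)
qed

lemma uniformly_hoelder_graph_hessian: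
  "uniformly_hoelder \<alpha> (ball 0 radius) (cball 0 1 \<times> cball 0 1) (\<lambda>i y. graph_hessian y (fst i) (snd i))"
proof (rule uniformly_hoelder_cong)
  let ?I = "cball (0::'a) 1 \<times> cball (0::'a) 1"
  have "uniformly_hoelder \<alpha> (ball 0 radius) ?I (\<lambda>i y. hessian_along_graph y (fst i) (perp \<eta> (snd i)))"
    using uniformly_hoelder_reindex[OF uniformly_hoelder_hessian_along_graph, of ?I "\<lambda>i. (fst i, perp \<eta> (snd i))"]
      norm_perp_le_one by auto
  moreover have "uniformly_hoelder \<alpha> (ball 0 radius) ?I (\<lambda>i y. f' (graph_point y) \<eta>)"
    using uniformly_hoelder_reindex[OF uniformly_hoelder_gradient, of ?I "\<lambda>_. \<eta>"] \<eta> by auto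
  moreover have "uniformly_hoelder \<alpha> (ball 0 radius) ?I (\<lambda>i y. f' (graph_point y) (perp \<eta> (snd i)))"
    using uniformly_hoelder_reindex[OF uniformly_hoelder_gradient, of ?I "\<lambda>i. perp \<eta> (snd i)"] norm_perp_le_one by auto
  moreover have "uniformly_hoelder \<alpha> (ball 0 radius) ?I (\<lambda>i y. hessian_along_graph y (fst i) \<eta>)"
    using uniformly_hoelder_reindex[OF uniformly_hoelder_hessian_along_graph, of ?I "\<lambda>i. (fst i, \<eta>)"] \<eta>
    by auto
  ultimately show "uniformly_hoelder \<alpha> (ball 0 radius) ?I (\<lambda>i y. - ((hessian_along_graph y (fst i) (perp \<eta> (snd i)) * f' (graph_point y) \<eta>
      + - (f' (graph_point y) (perp \<eta> (snd i)) * hessian_along_graph y (fst i) \<eta>)) * (1 / f' (graph_point y) \<eta>) * (1 / f' (graph_point y) \<eta>)))"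
    by (intro uniformly_hoelder_minus uniformly_hoelder_add uniformly_hoelder_mult uniformly_hoelder_inverse_transversal)
qed (simp add: graph_hessian_def)

lemma graph_hessian_bounds:
  obtains \<Lambda> where "0 \<le> \<Lambda>" "\<And>y w v. norm y < radius \<Longrightarrow> \<bar>graph_hessian y w v\<bar> \<le> \<Lambda> * norm w * norm v"
    "\<And>y z w v. norm y < radius \<Longrightarrow> norm z < radius \<Longrightarrow>
      \<bar>graph_hessian y w v - graph_hessian z w v\<bar> \<le> \<Lambda> * norm (y - z) powr \<alpha> * norm w * norm v"
proof -
  from uniformly_hoelder_graph_hessian obtain \<Lambda>
    where \<Lambda>: "bounded_hoelder \<alpha> (ball 0 radius) \<Lambda> (\<lambda>y. graph_hessian y w v)"
    if "norm w \<le> 1" "norm v \<le> 1" for w v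
    unfolding uniformly_hoelder_def by force
  show ?thesis
  proof (rule that)
    show "0 \<le> \<Lambda>" using \<Lambda>[of 0 0] by (simp add: bounded_hoelder_def)
    show "\<bar>graph_hessian y w v\<bar> \<le> \<Lambda> * norm w * norm v" if "norm y < radius" for y w v
      using that \<Lambda> by (intro homogeneous_bound) (auto simp: graph_hessian_scale bounded_hoelder_def)
    show "\<bar>graph_hessian y w v - graph_hessian z w v\<bar> \<le> \<Lambda> * norm (y - z) powr \<alpha> * norm w * norm v"
      if "norm y < radius" "norm z < radius" for y z w v
      using that \<Lambda> by (intro homogeneous_bound[of "\<lambda>w v. graph_hessian y w v - graph_hessian z w v"])
        (auto simp: graph_hessian_scale bounded_hoelder_def right_diff_distrib)
  qed
qed

lemma graph_slope_taylor:
  assumes hoelder: "\<And>y z w v. norm y < radius \<Longrightarrow> norm z < radius \<Longrightarrow>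
      \<bar>graph_hessian y w v - graph_hessian z w v\<bar> \<le> \<Lambda> * norm (y - z) powr \<alpha> * norm w * norm v" and \<Lambda>: "0 \<le> \<Lambda>"
    and y: "norm y < radius" "norm (y + z) < radius" "norm y0 < radius"
  shows "\<bar>graph_slope (y + z) v - graph_slope y v - graph_hessian y0 z v\<bar> \<le> \<Lambda> * (norm (y - y0) + norm z) powr \<alpha> * norm z * norm v"
proof -
  have in_ball: "norm (y + t *\<^sub>R z) < radius" if "0 \<le> t" "t \<le> 1" for t
    using convexD_alt[OF convex_ball, of y 0 radius "y + z" t] y that by (simp add: algebra_simps)
  obtain t
    where t: "0 < t" "t < 1" "graph_slope (y + z) v - graph_slope y v = graph_hessian (y + t *\<^sub>R z) z v"
    using mean_value_along_line[of "\<lambda>y. graph_slope y v" "\<lambda>y w. graph_hessian y w v" y z,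
        OF graph_slope_has_derivative[OF in_ball]] by blast
  have "norm (y + t *\<^sub>R z - y0) \<le> norm (y - y0) + norm z"
    using norm_add_scaleR_le[of t "y - y0" z] t by (simp add: algebra_simps)
  then have "\<Lambda> * norm (y + t *\<^sub>R z - y0) powr \<alpha> * norm z * norm v \<le> \<Lambda> * (norm (y - y0) + norm z) powr \<alpha> * norm z * norm v"
    using \<Lambda> \<alpha> by (intro mult_right_mono mult_left_mono powr_mono2) auto
  then show ?thesis using hoelder[OF in_ball[of t] y(3), of z v] t by simp
qed

lemma C2alpha_graph_exists: obtains \<Lambda>
  where "C2alpha_graph \<alpha> radius \<Lambda> \<eta> graph_height graph_slope graph_hessian"
proof -
  obtain \<Lambda> where \<Lambda>: "0 \<le> \<Lambda>" "\<And>y w v. norm y < radius \<Longrightarrow> \<bar>graph_hessian y w v\<bar> \<le> \<Lambda> * norm w * norm v"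
    and hoelder: "\<And>y z w v. norm y < radius \<Longrightarrow> norm z < radius \<Longrightarrow>
      \<bar>graph_hessian y w v - graph_hessian z w v\<bar> \<le> \<Lambda> * norm (y - z) powr \<alpha> * norm w * norm v"
    by (rule graph_hessian_bounds, rule that) assumption+
  have "linear (\<lambda>w. graph_hessian y w v)" if "norm y < radius" for y v
    using graph_slope_has_derivative[OF that] has_derivative_linear by blast
  note linear = this
  have "C2alpha_graph \<alpha> radius \<Lambda> \<eta> graph_height graph_slope graph_hessian"
  proof
    show "norm y < radius \<Longrightarrow> graph_hessian y (z1 + z2) v = graph_hessian y z1 v + graph_hessian y z2 v"
      for y z1 z2 v
      by (rule linear_add[OF linear])
    show "norm y < radius \<Longrightarrow> norm (y + z) < radius \<Longrightarrow> norm y0 < radius \<Longrightarrow>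
        \<bar>graph_slope (y + z) v - graph_slope y v - graph_hessian y0 z v\<bar>
          \<le> \<Lambda> * (norm (y - y0) + norm z) powr \<alpha> * norm z * norm v" for y z y0 v
      by (rule graph_slope_taylor[OF hoelder \<Lambda>(1)])
  qed (fact \<alpha> \<eta> \<Lambda> graph_height_zero graph_height_perp radius_bounds graph_height_has_derivative graph_hessian_scale)+
  then show ?thesis by (rule that)
qed

lemma graph_slope_zero: "graph_slope 0 v = - f' p (perp \<eta> v) / f' p \<eta>"
  by (simp add: graph_slope_def graph_point_def graph_height_zero perp_def)

end

section \<open>Capillary sets\<close>

lemma tangent_orthogonal:
  fixes x :: "real \<Rightarrow> 'a::euclidean_space"
  assumes normal: "((\<lambda>x. (N \<bullet> (x - q)) / norm (x - q)) \<longlongrightarrow> 0) (at q within M)"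
    and v: "((\<lambda>t. (1 / t) *\<^sub>R (x t - q)) \<longlongrightarrow> v) (at_right 0)"
    and in_M: "eventually (\<lambda>t. x t \<in> M) (at_right 0)"
  shows "N \<bullet> v = 0"
proof (cases "v = 0")
  case False
  note pos = eventually_at_right_less[of "0::real"]
  have "eventually (\<lambda>t. (1 / t) *\<^sub>R (x t - q) \<noteq> 0) (at_right 0)"
    using tendsto_imp_eventually_ne[OF v False] .
  then have distinct: "eventually (\<lambda>t. x t \<noteq> q) (at_right 0)" by (rule eventually_mono) auto
  have "((\<lambda>t. t *\<^sub>R ((1 / t) *\<^sub>R (x t - q))) \<longlongrightarrow> 0 *\<^sub>R v) (at_right 0)"
    by (intro tendsto_scaleR v tendsto_ident_at)
  then have "((\<lambda>t. x t - q) \<longlongrightarrow> 0 *\<^sub>R v) (at_right 0)"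
    by (rule Lim_transform_eventually) (rule eventually_mono[OF pos], simp)
  then have "(x \<longlongrightarrow> q) (at_right 0)" by (simp add: LIM_zero_cancel)
  then have "filterlim x (at q within M) (at_right 0)"
    unfolding filterlim_at using eventually_conj[OF in_M distinct] by blast
  from filterlim_compose[OF normal this] tendsto_norm[OF v]
  have "((\<lambda>t. (N \<bullet> (x t - q)) / norm (x t - q) * norm ((1 / t) *\<^sub>R (x t - q))) \<longlongrightarrow> 0 * norm v) (at_right 0)"
    by (rule tendsto_mult)
  then have "((\<lambda>t. N \<bullet> ((1 / t) *\<^sub>R (x t - q))) \<longlongrightarrow> 0) (at_right 0)"
    by (simp only: mult_zero_left, elim Lim_transform_eventually)
      (rule eventually_mono[OF eventually_conj[OF pos distinct]], simp)
  moreover have "((\<lambda>t. N \<bullet> ((1 / t) *\<^sub>R (x t - q))) \<longlongrightarrow> N \<bullet> v) (at_right 0)" by (intro tendsto_intros v)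
  ultimately show ?thesis using tendsto_unique trivial_limit_at_right_real by blast
qed simp

lemma difference_quotient_at_right:
  fixes x :: "real \<Rightarrow> 'a::real_normed_vector"
  assumes "(x has_derivative (\<lambda>h. h *\<^sub>R v)) (at 0)"
  shows "((\<lambda>t. (1 / t) *\<^sub>R (x t - x 0)) \<longlongrightarrow> v) (at_right 0)"
proof -
  have "((\<lambda>t. norm (x t - x 0 - (t - 0) *\<^sub>R v) / norm (t - 0)) \<longlongrightarrow> 0) (at_right 0)"
    using assms unfolding has_derivative_iff_norm filterlim_at_split by blast
  moreover have "norm (x t - x 0 - (t - 0) *\<^sub>R v) / norm (t - 0) = norm ((1 / t) *\<^sub>R (x t - x 0) - v)"
    if "0 < t" for t
  proof -
    have "(1 / t) *\<^sub>R (x t - x 0) - v = (1 / t) *\<^sub>R (x t - x 0 - (t - 0) *\<^sub>R v)"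
      using that by (simp add: scaleR_diff_right)
    then show ?thesis using that by simp
  qed
  then have "eventually (\<lambda>t. norm (x t - x 0 - (t - 0) *\<^sub>R v) / norm (t - 0) = norm ((1 / t) *\<^sub>R (x t - x 0) - v)) (at_right 0)"
    using eventually_at_right_less[of 0] by (rule eventually_mono[rotated])
  ultimately have "((\<lambda>t. norm ((1 / t) *\<^sub>R (x t - x 0) - v)) \<longlongrightarrow> 0) (at_right 0)"
    by (rule Lim_transform_eventually)
  then have "((\<lambda>t. (1 / t) *\<^sub>R (x t - x 0) - v) \<longlongrightarrow> 0) (at_right 0)" by (rule tendsto_norm_zero_cancel)
  then show ?thesis by (simp only: LIM_zero_iff)
qed

lemma tangent_orthogonal_patch:
  fixes \<psi> :: "'a::euclidean_space \<Rightarrow> 'b::euclidean_space"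
  assumes normal: "((\<lambda>x. (N \<bullet> (x - \<psi> y0)) / norm (x - \<psi> y0)) \<longlongrightarrow> 0) (at (\<psi> y0) within M)"
    and \<psi>: "(\<psi> has_derivative \<psi>') (at y0)" and y0: "y0 \<bullet> a = 0" "0 \<le> y0 \<bullet> b"
    and patch: "eventually (\<lambda>y. y \<bullet> a = 0 \<longrightarrow> 0 \<le> y \<bullet> b \<longrightarrow> \<psi> y \<in> M) (nhds y0)"
    and w: "w \<bullet> a = 0"
  shows "N \<bullet> \<psi>' w = 0"
proof -
  note linear = has_derivative_linear[OF \<psi>]
  have forward: "N \<bullet> \<psi>' w = 0" if w: "w \<bullet> a = 0" "0 \<le> w \<bullet> b" for w
  proof (rule tangent_orthogonal[OF normal])
    have "((\<lambda>t. y0 + t *\<^sub>R w) has_derivative (\<lambda>h. h *\<^sub>R w)) (at 0)" by (auto intro!: derivative_eq_intros)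
    from has_derivative_compose[OF this, of \<psi> \<psi>'] \<psi>
    have "((\<lambda>t. \<psi> (y0 + t *\<^sub>R w)) has_derivative (\<lambda>h. h *\<^sub>R \<psi>' w)) (at 0)"
      by (simp add: linear_cmul[OF linear])
    from difference_quotient_at_right[OF this]
    show "((\<lambda>t. (1 / t) *\<^sub>R (\<psi> (y0 + t *\<^sub>R w) - \<psi> y0)) \<longlongrightarrow> \<psi>' w) (at_right 0)" by simp
    have "((\<lambda>t. y0 + t *\<^sub>R w) \<longlongrightarrow> y0 + 0 *\<^sub>R w) (at_right 0)" by (intro tendsto_intros)
    then have "filterlim (\<lambda>t. y0 + t *\<^sub>R w) (nhds y0) (at_right 0)" by simp
    from eventually_compose_filterlim[OF patch this] eventually_at_right_less[of 0]
    show "eventually (\<lambda>t. \<psi> (y0 + t *\<^sub>R w) \<in> M) (at_right 0)"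
      by eventually_elim (use y0 w in \<open>auto simp: inner_add_left\<close>)
  qed
  show ?thesis
  proof (cases "0 \<le> w \<bullet> b")
    case False
    then have "N \<bullet> \<psi>' (- w) = 0" using w by (intro forward) auto
    then show ?thesis by (simp add: linear_neg[OF linear])
  qed (rule forward[OF w])
qed

lemma linear_functional_eq_inner_of_kernel:
  fixes L :: "'a::real_inner \<Rightarrow> real"
  assumes linear: "linear L" and N: "norm N = 1" and nonzero: "L h0 \<noteq> 0" and kernel: "\<And>h. L h = 0 \<Longrightarrow> N \<bullet> h = 0"
  shows "L N \<noteq> 0" "L h = L N * (N \<bullet> h)"
proof -
  have inner_eq: "N \<bullet> h = L h / L h0 * (N \<bullet> h0)" for h
  proof -
    have "L (h - (L h / L h0) *\<^sub>R h0) = 0"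
      using nonzero by (simp add: linear_diff[OF linear] linear_cmul[OF linear])
    from kernel[OF this] show ?thesis by (simp add: inner_diff_right)
  qed
  have unit: "L N / L h0 * (N \<bullet> h0) = 1" using inner_eq[of N] N by (metis norm_eq_1)
  then show "L N \<noteq> 0" by auto
  have "L N * (N \<bullet> h) = L h * (L N / L h0 * (N \<bullet> h0))" using inner_eq[of h] by simp
  then show "L h = L N * (N \<bullet> h)" unfolding unit by simp
qed

lemma C2alphaE:
  assumes "C2alpha \<alpha> f U"
  obtains f' f'' L where "\<And>x. x \<in> U \<Longrightarrow> (f has_derivative blinfun_apply (f' x)) (at x)"
    "\<And>x. x \<in> U \<Longrightarrow> (f' has_derivative blinfun_apply (f'' x)) (at x)"
    "\<And>x y. x \<in> U \<Longrightarrow> y \<in> U \<Longrightarrow> norm (f'' x - f'' y) \<le> L * dist x y powr \<alpha>"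
  using assms unfolding C2alpha_def by blast

lemma derivative_of_left_inverse:
  assumes "(f has_derivative f') (at x)" "(g has_derivative g') (at (f x))"
    and "open U" "x \<in> U" "\<And>y. y \<in> U \<Longrightarrow> g (f y) = y"
  shows "g' (f' v) = v"
proof -
  have "((\<lambda>y. g (f y)) has_derivative (\<lambda>v. g' (f' v))) (at x)"
    using assms(1,2) by (rule has_derivative_compose)
  moreover have "((\<lambda>y. g (f y)) has_derivative (\<lambda>v. v)) (at x)"
    by (rule has_derivative_transform_within_open[OF has_derivative_ident assms(3,4)]) (simp add: assms(5))
  ultimately have "(\<lambda>v. g' (f' v)) = (\<lambda>v. v)" by (rule has_derivative_unique)
  then show ?thesis by (rule fun_cong)
qed

lemma abs_component_blinfun2_le:
  fixes T :: "'a::real_normed_vector \<Rightarrow>\<^sub>L ('b::real_normed_vector \<Rightarrow>\<^sub>L (real^'m::finite))"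
  shows "\<bar>T w v $ i\<bar> \<le> norm T * norm w * norm v"
proof -
  have "\<bar>T w v $ i\<bar> \<le> norm (T w v)" by (rule component_le_norm_cart)
  also have "\<dots> \<le> norm (T w) * norm v" by (rule norm_blinfun)
  also have "\<dots> \<le> (norm T * norm w) * norm v" by (intro mult_right_mono norm_blinfun) auto
  finally show ?thesis .
qed

lemma C2alpha_diffeo_inverse_derivative:
  assumes diffeo: "C2alpha_diffeo \<alpha> \<phi> U V" and x: "x \<in> U" and \<phi>: "(\<phi> has_derivative \<phi>') (at x)"
  obtains \<psi>' where "(inv_into U \<phi> has_derivative \<psi>') (at (\<phi> x))" "\<And>v. \<psi>' (\<phi>' v) = v" "\<And>w. \<phi>' (\<psi>' w) = w"
proof -
  have V: "open U" "open V" "\<phi> ` U = V" "inj_on \<phi> U" "C2alpha \<alpha> (inv_into U \<phi>) V"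
    using diffeo by (auto simp: C2alpha_diffeo_def)
  have inverse: "inv_into U \<phi> (\<phi> x) = x" "\<phi> x \<in> V" if "x \<in> U" for x using that V by auto
  have right_inverse: "\<phi> (inv_into U \<phi> y) = y" if "y \<in> V" for y using that V(3) by (auto simp: f_inv_into_f)
  obtain \<psi>' where "\<And>y. y \<in> V \<Longrightarrow> (inv_into U \<phi> has_derivative blinfun_apply (\<psi>' y)) (at y)"
    by (rule C2alphaE[OF V(5)], rule that) assumption+
  note \<psi> = this[OF inverse(2)[OF x]]
  show ?thesis
  proof (rule that[OF \<psi>])
    show "\<psi>' (\<phi> x) (\<phi>' v) = v" for v by (rule derivative_of_left_inverse[OF \<phi> \<psi> V(1) x inverse(1)])
    show "\<phi>' (\<psi>' (\<phi> x) w) = w" for w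
      using derivative_of_left_inverse[OF \<psi> _ V(2) inverse(2)[OF x] right_inverse, of \<phi>'] \<phi>
      by (simp add: inverse(1)[OF x])
  qed
qed

lemma C2alpha_function_component:
  fixes \<phi> :: "real^'n::finite \<Rightarrow> real^'m::finite"
  assumes \<alpha>: "0 < \<alpha>" "\<alpha> \<le> 1" and R: "0 < R" and c: "\<bar>c\<bar> = 1"
    and \<phi>: "\<And>x. x \<in> ball p R \<Longrightarrow> (\<phi> has_derivative blinfun_apply (\<phi>' x)) (at x)"
      "\<And>x. x \<in> ball p R \<Longrightarrow> (\<phi>' has_derivative blinfun_apply (\<phi>'' x)) (at x)"
      "\<And>x y. x \<in> ball p R \<Longrightarrow> y \<in> ball p R \<Longrightarrow> norm (\<phi>'' x - \<phi>'' y) \<le> L * dist x y powr \<alpha>"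
  defines "K \<equiv> \<bar>L\<bar> + (norm (\<phi>'' p) + \<bar>L\<bar> * R powr \<alpha>)"
  shows "C2alpha_function \<alpha> K R p (\<lambda>x. c * \<phi> x $ i) (\<lambda>x v. c * \<phi>' x v $ i) (\<lambda>x w v. c * \<phi>'' x w v $ i)"
proof (rule C2alpha_function.intro)
  have L: "L \<le> K" using abs_ge_self[of L] by (simp add: K_def add_increasing2)
  fix x assume x: "x \<in> ball p R"
  show "((\<lambda>x. c * \<phi> x $ i) has_derivative (\<lambda>v. c * \<phi>' x v $ i)) (at x)"
    by (intro has_derivative_mult_right bounded_linear.has_derivative[OF bounded_linear_vec_nth] \<phi> x)
  show "((\<lambda>x. c * \<phi>' x v $ i) has_derivative (\<lambda>w. c * \<phi>'' x w v $ i)) (at x)" for v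
    by (intro has_derivative_mult_right \<phi> x
        bounded_linear.has_derivative[OF bounded_linear_compose[OF bounded_linear_vec_nth blinfun.bounded_linear_left]])
  show "linear (\<lambda>v. c * \<phi>'' x w v $ i)" for w
    by (intro linearI) (auto simp: blinfun.add_right blinfun.scaleR_right algebra_simps)
  show "\<bar>c * \<phi>'' x w v $ i - c * \<phi>'' y w v $ i\<bar> \<le> K * norm (x - y) powr \<alpha> * norm w * norm v"
    if y: "y \<in> ball p R" for y w v
  proof -
    have "norm (\<phi>'' x - \<phi>'' y) \<le> L * dist x y powr \<alpha>" by (rule \<phi>(3)[OF x y])
    also have "\<dots> \<le> K * dist x y powr \<alpha>" using L by (intro mult_right_mono) auto
    finally have "norm (\<phi>'' x - \<phi>'' y) * norm w * norm v \<le> K * norm (x - y) powr \<alpha> * norm w * norm v"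
      by (intro mult_right_mono) (auto simp: dist_norm)
    moreover have "\<bar>c * \<phi>'' x w v $ i - c * \<phi>'' y w v $ i\<bar> = \<bar>(\<phi>'' x - \<phi>'' y) w v $ i\<bar>"
      using c by (simp add: blinfun.diff_left abs_mult flip: right_diff_distrib)
    ultimately show ?thesis using abs_component_blinfun2_le[of "\<phi>'' x - \<phi>'' y" w v i] by linarith
  qed
  show "\<bar>c * \<phi>'' x w v $ i\<bar> \<le> K * norm w * norm v" for w v
  proof -
    have "norm (\<phi>'' x - \<phi>'' p) \<le> L * dist x p powr \<alpha>" using R by (intro \<phi>(3) x) simp
    also have "\<dots> \<le> \<bar>L\<bar> * R powr \<alpha>" using x \<alpha> by (intro mult_mono powr_mono2) (auto simp: dist_commute)
    finally have "norm (\<phi>'' x) \<le> K" using norm_triangle_sub[of "\<phi>'' x" "\<phi>'' p"] unfolding K_def by linarith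
    then have "norm (\<phi>'' x) * norm w * norm v \<le> K * norm w * norm v" by (intro mult_right_mono) auto
    then show ?thesis using abs_component_blinfun2_le[of "\<phi>'' x" w v i] c by (simp add: abs_mult)
  qed
qed (use \<alpha> R in \<open>auto simp: K_def\<close>)

definition (in C2alpha_graph) side :: "real \<Rightarrow> real \<Rightarrow> 'a set \<Rightarrow> 'a set" where
  "side \<tau> R A = {z\<in>A. norm z < R \<and> 0 < \<tau> * (z \<bullet> \<eta> - G z)}"

lemma (in C2alpha_graph) side_shift:
  assumes \<tau>: "\<bar>\<tau>\<bar> = 1" and t: "0 \<le> t" "norm z + t < R" "0 < \<tau> * (z \<bullet> \<eta> - G z) + t"
    and A: "z \<in> A" "\<And>z t. z \<in> A \<Longrightarrow> norm (z + t *\<^sub>R \<eta>) < R \<Longrightarrow> z + t *\<^sub>R \<eta> \<in> A"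
  shows "z + (\<tau> * t) *\<^sub>R \<eta> \<in> side \<tau> R A"
proof -
  have "norm (z + (\<tau> * t) *\<^sub>R \<eta>) \<le> norm z + t"
    using norm_triangle_ineq[of z "(\<tau> * t) *\<^sub>R \<eta>"] \<eta> \<tau> t(1) by (simp add: abs_mult)
  then have "norm (z + (\<tau> * t) *\<^sub>R \<eta>) < R" using t(2) by linarith
  moreover have "\<tau> * ((z + (\<tau> * t) *\<^sub>R \<eta>) \<bullet> \<eta> - G (z + (\<tau> * t) *\<^sub>R \<eta>)) = \<tau> * (z \<bullet> \<eta> - G z) + (\<tau> * \<tau>) * t"
    using \<eta> by (simp add: G_shift inner_add_left norm_eq_1 algebra_simps)
  moreover have "\<tau> * \<tau> = 1" using \<tau> by (metis abs_mult_self_eq mult_1)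
  ultimately show ?thesis using t(3) A by (simp add: side_def)
qed

lemma (in C2alpha_graph) connected_component_side_shift:
  assumes \<tau>: "\<bar>\<tau>\<bar> = 1" and z: "z \<in> side \<tau> R A" "0 \<le> \<delta>" "norm z + \<delta> < R"
    and A: "\<And>z t. z \<in> A \<Longrightarrow> norm (z + t *\<^sub>R \<eta>) < R \<Longrightarrow> z + t *\<^sub>R \<eta> \<in> A"
  shows "connected_component (side \<tau> R A) z (z + (\<tau> * \<delta>) *\<^sub>R \<eta>)"
  unfolding connected_component_def
proof (intro exI conjI)
  show "closed_segment z (z + (\<tau> * \<delta>) *\<^sub>R \<eta>) \<subseteq> side \<tau> R A"
  proof
    fix x assume "x \<in> closed_segment z (z + (\<tau> * \<delta>) *\<^sub>R \<eta>)"
    then obtain u where u: "0 \<le> u" "u \<le> 1" "x = z + (\<tau> * (u * \<delta>)) *\<^sub>R \<eta>"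
      by (auto simp: in_segment algebra_simps)
    moreover have "0 \<le> u * \<delta>" "u * \<delta> \<le> \<delta>" using u z(2) mult_left_le_one_le[of \<delta> u] by auto
    ultimately show "x \<in> side \<tau> R A"
      using z A side_shift[OF \<tau>, of "u * \<delta>" z R A] by (simp add: side_def add_pos_nonneg)
  qed
qed auto

lemma (in C2alpha_graph) side_connected:
  assumes R: "0 < R" and A: "convex A" "\<And>z t. z \<in> A \<Longrightarrow> norm (z + t *\<^sub>R \<eta>) < R \<Longrightarrow> z + t *\<^sub>R \<eta> \<in> A"
  obtains r' where "0 < r'" "r' \<le> R"
    "\<And>\<tau> z1 z2. \<bar>\<tau>\<bar> = 1 \<Longrightarrow> z1 \<in> side \<tau> r' A \<Longrightarrow> z2 \<in> side \<tau> r' A \<Longrightarrow> connected_component (side \<tau> R A) z1 z2"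
proof -
  define \<delta> where "\<delta> = R / 4"
  have \<delta>: "0 < \<delta>" using R by (simp add: \<delta>_def)
  have "\<exists>d>0. \<forall>y. dist y 0 < d \<longrightarrow> dist (G y) (G 0) < \<delta> / 2"
    using continuous_G[of 0] r \<delta> unfolding continuous_at_eps_delta by (metis half_gt_zero norm_zero)
  then obtain \<delta>' where \<delta>': "0 < \<delta>'" "\<And>y. norm y < \<delta>' \<Longrightarrow> \<bar>G y\<bar> < \<delta> / 2" by (auto simp: G0)
  define r' where "r' = min \<delta>' (\<delta> / 2)"
  have r': "0 < r'" "r' \<le> \<delta>'" "r' \<le> \<delta> / 2" "r' \<le> R" using \<delta>' \<delta> by (auto simp: r'_def \<delta>_def)
  have shift: "z + (\<tau> * t) *\<^sub>R \<eta> \<in> side \<tau> R A"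
    if "\<bar>\<tau>\<bar> = 1" "z \<in> A" "norm z < r'" "0 \<le> t" "t \<le> \<delta>" "0 < \<tau> * (z \<bullet> \<eta> - G z) + t" for \<tau> z t
    using that r' \<delta> A(2) by (intro side_shift) (auto simp: \<delta>_def)
  have upwards: "connected_component (side \<tau> R A) z (z + (\<tau> * \<delta>) *\<^sub>R \<eta>)"
    if "\<bar>\<tau>\<bar> = 1" "z \<in> side \<tau> r' A" for \<tau> z
    using that r' \<delta> A(2) by (intro connected_component_side_shift) (auto simp: \<delta>_def side_def)
  have across: "connected_component (side \<tau> R A) (z1 + (\<tau> * \<delta>) *\<^sub>R \<eta>) (z2 + (\<tau> * \<delta>) *\<^sub>R \<eta>)"
    if \<tau>: "\<bar>\<tau>\<bar> = 1" and z: "z1 \<in> side \<tau> r' A" "z2 \<in> side \<tau> r' A" for \<tau> z1 z2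
    unfolding connected_component_def
  proof (intro exI conjI)
    let ?T = "(\<lambda>w. (\<tau> * \<delta>) *\<^sub>R \<eta> + w) ` (A \<inter> ball 0 r')"
    show "connected ?T" by (intro convex_connected convex_translation convex_Int A convex_ball)
    show "z1 + (\<tau> * \<delta>) *\<^sub>R \<eta> \<in> ?T" "z2 + (\<tau> * \<delta>) *\<^sub>R \<eta> \<in> ?T" using z by (auto simp: side_def add.commute)
    have "0 < \<tau> * (w \<bullet> \<eta> - G w) + \<delta>" if w: "norm w < r'" for w
    proof -
      have "\<bar>w \<bullet> \<eta>\<bar> \<le> norm w" using Cauchy_Schwarz_ineq2[of w \<eta>] \<eta> by simp
      then have "\<bar>\<tau> * (w \<bullet> \<eta> - G w)\<bar> < \<delta>" using \<delta>'(2)[of w] w r' \<tau> by (simp add: abs_mult)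
      then show ?thesis by linarith
    qed
    then show "?T \<subseteq> side \<tau> R A" using shift[OF \<tau>, of _ \<delta>] \<delta> by (auto simp: add.commute)
  qed
  have "connected_component (side \<tau> R A) z1 z2" if "\<bar>\<tau>\<bar> = 1" "z1 \<in> side \<tau> r' A" "z2 \<in> side \<tau> r' A" for \<tau> z1 z2
    using upwards[OF that(1,2)] across[OF that] connected_component_sym[OF upwards[OF that(1,3)]] connected_component_trans by metis
  then show ?thesis using that[OF r'(1,4)] by blast
qed

lemma mem_iff_of_connected_component:
  fixes E :: "'a::real_normed_vector set"
  assumes "connected_component S z1 z2" and avoids: "\<And>z. z \<in> S \<Longrightarrow> p + z \<notin> frontier E"
  shows "p + z1 \<in> E \<longleftrightarrow> p + z2 \<in> E"
proof -
  obtain T where T: "connected T" "T \<subseteq> S" "z1 \<in> T" "z2 \<in> T"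
    using assms(1) by (auto simp: connected_component_def)
  have "connected ((+) p ` T)" using T(1) by (intro connected_continuous_image continuous_intros)
  moreover have "(+) p ` T \<inter> frontier E = {}" using T(2) avoids by blast
  moreover have "p + z1 \<in> (+) p ` T" "p + z2 \<in> (+) p ` T" using T by auto
  ultimately show ?thesis using connected_Int_frontier[of "(+) p ` T" E] by blast
qed

lemma (in C2alpha_graph) graph_point_not_mem:
  assumes E: "open E" and not_above: "\<And>z. norm z < R \<Longrightarrow> p + z \<in> E \<Longrightarrow> z \<bullet> \<eta> \<le> G z"
    and z: "norm z < R" "z \<bullet> \<eta> = G z"
  shows "p + z \<notin> E"
proof
  assume "p + z \<in> E"
  have "((\<lambda>t. z + t *\<^sub>R \<eta>) \<longlongrightarrow> z + 0 *\<^sub>R \<eta>) (at_right 0)" by (intro tendsto_intros)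
  then have lim: "((\<lambda>t. z + t *\<^sub>R \<eta>) \<longlongrightarrow> z) (at_right 0)" by simp
  have "eventually (\<lambda>t. p + (z + t *\<^sub>R \<eta>) \<in> E) (at_right 0)"
    using topological_tendstoD[OF tendsto_add[OF tendsto_const lim] E] \<open>p + z \<in> E\<close> by simp
  moreover have "eventually (\<lambda>t. norm (z + t *\<^sub>R \<eta>) < R) (at_right 0)"
    using order_tendstoD(2)[OF tendsto_norm[OF lim] z(1)] .
  ultimately have "eventually (\<lambda>t::real. False) (at_right 0)"
    using eventually_at_right_less[of 0]
  proof eventually_elim
    case (elim t)
    moreover have "G (z + t *\<^sub>R \<eta>) < (z + t *\<^sub>R \<eta>) \<bullet> \<eta>"
      using z(2) elim(3) \<eta> by (simp add: G_shift inner_add_left norm_eq_1)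
    ultimately show False using not_above[of "z + t *\<^sub>R \<eta>"] by simp
  qed
  then show False by simp
qed

lemma height_shift:
  fixes p z \<eta> :: "real^'n::finite"
  assumes "r \<le> p $ k \<or> \<eta> $ k = 0" "0 < (p + z) $ k" "norm (z + t *\<^sub>R \<eta>) < r"
  shows "0 < (p + (z + t *\<^sub>R \<eta>)) $ k"
proof (cases "\<eta> $ k = 0")
  case False
  have "\<bar>(z + t *\<^sub>R \<eta>) $ k\<bar> < r" using component_le_norm_cart[of "z + t *\<^sub>R \<eta>" k] assms(3) by linarith
  moreover have "(p + (z + t *\<^sub>R \<eta>)) $ k = p $ k + (z + t *\<^sub>R \<eta>) $ k" by simp
  ultimately show ?thesis using assms(1) False by linarith
qed (use assms in simp)

locale capillary =
  fixes s \<alpha> \<sigma> :: real and k :: "'n::finite" and E M :: "(real^'n) set" and nu :: "real^'n \<Rightarrow> real^'n"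
  assumes n2: "CARD('n) \<ge> 2"
    and s01: "0 < s" "s < 1"
    and alpha: "s < \<alpha>" "\<alpha> < 1"
    and E_open: "open E" and E_bdd: "bounded E"
    and E_sub: "E \<subseteq> halfspace k"
    and M_def: "M = closure (frontier E \<inter> halfspace k)"
    and M_hyp: "C2alpha_hypersurface_with_boundary \<alpha> M (M \<inter> {x. x $ k = 0})"
    and nu: "outer_unit_normal k E M nu"
    and sigma: "-1 < \<sigma>" "\<sigma> < 1"
    and angle: "\<forall>q \<in> M \<inter> {x. x $ k = 0}. nu q \<bullet> (- axis k 1) = \<sigma>"
begin

lemma nu_norm: "q \<in> M \<Longrightarrow> norm (nu q) = 1"
  using nu by (simp add: outer_unit_normal_def)

lemma nu_tangent: "q \<in> M \<Longrightarrow> ((\<lambda>x. (nu q \<bullet> (x - q)) / norm (x - q)) \<longlongrightarrow> 0) (at q within M)"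
  using nu by (simp add: outer_unit_normal_def)

lemma nu_continuous: "continuous_on M nu"
  using nu by (simp add: outer_unit_normal_def)

lemma nu_sides:
  assumes "q \<in> M" "0 < q $ k"
  shows "eventually (\<lambda>t. q + t *\<^sub>R nu q \<notin> E \<and> q - t *\<^sub>R nu q \<in> E) (at_right 0)"
proof -
  have "q \<in> M \<inter> halfspace k" using assms by (simp add: halfspace_def)
  then obtain r where "0 < r" "\<And>t. 0 < t \<and> t < r \<Longrightarrow> q + t *\<^sub>R nu q \<notin> E \<and> q - t *\<^sub>R nu q \<in> E"
    using nu unfolding outer_unit_normal_def by blast
  then show ?thesis by (intro eventually_at_rightI[of 0 r]) auto
qed

lemma E_height: "x \<in> E \<Longrightarrow> 0 < x $ k"
  using E_sub by (auto simp: halfspace_def)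

lemma M_closed: "closed M"
  by (simp add: M_def)

lemma frontier_in_M: "x \<in> frontier E \<Longrightarrow> 0 < x $ k \<Longrightarrow> x \<in> M"
  unfolding M_def using closure_subset by (force simp: halfspace_def)

lemma M_height: "q \<in> M \<Longrightarrow> 0 \<le> q $ k"
proof -
  assume "q \<in> M"
  moreover have "M \<subseteq> {x. 0 \<le> x $ k}" unfolding M_def
    by (intro closure_minimal) (auto simp: halfspace_def closed_halfspace_component_ge_cart)
  ultimately show ?thesis by auto
qed

lemma M_closure: "q \<in> M \<Longrightarrow> q \<in> closure E"
proof -
  assume "q \<in> M"
  moreover have "M \<subseteq> closure E" unfolding M_def
    by (intro closure_minimal) (auto simp: frontier_def)
  ultimately show ?thesis by auto
qed

lemma chart_component:
  assumes p0: "p0 \<in> M"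
  obtains U i a L and \<phi> :: "real^'n \<Rightarrow> real^'n" and \<phi>' \<phi>'' where "open U" "p0 \<in> U" "a \<noteq> 0"
    "\<And>x. x \<in> U \<Longrightarrow> (\<phi> has_derivative blinfun_apply (\<phi>' x)) (at x)"
    "\<And>x. x \<in> U \<Longrightarrow> (\<phi>' has_derivative blinfun_apply (\<phi>'' x)) (at x)"
    "\<And>x y. x \<in> U \<Longrightarrow> y \<in> U \<Longrightarrow> norm (\<phi>'' x - \<phi>'' y) \<le> L * dist x y powr \<alpha>"
    "\<And>h. blinfun_apply (\<phi>' p0) h $ i = a * (nu p0 \<bullet> h)" "\<And>q. q \<in> M \<Longrightarrow> q \<in> U \<Longrightarrow> \<phi> q $ i = 0"
proof -
  obtain U V \<phi> i j
    where U: "p0 \<in> U" "C2alpha_diffeo \<alpha> \<phi> U V" and M: "\<phi> ` (M \<inter> U) = V \<inter> {y. y $ i = 0 \<and> y $ j \<ge> 0}"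
    using bspec[OF conjunct2[OF M_hyp[unfolded C2alpha_hypersurface_with_boundary_def]] p0]
    by (elim exE conjE)
  define \<psi> where "\<psi> = inv_into U \<phi>"
  have V: "open U" "open V" "\<phi> ` U = V" "inj_on \<phi> U" "C2alpha \<alpha> \<phi> U"
    using U(2) by (auto simp: C2alpha_diffeo_def \<psi>_def)
  obtain \<phi>' \<phi>'' L where \<phi>: "\<And>x. x \<in> U \<Longrightarrow> (\<phi> has_derivative blinfun_apply (\<phi>' x)) (at x)"
    "\<And>x. x \<in> U \<Longrightarrow> (\<phi>' has_derivative blinfun_apply (\<phi>'' x)) (at x)"
    "\<And>x y. x \<in> U \<Longrightarrow> y \<in> U \<Longrightarrow> norm (\<phi>'' x - \<phi>'' y) \<le> L * dist x y powr \<alpha>"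
    by (rule C2alphaE[OF V(5)], rule that) assumption+
  obtain \<psi>' where \<psi>: "(\<psi> has_derivative \<psi>') (at (\<phi> p0))"
    and left: "\<And>v. \<psi>' (\<phi>' p0 v) = v" and right: "\<And>w. \<phi>' p0 (\<psi>' w) = w"
    by (rule C2alpha_diffeo_inverse_derivative[OF U(2,1) \<phi>(1)[OF U(1)], folded \<psi>_def], rule that) assumption+
  have inverse: "\<psi> (\<phi> x) = x" "\<phi> x \<in> V" if "x \<in> U" for x using that V by (auto simp: \<psi>_def)
  have y0: "\<phi> p0 \<in> V" "\<phi> p0 $ i = 0" "0 \<le> \<phi> p0 $ j" using inverse(2)[OF U(1)] M p0 U(1) by auto
  have kernel: "nu p0 \<bullet> v = 0" if v: "\<phi>' p0 v $ i = 0" for v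
  proof -
    have "y \<bullet> axis i 1 = 0 \<longrightarrow> 0 \<le> y \<bullet> axis j 1 \<longrightarrow> \<psi> y \<in> M" if "y \<in> V" for y
      using that M inverse(1)
      by (auto simp: inner_axis) (metis (mono_tags, lifting) IntE IntI imageE mem_Collect_eq)
    then have "eventually (\<lambda>y. y \<bullet> axis i 1 = 0 \<longrightarrow> 0 \<le> y \<bullet> axis j 1 \<longrightarrow> \<psi> y \<in> M) (nhds (\<phi> p0))"
      using eventually_nhds_in_open[OF V(2) y0(1)] by (rule eventually_mono[rotated])
    from tangent_orthogonal_patch[OF _ \<psi> _ _ this, of "nu p0" "\<phi>' p0 v"]
    show ?thesis using nu_tangent[OF p0] y0 v by (simp add: inverse(1)[OF U(1)] inner_axis left)
  qed
  have linear: "linear (\<lambda>h. \<phi>' p0 h $ i)"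
    by (intro linearI) (simp_all add: blinfun.add_right blinfun.scaleR_right)
  have "\<phi>' p0 (\<psi>' (axis i 1)) $ i \<noteq> 0" by (simp add: right)
  note eq = linear_functional_eq_inner_of_kernel[OF linear nu_norm[OF p0] this kernel]
  show ?thesis
    by (rule that[OF V(1) U(1) eq(1) \<phi> eq(2)]) (use M in auto)
qed

lemma defining_function:
  assumes p0: "p0 \<in> M"
  obtains K R a and f :: "real^'n \<Rightarrow> real" and f' f'' where "C2alpha_function \<alpha> K R p0 f f' f''" "0 < a"
    "\<And>v. f' p0 v = a * (nu p0 \<bullet> v)" "\<And>q. q \<in> M \<Longrightarrow> q \<in> ball p0 R \<Longrightarrow> f q = 0 \<and> 0 < f' q (nu q)"
proof -
  obtain U i a L and \<phi> :: "real^'n \<Rightarrow> real^'n" and \<phi>' \<phi>'' where U: "open U" "p0 \<in> U" and a: "a \<noteq> 0"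
    and \<phi>: "\<And>x. x \<in> U \<Longrightarrow> (\<phi> has_derivative blinfun_apply (\<phi>' x)) (at x)"
      "\<And>x. x \<in> U \<Longrightarrow> (\<phi>' has_derivative blinfun_apply (\<phi>'' x)) (at x)"
      "\<And>x y. x \<in> U \<Longrightarrow> y \<in> U \<Longrightarrow> norm (\<phi>'' x - \<phi>'' y) \<le> L * dist x y powr \<alpha>"
    and gradient: "\<And>h. blinfun_apply (\<phi>' p0) h $ i = a * (nu p0 \<bullet> h)"
    and zero: "\<And>q. q \<in> M \<Longrightarrow> q \<in> U \<Longrightarrow> \<phi> q $ i = 0"
    by (rule chart_component[OF p0], rule that) assumption+
  define f' where "f' = (\<lambda>x v. sgn a * \<phi>' x v $ i)"
  have f'_p0: "f' p0 v = \<bar>a\<bar> * (nu p0 \<bullet> v)" for v by (simp add: f'_def gradient abs_sgn)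
  have "continuous (at p0 within M) \<phi>'"
    using has_derivative_continuous[OF \<phi>(2)[OF U(2)]] continuous_at_imp_continuous_at_within by blast
  moreover have "continuous (at p0 within M) nu"
    using nu_continuous p0 by (simp add: continuous_on_eq_continuous_within)
  ultimately have "((\<lambda>q. f' q (nu q)) \<longlongrightarrow> f' p0 (nu p0)) (at p0 within M)"
    unfolding continuous_within f'_def by (intro tendsto_intros) auto
  moreover have positive: "0 < f' p0 (nu p0)" using a nu_norm[OF p0] by (simp add: f'_p0 norm_eq_1)
  ultimately have "eventually (\<lambda>q. 0 < f' q (nu q)) (at p0 within M)" by (rule order_tendstoD)
  then obtain \<rho> where \<rho>: "0 < \<rho>" "\<And>q. q \<in> M \<Longrightarrow> q \<noteq> p0 \<Longrightarrow> dist q p0 < \<rho> \<Longrightarrow> 0 < f' q (nu q)"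
    unfolding eventually_at by blast
  obtain R0 where R0: "0 < R0" "ball p0 R0 \<subseteq> U" using U openE by blast
  define R where "R = min R0 \<rho>"
  have R: "0 < R" "\<And>x. x \<in> ball p0 R \<Longrightarrow> x \<in> U" using R0 \<rho>(1) by (auto simp: R_def)
  show ?thesis
  proof (rule that)
    show "C2alpha_function \<alpha> (\<bar>L\<bar> + (norm (\<phi>'' p0) + \<bar>L\<bar> * R powr \<alpha>)) R p0 (\<lambda>x. sgn a * \<phi> x $ i) f' (\<lambda>x w v. sgn a * \<phi>'' x w v $ i)"
      unfolding f'_def using s01 alpha a R \<phi> by (intro C2alpha_function_component) (auto simp: abs_sgn_eq)
    show "sgn a * \<phi> q $ i = 0 \<and> 0 < f' q (nu q)" if "q \<in> M" "q \<in> ball p0 R" for q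
      using zero[of q] R(2) \<rho>(2)[of q] positive that by (auto simp: R_def dist_commute)
  qed (use a f'_p0 in auto)
qed

lemma subgraph_near:
  assumes graph: "C2alpha_graph \<alpha> r \<Lambda> \<eta> G G' B" and vertical: "r \<le> p0 $ k \<or> \<eta> $ k = 0"
    and frontier: "\<And>z. norm z < r \<Longrightarrow> 0 < (p0 + z) $ k \<Longrightarrow> p0 + z \<in> frontier E \<Longrightarrow> z \<bullet> \<eta> = G z"
    and inside: "\<And>\<rho>. 0 < \<rho> \<Longrightarrow> \<exists>z. norm z < \<rho> \<and> p0 + z \<in> E \<and> z \<bullet> \<eta> < G z"
    and outside: "\<And>\<rho>. 0 < \<rho> \<Longrightarrow> \<exists>z. norm z < \<rho> \<and> 0 < (p0 + z) $ k \<and> p0 + z \<notin> E \<and> G z < z \<bullet> \<eta>"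
  obtains r' where "0 < r'" "r' \<le> r" "\<And>z. norm z < r' \<Longrightarrow> 0 < (p0 + z) $ k \<Longrightarrow> p0 + z \<in> E \<longleftrightarrow> z \<bullet> \<eta> < G z"
proof -
  interpret C2alpha_graph \<alpha> r \<Lambda> \<eta> G G' B by (rule graph)
  define A where "A = {z. 0 < (p0 + z) $ k}"
  have "A = {z. - (p0 $ k) < axis k 1 \<bullet> z}" by (auto simp: A_def inner_axis')
  then have "convex A" by (simp only: convex_halfspace_gt)
  moreover have "z + t *\<^sub>R \<eta> \<in> A" if "z \<in> A" "norm (z + t *\<^sub>R \<eta>) < r" for z t
    using height_shift[OF vertical _ that(2)] that(1) by (simp add: A_def)
  ultimately obtain r' where r': "0 < r'" "r' \<le> r" and connected:
    "\<And>\<tau> z1 z2. \<bar>\<tau>\<bar> = 1 \<Longrightarrow> z1 \<in> side \<tau> r' A \<Longrightarrow> z2 \<in> side \<tau> r' A \<Longrightarrow> connected_component (side \<tau> r A) z1 z2"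
    using side_connected[OF r(1)] by metis
  have same: "p0 + z1 \<in> E \<longleftrightarrow> p0 + z2 \<in> E" if "\<bar>\<tau>\<bar> = 1" "z1 \<in> side \<tau> r' A" "z2 \<in> side \<tau> r' A" for \<tau> z1 z2
    by (rule mem_iff_of_connected_component[OF connected[OF that]]) (use frontier in \<open>force simp: side_def A_def\<close>)
  obtain zin where "norm zin < r'" "p0 + zin \<in> E" "zin \<bullet> \<eta> < G zin" using inside[OF r'(1)] by blast
  then have below: "p0 + z \<in> E" if "norm z < r'" "0 < (p0 + z) $ k" "z \<bullet> \<eta> < G z" for z
    using same[of "-1" zin z] E_height[of "p0 + zin"] that by (simp add: side_def A_def)
  obtain zout where "norm zout < r'" "0 < (p0 + zout) $ k" "p0 + zout \<notin> E" "G zout < zout \<bullet> \<eta>"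
    using outside[OF r'(1)] by blast
  then have above: "p0 + z \<notin> E" if "norm z < r'" "0 < (p0 + z) $ k" "G z < z \<bullet> \<eta>" for z
    using same[of 1 zout z] that by (simp add: side_def A_def)
  then have not_above: "z \<bullet> \<eta> \<le> G z" if "norm z < r'" "p0 + z \<in> E" for z
    using above[OF that(1)] E_height that(2) by (meson not_le)
  have "p0 + z \<notin> E" if "norm z < r'" "z \<bullet> \<eta> = G z" for z
    using graph_point_not_mem[OF E_open not_above that] .
  then show ?thesis using below above by (intro that[OF r']) (metis linorder_less_linear)
qed

lemma points_on_both_sides:
  fixes f :: "real^'n \<Rightarrow> real"
  assumes p0: "p0 \<in> M" and f: "\<And>x. x \<in> ball p0 R \<Longrightarrow> (f has_derivative f' x) (at x)"
      "\<And>q. q \<in> M \<Longrightarrow> q \<in> ball p0 R \<Longrightarrow> f q = 0 \<and> 0 < f' q (nu q)"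
    and \<rho>: "0 < \<rho>" "0 < R"
  obtains x y where "norm x < \<rho>" "p0 + x \<in> E" "f (p0 + x) < 0"
    "norm y < \<rho>" "0 < (p0 + y) $ k" "p0 + y \<notin> E" "0 < f (p0 + y)"
proof -
  obtain q where q: "q \<in> frontier E" "0 < q $ k" "dist q p0 < \<rho>" "dist q p0 < R"
    using p0 closure_approachable[of p0 "frontier E \<inter> halfspace k"] \<rho>
    unfolding M_def halfspace_def by (metis (no_types, lifting) IntE mem_Collect_eq min_less_iff_conj)
  have qM: "q \<in> M" using frontier_in_M q by simp
  have fq: "f q = 0" "0 < f' q (nu q)" "(f has_derivative f' q) (at q)"
    using f qM q(4) by (auto simp: dist_commute)
  have D: "((\<lambda>t. f (q + t *\<^sub>R nu q)) has_real_derivative f' q (nu q)) (at 0)"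
    using has_real_derivative_along_line[of f "f' q" q 0 "nu q"] fq(3) by simp
  have "eventually (\<lambda>t. 0 < f (q + t *\<^sub>R nu q)) (at_right 0)"
    using DERIV_pos_inc_right[OF D fq(2)] fq(1) unfolding eventually_at_right_field by auto
  moreover have "eventually (\<lambda>t. f (q - t *\<^sub>R nu q) < 0) (at_right 0)"
    using DERIV_pos_inc_left[OF D fq(2)] fq(1) unfolding eventually_at_right_field by auto
  moreover have "eventually (\<lambda>t. norm (q + t *\<^sub>R nu q - p0) < \<rho> \<and> norm (q - t *\<^sub>R nu q - p0) < \<rho> \<and> 0 < (q + t *\<^sub>R nu q) $ k) (at_right 0)"
  proof (intro eventually_conj)
    have "((\<lambda>t. norm (q + t *\<^sub>R nu q - p0)) \<longlongrightarrow> norm (q + 0 *\<^sub>R nu q - p0)) (at_right 0)"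
      "((\<lambda>t. norm (q - t *\<^sub>R nu q - p0)) \<longlongrightarrow> norm (q - 0 *\<^sub>R nu q - p0)) (at_right 0)"
      "((\<lambda>t. (q + t *\<^sub>R nu q) $ k) \<longlongrightarrow> (q + 0 *\<^sub>R nu q) $ k) (at_right 0)"
      by (intro tendsto_intros)+
    then show "eventually (\<lambda>t. norm (q + t *\<^sub>R nu q - p0) < \<rho>) (at_right 0)"
      "eventually (\<lambda>t. norm (q - t *\<^sub>R nu q - p0) < \<rho>) (at_right 0)"
      "eventually (\<lambda>t. 0 < (q + t *\<^sub>R nu q) $ k) (at_right 0)"
      using q by (auto intro: order_tendstoD simp: dist_norm)
  qed
  ultimately have "eventually (\<lambda>t. norm (q - t *\<^sub>R nu q - p0) < \<rho> \<and> q - t *\<^sub>R nu q \<in> E \<and> f (q - t *\<^sub>R nu q) < 0 \<and>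
      norm (q + t *\<^sub>R nu q - p0) < \<rho> \<and> 0 < (q + t *\<^sub>R nu q) $ k \<and> q + t *\<^sub>R nu q \<notin> E \<and> 0 < f (q + t *\<^sub>R nu q)) (at_right 0)"
    using nu_sides[OF qM q(2)] by eventually_elim simp
  then obtain t where "norm (q - t *\<^sub>R nu q - p0) < \<rho>" "q - t *\<^sub>R nu q \<in> E" "f (q - t *\<^sub>R nu q) < 0"
      "norm (q + t *\<^sub>R nu q - p0) < \<rho>" "0 < (q + t *\<^sub>R nu q) $ k" "q + t *\<^sub>R nu q \<notin> E" "0 < f (q + t *\<^sub>R nu q)"
    using eventually_happens'[OF trivial_limit_at_right_real] by blast
  then show ?thesis by (intro that[of "q - t *\<^sub>R nu q - p0" "q + t *\<^sub>R nu q - p0"]) simp_all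
qed

end

abbreviation frac_potential :: "real \<Rightarrow> real \<Rightarrow> (real^'n::finite) set \<Rightarrow> real^'n \<Rightarrow> real" where
  "frac_potential s \<rho> E q \<equiv> trunc_potential (real CARD('n) + s) \<rho> E q"

abbreviation near_frac_potential :: "real \<Rightarrow> real \<Rightarrow> real \<Rightarrow> (real^'n::finite) set \<Rightarrow> real^'n \<Rightarrow> real" where
  "near_frac_potential s \<epsilon> \<rho> E q \<equiv> near_potential (real CARD('n) + s) \<epsilon> \<rho> E q"

locale capillary_graph = capillary s \<alpha> \<sigma> k E M nu + C2alpha_graph \<alpha> r \<Lambda> \<eta> G G' B
  for s \<alpha> \<sigma> :: real and k :: "'n::finite" and E M :: "(real^'n) set" and nu :: "real^'n \<Rightarrow> real^'n"
    and r \<Lambda> :: real and \<eta> :: "real^'n" and G :: "real^'n \<Rightarrow> real"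
    and G' :: "real^'n \<Rightarrow> real^'n \<Rightarrow> real" and B :: "real^'n \<Rightarrow> real^'n \<Rightarrow> real^'n \<Rightarrow> real" +
  fixes p0 :: "real^'n"
  assumes p0M: "p0 \<in> M"
    and E_iff: "\<And>z. norm z < r \<Longrightarrow> 0 < (p0 + z) $ k \<Longrightarrow> p0 + z \<in> E \<longleftrightarrow> z \<bullet> \<eta> < G z"
    and G'_zero: "\<And>v. G' 0 v = - (nu p0 \<bullet> perp \<eta> v) / (nu p0 \<bullet> \<eta>)"
    and heights: "(0 < p0 $ k \<and> r \<le> p0 $ k) \<or> (p0 $ k = 0 \<and> \<eta> $ k = 0)"
begin

lemma frontier_graph:
  assumes z: "norm z < r" "0 < (p0 + z) $ k" "z \<bullet> \<eta> = G z"
  shows "p0 + z \<in> frontier E"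
proof -
  have "p0 + z \<notin> E" using E_iff[OF z(1,2)] z(3) by simp
  moreover have "p0 + z \<in> closure E"
  proof (rule Lim_in_closed_set[of _ "\<lambda>t. p0 + (z + (- t) *\<^sub>R \<eta>)" "at_right 0"])
    have "((\<lambda>t. z + (- t) *\<^sub>R \<eta>) \<longlongrightarrow> z + (- 0) *\<^sub>R \<eta>) (at_right 0)" by (intro tendsto_intros)
    then have lim: "((\<lambda>t. z + (- t) *\<^sub>R \<eta>) \<longlongrightarrow> z) (at_right 0)" by simp
    show "((\<lambda>t. p0 + (z + (- t) *\<^sub>R \<eta>)) \<longlongrightarrow> p0 + z) (at_right 0)" using tendsto_add[OF tendsto_const lim] .
    show "eventually (\<lambda>t. p0 + (z + (- t) *\<^sub>R \<eta>) \<in> closure E) (at_right 0)"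
      using order_tendstoD(2)[OF tendsto_norm[OF lim] z(1)] eventually_at_right_less[of 0]
    proof eventually_elim
      case (elim t)
      have "(z + (- t) *\<^sub>R \<eta>) \<bullet> \<eta> < G (z + (- t) *\<^sub>R \<eta>)"
        unfolding G_shift using elim(2) z(3) \<eta> by (simp add: inner_diff_left norm_eq_1)
      moreover have "0 < (p0 + (z + (- t) *\<^sub>R \<eta>)) $ k"
        using heights by (intro height_shift[OF _ z(2) elim(1)]) auto
      ultimately have "p0 + (z + (- t) *\<^sub>R \<eta>) \<in> E" using E_iff[OF elim(1)] by blast
      then show ?case using closure_subset by blast
    qed
  qed auto
  ultimately show ?thesis using E_open by (simp add: frontier_def interior_open)
qed

lemma frontier_graph_converse:
  assumes z: "norm z < r" "0 < (p0 + z) $ k" "p0 + z \<in> frontier E"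
  shows "z \<bullet> \<eta> = G z"
proof (rule antisym)
  show "G z \<le> z \<bullet> \<eta>" using E_iff[OF z(1,2)] z(3) E_open by (force simp: frontier_def interior_open)
  show "z \<bullet> \<eta> \<le> G z"
  proof (rule ccontr)
    assume "\<not> z \<bullet> \<eta> \<le> G z"
    moreover have "isCont (\<lambda>w. w \<bullet> \<eta> - G w) z" by (intro continuous_intros continuous_G z(1))
    ultimately have "eventually (\<lambda>w. 0 < w \<bullet> \<eta> - G w) (nhds z)"
      using order_tendstoD(1)[of "\<lambda>w. w \<bullet> \<eta> - G w" "z \<bullet> \<eta> - G z" "nhds z" 0]
        tendsto_at_iff_tendsto_nhds[of "\<lambda>w. w \<bullet> \<eta> - G w" z] by (simp add: isCont_def)
    moreover have "eventually (\<lambda>w. norm w < r) (nhds z)"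
      using order_tendstoD(2)[OF tendsto_norm[OF filterlim_ident] z(1)] .
    ultimately have "eventually (\<lambda>w. 0 < w \<bullet> \<eta> - G w \<and> norm w < r) (nhds z)" by (rule eventually_conj)
    then obtain S where S: "open S" "z \<in> S" "\<And>w. w \<in> S \<Longrightarrow> 0 < w \<bullet> \<eta> - G w \<and> norm w < r"
      unfolding eventually_nhds by blast
    have "p0 + w \<notin> E" if "w \<in> S" for w using E_iff[of w] S(3)[OF that] E_height[of "p0 + w"] by auto
    then have "(+) p0 ` S \<inter> E = {}" by auto
    then have "(+) p0 ` S \<inter> closure E = {}"
      using open_Int_closure_eq_empty[OF open_translation[OF S(1)]] by blast
    then show False using S(2) z(3) by (auto simp: frontier_def)
  qed
qed

lemma E_iff_recentered:
  assumes "w \<bullet> \<eta> = G w" "norm (w + z) < r" "0 < (p0 + (w + z)) $ k"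
  shows "p0 + w + z \<in> E \<longleftrightarrow> z \<bullet> \<eta> < recentered G w (perp \<eta> z)"
  unfolding recentered_perp unfolding recentered_def
  using E_iff[OF assms(2,3)] assms(1) by (simp add: inner_add_left add.assoc) linarith

lemma E_iff_at_boundary:
  assumes "p0 $ k = 0" "norm z < r"
  shows "p0 + z \<in> E \<longleftrightarrow> 0 < z \<bullet> axis k 1 \<and> z \<bullet> \<eta> < G z"
  using E_iff[OF assms(2)] E_height[of "p0 + z"] assms(1) by (auto simp: inner_axis)

end

context capillary
begin

lemma local_graph:
  assumes p0: "p0 \<in> M" and \<eta>: "norm \<eta> = 1" "0 < nu p0 \<bullet> \<eta>" and vertical: "0 < p0 $ k \<or> \<eta> $ k = 0"
  obtains r \<Lambda> G G' B where "capillary_graph s \<alpha> \<sigma> k E M nu r \<Lambda> \<eta> G G' B p0"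
proof -
  obtain K R a
    and f :: "real^'n \<Rightarrow> real" and f' f'' where f: "C2alpha_function \<alpha> K R p0 f f' f''" and a: "0 < a"
    and gradient: "\<And>v. f' p0 v = a * (nu p0 \<bullet> v)"
    and on_M: "\<And>q. q \<in> M \<Longrightarrow> q \<in> ball p0 R \<Longrightarrow> f q = 0 \<and> 0 < f' q (nu q)"
    by (rule defining_function[OF p0], rule that) assumption+
  have R: "0 < R" by (rule C2alpha_function.R[OF f])
  interpret implicit_graph \<alpha> K R p0 f f' f'' \<eta>
    by (intro implicit_graph.intro[OF f] implicit_graph_axioms.intro)
      (use \<eta> on_M[OF p0] R a in \<open>auto simp: gradient\<close>)
  obtain \<Lambda> where graph: "C2alpha_graph \<alpha> radius \<Lambda> \<eta> graph_height graph_slope graph_hessian"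
    by (rule C2alpha_graph_exists)
  define r where "r = (if 0 < p0 $ k then min radius (p0 $ k) else radius)"
  have r: "0 < r" "r \<le> radius" "0 < p0 $ k \<Longrightarrow> r \<le> p0 $ k" using radius_bounds by (auto simp: r_def)
  note sides = points_on_both_sides[OF p0 deriv on_M _ R]
  obtain r' where r': "0 < r'" "r' \<le> r"
    and E_iff: "\<And>z. norm z < r' \<Longrightarrow> 0 < (p0 + z) $ k \<Longrightarrow> p0 + z \<in> E \<longleftrightarrow> z \<bullet> \<eta> < graph_height z"
  proof (rule subgraph_near[OF C2alpha_graph_subset[OF graph r(1,2)], of p0])
    show "r \<le> p0 $ k \<or> \<eta> $ k = 0" using vertical r(3) by blast
    fix z assume z: "norm z < r" "0 < (p0 + z) $ k" "p0 + z \<in> frontier E"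
    have "norm z < R" using z(1) r(2) radius_bounds width_bounds by (simp add: height_def)
    then have "f (p0 + z) = 0" using on_M[OF frontier_in_M[OF z(3,2)]] by (simp add: dist_norm)
    then show "z \<bullet> \<eta> = graph_height z" using sign_iff_graph_height(2) z(1) r(2) by simp
  next
    fix \<rho> :: real assume "0 < \<rho>"
    then have "0 < min \<rho> radius" using radius_bounds by simp
    from sides[OF _ _ _ this] obtain x y where x: "norm x < min \<rho> radius" "p0 + x \<in> E" "f (p0 + x) < 0"
      and y: "norm y < min \<rho> radius" "0 < (p0 + y) $ k" "p0 + y \<notin> E" "0 < f (p0 + y)" by blast
    show "\<exists>z. norm z < \<rho> \<and> p0 + z \<in> E \<and> z \<bullet> \<eta> < graph_height z"
      using x sign_iff_graph_height(1)[of x] by auto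
    show "\<exists>z. norm z < \<rho> \<and> 0 < (p0 + z) $ k \<and> p0 + z \<notin> E \<and> graph_height z < z \<bullet> \<eta>"
      using y sign_iff_graph_height[of y] by (intro exI[of _ y]) auto
  qed (rule that; assumption)
  have "capillary_graph s \<alpha> \<sigma> k E M nu r' \<Lambda> \<eta> graph_height graph_slope graph_hessian p0"
  proof (intro capillary_graph.intro[OF capillary_axioms C2alpha_graph_subset[OF graph]] capillary_graph_axioms.intro)
    show "(0 < p0 $ k \<and> r' \<le> p0 $ k) \<or> (p0 $ k = 0 \<and> \<eta> $ k = 0)"
      using r(3) r' M_height[OF p0] vertical by fastforce
    show "graph_slope 0 v = - (nu p0 \<bullet> perp \<eta> v) / (nu p0 \<bullet> \<eta>)" for v
      using a by (simp add: graph_slope_zero gradient)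
  qed (use p0 r r' E_iff in auto)
  then show ?thesis by (rule that)
qed

lemma interior_graph:
  assumes p0: "p0 \<in> M" "0 < p0 $ k"
  obtains r \<Lambda> G G' B where "capillary_graph s \<alpha> \<sigma> k E M nu r \<Lambda> (nu p0) G G' B p0"
proof (rule local_graph[OF p0(1)])
  show "norm (nu p0) = 1" by (rule nu_norm[OF p0(1)])
  then show "0 < nu p0 \<bullet> nu p0" by (simp add: norm_eq_1)
qed (use p0 in auto)

text \<open>The normalised horizontal part of the normal: at points of \<open>\<partial>H\<close> the contact angle makes \<open>E\<close> a subgraph
  in this direction, over a half-space bounded by \<open>\<partial>H\<close>.\<close>
definition hnormal :: "real^'n \<Rightarrow> real^'n" where
  "hnormal q = (1 / sqrt (1 - \<sigma>\<^sup>2)) *\<^sub>R (nu q + \<sigma> *\<^sub>R axis k 1)"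

lemma sin_contact_angle_pos: "0 < sqrt (1 - \<sigma>\<^sup>2)"
  using sigma by (simp add: abs_square_less_1)

lemma nu_k: "q \<in> M \<Longrightarrow> q $ k = 0 \<Longrightarrow> nu q $ k = - \<sigma>"
  using angle by (auto simp: inner_axis)

lemma hnormal:
  assumes q: "q \<in> M" "q $ k = 0"
  shows "norm (hnormal q) = 1" "hnormal q $ k = 0" "nu q = sqrt (1 - \<sigma>\<^sup>2) *\<^sub>R hnormal q - \<sigma> *\<^sub>R axis k 1"
    "nu q \<bullet> hnormal q = sqrt (1 - \<sigma>\<^sup>2)"
proof -
  have unit: "nu q \<bullet> nu q = 1" using nu_norm[OF q(1)] by (simp add: norm_eq_1)
  have square: "sqrt (1 - \<sigma>\<^sup>2) * sqrt (1 - \<sigma>\<^sup>2) = 1 - \<sigma>\<^sup>2" using sin_contact_angle_pos by simp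
  show "hnormal q $ k = 0" using nu_k[OF q] by (simp add: hnormal_def)
  show "nu q = sqrt (1 - \<sigma>\<^sup>2) *\<^sub>R hnormal q - \<sigma> *\<^sub>R axis k 1"
    using sin_contact_angle_pos by (simp add: hnormal_def)
  have "(nu q + \<sigma> *\<^sub>R axis k 1) \<bullet> (nu q + \<sigma> *\<^sub>R axis k 1) = 1 - \<sigma>\<^sup>2"
    using unit nu_k[OF q]
    by (simp add: inner_add_left inner_add_right inner_axis inner_axis' inner_axis_axis power2_eq_square)
  then have "hnormal q \<bullet> hnormal q = 1"
    using square sin_contact_angle_pos unfolding hnormal_def inner_scaleR_left inner_scaleR_right by simp
  then show "norm (hnormal q) = 1" by (simp add: norm_eq_1)
  have "nu q \<bullet> (nu q + \<sigma> *\<^sub>R axis k 1) = 1 - \<sigma>\<^sup>2"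
    using unit nu_k[OF q] by (simp add: inner_add_right inner_axis power2_eq_square)
  then show "nu q \<bullet> hnormal q = sqrt (1 - \<sigma>\<^sup>2)"
    using sin_contact_angle_pos by (simp add: hnormal_def real_div_sqrt)
qed

lemma boundary_graph:
  assumes p0: "p0 \<in> M" "p0 $ k = 0"
  obtains r \<Lambda> G G' B where "capillary_graph s \<alpha> \<sigma> k E M nu r \<Lambda> (hnormal p0) G G' B p0"
  using local_graph[OF p0(1), of "hnormal p0"] hnormal[OF p0] sin_contact_angle_pos by metis

lemma E_borel: "E \<in> sets borel"
  using E_open by simp

lemma curvature_limit:
  assumes q: "q \<in> M" "0 < q $ k" and \<epsilon>: "\<And>j. 0 < \<epsilon> j" "\<epsilon> \<longlonglongrightarrow> 0"
  shows "(\<lambda>j. (LINT z|lborel. trunc_kernel (real CARD('n) + s) (\<epsilon> j) (z::real^'n)) - 2 * frac_potential s (\<epsilon> j) E q)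
    \<longlonglongrightarrow> frac_mean_curv s E q"
proof -
  obtain r \<Lambda> G G' B where "capillary_graph s \<alpha> \<sigma> k E M nu r \<Lambda> (nu q) G G' B q"
    by (rule interior_graph[OF q])
  then interpret graph: capillary_graph s \<alpha> \<sigma> k E M nu r \<Lambda> "nu q" G G' B q .
  have "integrable lborel (\<lambda>z. symmetrized_sign E q z * norm z powr (-(real CARD('n) + s)))"
  proof (rule integrable_symmetrized_kernel[where g=G and L="6 * \<Lambda>" and \<eta>="nu q" and r=r])
    fix z :: "real^'n" assume z: "norm z < r"
    have "0 < (q + z) $ k" using component_le_norm_cart[of z k] z graph.heights q by auto
    then show "q + z \<in> E \<longleftrightarrow> z \<bullet> nu q < G (perp (nu q) z)" using graph.E_iff[OF z] graph.G_perp by simp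
    show "\<bar>G z + G (- z)\<bar> \<le> 6 * \<Lambda> * (norm z)\<^sup>2" using graph.G_second_difference[of 0 z] z graph.G0 by simp
  qed (use n2 s01 E_borel graph.\<eta> graph.r graph.\<Lambda> in auto)
  then show ?thesis by (rule trunc_potential_tendsto_frac_mean_curv[OF s01(1) E_borel \<epsilon>])
qed

lemma curvature_difference_ge:
  assumes p: "p \<in> M" "0 < p $ k" and q: "q \<in> M" "0 < q $ k" and \<epsilon>0: "0 < \<epsilon>0"
    and lower: "\<And>\<epsilon>. 0 < \<epsilon> \<Longrightarrow> \<epsilon> \<le> \<epsilon>0 \<Longrightarrow> Y \<le> 2 * (frac_potential s \<epsilon> E q - frac_potential s \<epsilon> E p)"
  shows "Y \<le> \<bar>frac_mean_curv s E p - frac_mean_curv s E q\<bar>"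
proof -
  define \<epsilon> where "\<epsilon> = (\<lambda>j. \<epsilon>0 * inverse (real (Suc j)))"
  have pos: "0 < \<epsilon> j" "\<epsilon> j \<le> \<epsilon>0" for j using \<epsilon>0 by (auto simp: \<epsilon>_def field_simps)
  have "\<epsilon> \<longlonglongrightarrow> \<epsilon>0 * 0" unfolding \<epsilon>_def by (intro tendsto_mult tendsto_const LIMSEQ_inverse_real_of_nat)
  then have lim: "\<epsilon> \<longlonglongrightarrow> 0" by simp
  have "(\<lambda>j. 2 * (frac_potential s (\<epsilon> j) E q - frac_potential s (\<epsilon> j) E p)) \<longlonglongrightarrow> frac_mean_curv s E p - frac_mean_curv s E q"
    using tendsto_diff[OF curvature_limit[OF p pos(1) lim] curvature_limit[OF q pos(1) lim]]
    by (simp add: algebra_simps)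
  then have "Y \<le> frac_mean_curv s E p - frac_mean_curv s E q"
    by (rule LIMSEQ_le_const) (use lower[OF pos] in blast)
  then show ?thesis by linarith
qed

lemma curvature_difference_ge_near:
  assumes p: "p \<in> M" "0 < p $ k" and q: "q \<in> M" "0 < q $ k" and scales: "0 < \<epsilon>0" "0 < \<rho>"
    and near: "\<And>\<epsilon>. 0 < \<epsilon> \<Longrightarrow> \<epsilon> \<le> \<epsilon>0 \<Longrightarrow> \<bar>near_frac_potential s \<epsilon> \<rho> E p - near_frac_potential s \<epsilon> \<rho> E q\<bar> \<le> Z"
  shows "2 * (frac_potential s \<rho> E q - frac_potential s \<rho> E p) - 2 * Z \<le> \<bar>frac_mean_curv s E p - frac_mean_curv s E q\<bar>"
proof (rule curvature_difference_ge[OF p q scales(1)])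
  fix \<epsilon> :: real assume \<epsilon>: "0 < \<epsilon>" "\<epsilon> \<le> \<epsilon>0"
  have "real DIM(real^'n) < real CARD('n) + s" using s01 by simp
  note split = near_potential_eq[OF this \<epsilon>(1) scales(2) E_borel]
  show "2 * (frac_potential s \<rho> E q - frac_potential s \<rho> E p) - 2 * Z \<le> 2 * (frac_potential s \<epsilon> E q - frac_potential s \<epsilon> E p)"
    using near[OF \<epsilon>] unfolding split abs_le_iff right_diff_distrib by linarith
qed

end

context capillary_graph
begin

lemma G'_zero_at_boundary:
  assumes "p0 $ k = 0" "\<eta> = hnormal p0"
  shows "G' 0 v = \<sigma> / sqrt (1 - \<sigma>\<^sup>2) * v $ k"
proof -
  note h = hnormal[OF p0M assms(1), folded assms(2)]
  have "nu p0 \<bullet> perp \<eta> v = sqrt (1 - \<sigma>\<^sup>2) * (\<eta> \<bullet> perp \<eta> v) - \<sigma> * perp \<eta> v $ k"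
    by (subst h(3)) (simp add: inner_diff_left inner_axis')
  also have "\<eta> \<bullet> perp \<eta> v = 0" using inner_perp[OF \<eta>, of v] by (simp add: inner_commute)
  also have "perp \<eta> v $ k = v $ k" using h(2) by (simp add: perp_def)
  finally show ?thesis unfolding G'_zero h(4) by simp
qed

end

section \<open>Potentials at nearby boundary points\<close>

lemma power2_le_powr:
  fixes t \<alpha> :: real
  assumes "0 \<le> t" "t \<le> 1" "0 < \<alpha>" "\<alpha> \<le> 1"
  shows "t\<^sup>2 \<le> t powr (1 + \<alpha>)"
proof (cases "t = 0")
  case False
  have "t powr 2 \<le> t powr (1 + \<alpha>)" using assms by (intro powr_mono') auto
  then show ?thesis using assms False by (simp add: powr_numeral)
qed simp

lemma powr_add_le:
  fixes x y \<alpha> :: real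
  assumes "0 \<le> x" "0 \<le> y" "0 < \<alpha>" "\<alpha> \<le> 1"
  shows "(2 * x + y) powr \<alpha> \<le> 3 * (x powr \<alpha> + y powr \<alpha>)"
proof -
  define m where "m = max x y"
  have "(2 * x + y) powr \<alpha> \<le> (3 * m) powr \<alpha>" using assms by (intro powr_mono2) (auto simp: m_def)
  also have "\<dots> = 3 powr \<alpha> * m powr \<alpha>" using assms by (simp add: powr_mult m_def)
  also have "\<dots> \<le> 3 powr 1 * m powr \<alpha>" using assms by (intro mult_right_mono powr_mono) auto
  also have "m powr \<alpha> \<le> x powr \<alpha> + y powr \<alpha>" by (auto simp: m_def max_def)
  finally show ?thesis by simp
qed

text \<open>For orthonormal \<open>\<eta>\<close>, \<open>\<kappa>\<close> the isometry that fixes both and negates their orthogonal complement.\<close>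
definition half_turn :: "'a::real_inner \<Rightarrow> 'a \<Rightarrow> 'a \<Rightarrow> 'a" where
  "half_turn \<eta> \<kappa> z = - mirror \<eta> (mirror \<kappa> z)"

context
  fixes \<eta> \<kappa> :: "'a::euclidean_space"
  assumes orthonormal: "norm \<eta> = 1" "norm \<kappa> = 1" "\<kappa> \<bullet> \<eta> = 0"
begin

lemma half_turn_eq: "half_turn \<eta> \<kappa> z = (2 * (z \<bullet> \<eta>)) *\<^sub>R \<eta> + (2 * (z \<bullet> \<kappa>)) *\<^sub>R \<kappa> - z"
  using orthonormal by (simp add: half_turn_def mirror_def inner_diff_left)

lemma half_turn_shift: "half_turn \<eta> \<kappa> (z + u *\<^sub>R \<eta>) = half_turn \<eta> \<kappa> z + u *\<^sub>R \<eta>"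
proof -
  have "\<eta> \<bullet> \<eta> = 1" "\<eta> \<bullet> \<kappa> = 0" using orthonormal by (simp_all add: norm_eq_1 inner_commute)
  then show ?thesis by (simp add: half_turn_eq inner_add_left algebra_simps flip: scaleR_2)
qed

lemma half_turn_inner: "half_turn \<eta> \<kappa> z \<bullet> \<eta> = z \<bullet> \<eta>" "half_turn \<eta> \<kappa> z \<bullet> \<kappa> = z \<bullet> \<kappa>"
  using orthonormal
  by (simp_all add: half_turn_eq inner_add_left inner_diff_left norm_eq_1 inner_commute[of \<eta> \<kappa>])

lemma norm_half_turn: "norm (half_turn \<eta> \<kappa> z) = norm z"
  using orthonormal by (simp add: half_turn_def norm_mirror)

lemma borel_measurable_half_turn: "half_turn \<eta> \<kappa> \<in> borel \<rightarrow>\<^sub>M borel"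
  unfolding half_turn_def[abs_def]
  by (intro borel_measurable_uminus measurable_compose[OF borel_measurable_mirror] borel_measurable_mirror)

lemma distr_lborel_half_turn:
  assumes "2 \<le> DIM('a)"
  shows "distr lborel borel (half_turn \<eta> \<kappa>) = lborel"
  unfolding half_turn_def[abs_def]
  by (rule distr_lborel_compose[OF distr_lborel_compose[OF distr_lborel_mirror[OF orthonormal(2) assms]
        distr_lborel_mirror[OF orthonormal(1) assms]] distr_lborel_uminus])
    (auto intro: borel_measurable_mirror measurable_compose[OF borel_measurable_mirror])

end

context C2alpha_graph
begin

lemma recentered_odd:
  assumes "norm y + norm z < r"
  shows "\<bar>recentered G y z + recentered G y (- z)\<bar> \<le> 6 * \<Lambda> * norm z powr (1 + \<alpha>)"
proof -
  have "norm z \<le> 1" using assms r norm_ge_zero[of y] by linarith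
  then have "6 * \<Lambda> * (norm z)\<^sup>2 \<le> 6 * \<Lambda> * norm z powr (1 + \<alpha>)"
    using \<Lambda> \<alpha> by (intro mult_left_mono power2_le_powr) auto
  then show ?thesis using G_second_difference[OF assms] by (simp add: recentered_def)
qed

lemma recentered_increment:
  assumes "norm y + norm z < r"
  shows "\<bar>recentered G y z - G' 0 z\<bar> \<le> 3 * \<Lambda> * (norm y + norm z) * norm z"
  using G_increment[OF assms, of 0] r by (simp add: recentered_def)

lemma recentered_symmetry:
  assumes y: "norm y + norm z < r" "norm y \<le> 2 * h"
    and w: "norm w = norm z" "G' 0 w = G' 0 z" and h: "0 < h" "h \<le> 1"
  shows "\<bar>recentered G y z - recentered G y w\<bar> \<le> 12 * \<Lambda> * (norm z powr (1 + \<alpha>) + h powr \<alpha> * norm z)"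
proof -
  have z: "norm z \<le> 1" using y(1) r norm_ge_zero[of y] by linarith
  have "\<bar>recentered G y z - recentered G y w\<bar> \<le> 2 * (3 * \<Lambda> * (norm y + norm z) * norm z)"
    using recentered_increment[OF y(1)] recentered_increment[of y w] y(1) w by (simp add: abs_le_iff)
  also have "\<dots> = 6 * \<Lambda> * ((norm z)\<^sup>2 + norm y * norm z)" by (simp add: power2_eq_square algebra_simps)
  also have "\<dots> \<le> 6 * \<Lambda> * (norm z powr (1 + \<alpha>) + (2 * h powr \<alpha>) * norm z)"
    using \<Lambda> \<alpha> z h y(2) powr_mono'[of \<alpha> 1 h]
    by (intro mult_left_mono add_mono mult_right_mono power2_le_powr) auto
  also have "\<dots> \<le> 6 * \<Lambda> * (2 * norm z powr (1 + \<alpha>) + 2 * h powr \<alpha> * norm z)"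
    using \<Lambda> by (intro mult_left_mono) auto
  also have "\<dots> = 12 * \<Lambda> * (norm z powr (1 + \<alpha>) + h powr \<alpha> * norm z)" by (simp add: algebra_simps)
  finally show ?thesis .
qed

lemma recentered_subgraph_pair:
  assumes "2 \<le> DIM('a)" "0 < s" "s < \<alpha>" "\<alpha> < 1" "E1 \<in> sets borel" "E2 \<in> sets borel"
    and L: "6 * \<Lambda> \<le> L" and \<rho>: "norm y + norm d + \<rho> < r"
  shows "subgraph_pair (real DIM('a) + s) s \<alpha> \<rho> L (norm d) \<eta> E1 E2 (recentered G (y + d)) (recentered G y)"
proof
  fix z :: 'a assume "z \<bullet> \<eta> = 0" "norm z < \<rho>"
  then have z: "norm y + norm d + norm z < r" "norm (y + d) + norm z < r" "norm y + norm z < r"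
    using \<rho> norm_triangle_ineq[of y d] norm_ge_zero[of d] by linarith+
  have scale: "c * \<Lambda> * x \<le> L * x" if "0 \<le> x" "c \<le> 6" for c x
    using that L \<Lambda> mult_right_mono[of c 6 \<Lambda>] by (intro mult_right_mono) auto
  show "\<bar>recentered G (y + d) z + recentered G (y + d) (- z)\<bar> \<le> L * norm z powr (1 + \<alpha>)"
    "\<bar>recentered G y z + recentered G y (- z)\<bar> \<le> L * norm z powr (1 + \<alpha>)"
    using recentered_odd[OF z(2)] recentered_odd[OF z(3)] scale[of "norm z powr (1 + \<alpha>)" 6] by simp_all
  show "\<bar>recentered G (y + d) z - recentered G y z\<bar> \<le> L * norm d * norm z"
    using mixed_difference_le[OF z(1)] scale[of "norm d * norm z" 3] by (simp add: recentered_diff mult.assoc)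
  show "\<bar>(recentered G (y + d) z - recentered G y z) + (recentered G (y + d) (- z) - recentered G y (- z))\<bar>
      \<le> L * norm d * norm z powr (1 + \<alpha>)"
    using mixed_difference_symmetrized_le[OF z(1)] scale[of "norm d * norm z powr (1 + \<alpha>)" 2]
    by (simp add: recentered_diff mult.assoc)
qed (use assms \<eta> \<Lambda> in auto)

lemma mixed_difference_half_turn:
  assumes \<kappa>: "norm \<kappa> = 1" "\<kappa> \<bullet> \<eta> = 0" and d: "B 0 \<kappa> d = 0" "norm y = h" "norm d = h"
    and z: "z \<bullet> \<eta> = 0" "norm y + norm d + norm z < r"
  shows "\<bar>mixed_difference G d z y + mixed_difference G d (half_turn \<eta> \<kappa> z) y\<bar>
    \<le> 12 * \<Lambda> * h * (norm z powr (1 + \<alpha>) + h powr \<alpha> * norm z)"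
proof -
  note orthonormal = \<eta> \<kappa>
  have h: "0 \<le> h" using d(2) norm_ge_zero[of y] by simp
  have "z + half_turn \<eta> \<kappa> z = (2 * (z \<bullet> \<kappa>)) *\<^sub>R \<kappa>" using z(1) by (simp add: half_turn_eq[OF orthonormal])
  then have "B 0 (z + half_turn \<eta> \<kappa> z) d = 0" using B_scale[of 0] r d(1) by simp
  then have "\<bar>mixed_difference G d z y + mixed_difference G d (half_turn \<eta> \<kappa> z) y\<bar>
      \<le> 2 * \<Lambda> * (2 * h + norm z) powr \<alpha> * h * norm z"
    using mixed_difference_cancel[OF z(2) norm_half_turn[OF orthonormal]] d by simp
  also have "\<dots> \<le> 2 * \<Lambda> * (3 * (h powr \<alpha> + norm z powr \<alpha>)) * h * norm z"
    using \<Lambda> \<alpha> h by (intro mult_right_mono mult_left_mono powr_add_le) auto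
  also have "\<dots> = 6 * \<Lambda> * h * (norm z powr \<alpha> * norm z + h powr \<alpha> * norm z)" by (simp add: algebra_simps)
  also have "norm z powr \<alpha> * norm z = norm z powr (1 + \<alpha>)" by (cases "z = 0") (simp_all add: powr_add)
  also have "6 * \<Lambda> * h * (norm z powr (1 + \<alpha>) + h powr \<alpha> * norm z) \<le> 12 * \<Lambda> * h * (norm z powr (1 + \<alpha>) + h powr \<alpha> * norm z)"
    using \<Lambda> h by (intro mult_right_mono) auto
  finally show ?thesis .
qed

lemma cut_subgraph_recentered:
  assumes E: "\<And>z. norm z < r \<Longrightarrow> p + z \<in> E \<longleftrightarrow> 0 < z \<bullet> \<kappa> \<and> z \<bullet> \<eta> < G z"
    and y: "\<kappa> \<bullet> \<eta> = 0" "y \<bullet> \<eta> = 0" "y \<bullet> \<kappa> = h" and z: "norm (graph_lift \<eta> G y) + norm z < r"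
  shows "p + graph_lift \<eta> G y + z \<in> E \<longleftrightarrow> - h < z \<bullet> \<kappa> \<and> z \<bullet> \<eta> < recentered G y (perp \<eta> z)"
proof -
  have "\<eta> \<bullet> \<kappa> = 0" using y(1) by (simp add: inner_commute)
  then have height: "graph_lift \<eta> G y \<bullet> \<kappa> = h" using y(3) by (simp add: graph_lift_def inner_add_left)
  have "norm (graph_lift \<eta> G y + z) < r" using z norm_triangle_ineq[of "graph_lift \<eta> G y" z] by linarith
  from E[OF this] show ?thesis
    unfolding recentered_perp recentered_graph_lift[of y z, symmetric]
    using height graph_lift_inner[OF y(2)] by (auto simp: recentered_def inner_add_left add.assoc)
qed

lemma G'_difference_quotient: "((\<lambda>t. (G' (t *\<^sub>R v) w - G' 0 w) / t) \<longlongrightarrow> B 0 v w) (at_right 0)"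
proof -
  have zero: "norm (0::'a) < r" using r by simp
  have vanish: "((\<lambda>t. t * norm v) \<longlongrightarrow> 0) (at_right 0)" by (rule tendsto_eq_intros refl | simp)+
  have "((\<lambda>t. (t * norm v) powr \<alpha>) \<longlongrightarrow> 0) (at_right 0)"
    using \<alpha>
    by (intro tendsto_zero_powrI[OF vanish tendsto_const] eventually_mono[OF eventually_at_right_less[of 0]]) simp_all
  then have "((\<lambda>t. \<Lambda> * (t * norm v) powr \<alpha> * norm v * norm w) \<longlongrightarrow> \<Lambda> * 0 * norm v * norm w) (at_right 0)"
    by (intro tendsto_mult tendsto_const)
  then have bound: "((\<lambda>t. \<Lambda> * (t * norm v) powr \<alpha> * norm v * norm w) \<longlongrightarrow> 0) (at_right 0)" by simp
  have "eventually (\<lambda>t. norm ((G' (t *\<^sub>R v) w - G' 0 w) / t - B 0 v w) \<le> \<Lambda> * (t * norm v) powr \<alpha> * norm v * norm w) (at_right 0)"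
    using order_tendstoD(2)[OF vanish r(1)] eventually_at_right_less[of 0]
  proof eventually_elim
    case (elim t)
    then have "\<bar>G' (t *\<^sub>R v) w - G' 0 w - t * B 0 v w\<bar> \<le> t * (\<Lambda> * (t * norm v) powr \<alpha> * norm v * norm w)"
      using taylor[of 0 "t *\<^sub>R v" 0 w] zero by (simp add: B_scale[OF zero] mult_ac)
    moreover have "G' (t *\<^sub>R v) w - G' 0 w - t * B 0 v w = t * ((G' (t *\<^sub>R v) w - G' 0 w) / t - B 0 v w)"
      using elim by (simp add: field_simps)
    ultimately show ?case using elim by (simp add: abs_mult)
  qed
  from Lim_null_comparison[OF this bound] show ?thesis by (rule LIM_zero_cancel)
qed

end

context capillary_graph
begin

lemma near_potential_interior_pair_le:
  assumes p0: "0 < p0 $ k" and on_graph: "w \<bullet> \<eta> = G w" "(w + d) \<bullet> \<eta> = G (w + d)"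
    and \<rho>: "norm w + norm d + \<rho> < r" and \<epsilon>: "0 < \<epsilon>" "\<epsilon> \<le> \<rho>"
  shows "\<bar>near_frac_potential s \<epsilon> \<rho> E (p0 + (w + d)) - near_frac_potential s \<epsilon> \<rho> E (p0 + w)\<bar>
      \<le> norm d * graph_const TYPE(real^'n) s \<alpha> (6 * \<Lambda>) * \<rho> powr (\<alpha> - s)"
proof -
  interpret pair: subgraph_pair "real DIM(real^'n) + s" s \<alpha> \<rho> "6 * \<Lambda>" "norm d" \<eta> E E "recentered G (w + d)" "recentered G w"
    using n2 s01 alpha E_borel \<rho> by (intro recentered_subgraph_pair) auto
  have inside: "0 < (p0 + z) $ k" if "norm z < r" for z
    using component_le_norm_cart[of z k] that heights p0 by auto
  have "p0 + w' + z \<in> E \<longleftrightarrow> z \<bullet> \<eta> < recentered G w' (perp \<eta> z)"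
    if "w' \<bullet> \<eta> = G w'" "norm w' \<le> norm w + norm d" "norm z < \<rho>" for w' z
  proof -
    have "norm (w' + z) < r" using norm_triangle_ineq[of w' z] that \<rho> by linarith
    show ?thesis by (rule E_iff_recentered[OF that(1) \<open>norm (w' + z) < r\<close> inside[OF \<open>norm (w' + z) < r\<close>]])
  qed
  then show ?thesis
    using pair.near_potential_difference_le_uncut[OF \<epsilon> order_refl, of "p0 + (w + d)" "p0 + w"] on_graph norm_triangle_ineq[of w d]
    by simp
qed

lemma near_potential_boundary_pair_le:
  fixes h :: real
  assumes p0: "p0 $ k = 0" and G'0: "\<And>v. G' 0 v = c * v $ k"
    and d: "norm d = h" "d \<bullet> \<eta> = 0" "d $ k = 0" "B 0 (axis k 1) d = 0"
    and h: "0 < h" "h \<le> \<rho>" "2 * h + \<rho> < r" and \<epsilon>: "0 < \<epsilon>" "\<epsilon> \<le> h"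
  defines "y \<equiv> h *\<^sub>R axis k 1"
  assumes lifts: "norm (graph_lift \<eta> G y) + \<rho> < r" "norm (graph_lift \<eta> G (y + d)) + \<rho> < r"
  shows "\<bar>near_frac_potential s \<epsilon> \<rho> E (p0 + graph_lift \<eta> G (y + d)) - near_frac_potential s \<epsilon> \<rho> E (p0 + graph_lift \<eta> G y)\<bar>
      \<le> 2 * h * graph_const TYPE(real^'n) s \<alpha> (12 * \<Lambda>) * \<rho> powr (\<alpha> - s)"
proof -
  let ?\<kappa> = "axis k (1::real) :: real^'n"
  have \<kappa>: "norm ?\<kappa> = 1" "?\<kappa> \<bullet> \<eta> = 0" using heights p0 by (auto simp: norm_axis_1 inner_axis')
  note orthonormal = \<eta> \<kappa>
  have y: "norm y = h" "y \<bullet> \<eta> = 0" "y \<bullet> ?\<kappa> = h" using h \<kappa> by (auto simp: y_def norm_eq_1)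
  have h1: "h \<le> 1" using h r by linarith
  have d\<kappa>: "d \<bullet> ?\<kappa> = 0" using d(3) by (simp add: inner_axis)
  have G'_half_turn: "G' 0 (half_turn \<eta> ?\<kappa> z) = G' 0 z" for z
    using half_turn_inner(2)[OF orthonormal, of z] by (simp add: G'0 inner_axis)
  have ball: "norm y + norm d + norm z < r" if "norm z < \<rho>" for z using that h y d by simp
  interpret pair: subgraph_pair "real DIM(real^'n) + s" s \<alpha> \<rho> "12 * \<Lambda>" h \<eta> E E "recentered G (y + d)" "recentered G y"
    using recentered_subgraph_pair[of s E E "12 * \<Lambda>" y d \<rho>] n2 s01 alpha E_borel h y d \<Lambda> by simp
  have "\<bar>near_potential (real DIM(real^'n) + s) \<epsilon> \<rho> E (p0 + graph_lift \<eta> G (y + d))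
        - near_potential (real DIM(real^'n) + s) \<epsilon> \<rho> E (p0 + graph_lift \<eta> G y)\<bar>
      \<le> 2 * h * graph_const TYPE(real^'n) s \<alpha> (12 * \<Lambda>) * \<rho> powr (\<alpha> - s)"
  proof (rule pair.near_potential_difference_le_cut[OF \<epsilon> h(2) \<kappa> distr_lborel_half_turn[OF orthonormal] borel_measurable_half_turn[OF orthonormal]
        half_turn_shift[OF orthonormal] _ norm_half_turn[OF orthonormal] half_turn_inner(2)[OF orthonormal]])
    fix z :: "real^'n" assume z: "norm z < \<rho>"
    show "p0 + graph_lift \<eta> G (y + d) + z \<in> E \<longleftrightarrow> - h < z \<bullet> ?\<kappa> \<and> z \<bullet> \<eta> < recentered G (y + d) (perp \<eta> z)"
      using E_iff_at_boundary[OF p0] \<kappa>(2) y d d\<kappa> lifts z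
      by (intro cut_subgraph_recentered) (auto simp: inner_add_left)
    show "p0 + graph_lift \<eta> G y + z \<in> E \<longleftrightarrow> - h < z \<bullet> ?\<kappa> \<and> z \<bullet> \<eta> < recentered G y (perp \<eta> z)"
      using E_iff_at_boundary[OF p0] \<kappa>(2) y lifts z by (intro cut_subgraph_recentered) auto
    have yd: "norm (y + d) \<le> 2 * h" using norm_triangle_ineq[of y d] y d by simp
    show "\<bar>recentered G (y + d) z - recentered G (y + d) (half_turn \<eta> ?\<kappa> z)\<bar>
        \<le> 12 * \<Lambda> * (norm z powr (1 + \<alpha>) + h powr \<alpha> * norm z)"
      "\<bar>recentered G y z - recentered G y (half_turn \<eta> ?\<kappa> z)\<bar> \<le> 12 * \<Lambda> * (norm z powr (1 + \<alpha>) + h powr \<alpha> * norm z)"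
      using yd y ball[OF z] d h h1 norm_half_turn[OF orthonormal] G'_half_turn
      by (intro recentered_symmetry; simp)+
    assume "z \<bullet> \<eta> = 0"
    then show "\<bar>(recentered G (y + d) z - recentered G y z)
          + (recentered G (y + d) (half_turn \<eta> ?\<kappa> z) - recentered G y (half_turn \<eta> ?\<kappa> z))\<bar>
        \<le> 12 * \<Lambda> * h * (norm z powr (1 + \<alpha>) + h powr \<alpha> * norm z)"
      unfolding recentered_diff using \<kappa> ball[OF z] y(1) d(1,4) by (intro mixed_difference_half_turn) auto
  qed (use n2 half_turn_inner(1)[OF orthonormal] in auto)
  then show ?thesis by simp
qed

lemma graph_lift_in_M:
  assumes p0: "p0 $ k = 0" and y: "y \<bullet> \<eta> = 0" "0 \<le> y $ k" "norm (graph_lift \<eta> G y) < r" "norm y < r"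
  shows "p0 + graph_lift \<eta> G y \<in> M"
proof -
  let ?\<kappa> = "axis k (1::real) :: real^'n"
  have \<eta>k: "\<eta> $ k = 0" using heights p0 by auto
  have above: "p0 + graph_lift \<eta> G y \<in> M" if y: "y \<bullet> \<eta> = 0" "0 < y $ k" "norm (graph_lift \<eta> G y) < r" for y
  proof -
    have "0 < (p0 + graph_lift \<eta> G y) $ k" using p0 \<eta>k y by (simp add: graph_lift_def)
    then show ?thesis using frontier_graph[OF y(3) _ graph_lift_inner[OF y(1)]] by (intro frontier_in_M) auto
  qed
  have lim: "((\<lambda>t. y + t *\<^sub>R ?\<kappa>) \<longlongrightarrow> y) (at_right 0)" by (rule tendsto_eq_intros refl | simp)+
  note lift = graph_lift_tendsto[OF lim y(4)]
  show ?thesis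
  proof (rule Lim_in_closed_set[OF M_closed _ _ tendsto_add[OF tendsto_const lift]])
    show "eventually (\<lambda>t. p0 + graph_lift \<eta> G (y + t *\<^sub>R ?\<kappa>) \<in> M) (at_right 0)"
      using order_tendstoD(2)[OF tendsto_norm[OF lift] y(3)] eventually_at_right_less[of 0]
      by eventually_elim (rule above; use y \<eta>k in \<open>simp add: inner_add_left inner_axis'\<close>)
  qed simp
qed

lemma graph_lift_tangent:
  assumes p0: "p0 $ k = 0"
    and y: "y \<bullet> \<eta> = 0" "y $ k = 0" "norm (graph_lift \<eta> G y) < r" "norm y < r" and w: "w \<bullet> \<eta> = 0"
  shows "nu (p0 + graph_lift \<eta> G y) \<bullet> (w + G' y w *\<^sub>R \<eta>) = 0"
proof (rule tangent_orthogonal_patch[where \<psi>="\<lambda>y. p0 + graph_lift \<eta> G y" and \<psi>'="\<lambda>w. w + G' y w *\<^sub>R \<eta>"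
      and a=\<eta> and b="axis k 1"])
  show "((\<lambda>x. (nu (p0 + graph_lift \<eta> G y) \<bullet> (x - (p0 + graph_lift \<eta> G y))) / norm (x - (p0 + graph_lift \<eta> G y)))
      \<longlongrightarrow> 0) (at (p0 + graph_lift \<eta> G y) within M)"
    using y by (intro nu_tangent graph_lift_in_M[OF p0]) auto
  show "((\<lambda>y. p0 + graph_lift \<eta> G y) has_derivative (\<lambda>w. w + G' y w *\<^sub>R \<eta>)) (at y)"
    unfolding graph_lift_def using deriv[OF y(4)] by (auto intro!: derivative_eq_intros)
  have "eventually (\<lambda>y. norm y < r) (nhds y)"
    using order_tendstoD(2)[OF tendsto_norm[OF filterlim_ident] y(4)] .
  moreover have "eventually (\<lambda>y. norm (graph_lift \<eta> G y) < r) (nhds y)"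
    using order_tendstoD(2)[OF tendsto_norm[OF graph_lift_tendsto[OF filterlim_ident y(4)]] y(3)] .
  ultimately show "eventually (\<lambda>y. y \<bullet> \<eta> = 0 \<longrightarrow> 0 \<le> y \<bullet> axis k 1 \<longrightarrow> p0 + graph_lift \<eta> G y \<in> M) (nhds y)"
    by eventually_elim (use graph_lift_in_M[OF p0] in \<open>simp add: inner_axis\<close>)
qed (use y w in \<open>simp_all add: inner_axis\<close>)

lemma boundary_normal:
  assumes p0: "p0 $ k = 0" and G'0: "\<And>v. v $ k = 0 \<Longrightarrow> G' 0 v = 0"
    and y: "y \<bullet> \<eta> = 0" "y $ k = 0" "norm (graph_lift \<eta> G y) < r" "norm y < r"
  defines "n \<equiv> nu (p0 + graph_lift \<eta> G y)"
  shows "G' y (axis k 1) * (n \<bullet> \<eta>) = \<sigma>" "(n \<bullet> \<eta>)\<^sup>2 \<le> 1 - \<sigma>\<^sup>2" "1 - \<sigma>\<^sup>2 - (n \<bullet> \<eta>)\<^sup>2 \<le> (3 * \<Lambda> * norm y)\<^sup>2"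
proof -
  let ?\<kappa> = "axis k (1::real) :: real^'n"
  define N where "N = n \<bullet> \<eta>"
  define \<omega> where "\<omega> = n - N *\<^sub>R \<eta> + \<sigma> *\<^sub>R ?\<kappa>"
  have \<eta>k: "\<eta> $ k = 0" using heights p0 by auto
  have X: "p0 + graph_lift \<eta> G y \<in> M" "(p0 + graph_lift \<eta> G y) $ k = 0"
    using graph_lift_in_M[OF p0 y(1) _ y(3,4)] y(2) p0 \<eta>k by (simp_all add: graph_lift_def)
  have n: "norm n = 1" "n \<bullet> n = 1" "n $ k = - \<sigma>"
    using nu_norm[OF X(1)] nu_k[OF X] by (simp_all add: n_def norm_eq_1)
  have tangent: "n \<bullet> w = - G' y w * N" if "w \<bullet> \<eta> = 0" for w
    using graph_lift_tangent[OF p0 y that] by (simp add: n_def inner_add_right N_def)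
  show "G' y ?\<kappa> * (n \<bullet> \<eta>) = \<sigma>" using tangent[of ?\<kappa>] \<eta>k n by (simp add: inner_axis inner_axis' N_def)
  have \<omega>: "\<omega> \<bullet> \<eta> = 0" "\<omega> $ k = 0"
    using n \<eta>k \<eta> by (auto simp: \<omega>_def inner_add_left inner_diff_left inner_axis' N_def norm_eq_1)
  have split: "n = \<omega> + N *\<^sub>R \<eta> - \<sigma> *\<^sub>R ?\<kappa>" by (simp add: \<omega>_def)
  have n\<omega>: "n \<bullet> \<omega> = \<omega> \<bullet> \<omega>"
    using \<omega> by (subst split) (simp add: inner_add_left inner_diff_left inner_axis' inner_commute[of \<eta> \<omega>])
  have "n \<bullet> \<omega> = 1 - N\<^sup>2 - \<sigma>\<^sup>2"
    using n \<eta>k by (simp add: \<omega>_def inner_add_right inner_diff_right inner_axis N_def power2_eq_square)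
  then have gap: "(norm \<omega>)\<^sup>2 = 1 - \<sigma>\<^sup>2 - N\<^sup>2" using n\<omega> by (simp add: power2_norm_eq_inner)
  then show "(n \<bullet> \<eta>)\<^sup>2 \<le> 1 - \<sigma>\<^sup>2" using zero_le_power2[of "norm \<omega>"] by (simp add: N_def)
  have "\<bar>N\<bar> \<le> 1" unfolding N_def using Cauchy_Schwarz_ineq2[of n \<eta>] n \<eta> by simp
  moreover have "\<bar>G' y \<omega>\<bar> \<le> 3 * \<Lambda> * norm y * norm \<omega>"
    using G'_lipschitz[of 0 y \<omega>] y(4) r G'0[OF \<omega>(2)] by simp
  moreover have "(norm \<omega>)\<^sup>2 \<le> \<bar>G' y \<omega> * N\<bar>"
    using n\<omega> tangent[OF \<omega>(1)] abs_ge_minus_self[of "G' y \<omega> * N"] by (simp add: power2_norm_eq_inner)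
  ultimately have "norm \<omega> * norm \<omega> \<le> (3 * \<Lambda> * norm y) * norm \<omega>"
    using mult_mono[of "\<bar>G' y \<omega>\<bar>" "3 * \<Lambda> * norm y * norm \<omega>" "\<bar>N\<bar>" 1] \<Lambda>
    by (simp add: power2_eq_square abs_mult)
  then have "norm \<omega> \<le> 3 * \<Lambda> * norm y" using \<Lambda> by (cases "\<omega> = 0") auto
  then have "(norm \<omega>)\<^sup>2 \<le> (3 * \<Lambda> * norm y)\<^sup>2" by (rule power_mono) simp
  then show "1 - \<sigma>\<^sup>2 - (n \<bullet> \<eta>)\<^sup>2 \<le> (3 * \<Lambda> * norm y)\<^sup>2" using gap by (simp add: N_def)
qed

lemma boundary_normal_limit:
  assumes p0: "p0 $ k = 0" and \<eta>h: "\<eta> = hnormal p0" and v: "v $ k = 0" "v \<bullet> \<eta> = 0"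
  defines "N \<equiv> \<lambda>t. nu (p0 + graph_lift \<eta> G (t *\<^sub>R v)) \<bullet> \<eta>"
  shows "(N \<longlongrightarrow> sqrt (1 - \<sigma>\<^sup>2)) (at_right 0)"
    and "eventually (\<lambda>t. G' (t *\<^sub>R v) (axis k 1) * N t = \<sigma> \<and> (N t)\<^sup>2 \<le> 1 - \<sigma>\<^sup>2
      \<and> 1 - \<sigma>\<^sup>2 - (N t)\<^sup>2 \<le> (3 * \<Lambda> * norm (t *\<^sub>R v))\<^sup>2) (at_right 0)"
proof -
  have lim: "((\<lambda>t. t *\<^sub>R v) \<longlongrightarrow> 0) (at_right 0)" by (rule tendsto_eq_intros refl | simp)+
  have lift: "((\<lambda>t. graph_lift \<eta> G (t *\<^sub>R v)) \<longlongrightarrow> 0) (at_right 0)"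
    by (rule graph_lift_tendsto_zero[OF lim])
  have small: "eventually (\<lambda>t. norm (graph_lift \<eta> G (t *\<^sub>R v)) < r \<and> norm (t *\<^sub>R v) < r) (at_right 0)"
    using order_tendstoD(2)[OF tendsto_norm_zero[OF lift] r(1)] order_tendstoD(2)[OF tendsto_norm_zero[OF lim] r(1)]
    by (rule eventually_conj)
  have "((\<lambda>t. nu (p0 + graph_lift \<eta> G (t *\<^sub>R v))) \<longlongrightarrow> nu p0) (at_right 0)"
  proof (rule continuous_on_tendsto_compose[OF nu_continuous _ p0M])
    show "((\<lambda>t. p0 + graph_lift \<eta> G (t *\<^sub>R v)) \<longlongrightarrow> p0) (at_right 0)"
      using tendsto_add[OF tendsto_const[of p0] lift] by simp
    show "eventually (\<lambda>t. p0 + graph_lift \<eta> G (t *\<^sub>R v) \<in> M) (at_right 0)"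
      using small by eventually_elim (use v in \<open>intro graph_lift_in_M[OF p0], auto\<close>)
  qed
  from tendsto_inner[OF this tendsto_const[of \<eta>]] show "(N \<longlongrightarrow> sqrt (1 - \<sigma>\<^sup>2)) (at_right 0)"
    using hnormal(4)[OF p0M p0] by (simp add: N_def \<eta>h[symmetric])
  have "G' 0 w = 0" if "w $ k = 0" for w using that by (simp add: G'_zero_at_boundary[OF p0 \<eta>h])
  note relations = boundary_normal[OF p0 this]
  show "eventually (\<lambda>t. G' (t *\<^sub>R v) (axis k 1) * N t = \<sigma> \<and> (N t)\<^sup>2 \<le> 1 - \<sigma>\<^sup>2
      \<and> 1 - \<sigma>\<^sup>2 - (N t)\<^sup>2 \<le> (3 * \<Lambda> * norm (t *\<^sub>R v))\<^sup>2) (at_right 0)"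
    unfolding N_def using small by eventually_elim (use v in \<open>intro conjI relations, auto\<close>)
qed

text \<open>Differentiating the contact angle condition along \<open>\<partial>H\<close>.\<close>
lemma mixed_second_derivative_zero:
  assumes p0: "p0 $ k = 0" and \<eta>h: "\<eta> = hnormal p0" and v: "v $ k = 0" "v \<bullet> \<eta> = 0"
  shows "B 0 (axis k 1) v = 0"
proof -
  let ?\<kappa> = "axis k (1::real) :: real^'n"
  define N0 where "N0 = sqrt (1 - \<sigma>\<^sup>2)"
  define N where "N t = nu (p0 + graph_lift \<eta> G (t *\<^sub>R v)) \<bullet> \<eta>" for t
  have N0: "0 < N0" "N0\<^sup>2 = 1 - \<sigma>\<^sup>2" using sin_contact_angle_pos by (simp_all add: N0_def)
  note N_lim = boundary_normal_limit(1)[OF assms, folded N_def N0_def]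
  note relations = boundary_normal_limit(2)[OF assms, folded N_def N0(2)]
  have gap: "((\<lambda>t. (N0\<^sup>2 - (N t)\<^sup>2) / t) \<longlongrightarrow> 0) (at_right 0)"
  proof (rule tendsto_sandwich[OF _ _ tendsto_const])
    show "((\<lambda>t. (3 * \<Lambda> * norm v)\<^sup>2 * t) \<longlongrightarrow> 0) (at_right 0)" by (rule tendsto_eq_intros refl | simp)+
    show "eventually (\<lambda>t. 0 \<le> (N0\<^sup>2 - (N t)\<^sup>2) / t) (at_right 0)"
      using relations eventually_at_right_less[of 0] by eventually_elim simp
    show "eventually (\<lambda>t. (N0\<^sup>2 - (N t)\<^sup>2) / t \<le> (3 * \<Lambda> * norm v)\<^sup>2 * t) (at_right 0)"
      using relations eventually_at_right_less[of 0]
      by eventually_elim (simp add: divide_le_eq power_mult_distrib power2_eq_square mult_ac)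
  qed
  have "((\<lambda>t. \<sigma> / (N t * N0 * (N0 + N t)) * ((N0\<^sup>2 - (N t)\<^sup>2) / t)) \<longlongrightarrow> \<sigma> / (N0 * N0 * (N0 + N0)) * 0) (at_right 0)"
    using N0(1) by (intro tendsto_mult tendsto_divide tendsto_add tendsto_const N_lim gap) auto
  moreover have "eventually (\<lambda>t. \<sigma> / (N t * N0 * (N0 + N t)) * ((N0\<^sup>2 - (N t)\<^sup>2) / t) = (G' (t *\<^sub>R v) ?\<kappa> - G' 0 ?\<kappa>) / t) (at_right 0)"
    using relations eventually_at_right_less[of 0] order_tendstoD(1)[OF N_lim N0(1)]
  proof eventually_elim
    case (elim t)
    have "N0\<^sup>2 - (N t)\<^sup>2 = (N0 - N t) * (N0 + N t)" by (simp add: power2_eq_square algebra_simps)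
    then have "\<sigma> / (N t * N0 * (N0 + N t)) * ((N0\<^sup>2 - (N t)\<^sup>2) / t) = \<sigma> * (N0 - N t) / (N t * N0) / t"
      using elim N0(1) by simp
    also have "\<dots> = (\<sigma> / N t - \<sigma> / N0) / t" using elim N0(1) by (simp add: field_simps)
    also have "\<sigma> / N t = G' (t *\<^sub>R v) ?\<kappa>" using elim by (simp add: divide_eq_eq)
    also have "\<sigma> / N0 = G' 0 ?\<kappa>" by (simp add: G'_zero_at_boundary[OF p0 \<eta>h] N0_def)
    finally show ?case .
  qed
  ultimately have "((\<lambda>t. (G' (t *\<^sub>R v) ?\<kappa> - G' 0 ?\<kappa>) / t) \<longlongrightarrow> 0) (at_right 0)"
    by (simp add: filterlim_cong[OF refl refl])
  then have "B 0 v ?\<kappa> = 0"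
    using G'_difference_quotient tendsto_unique[OF trivial_limit_at_right_real] by blast
  then show ?thesis using B_symmetric[of v ?\<kappa>] by simp
qed

end

locale touching_graphs = A: C2alpha_graph \<alpha> r1 \<Lambda>1 \<eta> G1 G1' B1 + B: C2alpha_graph \<alpha> r2 \<Lambda>2 \<eta> G2 G2' B2
  for \<alpha> r1 \<Lambda>1 :: real and \<eta> :: "'a::euclidean_space" and G1 G1' B1 r2 \<Lambda>2 G2 G2' B2 +
  assumes touching: "\<And>v. G1' 0 v = G2' 0 v"
begin

lemma recentered_difference_le:
  assumes "norm y + norm z < r1" "norm y + norm z < r2"
  shows "\<bar>recentered G1 y z - recentered G2 y z\<bar> \<le> 3 * (\<Lambda>1 + \<Lambda>2) * (norm y + norm z) * norm z"
proof -
  have "\<bar>recentered G1 y z - recentered G2 y z\<bar>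
      \<le> 3 * \<Lambda>1 * (norm y + norm z) * norm z + 3 * \<Lambda>2 * (norm y + norm z) * norm z"
    using A.recentered_increment[OF assms(1)] B.recentered_increment[OF assms(2)] touching[of z]
    by (simp add: abs_le_iff)
  then show ?thesis by (simp add: algebra_simps)
qed

lemma recentered_difference_weight:
  assumes "norm y + norm z < r1" "norm y + norm z < r2"
  shows "2 * \<bar>recentered G1 y z - recentered G2 y z\<bar> \<le> 6 * (\<Lambda>1 + \<Lambda>2) * (norm z powr (1 + \<alpha>) + norm y powr \<alpha> * norm z)"
proof -
  have small: "norm y \<le> 1" "norm z \<le> 1" using assms(1) A.r norm_ge_zero[of y] norm_ge_zero[of z] by linarith+
  have "2 * \<bar>recentered G1 y z - recentered G2 y z\<bar> \<le> 2 * (3 * (\<Lambda>1 + \<Lambda>2) * (norm y + norm z) * norm z)"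
    using recentered_difference_le[OF assms] by (rule mult_left_mono) simp
  also have "\<dots> = 6 * (\<Lambda>1 + \<Lambda>2) * ((norm z)\<^sup>2 + norm y * norm z)"
    by (simp add: power2_eq_square algebra_simps)
  also have "\<dots> \<le> 6 * (\<Lambda>1 + \<Lambda>2) * (norm z powr (1 + \<alpha>) + norm y powr \<alpha> * norm z)"
    using A.\<Lambda> B.\<Lambda> A.\<alpha> small powr_mono'[of \<alpha> 1 "norm y"]
    by (intro mult_left_mono add_mono mult_right_mono power2_le_powr) auto
  finally show ?thesis .
qed

lemma recentered_subgraph_pair:
  assumes "2 \<le> DIM('a)" "0 < s" "s < \<alpha>" "\<alpha> < 1" "E1 \<in> sets borel" "E2 \<in> sets borel"
    and \<rho>: "norm y + \<rho> < r1" "norm y + \<rho> < r2"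
  shows "subgraph_pair (real DIM('a) + s) s \<alpha> \<rho> (6 * (\<Lambda>1 + \<Lambda>2)) 1 \<eta> E1 E2 (recentered G1 y) (recentered G2 y)"
proof
  fix z :: 'a assume "norm z < \<rho>"
  then have z: "norm y + norm z < r1" "norm y + norm z < r2" using \<rho> by linarith+
  note odd = A.recentered_odd[OF z(1)] B.recentered_odd[OF z(2)]
  have scale: "c * x \<le> 6 * (\<Lambda>1 + \<Lambda>2) * x" if "0 \<le> x" "c \<le> 6 * (\<Lambda>1 + \<Lambda>2)" for c x
    using that by (intro mult_right_mono) auto
  show "\<bar>recentered G1 y z + recentered G1 y (- z)\<bar> \<le> 6 * (\<Lambda>1 + \<Lambda>2) * norm z powr (1 + \<alpha>)"
    "\<bar>recentered G2 y z + recentered G2 y (- z)\<bar> \<le> 6 * (\<Lambda>1 + \<Lambda>2) * norm z powr (1 + \<alpha>)"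
    by (rule order_trans[OF odd(1) scale]; use A.\<Lambda> B.\<Lambda> in simp) (rule order_trans[OF odd(2) scale]; use A.\<Lambda> B.\<Lambda> in simp)
  show "\<bar>(recentered G1 y z - recentered G2 y z) + (recentered G1 y (- z) - recentered G2 y (- z))\<bar>
      \<le> 6 * (\<Lambda>1 + \<Lambda>2) * 1 * norm z powr (1 + \<alpha>)"
    using odd by (simp add: distrib_right distrib_left abs_le_iff)
  have "3 * (\<Lambda>1 + \<Lambda>2) * (norm y + norm z) * norm z \<le> 6 * (\<Lambda>1 + \<Lambda>2) * 1 * norm z"
    using A.\<Lambda> B.\<Lambda> A.r z by (intro mult_right_mono mult_mono) auto
  then show "\<bar>recentered G1 y z - recentered G2 y z\<bar> \<le> 6 * (\<Lambda>1 + \<Lambda>2) * 1 * norm z"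
    using recentered_difference_le[OF z] by linarith
qed (use assms A.\<eta> A.\<Lambda> B.\<Lambda> in auto)

lemma near_potential_difference_le:
  fixes q0 \<kappa> :: 'a
  assumes exponents: "2 \<le> DIM('a)" "0 < s" "s < \<alpha>" "\<alpha> < 1" and E: "E1 \<in> sets borel" "E2 \<in> sets borel"
    and \<kappa>: "norm \<kappa> = 1" "\<kappa> \<bullet> \<eta> = 0"
    and E1: "\<And>z. norm z < r1 \<Longrightarrow> q0 + z \<in> E1 \<longleftrightarrow> 0 < z \<bullet> \<kappa> \<and> z \<bullet> \<eta> < G1 z"
    and E2: "\<And>z. norm z < r2 \<Longrightarrow> q0 + z \<in> E2 \<longleftrightarrow> 0 < z \<bullet> \<kappa> \<and> z \<bullet> \<eta> < G2 z"
    and h: "0 < h" "h \<le> \<rho>" "h + \<rho> < r1" "h + \<rho> < r2" and \<epsilon>: "0 < \<epsilon>" "\<epsilon> \<le> h"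
  defines "w1 \<equiv> graph_lift \<eta> G1 (h *\<^sub>R \<kappa>)" and "w2 \<equiv> graph_lift \<eta> G2 (h *\<^sub>R \<kappa>)"
  assumes lifts: "norm w1 + \<rho> < r1" "norm w2 + \<rho> < r2"
  shows "\<bar>near_potential (real DIM('a) + s) \<epsilon> \<rho> E1 (q0 + w1) - near_potential (real DIM('a) + s) \<epsilon> \<rho> E2 (q0 + w2)\<bar>
      \<le> 2 * graph_const TYPE('a) s \<alpha> (6 * (\<Lambda>1 + \<Lambda>2)) * \<rho> powr (\<alpha> - s)"
proof -
  define y where "y = h *\<^sub>R \<kappa>"
  have y: "norm y = h" "y \<bullet> \<kappa> = h" "y \<bullet> \<eta> = 0" using h \<kappa> by (auto simp: y_def norm_eq_1)
  interpret pair: subgraph_pair "real DIM('a) + s" s \<alpha> \<rho> "6 * (\<Lambda>1 + \<Lambda>2)" 1 \<eta> E1 E2 "recentered G1 y" "recentered G2 y"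
    using exponents E h y by (intro recentered_subgraph_pair) auto
  have "\<bar>near_potential (real DIM('a) + s) \<epsilon> \<rho> E1 (q0 + w1) - near_potential (real DIM('a) + s) \<epsilon> \<rho> E2 (q0 + w2)\<bar>
      \<le> 2 * 1 * graph_const TYPE('a) s \<alpha> (6 * (\<Lambda>1 + \<Lambda>2)) * \<rho> powr (\<alpha> - s)"
  proof (rule pair.near_potential_difference_le_cut[OF \<epsilon> h(2) \<kappa>, of "\<lambda>z. z"])
    fix z :: 'a assume z: "norm z < \<rho>"
    show "q0 + w1 + z \<in> E1 \<longleftrightarrow> - h < z \<bullet> \<kappa> \<and> z \<bullet> \<eta> < recentered G1 y (perp \<eta> z)"
      unfolding w1_def y_def[symmetric] using lifts z y
      by (intro A.cut_subgraph_recentered E1 \<kappa>) (auto simp: w1_def y_def)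
    show "q0 + w2 + z \<in> E2 \<longleftrightarrow> - h < z \<bullet> \<kappa> \<and> z \<bullet> \<eta> < recentered G2 y (perp \<eta> z)"
      unfolding w2_def y_def[symmetric] using lifts z y
      by (intro B.cut_subgraph_recentered E2 \<kappa>) (auto simp: w2_def y_def)
    have "norm y + norm z < r1" "norm y + norm z < r2" using y z h by linarith+
    from recentered_difference_weight[OF this, unfolded y(1)]
    show "\<bar>(recentered G1 y z - recentered G2 y z) + (recentered G1 y z - recentered G2 y z)\<bar>
        \<le> 6 * (\<Lambda>1 + \<Lambda>2) * 1 * (norm z powr (1 + \<alpha>) + h powr \<alpha> * norm z)"
      by (simp only: mult_2[symmetric] abs_mult abs_numeral mult_1_right)
  qed (use A.\<Lambda> B.\<Lambda> h in \<open>auto simp: distr_id2\<close>)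
  then show ?thesis by simp
qed

end

section \<open>Defect and curvature\<close>

lemma le_of_vanishing_error:
  fixes D C K \<gamma> R :: real
  assumes "0 < \<gamma>" "0 < R" and le: "\<And>\<rho>. 0 < \<rho> \<Longrightarrow> \<rho> < R \<Longrightarrow> D - \<rho> - C * \<rho> powr \<gamma> \<le> K"
  shows "D \<le> K"
proof (rule tendsto_upperbound)
  have id: "((\<lambda>\<rho>::real. \<rho>) \<longlongrightarrow> 0) (at_right 0)" by (rule tendsto_ident_at)
  have "((\<lambda>\<rho>. \<rho> powr \<gamma>) \<longlongrightarrow> 0) (at_right 0)"
    by (rule tendsto_zero_powrI[OF id tendsto_const _ assms(1)])
      (rule eventually_mono[OF eventually_at_right_less[of 0]], simp)
  then have "((\<lambda>\<rho>. D - \<rho> - C * \<rho> powr \<gamma>) \<longlongrightarrow> D - 0 - C * 0) (at_right 0)"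
    by (intro tendsto_diff tendsto_mult tendsto_const id)
  then show "((\<lambda>\<rho>. D - \<rho> - C * \<rho> powr \<gamma>) \<longlongrightarrow> D) (at_right 0)" by simp
  show "eventually (\<lambda>\<rho>. D - \<rho> - C * \<rho> powr \<gamma> \<le> K) (at_right 0)"
    unfolding eventually_at_right_field using assms by blast
qed simp

lemma (in C2alpha_graph) G_directional: "((\<lambda>t. G (t *\<^sub>R u) / t) \<longlongrightarrow> G' 0 u) (at_right 0)"
proof -
  have "((\<lambda>t. t *\<^sub>R u) has_derivative (\<lambda>h. h *\<^sub>R u)) (at 0)" by (auto intro!: derivative_eq_intros)
  from has_derivative_compose[OF this, of G "G' 0"]
  have "((\<lambda>t. G (t *\<^sub>R u)) has_derivative (\<lambda>h. h *\<^sub>R G' 0 u)) (at 0)"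
    using deriv[of 0] r by (simp add: linear_cmul[OF G'_linear])
  from difference_quotient_at_right[OF this] show ?thesis by (simp add: G0)
qed

lemma graph_directions_eq:
  fixes \<eta>1 \<eta>2 \<kappa> :: "'a::euclidean_space"
  assumes graphs: "C2alpha_graph \<alpha> r1 \<Lambda>1 \<eta>1 G1 G1' B1" "C2alpha_graph \<alpha> r2 \<Lambda>2 \<eta>2 G2 G2' B2"
    and \<kappa>: "norm \<kappa> = 1" "\<kappa> \<bullet> \<eta>1 = 0" "\<kappa> \<bullet> \<eta>2 = 0"
    and slopes: "\<And>v. G1' 0 v = c * (v \<bullet> \<kappa>)" "\<And>v. G2' 0 v = c * (v \<bullet> \<kappa>)"
    and R: "0 < R" and inclusion: "\<And>z. norm z < R \<Longrightarrow> 0 < z \<bullet> \<kappa> \<Longrightarrow> z \<bullet> \<eta>1 < G1 z \<Longrightarrow> z \<bullet> \<eta>2 < G2 z"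
  shows "\<eta>1 = \<eta>2"
proof (rule ccontr)
  assume "\<eta>1 \<noteq> \<eta>2"
  interpret A: C2alpha_graph \<alpha> r1 \<Lambda>1 \<eta>1 G1 G1' B1 by (rule graphs(1))
  interpret B: C2alpha_graph \<alpha> r2 \<Lambda>2 \<eta>2 G2 G2' B2 by (rule graphs(2))
  define b where "b = 1 - \<eta>2 \<bullet> \<eta>1"
  have unit: "\<eta>1 \<bullet> \<eta>1 = 1" "\<eta>2 \<bullet> \<eta>2 = 1" "\<kappa> \<bullet> \<kappa> = 1" using A.\<eta> B.\<eta> \<kappa> by (simp_all add: norm_eq_1)
  have "0 < (\<eta>2 - \<eta>1) \<bullet> (\<eta>2 - \<eta>1)" using \<open>\<eta>1 \<noteq> \<eta>2\<close> by simp
  also have "\<dots> = 2 * b"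
    using unit by (simp add: b_def inner_diff_left inner_diff_right inner_commute[of \<eta>1 \<eta>2])
  finally have b: "0 < b" by simp
  define \<delta> where "\<delta> = b / (2 * (\<bar>c\<bar> + 1))"
  have \<delta>: "0 < \<delta>" "\<bar>c * \<delta>\<bar> < b"
  proof -
    show "0 < \<delta>" using b by (simp add: \<delta>_def)
    then have "\<bar>c * \<delta>\<bar> \<le> (\<bar>c\<bar> + 1) * \<delta>" by (simp add: abs_mult)
    also have "\<dots> = b / 2" by (simp add: \<delta>_def field_simps)
    finally show "\<bar>c * \<delta>\<bar> < b" using b by simp
  qed
  define u where "u = (\<eta>2 - \<eta>1) + \<delta> *\<^sub>R \<kappa>"
  have u: "u \<bullet> \<eta>1 = - b" "u \<bullet> \<eta>2 = b" "u \<bullet> \<kappa> = \<delta>"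
    using unit \<kappa>(2,3) by (simp_all add: u_def b_def inner_add_left inner_diff_left inner_commute[of \<eta>1 \<eta>2]
        inner_commute[of \<eta>1 \<kappa>] inner_commute[of \<eta>2 \<kappa>])
  have limits: "((\<lambda>t. G1 (t *\<^sub>R u) / t) \<longlongrightarrow> c * \<delta>) (at_right 0)" "((\<lambda>t. G2 (t *\<^sub>R u) / t) \<longlongrightarrow> c * \<delta>) (at_right 0)"
    using A.G_directional[of u] B.G_directional[of u] by (simp_all add: slopes u)
  have "((\<lambda>t. norm (t *\<^sub>R u)) \<longlongrightarrow> norm (0 *\<^sub>R u)) (at_right 0)" by (intro tendsto_intros)
  then have "((\<lambda>t. norm (t *\<^sub>R u)) \<longlongrightarrow> 0) (at_right 0)" by simp
  from order_tendstoD(2)[OF this R] have small: "eventually (\<lambda>t. norm (t *\<^sub>R u) < R) (at_right 0)" .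
  have "- b < c * \<delta>" "c * \<delta> < b" using \<delta>(2) by (simp_all add: abs_less_iff)
  then have "eventually (\<lambda>t. - b < G1 (t *\<^sub>R u) / t) (at_right 0)" "eventually (\<lambda>t. G2 (t *\<^sub>R u) / t < b) (at_right 0)"
    using order_tendstoD(1)[OF limits(1)] order_tendstoD(2)[OF limits(2)] by blast+
  then have "eventually (\<lambda>t::real. False) (at_right 0)" using eventually_at_right_less[of 0] small
  proof eventually_elim
    case (elim t)
    then show False
      using inclusion[of "t *\<^sub>R u"] \<delta>(1) by (simp add: u divide_less_eq less_divide_eq mult.commute[of b])
  qed
  then show False by simp
qed

context capillary_graph
begin

lemma chord_on_graph:
  assumes e: "norm e = 1" "e $ k = 0" and l: "0 < l" "norm w + l < r" "0 < (p0 + w) $ k"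
    and frontier: "p0 + w \<in> frontier E" "p0 + (w + l *\<^sub>R e) \<in> frontier E"
  shows "w \<bullet> \<eta> = G w" "(w + l *\<^sub>R e) \<bullet> \<eta> = G (w + l *\<^sub>R e)"
proof -
  have "norm (w + l *\<^sub>R e) < r" using norm_triangle_ineq[of w "l *\<^sub>R e"] e l by simp
  then show "w \<bullet> \<eta> = G w" "(w + l *\<^sub>R e) \<bullet> \<eta> = G (w + l *\<^sub>R e)"
    using l e frontier by (auto intro!: frontier_graph_converse)
qed

lemma merging_chords_tangent:
  assumes e: "norm e = 1" "e $ k = 0"
    and frontier: "\<And>j. qs j \<in> frontier E" "\<And>j. qs j + l j *\<^sub>R e \<in> frontier E"
    and pos: "\<And>j. 0 < qs j $ k" and l: "\<And>j::nat. 0 < l j" "l \<longlonglongrightarrow> 0" and qs: "qs \<longlonglongrightarrow> p0"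
  shows "e \<bullet> \<eta> = G' 0 e"
proof (rule secants_tangent[OF e(1) _ l])
  show "(\<lambda>j. qs j - p0) \<longlonglongrightarrow> 0" using qs by (rule LIM_zero)
  fix j assume "norm (qs j - p0) + l j < r"
  from chord_on_graph[OF e l(1) this]
  show "(qs j - p0) \<bullet> \<eta> = G (qs j - p0)" "(qs j - p0 + l j *\<^sub>R e) \<bullet> \<eta> = G (qs j - p0 + l j *\<^sub>R e)"
    using pos[of j] frontier[of j] by (simp_all add: add.assoc[symmetric])
qed

lemma height_graph_lift:
  assumes "p0 $ k = 0"
  shows "(p0 + graph_lift \<eta> G y) $ k = y $ k"
  using heights assms by (auto simp: graph_lift_def)

lemma boundary_chord_quotient_tendsto:
  assumes e: "norm e = 1" "G' 0 e = 0" and h: "\<And>j::nat. 0 < h j" "h \<longlonglongrightarrow> 0"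
  shows "(\<lambda>j. (1 / h j) *\<^sub>R (graph_lift \<eta> G (h j *\<^sub>R axis k 1 + h j *\<^sub>R e) - graph_lift \<eta> G (h j *\<^sub>R axis k 1))) \<longlonglongrightarrow> e"
proof -
  define y where "y j = h j *\<^sub>R (axis k 1 :: real^'n)" for j
  have zero: "norm (0::real^'n) < r" using r by simp
  have "(\<lambda>j. recentered G (y j) (h j *\<^sub>R e) / h j) \<longlonglongrightarrow> 0"
  proof (rule Lim_null_comparison)
    have "(\<lambda>j. 6 * \<Lambda> * h j) \<longlonglongrightarrow> 6 * \<Lambda> * 0" by (intro tendsto_mult tendsto_const h)
    then show "(\<lambda>j. 6 * \<Lambda> * h j) \<longlonglongrightarrow> 0" by simp
    have "eventually (\<lambda>j. h j < r/2) sequentially" using order_tendstoD(2)[OF h(2), of "r/2"] r by simp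
    then show "eventually (\<lambda>j. norm (recentered G (y j) (h j *\<^sub>R e) / h j) \<le> 6 * \<Lambda> * h j) sequentially"
    proof eventually_elim
      case (elim j)
      have norms: "norm (y j) = h j" "norm (h j *\<^sub>R e) = h j"
        using h(1)[of j] e by (simp_all add: y_def norm_axis_1)
      have "G' 0 (h j *\<^sub>R e) = 0" using linear_cmul[OF G'_linear[OF zero]] e(2) by simp
      then have "\<bar>recentered G (y j) (h j *\<^sub>R e)\<bar> \<le> 6 * \<Lambda> * h j * h j"
        using recentered_increment[of "y j" "h j *\<^sub>R e"] elim unfolding norms by simp
      then show ?case using h(1)[of j] by (simp add: divide_le_eq)
    qed
  qed
  then have "(\<lambda>j. e + (recentered G (y j) (h j *\<^sub>R e) / h j) *\<^sub>R \<eta>) \<longlonglongrightarrow> e + 0 *\<^sub>R \<eta>"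
    by (intro tendsto_add tendsto_const tendsto_scaleR)
  moreover have "(1 / h j) *\<^sub>R (graph_lift \<eta> G (y j + h j *\<^sub>R e) - graph_lift \<eta> G (y j))
      = e + (recentered G (y j) (h j *\<^sub>R e) / h j) *\<^sub>R \<eta>" for j
  proof -
    have "graph_lift \<eta> G (y j + h j *\<^sub>R e) - graph_lift \<eta> G (y j) = h j *\<^sub>R e + recentered G (y j) (h j *\<^sub>R e) *\<^sub>R \<eta>"
      by (simp add: graph_lift_def recentered_def scaleR_diff_left)
    then show ?thesis using h(1)[of j] by (simp add: scaleR_add_right)
  qed
  ultimately show ?thesis by (simp add: y_def)
qed

lemma boundary_pair_curvature:
  fixes h :: real
  assumes p0: "p0 $ k = 0" and G'0: "\<And>v. G' 0 v = c * v $ k"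
    and e: "norm e = 1" "e \<bullet> \<eta> = 0" "e $ k = 0" "B 0 (axis k 1) e = 0" and h: "0 < h" "h \<le> \<rho>" "2 * h + \<rho> < r"
  defines "p \<equiv> p0 + graph_lift \<eta> G (h *\<^sub>R axis k 1 + h *\<^sub>R e)" and "q \<equiv> p0 + graph_lift \<eta> G (h *\<^sub>R axis k 1)"
  assumes lifts: "norm (graph_lift \<eta> G (h *\<^sub>R axis k 1)) + \<rho> < r" "norm (graph_lift \<eta> G (h *\<^sub>R axis k 1 + h *\<^sub>R e)) + \<rho> < r"
  shows "p \<in> M" "q \<in> M" "0 < q $ k" "p $ k = q $ k" "p \<noteq> q"
    and "2 * (frac_potential s \<rho> E q - frac_potential s \<rho> E p) - 4 * graph_const TYPE(real^'n) s \<alpha> (12 * \<Lambda>) * \<rho> powr (\<alpha> - s) * h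
      \<le> \<bar>frac_mean_curv s E p - frac_mean_curv s E q\<bar>"
proof -
  let ?y = "h *\<^sub>R axis k 1 :: real^'n"
  have y: "?y \<bullet> \<eta> = 0" "?y $ k = h" "(?y + h *\<^sub>R e) \<bullet> \<eta> = 0" "(?y + h *\<^sub>R e) $ k = h"
    using heights p0 e by (auto simp: inner_axis' inner_add_left)
  have norms: "norm ?y < r" "norm (?y + h *\<^sub>R e) < r"
    using h norm_triangle_ineq[of ?y "h *\<^sub>R e"] e(1) by (simp_all add: norm_axis_1)
  show pM: "p \<in> M" and qM: "q \<in> M"
    unfolding p_def q_def using y norms lifts h by (auto intro!: graph_lift_in_M[OF p0])
  have heights_eq: "q $ k = h" "p $ k = h"
    unfolding p_def q_def by (simp_all only: height_graph_lift[OF p0] y)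
  then show q_pos: "0 < q $ k" and "p $ k = q $ k" using h by simp_all
  have "e \<bullet> e = 1" "\<eta> \<bullet> e = 0" using e by (simp_all add: norm_eq_1 inner_commute)
  then have "(p - q) \<bullet> e = h" by (simp add: p_def q_def graph_lift_def inner_add_left inner_diff_left)
  then show "p \<noteq> q" using h by auto
  have "B 0 (axis k 1) (h *\<^sub>R e) = 0" using B_scale_right[of 0] r e(4) by simp
  then have "\<bar>near_frac_potential s \<epsilon> \<rho> E p - near_frac_potential s \<epsilon> \<rho> E q\<bar>
      \<le> 2 * h * graph_const TYPE(real^'n) s \<alpha> (12 * \<Lambda>) * \<rho> powr (\<alpha> - s)" if "0 < \<epsilon>" "\<epsilon> \<le> h" for \<epsilon>
    unfolding p_def q_def using e h lifts that by (intro near_potential_boundary_pair_le[OF p0 G'0]) auto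
  from curvature_difference_ge_near[OF pM _ qM q_pos h(1) _ this] heights_eq h
  show "2 * (frac_potential s \<rho> E q - frac_potential s \<rho> E p) - 4 * graph_const TYPE(real^'n) s \<alpha> (12 * \<Lambda>) * \<rho> powr (\<alpha> - s) * h
      \<le> \<bar>frac_mean_curv s E p - frac_mean_curv s E q\<bar>" by (simp add: mult_ac)
qed

end

locale critical_plane = capillary s \<alpha> \<sigma> k E M nu + moving_plane "real CARD('n) + s" e lam E
  for s \<alpha> \<sigma> :: real and k :: "'n::finite" and E M :: "(real^'n) set" and nu :: "real^'n \<Rightarrow> real^'n"
    and e :: "real^'n" and lam :: real +
  fixes K :: real
  assumes e_k: "e $ k = 0"
    and curvature_le: "\<And>p q. p \<in> M \<Longrightarrow> q \<in> M \<Longrightarrow> 0 < q $ k \<Longrightarrow> p $ k = q $ k \<Longrightarrow> p \<noteq> q \<Longrightarrow>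
       \<bar>frac_mean_curv s E p - frac_mean_curv s E q\<bar> \<le> K * norm (p - q)"
begin

lemma defect_interior_distinct:
  assumes q: "q \<in> M" "0 < q $ k"
    and p: "p \<in> M" "p = q + l *\<^sub>R e" and l: "0 < l" and midpoint: "(q + p) \<bullet> e = 2 * lam"
  shows "2 * defect \<le> K"
proof -
  have pq: "p $ k = q $ k" "p \<noteq> q" "norm (p - q) = l" "0 < p $ k" using p(2) q(2) l e_k e_unit by auto
  have "2 * (defect * l) \<le> \<bar>frac_mean_curv s E p - frac_mean_curv s E q\<bar>"
  proof (rule curvature_difference_ge[OF p(1) pq(4) q diameter_pos])
    fix \<epsilon> assume "0 < \<epsilon>" "\<epsilon> \<le> diameter E"
    from potential_difference_ge_distinct[OF p(2) M_closure[OF p(1)] l midpoint this]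
    show "2 * (defect * l) \<le> 2 * (frac_potential s \<epsilon> E q - frac_potential s \<epsilon> E p)" by simp
  qed
  also have "\<dots> \<le> K * l" using curvature_le[OF p(1) q pq(1,2)] pq(3) by simp
  finally have "(2 * defect) * l \<le> K * l" by simp
  then show ?thesis using l by (rule mult_right_le_imp_le)
qed

lemma defect_le_of_merging:
  assumes lim: "ps \<longlonglongrightarrow> p0" "qs \<longlonglongrightarrow> p0" and p0: "p0 \<in> M" "p0 \<bullet> e = lam" and R: "0 < R"
    and l: "\<And>j. 0 < l j" "(\<lambda>j. (1 / l j) *\<^sub>R (ps j - qs j)) \<longlonglongrightarrow> e"
    and potentials: "\<And>\<rho>. 0 < \<rho> \<Longrightarrow> \<rho> < R \<Longrightarrow> eventually (\<lambda>j.
      2 * (frac_potential s \<rho> E (qs j) - frac_potential s \<rho> E (ps j)) - C * \<rho> powr (\<alpha> - s) * l j \<le> K * norm (ps j - qs j)) sequentially"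
  shows "2 * defect \<le> K"
proof (rule le_of_vanishing_error[where \<gamma>="\<alpha> - s" and R="min (diameter E) R" and C=C])
  show "0 < \<alpha> - s" "0 < min (diameter E) R" using alpha diameter_pos R by auto
  fix \<rho> assume \<rho>: "0 < \<rho>" "\<rho> < min (diameter E) R"
  show "2 * defect - \<rho> - C * \<rho> powr (\<alpha> - s) \<le> K"
  proof (rule tendsto_lowerbound)
    have "(\<lambda>j. K * norm ((1 / l j) *\<^sub>R (ps j - qs j))) \<longlonglongrightarrow> K * norm e"
      by (intro tendsto_mult tendsto_const tendsto_norm l(2))
    then show "(\<lambda>j. K * norm ((1 / l j) *\<^sub>R (ps j - qs j))) \<longlonglongrightarrow> K" using e_unit by simp
    have "eventually (\<lambda>j. (defect - \<rho>/2) * l j \<le> frac_potential s \<rho> E (qs j) - frac_potential s \<rho> E (ps j)) sequentially"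
      using \<rho> by (intro potential_difference_ge_merging[OF lim M_closure[OF p0(1)] p0(2) l]) auto
    moreover have "eventually (\<lambda>j. 2 * (frac_potential s \<rho> E (qs j) - frac_potential s \<rho> E (ps j)) - C * \<rho> powr (\<alpha> - s) * l j
        \<le> K * norm (ps j - qs j)) sequentially"
      using \<rho> by (intro potentials) auto
    ultimately show "eventually (\<lambda>j. 2 * defect - \<rho> - C * \<rho> powr (\<alpha> - s) \<le> K * norm ((1 / l j) *\<^sub>R (ps j - qs j))) sequentially"
    proof eventually_elim
      case (elim j)
      have "(2 * defect - \<rho> - C * \<rho> powr (\<alpha> - s)) * l j = 2 * ((defect - \<rho>/2) * l j) - C * \<rho> powr (\<alpha> - s) * l j"
        by (simp add: algebra_simps)
      also have "\<dots> \<le> 2 * (frac_potential s \<rho> E (qs j) - frac_potential s \<rho> E (ps j)) - C * \<rho> powr (\<alpha> - s) * l j"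
        by (intro diff_right_mono mult_left_mono elim(1)) simp
      also have "\<dots> \<le> K * norm (ps j - qs j)" by (rule elim(2))
      finally have "(2 * defect - \<rho> - C * \<rho> powr (\<alpha> - s)) * l j \<le> K * norm (ps j - qs j)" .
      moreover have "K * norm ((1 / l j) *\<^sub>R (ps j - qs j)) = K * norm (ps j - qs j) / l j"
        using l(1)[of j] by simp
      ultimately show ?case using l(1)[of j] by (simp add: le_divide_eq)
    qed
  qed simp
qed

lemma defect_interior_merging:
  assumes p0: "p0 \<in> M" "0 < p0 $ k" "p0 \<bullet> e = lam"
    and frontier: "\<And>j. qs j \<in> frontier E" "\<And>j. ps j \<in> frontier E" and pos: "\<And>j. 0 < qs j $ k"
    and l: "\<And>j::nat. 0 < l j" "\<And>j. ps j = qs j + l j *\<^sub>R e" "l \<longlonglongrightarrow> 0" and qs: "qs \<longlonglongrightarrow> p0"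
  shows "2 * defect \<le> K"
proof -
  obtain r \<Lambda> G G' B where "capillary_graph s \<alpha> \<sigma> k E M nu r \<Lambda> (nu p0) G G' B p0"
    by (rule interior_graph[OF p0(1,2)])
  then interpret graph: capillary_graph s \<alpha> \<sigma> k E M nu r \<Lambda> "nu p0" G G' B p0 .
  define C where "C = graph_const TYPE(real^'n) s \<alpha> (6 * \<Lambda>)"
  have "(\<lambda>j. qs j + l j *\<^sub>R e) \<longlonglongrightarrow> p0 + 0 *\<^sub>R e" by (intro tendsto_add tendsto_scaleR qs l(3) tendsto_const)
  moreover have "ps = (\<lambda>j. qs j + l j *\<^sub>R e)" using l(2) by (rule ext)
  ultimately have ps: "ps \<longlonglongrightarrow> p0" by simp
  have quotient: "(1 / l j) *\<^sub>R (ps j - qs j) = e" for j using l(1)[of j] l(2)[of j] by simp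
  have sizes: "(\<lambda>j. norm (qs j - p0) + l j) \<longlonglongrightarrow> 0"
    using tendsto_add[OF tendsto_norm_zero[OF LIM_zero[OF qs]] l(3)] by simp
  show ?thesis
  proof (rule defect_le_of_merging[where R="r/2" and C="2 * C", OF ps qs p0(1,3) _ l(1)])
    show "0 < r/2" "(\<lambda>j. (1 / l j) *\<^sub>R (ps j - qs j)) \<longlonglongrightarrow> e" using graph.r by (simp_all add: quotient)
    fix \<rho> assume \<rho>: "0 < \<rho>" "\<rho> < r/2"
    have "eventually (\<lambda>j. norm (qs j - p0) + l j < r/2) sequentially"
      using order_tendstoD(2)[OF sizes, of "r/2"] graph.r by simp
    then show "eventually (\<lambda>j. 2 * (frac_potential s \<rho> E (qs j) - frac_potential s \<rho> E (ps j)) - 2 * C * \<rho> powr (\<alpha> - s) * l j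
        \<le> K * norm (ps j - qs j)) sequentially"
    proof eventually_elim
      case (elim j)
      define w where "w = qs j - p0"
      have w: "norm w + l j < r" "norm w + norm (l j *\<^sub>R e) + \<rho> < r"
        using elim \<rho> l(1)[of j] e_unit by (simp_all add: w_def)
      have points: "qs j = p0 + w" "ps j = p0 + (w + l j *\<^sub>R e)" using l(2) by (simp_all add: w_def)
      have heights: "0 < ps j $ k" "ps j $ k = qs j $ k" "ps j \<noteq> qs j"
        using pos[of j] l(1)[of j] l(2)[of j] e_k e_unit by auto
      have M: "ps j \<in> M" "qs j \<in> M" using frontier_in_M frontier pos heights(1) by auto
      have "w \<bullet> nu p0 = G w" "(w + l j *\<^sub>R e) \<bullet> nu p0 = G (w + l j *\<^sub>R e)"
        using graph.chord_on_graph[OF e_unit e_k l(1) w(1)] frontier[of j] pos[of j]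
        unfolding points by blast+
      from graph.near_potential_interior_pair_le[OF p0(2) this w(2)]
      have "\<bar>near_frac_potential s \<epsilon> \<rho> E (ps j) - near_frac_potential s \<epsilon> \<rho> E (qs j)\<bar> \<le> l j * C * \<rho> powr (\<alpha> - s)"
        if "0 < \<epsilon>" "\<epsilon> \<le> \<rho>" for \<epsilon>
        using that l(1)[of j] e_unit unfolding points C_def by simp
      from curvature_difference_ge_near[OF M(1) heights(1) M(2) pos \<rho>(1,1) this] curvature_le[OF M pos heights(2,3)]
      show ?case by (simp add: mult_ac)
    qed
  qed
qed

lemma defect_boundary_tangent:
  assumes p0: "p0 \<in> M" "p0 $ k = 0" "p0 \<bullet> e = lam" and tangent: "e \<bullet> hnormal p0 = 0"
  shows "2 * defect \<le> K"
proof -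
  let ?\<kappa> = "axis k (1::real) :: real^'n"
  define \<eta> where "\<eta> = hnormal p0"
  obtain r \<Lambda> G G' B where "capillary_graph s \<alpha> \<sigma> k E M nu r \<Lambda> \<eta> G G' B p0"
    unfolding \<eta>_def by (rule boundary_graph[OF p0(1,2)])
  then interpret graph: capillary_graph s \<alpha> \<sigma> k E M nu r \<Lambda> \<eta> G G' B p0 .
  note G'0 = graph.G'_zero_at_boundary[OF p0(2) \<eta>_def]
  have tangent: "e \<bullet> \<eta> = 0" "G' 0 e = 0" using tangent G'0 e_k by (simp_all add: \<eta>_def)
  have mixed: "B 0 ?\<kappa> e = 0" by (rule graph.mixed_second_derivative_zero[OF p0(2) \<eta>_def e_k tangent(1)])
  define h where "h = (\<lambda>j. inverse (real (Suc j)))"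
  have h: "h \<longlonglongrightarrow> 0" "\<And>j. 0 < h j" unfolding h_def by (rule LIMSEQ_inverse_real_of_nat) simp
  define wq where "wq j = graph_lift \<eta> G (h j *\<^sub>R ?\<kappa>)" for j
  define wp where "wp j = graph_lift \<eta> G (h j *\<^sub>R ?\<kappa> + h j *\<^sub>R e)" for j
  have "(\<lambda>j. h j *\<^sub>R ?\<kappa>) \<longlonglongrightarrow> 0 *\<^sub>R ?\<kappa>" "(\<lambda>j. h j *\<^sub>R ?\<kappa> + h j *\<^sub>R e) \<longlonglongrightarrow> 0 *\<^sub>R ?\<kappa> + 0 *\<^sub>R e"
    by (intro tendsto_intros h)+
  then have y: "(\<lambda>j. h j *\<^sub>R ?\<kappa>) \<longlonglongrightarrow> 0" "(\<lambda>j. h j *\<^sub>R ?\<kappa> + h j *\<^sub>R e) \<longlonglongrightarrow> 0" by simp_all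
  have lifts: "wq \<longlonglongrightarrow> 0" "wp \<longlonglongrightarrow> 0"
    unfolding wq_def[abs_def] wp_def[abs_def] by (rule graph.graph_lift_tendsto_zero, rule y)+
  have lims: "(\<lambda>j. p0 + wp j) \<longlonglongrightarrow> p0" "(\<lambda>j. p0 + wq j) \<longlonglongrightarrow> p0"
    using tendsto_add[OF tendsto_const[of p0] lifts(2)] tendsto_add[OF tendsto_const[of p0] lifts(1)]
    by simp_all
  define C where "C = graph_const TYPE(real^'n) s \<alpha> (12 * \<Lambda>)"
  show ?thesis
  proof (rule defect_le_of_merging[where R="r/2" and C="4 * C", OF lims p0(1,3) _ h(2)])
    show "0 < r/2" using graph.r by simp
    show "(\<lambda>j. (1 / h j) *\<^sub>R (p0 + wp j - (p0 + wq j))) \<longlonglongrightarrow> e"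
      using graph.boundary_chord_quotient_tendsto[OF e_unit tangent(2) h(2,1)] by (simp add: wp_def wq_def)
    fix \<rho> assume \<rho>: "0 < \<rho>" "\<rho> < r/2"
    have "0 < r/4" "0 < r/2" using graph.r by simp_all
    note small = order_tendstoD(2)[OF h(1)] order_tendstoD(2)[OF tendsto_norm_zero[OF lifts(1)]]
        order_tendstoD(2)[OF tendsto_norm_zero[OF lifts(2)]]
    show "eventually (\<lambda>j. 2 * (frac_potential s \<rho> E (p0 + wq j) - frac_potential s \<rho> E (p0 + wp j))
        - 4 * C * \<rho> powr (\<alpha> - s) * h j \<le> K * norm (p0 + wp j - (p0 + wq j))) sequentially"
      using small(1)[OF \<rho>(1)] small(1)[OF \<open>0 < r/4\<close>] small(2,3)[OF \<open>0 < r/2\<close>]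
    proof eventually_elim
      case (elim j)
      note pair = graph.boundary_pair_curvature[OF p0(2) G'0 e_unit tangent(1) e_k mixed h(2), of j \<rho>, folded wp_def wq_def C_def]
      have "h j \<le> \<rho>" "2 * h j + \<rho> < r" "norm (wq j) + \<rho> < r" "norm (wp j) + \<rho> < r" using elim \<rho> by simp_all
      note pair = pair[OF this]
      show ?case using pair(6) curvature_le[OF pair(1-5)] by simp
    qed
  qed
qed

lemma defect_boundary_merging:
  assumes p0: "p0 \<in> M" "p0 $ k = 0" "p0 \<bullet> e = lam"
    and frontier: "\<And>j. qs j \<in> frontier E" "\<And>j. ps j \<in> frontier E" and pos: "\<And>j. 0 < qs j $ k"
    and l: "\<And>j::nat. 0 < l j" "\<And>j. ps j = qs j + l j *\<^sub>R e" "l \<longlonglongrightarrow> 0" and qs: "qs \<longlonglongrightarrow> p0"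
  shows "2 * defect \<le> K"
proof (rule defect_boundary_tangent[OF p0])
  obtain r \<Lambda> G G' B where "capillary_graph s \<alpha> \<sigma> k E M nu r \<Lambda> (hnormal p0) G G' B p0"
    by (rule boundary_graph[OF p0(1,2)])
  then interpret graph: capillary_graph s \<alpha> \<sigma> k E M nu r \<Lambda> "hnormal p0" G G' B p0 .
  have "e \<bullet> hnormal p0 = G' 0 e"
    by (rule graph.merging_chords_tangent[OF e_unit e_k frontier(1) _ pos l(1,3) qs]) (use frontier(2) l(2) in metis)
  also have "\<dots> = 0" using graph.G'_zero_at_boundary[OF p0(2) refl] e_k by simp
  finally show "e \<bullet> hnormal p0 = 0" .
qed

end

lemma near_potential_reflection:
  fixes e :: "real^'n::finite"
  assumes "norm e = 1" "2 \<le> CARD('n)" "E \<in> sets borel" and m: "real CARD('n) < m" and scales: "0 < \<epsilon>" "0 < \<rho>"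
  shows "near_potential m \<epsilon> \<rho> {x. reflection e c x \<in> E} (reflection e c p) = near_potential m \<epsilon> \<rho> E p"
proof -
  have "real DIM(real^'n) < m" using m by simp
  note split = near_potential_eq[OF this scales]
  show ?thesis
    unfolding split[OF assms(3)] split[OF borel_reflection_vimage[OF assms(3)]]
    by (simp add: trunc_potential_reflection[OF assms(1-3)] scales)
qed

locale boundary_chord = critical_plane s \<alpha> \<sigma> k E M nu e lam K
    + P: capillary_graph s \<alpha> \<sigma> k E M nu rp \<Lambda>p \<eta>p Gp Gp' Bp p + Q: capillary_graph s \<alpha> \<sigma> k E M nu rq \<Lambda>q \<eta>q Gq Gq' Bq q
  for s \<alpha> \<sigma> :: real and k :: "'n::finite" and E M :: "(real^'n) set" and nu :: "real^'n \<Rightarrow> real^'n"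
    and e :: "real^'n" and lam K :: real
    and rp \<Lambda>p :: real and \<eta>p :: "real^'n" and Gp :: "real^'n \<Rightarrow> real"
    and Gp' :: "real^'n \<Rightarrow> real^'n \<Rightarrow> real" and Bp :: "real^'n \<Rightarrow> real^'n \<Rightarrow> real^'n \<Rightarrow> real" and p :: "real^'n"
    and rq \<Lambda>q :: real and \<eta>q :: "real^'n" and Gq :: "real^'n \<Rightarrow> real"
    and Gq' :: "real^'n \<Rightarrow> real^'n \<Rightarrow> real" and Bq :: "real^'n \<Rightarrow> real^'n \<Rightarrow> real^'n \<Rightarrow> real" and q :: "real^'n" +
  fixes l :: real
  assumes at_boundary: "p $ k = 0" "q $ k = 0" and directions: "\<eta>p = hnormal p" "\<eta>q = hnormal q"
    and l: "0 < l" and chord: "p = q + l *\<^sub>R e" and midpoint: "(q + p) \<bullet> e = 2 * lam"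
begin

lemma q_inner: "q \<bullet> e = lam - l/2"
  using midpoint e_unit unfolding chord inner_add_left inner_scaleR_left by (simp add: norm_eq_1)

lemma reflection_p: "reflection e lam p = q"
proof -
  have "reflection e lam q = p" unfolding reflection_def q_inner chord by simp
  then show ?thesis using reflection_reflection[OF e_unit, of lam q] by simp
qed

lemma mirror_k: "mirror e z $ k = z $ k"
  by (simp add: mirror_def e_k)

definition reflected_E :: "(real^'n) set" where
  "reflected_E = {x. reflection e lam x \<in> E}"

lemma mem_reflected_E_iff:
  assumes "norm z < rp"
  shows "q + z \<in> reflected_E \<longleftrightarrow> 0 < z \<bullet> axis k 1 \<and> z \<bullet> mirror e \<eta>p < Gp (mirror e z)"
proof -
  have "q + z \<in> reflected_E \<longleftrightarrow> p + mirror e z \<in> E"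
    using reflection_reflection[OF e_unit, of lam p]
    by (simp add: reflected_E_def reflection_add reflection_p)
  moreover have "mirror e z \<bullet> \<eta>p = z \<bullet> mirror e \<eta>p"
    using mirror_inner[OF e_unit, of z "mirror e \<eta>p"] by (simp add: mirror_mirror[OF e_unit])
  ultimately show ?thesis
    using P.E_iff_at_boundary[OF at_boundary(1), of "mirror e z"] assms
    by (simp add: norm_mirror[OF e_unit] inner_axis mirror_k)
qed

lemma reflected_subgraph_inclusion:
  assumes z: "norm z < rp" "norm z < rq" "norm z < l/2" "0 < z \<bullet> axis k 1" "z \<bullet> mirror e \<eta>p < Gp (mirror e z)"
  shows "z \<bullet> \<eta>q < Gq z"
proof -
  have x: "reflection e lam (q + z) \<in> E"
    using mem_reflected_E_iff[OF z(1)] z(4,5) by (simp add: reflected_E_def)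
  have "\<bar>z \<bullet> e\<bar> < l/2" using Cauchy_Schwarz_ineq2[of z e] e_unit z(3) by simp
  then have "lam < reflection e lam (q + z) \<bullet> e"
    unfolding reflection_inner[OF e_unit] inner_add_left q_inner by (simp add: abs_less_iff)
  from reflection_mem[OF x this] have "q + z \<in> E" by (simp add: reflection_reflection[OF e_unit])
  then show ?thesis using Q.E_iff_at_boundary[OF at_boundary(2) z(2)] by simp
qed

lemma Gp'_zero: "Gp' 0 v = \<sigma> / sqrt (1 - \<sigma>\<^sup>2) * v $ k" and Gq'_zero: "Gq' 0 v = \<sigma> / sqrt (1 - \<sigma>\<^sup>2) * v $ k"
  by (rule P.G'_zero_at_boundary[OF at_boundary(1) directions(1)], rule Q.G'_zero_at_boundary[OF at_boundary(2) directions(2)])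

lemma axis_orthogonal: "axis k 1 \<bullet> \<eta>p = 0" "axis k 1 \<bullet> \<eta>q = 0" "axis k 1 \<bullet> mirror e \<eta>p = 0" "mirror e (axis k 1) = axis k 1"
  using P.heights Q.heights at_boundary by (simp_all add: inner_axis' mirror_k e_k mirror_orthogonal)

lemma mirror_direction: "mirror e \<eta>p = \<eta>q"
proof (rule graph_directions_eq[OF C2alpha_graph_mirror[OF P.C2alpha_graph_axioms e_unit] Q.C2alpha_graph_axioms])
  show "Gp' (mirror e 0) (mirror e v) = \<sigma> / sqrt (1 - \<sigma>\<^sup>2) * (v \<bullet> axis k 1)" for v
    using Gp'_zero[of "mirror e v"] by (simp add: mirror_def[of e 0] mirror_k inner_axis)
  show "Gq' 0 v = \<sigma> / sqrt (1 - \<sigma>\<^sup>2) * (v \<bullet> axis k 1)" for v by (simp add: Gq'_zero inner_axis)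
  show "0 < min (min rp rq) (l/2)" using P.r Q.r l by simp
  show "z \<bullet> \<eta>q < Gq z"
    if "norm z < min (min rp rq) (l/2)" "0 < z \<bullet> axis k 1" "z \<bullet> mirror e \<eta>p < Gp (mirror e z)" for z
    using that by (intro reflected_subgraph_inclusion) auto
qed (simp_all add: norm_axis_1 axis_orthogonal)

sublocale touching: touching_graphs \<alpha> rp \<Lambda>p \<eta>q "\<lambda>z. Gp (mirror e z)" "\<lambda>y v. Gp' (mirror e y) (mirror e v)"
  "\<lambda>y z v. Bp (mirror e y) (mirror e z) (mirror e v)" rq \<Lambda>q Gq Gq' Bq
proof (rule touching_graphs.intro[OF _ Q.C2alpha_graph_axioms])
  show "C2alpha_graph \<alpha> rp \<Lambda>p \<eta>q (\<lambda>z. Gp (mirror e z)) (\<lambda>y v. Gp' (mirror e y) (mirror e v))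
      (\<lambda>y z v. Bp (mirror e y) (mirror e z) (mirror e v))"
    using C2alpha_graph_mirror[OF P.C2alpha_graph_axioms e_unit] unfolding mirror_direction .
  show "touching_graphs_axioms (\<lambda>y v. Gp' (mirror e y) (mirror e v)) Gq'"
    using Gp'_zero Gq'_zero by unfold_locales (simp add: mirror_def[of e 0] mirror_k)
qed

definition lift_p :: "real \<Rightarrow> real^'n" where
  "lift_p h = graph_lift \<eta>p Gp (h *\<^sub>R axis k 1)"

definition lift_q :: "real \<Rightarrow> real^'n" where
  "lift_q h = graph_lift \<eta>q Gq (h *\<^sub>R axis k 1)"

lemma near_potential_difference_le:
  assumes h: "0 < h" "h \<le> \<rho>" "h + \<rho> < rp" "h + \<rho> < rq"
    and lifts: "norm (lift_p h) + \<rho> < rp" "norm (lift_q h) + \<rho> < rq"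
    and \<epsilon>: "0 < \<epsilon>" "\<epsilon> \<le> h"
  shows "\<bar>near_frac_potential s \<epsilon> \<rho> E (p + lift_p h) - near_frac_potential s \<epsilon> \<rho> E (q + lift_q h)\<bar>
    \<le> 2 * graph_const TYPE(real^'n) s \<alpha> (6 * (\<Lambda>p + \<Lambda>q)) * \<rho> powr (\<alpha> - s)"
proof -
  define w where "w = graph_lift \<eta>q (\<lambda>z. Gp (mirror e z)) (h *\<^sub>R axis k 1)"
  have mirror_lift: "mirror e (lift_p h) = w"
    by (simp add: lift_p_def w_def graph_lift_def mirror_add mirror_scaleR axis_orthogonal mirror_direction)
  then have norm_w: "norm w = norm (lift_p h)" using norm_mirror[OF e_unit] by metis
  have "reflection e lam (p + lift_p h) = q + w" by (simp add: reflection_add reflection_p mirror_lift)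
  then have "near_frac_potential s \<epsilon> \<rho> E (p + lift_p h) = near_frac_potential s \<epsilon> \<rho> reflected_E (q + w)"
    using near_potential_reflection[OF e_unit dim borel_E _ \<epsilon>(1), of "real CARD('n) + s" \<rho> lam "p + lift_p h"] s01 h
    by (simp add: reflected_E_def)
  moreover have "\<bar>near_potential (real DIM(real^'n) + s) \<epsilon> \<rho> reflected_E (q + w) - near_potential (real DIM(real^'n) + s) \<epsilon> \<rho> E (q + lift_q h)\<bar>
      \<le> 2 * graph_const TYPE(real^'n) s \<alpha> (6 * (\<Lambda>p + \<Lambda>q)) * \<rho> powr (\<alpha> - s)"
    unfolding w_def lift_q_def
  proof (rule touching.near_potential_difference_le[OF _ s01(1) alpha _ borel_E, where \<kappa>="axis k 1" and h=h])
    show "reflected_E \<in> sets borel" unfolding reflected_E_def by (rule borel_reflection_vimage[OF borel_E])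
  qed (use dim h \<epsilon> lifts mem_reflected_E_iff Q.E_iff_at_boundary[OF at_boundary(2)] axis_orthogonal norm_w in
      \<open>simp_all add: norm_axis_1 w_def[symmetric] lift_q_def[symmetric] mirror_direction\<close>)
  ultimately show ?thesis by simp
qed

lemma potential_difference_le:
  assumes h: "0 < h" "h \<le> \<rho>" "h + \<rho> < rp" "h + \<rho> < rq"
    and lifts: "norm (lift_p h) + \<rho> < rp" "norm (lift_q h) + \<rho> < rq"
  shows "2 * (frac_potential s \<rho> E (q + lift_q h) - frac_potential s \<rho> E (p + lift_p h)) - 4 * graph_const TYPE(real^'n) s \<alpha> (6 * (\<Lambda>p + \<Lambda>q)) * \<rho> powr (\<alpha> - s)
    \<le> K * norm ((p + lift_p h) - (q + lift_q h))"
proof (cases "p + lift_p h = q + lift_q h")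
  case True
  have "0 \<le> graph_const TYPE(real^'n) s \<alpha> (6 * (\<Lambda>p + \<Lambda>q))"
    using s01 alpha P.\<Lambda> Q.\<Lambda> by (intro graph_const_nonneg) auto
  then show ?thesis by (simp add: True)
next
  case False
  have y: "(h *\<^sub>R axis k 1 :: real^'n) $ k = h" "norm (h *\<^sub>R axis k 1 :: real^'n) = h"
    using h by (simp_all add: norm_axis_1)
  have M: "p + lift_p h \<in> M" "q + lift_q h \<in> M"
    unfolding lift_p_def lift_q_def using h lifts y axis_orthogonal at_boundary
    by (intro P.graph_lift_in_M Q.graph_lift_in_M; simp add: lift_p_def lift_q_def)+
  have heights: "0 < (p + lift_p h) $ k" "0 < (q + lift_q h) $ k" "(p + lift_p h) $ k = (q + lift_q h) $ k"
    unfolding lift_p_def lift_q_def P.height_graph_lift[OF at_boundary(1)] Q.height_graph_lift[OF at_boundary(2)] y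
    using h by simp_all
  have "2 * (frac_potential s \<rho> E (q + lift_q h) - frac_potential s \<rho> E (p + lift_p h)) - 2 * (2 * graph_const TYPE(real^'n) s \<alpha> (6 * (\<Lambda>p + \<Lambda>q)) * \<rho> powr (\<alpha> - s))
      \<le> \<bar>frac_mean_curv s E (p + lift_p h) - frac_mean_curv s E (q + lift_q h)\<bar>"
    using h
    by (intro curvature_difference_ge_near[OF M(1) heights(1) M(2) heights(2) h(1)] near_potential_difference_le lifts) auto
  also have "\<dots> \<le> K * norm ((p + lift_p h) - (q + lift_q h))" by (rule curvature_le[OF M heights(2,3) False])
  finally show ?thesis by simp
qed

lemma lift_tendsto:
  assumes "h \<longlonglongrightarrow> 0"
  shows "(\<lambda>j. lift_p (h j)) \<longlonglongrightarrow> 0" "(\<lambda>j. lift_q (h j)) \<longlonglongrightarrow> 0"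
proof -
  have "(\<lambda>j. h j *\<^sub>R (axis k 1 :: real^'n)) \<longlonglongrightarrow> 0 *\<^sub>R axis k 1" by (intro tendsto_intros assms)
  then have "(\<lambda>j. h j *\<^sub>R (axis k 1 :: real^'n)) \<longlonglongrightarrow> 0" by simp
  from P.graph_lift_tendsto_zero[OF this] Q.graph_lift_tendsto_zero[OF this]
  show "(\<lambda>j. lift_p (h j)) \<longlonglongrightarrow> 0" "(\<lambda>j. lift_q (h j)) \<longlonglongrightarrow> 0"
    by (simp_all only: lift_p_def lift_q_def)
qed

lemma potential_difference_at_boundary_le:
  assumes \<rho>: "0 < \<rho>" "\<rho> < rp/2" "\<rho> < rq/2"
  shows "2 * (frac_potential s \<rho> E q - frac_potential s \<rho> E p)
    - 4 * graph_const TYPE(real^'n) s \<alpha> (6 * (\<Lambda>p + \<Lambda>q)) * \<rho> powr (\<alpha> - s) \<le> K * norm (p - q)"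
proof (rule tendsto_le)
  define h where "h j = inverse (real (Suc j))" for j
  have h: "h \<longlonglongrightarrow> 0" unfolding h_def[abs_def] by (rule LIMSEQ_inverse_real_of_nat)
  note lifts = lift_tendsto[OF h]
  have points: "(\<lambda>j. p + lift_p (h j)) \<longlonglongrightarrow> p" "(\<lambda>j. q + lift_q (h j)) \<longlonglongrightarrow> q"
    using tendsto_add[OF tendsto_const[of p] lifts(1)] tendsto_add[OF tendsto_const[of q] lifts(2)]
    by simp_all
  then show "(\<lambda>j. K * norm ((p + lift_p (h j)) - (q + lift_q (h j)))) \<longlonglongrightarrow> K * norm (p - q)"
    by (intro tendsto_intros)
  show "(\<lambda>j. 2 * (frac_potential s \<rho> E (q + lift_q (h j)) - frac_potential s \<rho> E (p + lift_p (h j)))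
      - 4 * graph_const TYPE(real^'n) s \<alpha> (6 * (\<Lambda>p + \<Lambda>q)) * \<rho> powr (\<alpha> - s))
    \<longlonglongrightarrow> 2 * (frac_potential s \<rho> E q - frac_potential s \<rho> E p)
      - 4 * graph_const TYPE(real^'n) s \<alpha> (6 * (\<Lambda>p + \<Lambda>q)) * \<rho> powr (\<alpha> - s)"
    using points
    by (intro tendsto_diff tendsto_mult tendsto_const trunc_potential_tendsto[OF borel_E bounded_E \<rho>(1) m_pos])
  have "0 < rp/2" "0 < rq/2" using P.r Q.r by simp_all
  note small = order_tendstoD(2)[OF h] order_tendstoD(2)[OF tendsto_norm_zero[OF lifts(1)] this(1)]
    order_tendstoD(2)[OF tendsto_norm_zero[OF lifts(2)] this(2)]
  show "eventually (\<lambda>j. 2 * (frac_potential s \<rho> E (q + lift_q (h j)) - frac_potential s \<rho> E (p + lift_p (h j)))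
      - 4 * graph_const TYPE(real^'n) s \<alpha> (6 * (\<Lambda>p + \<Lambda>q)) * \<rho> powr (\<alpha> - s)
      \<le> K * norm ((p + lift_p (h j)) - (q + lift_q (h j)))) sequentially"
    using small(1)[OF \<rho>(1)] small(2,3)
  proof eventually_elim
    case (elim j)
    have "0 < h j" by (simp add: h_def)
    then show ?case using elim \<rho> by (intro potential_difference_le) auto
  qed
qed simp

lemma defect_le_of_boundary_chord: "2 * defect \<le> K"
proof -
  define C where "C = 4 * graph_const TYPE(real^'n) s \<alpha> (6 * (\<Lambda>p + \<Lambda>q))"
  have "2 * defect * l \<le> K * l"
  proof (rule le_of_vanishing_error[where \<gamma>="\<alpha> - s" and R="min (diameter E) (min (rp/2) (rq/2))" and C=C])
    show "0 < \<alpha> - s" "0 < min (diameter E) (min (rp/2) (rq/2))" using alpha diameter_pos P.r Q.r by auto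
    fix \<rho> assume \<rho>: "0 < \<rho>" "\<rho> < min (diameter E) (min (rp/2) (rq/2))"
    have "p \<in> closure E" by (rule M_closure[OF P.p0M])
    then have "defect * l \<le> frac_potential s \<rho> E q - frac_potential s \<rho> E p"
      using \<rho> by (intro potential_difference_ge_distinct[OF chord _ l midpoint]) auto
    moreover have "2 * (frac_potential s \<rho> E q - frac_potential s \<rho> E p) - C * \<rho> powr (\<alpha> - s) \<le> K * norm (p - q)"
      unfolding C_def using \<rho> by (intro potential_difference_at_boundary_le) auto
    moreover have "norm (p - q) = l" using l e_unit by (simp add: chord)
    ultimately show "2 * defect * l - \<rho> - C * \<rho> powr (\<alpha> - s) \<le> K * l" using \<rho>(1) by simp
  qed
  then show ?thesis using l by (rule mult_right_le_imp_le)
qed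

end

context critical_plane
begin

lemma defect_boundary_distinct:
  assumes q: "q \<in> M" "q $ k = 0"
    and p: "p \<in> M" "p = q + l *\<^sub>R e" and l: "0 < l" and midpoint: "(q + p) \<bullet> e = 2 * lam"
  shows "2 * defect \<le> K"
proof -
  have pk: "p $ k = 0" using p(2) q(2) e_k by simp
  obtain rp \<Lambda>p Gp Gp' Bp where P: "capillary_graph s \<alpha> \<sigma> k E M nu rp \<Lambda>p (hnormal p) Gp Gp' Bp p"
    by (rule boundary_graph[OF p(1) pk])
  obtain rq \<Lambda>q Gq Gq' Bq where Q: "capillary_graph s \<alpha> \<sigma> k E M nu rq \<Lambda>q (hnormal q) Gq Gq' Bq q"
    by (rule boundary_graph[OF q])
  interpret boundary_chord s \<alpha> \<sigma> k E M nu e lam K rp \<Lambda>p "hnormal p" Gp Gp' Bp p rq \<Lambda>q "hnormal q" Gq Gq' Bq q l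
  proof (rule boundary_chord.intro[OF critical_plane_axioms P Q])
    show "boundary_chord_axioms \<sigma> k nu e lam (hnormal p) p (hnormal q) q l"
      by (rule boundary_chord_axioms.intro) (use pk q l p(2) midpoint in simp_all)
  qed
  show ?thesis by (rule defect_le_of_boundary_chord)
qed

lemma defect_le:
  assumes chords: "\<And>j::nat. chord E e (qs j) (ps j)" and qs: "qs \<longlonglongrightarrow> q" and ps: "ps \<longlonglongrightarrow> p"
    and midpoint: "(q + p) \<bullet> e = 2 * lam"
  shows "2 * defect \<le> K"
proof -
  have "e \<bullet> axis k 1 = 0" "\<And>x. x \<in> E \<Longrightarrow> 0 < x \<bullet> axis k 1"
    using e_k E_sub by (auto simp: inner_axis halfspace_def)
  note heights = chord_inner[OF chords this, unfolded inner_axis, simplified]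
  note frontier = chord_frontier[OF E_open chords]
  have "qs j \<in> M" "ps j \<in> M" for j using frontier_in_M frontier heights by metis+
  then have M: "q \<in> M" "p \<in> M" using closed_sequentially[OF M_closed] qs ps by blast+
  define l where "l j = (ps j - qs j) \<bullet> e" for j
  have l: "0 < l j" "ps j = qs j + l j *\<^sub>R e" for j unfolding l_def by (rule chord_length[OF chords e_unit])+
  have l_lim: "l \<longlonglongrightarrow> (p - q) \<bullet> e" unfolding l_def[abs_def] by (intro tendsto_intros qs ps)
  note p = chord_limit(2)[OF chords e_unit qs ps]
  consider (merging) "(p - q) \<bullet> e = 0" | (distinct) "0 < (p - q) \<bullet> e"
    using chord_limit(1)[OF chords e_unit qs ps] by linarith
  then show ?thesis
  proof cases
    case merging
    then have "q \<bullet> e = lam" "l \<longlonglongrightarrow> 0" using midpoint l_lim by (simp_all add: inner_add_left inner_diff_left)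
    note merge = this(1) frontier heights(1) l this(2) qs
    show ?thesis
    proof (cases "q $ k = 0")
      case True
      then show ?thesis by (rule defect_boundary_merging[OF M(1) _ merge])
    next
      case False
      then have "0 < q $ k" using M_height[OF M(1)] by simp
      then show ?thesis by (rule defect_interior_merging[OF M(1) _ merge])
    qed
  next
    case distinct
    show ?thesis
    proof (cases "q $ k = 0")
      case True
      then show ?thesis by (rule defect_boundary_distinct[OF M(1) _ M(2) p distinct midpoint])
    next
      case False
      then have "0 < q $ k" using M_height[OF M(1)] by simp
      then show ?thesis by (rule defect_interior_distinct[OF M(1) _ M(2) p distinct midpoint])
    qed
  qed
qed

end

lemma s_deficit_finite:
  fixes s :: real and E M :: "(real^'n::finite) set"
  assumes diameter: "0 < diameter E" and finite: "s_deficit s k E M < \<infinity>"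
  obtains K where "real_of_ereal (s_deficit s k E M) = diameter E powr (s + 1) * K"
    "\<And>p q. p \<in> M \<Longrightarrow> q \<in> M \<Longrightarrow> 0 < q $ k \<Longrightarrow> p $ k = q $ k \<Longrightarrow> p \<noteq> q \<Longrightarrow>
       \<bar>frac_mean_curv s E p - frac_mean_curv s E q\<bar> \<le> K * norm (p - q)"
proof -
  define S where "S = insert 0 {ereal (\<bar>frac_mean_curv s E p - frac_mean_curv s E q\<bar> / norm (p - q)) | p q.
            p \<in> M \<inter> halfspace k \<and> q \<in> M \<inter> halfspace k \<and> p \<noteq> q \<and> p $ k = q $ k}"
  have deficit: "s_deficit s k E M = ereal (diameter E powr (s + 1)) * Sup S"
    by (simp add: s_deficit_def S_def)
  have "0 \<le> Sup S" by (rule Sup_upper) (simp add: S_def)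
  moreover have "Sup S \<noteq> \<infinity>" using finite diameter unfolding deficit by auto
  ultimately obtain K where K: "Sup S = ereal K" by (cases "Sup S") auto
  show ?thesis
  proof (rule that)
    show "real_of_ereal (s_deficit s k E M) = diameter E powr (s + 1) * K" unfolding deficit K by simp
    fix p q assume pq: "p \<in> M" "q \<in> M" "0 < q $ k" "p $ k = q $ k" "p \<noteq> q"
    then have "ereal (\<bar>frac_mean_curv s E p - frac_mean_curv s E q\<bar> / norm (p - q)) \<in> S"
      unfolding S_def by (intro insertI2 CollectI exI[of _ p] exI[of _ q]) (auto simp: halfspace_def)
    then have "ereal (\<bar>frac_mean_curv s E p - frac_mean_curv s E q\<bar> / norm (p - q)) \<le> ereal K"
      unfolding K[symmetric] by (rule Sup_upper)
    then show "\<bar>frac_mean_curv s E p - frac_mean_curv s E q\<bar> \<le> K * norm (p - q)"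
      using pq by (simp add: divide_le_eq)
  qed
qed

lemma diameter_open_pos:
  fixes E :: "'a::euclidean_space set"
  assumes "open E" "bounded E" "E \<noteq> {}"
  shows "0 < diameter E"
proof -
  obtain x r where r: "0 < r" "cball x r \<subseteq> E" using assms(1,3) open_contains_cball by blast
  have "0 < diameter (cball x r)" using r by simp
  also have "\<dots> \<le> diameter E" by (rule diameter_subset[OF r(2) assms(2)])
  finally show ?thesis .
qed

theorem theorem1p1:
  fixes s \<alpha> \<sigma> :: real
    and k :: "'n::finite"
    and E M :: "(real^'n) set"
    and nu :: "real^'n \<Rightarrow> real^'n"
  assumes n2: "CARD('n) \<ge> 2"
    and s01: "0 < s" "s < 1"
    and alpha: "s < \<alpha>" "\<alpha> < 1"
    and E_open: "open E" and E_bdd: "bounded E" and E_conn: "connected E"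
    and E_sub: "E \<subseteq> halfspace k"
    and M_def: "M = closure (frontier E \<inter> halfspace k)"
    and M_hyp: "C2alpha_hypersurface_with_boundary \<alpha> M (M \<inter> {x. x $ k = 0})"
    and nu: "outer_unit_normal k E M nu"
    and sigma: "-1 < \<sigma>" "\<sigma> < 1"
    and angle: "\<forall>q \<in> M \<inter> {x. x $ k = 0}. nu q \<bullet> (- axis k 1) = \<sigma>"
  shows "\<forall>e. norm e = 1 \<and> e $ k = 0 \<longrightarrow>
           s_deficit s k E M < \<infinity> \<longrightarrow> (\<exists>c.
              measure lebesgue (symdiff E (reflection e c ` E))
                \<le> 3 * sqrt (5 / (2 * (real CARD('n) + s)))
                    * diameter E ^ CARD('n) * sqrt (real_of_ereal (s_deficit s k E M)))"
proof (intro allI impI)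
  fix e :: "real^'n" assume e: "norm e = 1 \<and> e $ k = 0" and finite: "s_deficit s k E M < \<infinity>"
  show "\<exists>c. measure lebesgue (symdiff E (reflection e c ` E))
                \<le> 3 * sqrt (5 / (2 * (real CARD('n) + s)))
                    * diameter E ^ CARD('n) * sqrt (real_of_ereal (s_deficit s k E M))"
  proof (cases "E = {}")
    case True
    then show ?thesis by (simp add: symdiff_def s_deficit_def)
  next
    case False
    have diameter: "0 < diameter E" by (rule diameter_open_pos[OF E_open E_bdd False])
    obtain K where deficit: "real_of_ereal (s_deficit s k E M) = diameter E powr (s + 1) * K"
      and curvature: "\<And>p q. p \<in> M \<Longrightarrow> q \<in> M \<Longrightarrow> 0 < q $ k \<Longrightarrow> p $ k = q $ k \<Longrightarrow> p \<noteq> q \<Longrightarrow>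
         \<bar>frac_mean_curv s E p - frac_mean_curv s E q\<bar> \<le> K * norm (p - q)"
      by (rule s_deficit_finite[OF diameter finite], rule that) assumption+
    obtain qs ps q p where chords: "\<And>j::nat. chord E e (qs j) (ps j)" "qs \<longlonglongrightarrow> q" "ps \<longlonglongrightarrow> p"
        "(q + p) \<bullet> e = 2 * critical_level E e"
      using critical_chords[OF E_open E_bdd False] e by metis
    interpret critical_plane s \<alpha> \<sigma> k E M nu e "critical_level E e" K
      by unfold_locales (use n2 s01 alpha E_open E_bdd E_sub M_def M_hyp nu sigma angle e diameter curvature
        reflection_beyond_critical_level in auto)
    show ?thesis
      unfolding deficit by (rule exI, rule measure_symdiff_reflection_le_defect[OF refl defect_le[OF chords]])
  qed
qed

end
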